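(* Let $T>0$, $\alpha,\beta\in[0,1]$, $\kappa>0$, $\theta=-1$, and let $p(0)=0$, $p(z)=c_\gamma|z|^{-\gamma-1}$ for $z\in\mathbb{Z}\setminus\{0\}$, with $\gamma\in(1,2)$ and $c_\gamma$ normalizing $p$ to a probability on $\mathbb{Z}$. Let $g:[0,1]\to[0,1]$ be measurable and let $\{\mu_N\}_{N\ge1}$ be a sequence of probability measures, $\mu_N$ on $\Omega_N=\{0,1\}^{\{1,\dots,N-1\}}$, associated to $g$. Let $\{\eta_{tN^\gamma}:t\ge0\}$ be the Markov process on $\Omega_N$ with generator $N^\gamma\mathcal{L}_N$ (long-jump symmetric exclusion with reservoirs with $\theta=-1$, defined in the context), started from $\mu_N$, with law $\mathbb{P}_{\mu_N}$. Then, for any $0\le t\le T$, any continuous $G:[0,1]\to\mathbb{R}$ and any $\delta>0$, $$\lim_{N\to\infty}\mathbb{P}_{\mu_N}\Big(\Big|\frac1{N-1}\sum_{x=1}^{N-1}G\big(\tfrac xN\big)\eta_{tN^\gamma}(x)-\int_0^1G(q)\rho^\kappa_t(q)\,dq\Big|>\delta\Big)=0,$$ where $\rho^\kappa_t(\cdot)$ is the unique weak solution (in the sense of the context), starting from $g$, of the regional fractional reaction-diffusion equation with Dirichlet boundary conditions $$\partial_t\rho^\kappa_t(q)=L_\kappa\rho^\kappa_t(q)+\kappa\tilde V_0(q),\ (t,q)\in[0,T]\times(0,1),\qquad \rho^\kappa_t(0)=\alpha,\ \rho^\kappa_t(1)=\beta.$$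
   Context: **Process.** $\Lambda_N=\{1,\dots,N-1\}$, $\Omega_N=\{0,1\}^{\Lambda_N}$. For $f:\Omega_N\to\mathbb{R}$, $\mathcal{L}_N=\mathcal{L}_{N,0}+\mathcal{L}_{N,b}$ with $$(\mathcal{L}_{N,0}f)(\eta)=\tfrac12\sum_{x,y\in\Lambda_N}p(x-y)[f(\eta^{x,y})-f(\eta)],\qquad(\mathcal{L}_{N,b}f)(\eta)=\kappa N^{-\theta}\sum_{y\in\{0,N\}}\sum_{x\in\Lambda_N}p(y-x)\,c_x(\eta;r(y))[f(\eta^x)-f(\eta)]$$ (here $\theta=-1$, so $N^{-\theta}=N$), where $r(0)=\alpha$, $r(N)=\beta$, $c_x(\eta;r)=\eta(x)(1-r)+(1-\eta(x))r$, $\eta^{x,y}$ is $\eta$ with the values at $x$ and $y$ exchanged, and $\eta^x$ is $\eta$ with $\eta(x)$ replaced by $1-\eta(x)$. **Associated measures.** $\{\mu_N\}$ is associated to $g$ if for every continuous $G:[0,1]\to\mathbb{R}$ and $\delta>0$, $\lim_{N\to\infty}\mu_N\big(\eta:|\frac{1}{N-1}\sum_{x\in\Lambda_N}G(\frac xN)\eta(x)-\int_0^1G(q)g(q)dq|>\delta\big)=0$. **Operators.** The regional fractional Laplacian on $(0,1)$ acts on $G\in C_c^\infty((0,1))$ by $$(LG)(q)=c_\gamma\lim_{\varepsilon\to0}\int_0^1\mathbf{1}_{|q-v|\ge\varepsilon}\frac{G(v)-G(q)}{|q-v|^{1+\gamma}}\,dv,\quad q\in(0,1).$$ Put $\tilde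 V_1(q)=c_\gamma\big(\frac1{q^{\gamma+1}}+\frac1{(1-q)^{\gamma+1}}\big)$, $\tilde V_0(q)=c_\gamma\big(\frac{\alpha}{q^{\gamma+1}}+\frac{\beta}{(1-q)^{\gamma+1}}\big)$, and $L_\kappa=L-\kappa\tilde V_1$ (multiplication by $\tilde V_1$). **Function spaces.** $\mathcal{H}^{\gamma/2}$ is the Hilbert space of square integrable $f:(0,1)\to\mathbb{R}$ with $\|f\|_{\gamma/2}^2=\frac{c_\gamma}2\iint_{[0,1]^2}\frac{(f(q)-f(v))^2}{|q-v|^{1+\gamma}}dq\,dv<\infty$, with norm $\|f\|_{\mathcal{H}^{\gamma/2}}^2=\|f\|_{L^2}^2+\|f\|_{\gamma/2}^2$. $L^2(0,T;\mathcal{H}^{\gamma/2})$ is the set of measurable $f:[0,T]\to\mathcal{H}^{\gamma/2}$ with $\int_0^T\|f_t\|^2_{\mathcal{H}^{\gamma/2}}dt<\infty$. $C^{1,\infty}_c([0,T]\times(0,1))$ is the set of functions $G_s(q)$ that are $C^1$ in time and smooth in space, such that for any $s$, $G_s$ has compact support in $(0,1)$. **Weak solution.** $\rho^\kappa:[0,T]\times[0,1]\to[0,1]$ is a weak solution starting from $g$ if: 1. $\rho^\kappa\in L^2(0,T;\mathcal{H}^{\gamma/2})$; 2. $\int_0^T\int_0^1\big\{\frac{(\alpha-\rho^\kappa_t(q))^2}{q^{1+\gamma}}+\frac{(\beta-\rho^\kappa_t(q))^2}{(1-q)^{1+\gamma}}\big\}dq\,dt<\infty$; 3. for all $t\in[0,T]$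 and all $G\in C^{1,\infty}_c([0,T]\times(0,1))$, $$\int_0^1\rho^\kappa_tG_t\,dq-\int_0^1gG_0\,dq-\int_0^t\!\int_0^1\rho^\kappa_s(q)(\partial_s+L_\kappa)G_s(q)\,dq\,ds-\kappa\int_0^t\!\int_0^1G_s(q)\tilde V_0(q)\,dq\,ds=0.$$ *)

theory Defs
  imports "HOL-Probability.Probability"
begin

section \<open>Markov processes with a given generator on a finite set\<close>

text \<open>Transition function of a time-homogeneous Markov process on \<open>S\<close> whose semigroup
  \<open>f \<mapsto> (\<lambda>x. \<integral> f d(K t x))\<close> has the (infinitesimal) generator \<open>A\<close>. Only the values of functions
  on \<open>S\<close> matter.\<close>

definition transition_function ::
  "'c set \<Rightarrow> (('c \<Rightarrow> real) \<Rightarrow> 'c \<Rightarrow> real) \<Rightarrow> (real \<Rightarrow> 'c \<Rightarrow> 'c pmf) \<Rightarrow> bool" where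
  "transition_function S A K \<longleftrightarrow>
     (\<forall>t\<ge>0. \<forall>x\<in>S. set_pmf (K t x) \<subseteq> S) \<and>
     (\<forall>x\<in>S. K 0 x = return_pmf x) \<and>
     (\<forall>s\<ge>0. \<forall>t\<ge>0. \<forall>x\<in>S. K (s + t) x = bind_pmf (K s x) (K t)) \<and>
     (\<forall>f. \<forall>x\<in>S. ((\<lambda>h. (measure_pmf.expectation (K h x) f - f x) / h) \<longlongrightarrow> A f x) (at_right 0))"

definition natural_filtration ::
  "'w measure \<Rightarrow> 'c set \<Rightarrow> (real \<Rightarrow> 'w \<Rightarrow> 'c) \<Rightarrow> real \<Rightarrow> 'w measure" where
  "natural_filtration M S X s =
     sigma (space M) {X r -` B \<inter> space M | r B. 0 \<le> r \<and> r \<le> s \<and> B \<subseteq> S}"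

text \<open>The finite set \<open>S\<close> carries the discrete topology, so right-continuity and existence of left
  limits mean that paths are eventually constant on either side of each time.\<close>

definition cadlag_discrete :: "'c set \<Rightarrow> (real \<Rightarrow> 'c) \<Rightarrow> bool" where
  "cadlag_discrete S \<omega> \<longleftrightarrow>
     (\<forall>t\<ge>0. eventually (\<lambda>s. \<omega> s = \<omega> t) (at_right t)) \<and>
     (\<forall>t>0. \<exists>l\<in>S. eventually (\<lambda>s. \<omega> s = l) (at_left t))"

definition markov_process ::
  "'w measure \<Rightarrow> 'c set \<Rightarrow> (('c \<Rightarrow> real) \<Rightarrow> 'c \<Rightarrow> real) \<Rightarrow> 'c measure \<Rightarrow> (real \<Rightarrow> 'w \<Rightarrow> 'c) \<Rightarrow> bool"
  where
  "markov_process M S A \<mu> X \<longleftrightarrow>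
     prob_space M \<and>
     (\<forall>t\<ge>0. X t \<in> M \<rightarrow>\<^sub>M count_space S) \<and>
     (\<forall>\<omega>\<in>space M. cadlag_discrete S (\<lambda>t. X t \<omega>)) \<and>
     distr M (count_space S) (X 0) = \<mu> \<and>
     (\<exists>K. transition_function S A K \<and>
       (\<forall>s\<ge>0. \<forall>t\<ge>0. \<forall>f. AE \<omega> in M.
          real_cond_exp M (natural_filtration M S X s) (\<lambda>\<omega>. f (X (s + t) \<omega>)) \<omega>
            = measure_pmf.expectation (K t (X s \<omega>)) f))"


section \<open>The exclusion process with long jumps and reservoirs\<close>

definition c_norm :: "real \<Rightarrow> real" where
  "c_norm \<gamma> = 1 / (\<Sum>\<^sub>\<infinity>z\<in>UNIV - {0::int}. \<bar>real_of_int z\<bar> powr (- \<gamma> - 1))"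

definition jump_prob :: "real \<Rightarrow> int \<Rightarrow> real" where
  "jump_prob \<gamma> z = (if z = 0 then 0 else c_norm \<gamma> * \<bar>real_of_int z\<bar> powr (- \<gamma> - 1))"

definition bulk :: "nat \<Rightarrow> nat set" where
  "bulk N = {1..<N}"

definition configs :: "nat \<Rightarrow> (nat \<Rightarrow> nat) set" where
  "configs N = bulk N \<rightarrow>\<^sub>E {0, 1}"

definition exchange :: "nat \<Rightarrow> nat \<Rightarrow> (nat \<Rightarrow> nat) \<Rightarrow> (nat \<Rightarrow> nat)" where
  "exchange x y \<eta> = \<eta>(x := \<eta> y, y := \<eta> x)"

definition flip :: "nat \<Rightarrow> (nat \<Rightarrow> nat) \<Rightarrow> (nat \<Rightarrow> nat)" where
  "flip x \<eta> = \<eta>(x := 1 - \<eta> x)"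

definition bulk_gen ::
  "real \<Rightarrow> nat \<Rightarrow> ((nat \<Rightarrow> nat) \<Rightarrow> real) \<Rightarrow> (nat \<Rightarrow> nat) \<Rightarrow> real" where
  "bulk_gen \<gamma> N f \<eta> =
     1/2 * (\<Sum>x\<in>bulk N. \<Sum>y\<in>bulk N. jump_prob \<gamma> (int x - int y) * (f (exchange x y \<eta>) - f \<eta>))"

definition flip_rate :: "nat \<Rightarrow> (nat \<Rightarrow> nat) \<Rightarrow> real \<Rightarrow> real" where
  "flip_rate x \<eta> r = real (\<eta> x) * (1 - r) + (1 - real (\<eta> x)) * r"

definition reservoir_gen ::
  "real \<Rightarrow> real \<Rightarrow> real \<Rightarrow> real \<Rightarrow> real \<Rightarrow> nat \<Rightarrow>
    ((nat \<Rightarrow> nat) \<Rightarrow> real) \<Rightarrow> (nat \<Rightarrow> nat) \<Rightarrow> real" where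
  "reservoir_gen \<gamma> \<kappa> \<theta> \<alpha> \<beta> N f \<eta> =
     \<kappa> * real N powr (- \<theta>) *
       (\<Sum>y\<in>{0, N}. \<Sum>x\<in>bulk N. jump_prob \<gamma> (int y - int x)
          * flip_rate x \<eta> (if y = 0 then \<alpha> else \<beta>) * (f (flip x \<eta>) - f \<eta>))"

definition exclusion_gen ::
  "real \<Rightarrow> real \<Rightarrow> real \<Rightarrow> real \<Rightarrow> real \<Rightarrow> nat \<Rightarrow>
    ((nat \<Rightarrow> nat) \<Rightarrow> real) \<Rightarrow> (nat \<Rightarrow> nat) \<Rightarrow> real" where
  "exclusion_gen \<gamma> \<kappa> \<theta> \<alpha> \<beta> N f \<eta> = bulk_gen \<gamma> N f \<eta> + reservoir_gen \<gamma> \<kappa> \<theta> \<alpha> \<beta> N f \<eta>"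

definition empirical :: "nat \<Rightarrow> (real \<Rightarrow> real) \<Rightarrow> (nat \<Rightarrow> nat) \<Rightarrow> real" where
  "empirical N G \<eta> = 1 / (real N - 1) * (\<Sum>x\<in>bulk N. G (real x / real N) * real (\<eta> x))"

definition associated :: "(nat \<Rightarrow> (nat \<Rightarrow> nat) measure) \<Rightarrow> (real \<Rightarrow> real) \<Rightarrow> bool" where
  "associated \<mu> g \<longleftrightarrow>
     (\<forall>G \<delta>. continuous_on {0..1} G \<longrightarrow> \<delta> > 0 \<longrightarrow>
        (\<lambda>N. measure (\<mu> N) {\<eta> \<in> configs N.
            \<bar>empirical N G \<eta> - (LINT q:{0..1}|lebesgue. G q * g q)\<bar> > \<delta>}) \<longlonglongrightarrow> 0)"


section \<open>The regional fractional reaction-diffusion equation\<close>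

definition regional_frac_lap :: "real \<Rightarrow> (real \<Rightarrow> real) \<Rightarrow> real \<Rightarrow> real" where
  "regional_frac_lap \<gamma> G q = c_norm \<gamma> *
     Lim (at_right 0) (\<lambda>\<epsilon>. LINT v:{0..1}|lebesgue.
       indicator {v. \<bar>q - v\<bar> \<ge> \<epsilon>} v * ((G v - G q) / \<bar>q - v\<bar> powr (1 + \<gamma>)))"

definition V1 :: "real \<Rightarrow> real \<Rightarrow> real" where
  "V1 \<gamma> q = c_norm \<gamma> * (1 / q powr (\<gamma> + 1) + 1 / (1 - q) powr (\<gamma> + 1))"

definition V0 :: "real \<Rightarrow> real \<Rightarrow> real \<Rightarrow> real \<Rightarrow> real" where
  "V0 \<gamma> \<alpha> \<beta> q = c_norm \<gamma> * (\<alpha> / q powr (\<gamma> + 1) + \<beta> / (1 - q) powr (\<gamma> + 1))"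

definition L_op :: "real \<Rightarrow> real \<Rightarrow> (real \<Rightarrow> real) \<Rightarrow> real \<Rightarrow> real" where
  "L_op \<gamma> \<kappa> G q = regional_frac_lap \<gamma> G q - \<kappa> * V1 \<gamma> q * G q"

text \<open>Elements of the fractional Sobolev space are represented by functions; those agreeing almost
  everywhere on \<open>(0,1)\<close> are at distance zero and hence belong to the same open sets.\<close>

definition sobolev_norm_sq :: "real \<Rightarrow> (real \<Rightarrow> real) \<Rightarrow> ennreal" where
  "sobolev_norm_sq \<gamma> f =
     (\<integral>\<^sup>+q\<in>{0<..<1}. ennreal ((f q)\<^sup>2) \<partial>lebesgue) +
     ennreal (c_norm \<gamma> / 2) *
       (\<integral>\<^sup>+q\<in>{0<..<1}. (\<integral>\<^sup>+v\<in>{0<..<1}.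
          ennreal ((f q - f v)\<^sup>2 / \<bar>q - v\<bar> powr (1 + \<gamma>)) \<partial>lebesgue) \<partial>lebesgue)"

definition sobolev :: "real \<Rightarrow> (real \<Rightarrow> real) set" where
  "sobolev \<gamma> = {f. f \<in> borel_measurable (lebesgue_on {0<..<1}) \<and> sobolev_norm_sq \<gamma> f < \<infinity>}"

definition sobolev_open :: "real \<Rightarrow> (real \<Rightarrow> real) set \<Rightarrow> bool" where
  "sobolev_open \<gamma> U \<longleftrightarrow> U \<subseteq> sobolev \<gamma> \<and>
     (\<forall>f\<in>U. \<exists>e>0. \<forall>h\<in>sobolev \<gamma>.
        sobolev_norm_sq \<gamma> (\<lambda>q. f q - h q) < ennreal (e\<^sup>2) \<longrightarrow> h \<in> U)"

definition sobolev_borel :: "real \<Rightarrow> (real \<Rightarrow> real) measure" where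
  "sobolev_borel \<gamma> = sigma (sobolev \<gamma>) {U. sobolev_open \<gamma> U}"

definition L2_sobolev :: "real \<Rightarrow> real \<Rightarrow> (real \<Rightarrow> real \<Rightarrow> real) set" where
  "L2_sobolev \<gamma> T = {f. f \<in> lebesgue_on {0..T} \<rightarrow>\<^sub>M sobolev_borel \<gamma> \<and>
     (\<integral>\<^sup>+t\<in>{0..T}. sobolev_norm_sq \<gamma> (f t) \<partial>lebesgue) < \<infinity>}"

text \<open>\<open>D k\<close> is the \<open>k\<close>-th space derivative of \<open>G\<close>. All derivatives are continuous up to the boundary
  of \<open>(0,1)\<close>: the support of \<open>G s\<close> may depend on \<open>s\<close>, and without this the integrals in the
  weak formulation could diverge.\<close>

definition test_functions :: "real \<Rightarrow> (real \<Rightarrow> real \<Rightarrow> real) set" where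
  "test_functions T = {G.
     (\<forall>q\<in>{0..1}. (\<lambda>s. G s q) differentiable_on {0..T}) \<and>
     continuous_on ({0..T} \<times> {0..1})
       (\<lambda>(s, q). vector_derivative (\<lambda>r. G r q) (at s within {0..T})) \<and>
     (\<exists>D :: nat \<Rightarrow> real \<Rightarrow> real \<Rightarrow> real.
        D 0 = G \<and>
        (\<forall>k. \<forall>s\<in>{0..T}. \<forall>q\<in>{0..1}.
           (D k s has_real_derivative D (Suc k) s q) (at q within {0..1})) \<and>
        (\<forall>k. continuous_on ({0..T} \<times> {0..1}) (\<lambda>(s, q). D k s q))) \<and>
     (\<forall>s\<in>{0..T}. \<exists>C. compact C \<and> C \<subseteq> {0<..<1} \<and> (\<forall>q\<in>{0..1} - C. G s q = 0))}"

text \<open>Membership in \<open>L2_sobolev\<close> is required up to a null set of times: for instance the time-zero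
  value is \<open>g\<close>, which need not have finite Sobolev norm.\<close>

definition weak_solution ::
  "real \<Rightarrow> real \<Rightarrow> real \<Rightarrow> real \<Rightarrow> real \<Rightarrow> (real \<Rightarrow> real) \<Rightarrow> (real \<Rightarrow> real \<Rightarrow> real) \<Rightarrow> bool"
  where
  "weak_solution \<gamma> \<kappa> \<alpha> \<beta> T g \<rho> \<longleftrightarrow>
     (\<forall>t\<in>{0..T}. \<rho> t \<in> {0..1} \<rightarrow> {0..1} \<and> \<rho> t \<in> borel_measurable (lebesgue_on {0..1})) \<and>
     (\<exists>f\<in>L2_sobolev \<gamma> T. AE t in lebesgue_on {0..T}. f t = \<rho> t) \<and>
     (\<integral>\<^sup>+t\<in>{0..T}. (\<integral>\<^sup>+q\<in>{0<..<1}.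
        ennreal ((\<alpha> - \<rho> t q)\<^sup>2 / q powr (1 + \<gamma>) + (\<beta> - \<rho> t q)\<^sup>2 / (1 - q) powr (1 + \<gamma>))
        \<partial>lebesgue) \<partial>lebesgue) < \<infinity> \<and>
     (\<forall>t\<in>{0..T}. \<forall>G\<in>test_functions T.
        (LINT q:{0..1}|lebesgue. \<rho> t q * G t q)
        - (LINT q:{0..1}|lebesgue. g q * G 0 q)
        - (LINT s:{0..t}|lebesgue. LINT q:{0<..<1}|lebesgue.
             \<rho> s q * (vector_derivative (\<lambda>r. G r q) (at s within {0..T}) + L_op \<gamma> \<kappa> (G s) q))
        - \<kappa> * (LINT s:{0..t}|lebesgue. LINT q:{0<..<1}|lebesgue. G s q * V0 \<gamma> \<alpha> \<beta> q)
        = 0)"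

end

theory Submission
  imports Defs "HOL-Complex_Analysis.Great_Picard"
begin

text \<open>The expectations \<open>m\<^sub>t(x)\<close> of the occupation variables solve a closed linear equation, and the occupation variables
  started from a fixed configuration are negatively correlated, so the empirical measure concentrates around \<open>m\<^sub>t\<close>. A
  Lyapunov functional for the linear equation bounds the energy of \<open>m\<^sub>t\<close> and of its time derivative at positive times,
  uniformly in \<open>N\<close>; this gives strong compactness, and every limit point is a weak solution. Uniqueness of weak solutions
  follows by testing with near-maximizers of the dual energy norm of the difference of two solutions.\<close>

text \<open>Negative correlation needs a fixed starting configuration: for a general initial law the
  covariances need not vanish at time 0. Convergence in probability is therefore shown by
  contradiction. If it failed, initial configurations with a bad outcome would carry probability
  bounded below for infinitely many N. As the laws are associated to g, such configurations can be
  picked that are themselves associated to g; along a subsequence their means converge to a weak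
  solution, which is unique. Existence comes from the same construction. Only one-time marginals
  enter, so no compactness of path laws is involved.

  The initial profile is merely measurable and may have infinite energy. This dictates the powers of
  t in the Lyapunov functional and the separate treatment of time 0. For \<theta> = -1 the
  reservoirs act as a killing potential of order one with singularity q^(-1-\<gamma>). It controls
  functions near the boundary, so that those of finite total energy are approximated by compactly
  supported ones of bounded energy, and its positive lower bound gives coercivity.\<close>

abbreviation (input) seq_limit (infix "---->" 60) where "seq_limit X L == X \<longlonglongrightarrow> L"
abbreviation (input) nn_lborel (binder "NL " 10) where "nn_lborel f == integral\<^sup>N lborel f"
notation (input) abs ("|_|")

section \<open>The jump kernel and its scaling\<close>

text \<open>\<open>infsum\<close> of a divergent family is 0 and \<open>1 / 0\<close> is 0, so
  positivity depends on summability and not only on the sign of the terms. The term z = 1 already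
  contributes 1.\<close>

lemma c_norm_pos:
 assumes "1 < \<gamma>"
 shows "0 < c_norm \<gamma>"
proof -
 define f :: "int => real" where "f z = |real_of_int z| powr (- \<gamma> - 1)" for z
 have sn: "summable (%n::nat. real n powr (- \<gamma> - 1))"
  using assms by (subst summable_real_powr_iff) auto
 have "summable (%n::nat. real (Suc n) powr (- \<gamma> - 1))"
  using summable_Suc_iff[of "%n. real n powr (- \<gamma> - 1)"] sn by blast
 then have s0: "(%n::nat. real (Suc n) powr (- \<gamma> - 1)) summable_on UNIV"
  by (subst summable_on_UNIV_nonneg_real_iff) auto
 have r1: "(f \<circ> (%n. int (Suc n))) = (%n. real (Suc n) powr (- \<gamma> - 1))"
  by (auto simp: f_def fun_eq_iff add.commute)
 have r2: "(f \<circ> (%n. - int (Suc n))) = (%n. real (Suc n) powr (- \<gamma> - 1))"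
  by (auto simp: f_def fun_eq_iff add.commute abs_if)
 have a1: "f summable_on range (%n. int (Suc n))"
  using s0 unfolding r1[symmetric] by (subst summable_on_reindex) (auto intro: injI)
 have a2: "f summable_on range (%n. - int (Suc n))"
  using s0 unfolding r2[symmetric] by (subst summable_on_reindex) (auto intro: injI)
 have e: "UNIV - {0::int} = range (%n. int (Suc n)) \<union> range (%n. - int (Suc n))"
 proof (intro set_eqI iffI)
  fix z :: int assume "z : UNIV - {0}"
  then have "z = int (Suc (nat z - 1)) \<or> z = - int (Suc (nat (-z) - 1))" by auto
  then show "z : range (%n. int (Suc n)) \<union> range (%n. - int (Suc n))" by blast
 qed auto
 have s: "f summable_on (UNIV - {0})"
  unfolding e by (rule summable_on_Un_disjoint[OF a1 a2]) auto
 have "sum f {1} <= infsum f (UNIV - {0})"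
  by (rule finite_sum_le_infsum[OF s]) (auto simp: f_def)
 then have "1 <= infsum f (UNIV - {0})" by (simp add: f_def)
 then show ?thesis unfolding c_norm_def f_def by simp
qed

text \<open>Comparison with the integral of x^(a-1): since this function decreases, the mean value
  theorem bounds each term by the increment of x^a / a. The singularity at 0 is integrable; the
  first term, next to it, is treated separately.\<close>

lemma sum_powr_le:
 fixes a :: real
 assumes "0 < a" "a < 1"
 shows "(\<Sum>z=1..M. real z powr (a - 1)) <= real M powr a / a"
proof (induction M)
 case (Suc M)
 have "real (Suc M) powr (a - 1) <= (real (Suc M) powr a - real M powr a) / a"
 proof (cases "M = 0")
  case False
  have "\<exists>z. real M < z & z < real (Suc M) \<and>
    real (Suc M) powr a - real M powr a = (real (Suc M) - real M) * (a * z powr (a - 1))"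
   using False by (intro MVT2) (auto intro!: derivative_eq_intros)
  then obtain z where z: "real M < z" "z < real (Suc M)"
   "real (Suc M) powr a - real M powr a = a * z powr (a - 1)" by auto
  have "real (Suc M) powr (a - 1) <= z powr (a - 1)"
   using z assms False by (intro powr_mono2') auto
  then show ?thesis using z assms by simp
 qed (use assms in auto)
 then show ?case using Suc by (simp add: diff_divide_distrib)
qed (use assms in auto)

locale frac_params =
 fixes \<gamma> \<kappa> \<alpha> \<beta> :: real
 assumes gam: "1 < \<gamma>" "\<gamma> < 2" and kap: "0 < \<kappa>"
  and al: "0 <= \<alpha>" "\<alpha> <= 1" and be: "0 <= \<beta>" "\<beta> <= 1"
begin

abbreviation "cg \<equiv> c_norm \<gamma>"

lemma cg: "0 < cg" using c_norm_pos gam by blast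

text \<open>Since \<open>0 powr x = 0\<close>, the value at 0 is 0, as for \<open>jump_prob\<close>;
  double sums may then run over the diagonal without case distinctions.\<close>

definition kern :: "real => real" where "kern d = cg * |d| powr (- \<gamma> - 1)"

lemma kern_nonneg [simp]: "0 <= kern d" using cg by (simp add: kern_def)
lemma kern_0 [simp]: "kern 0 = 0" by (simp add: kern_def)
lemma kern_minus [simp]: "kern (- d) = kern d" by (simp add: kern_def)
lemma kern_commute: "kern (a - b) = kern (b - a)" by (simp add: kern_def abs_minus_commute)

lemma kern_inverse: "kern d = cg / |d| powr (1 + \<gamma>)"
proof -
 have "- \<gamma> - 1 = - (1 + \<gamma>)" by simp
 then show ?thesis unfolding kern_def by (simp only: powr_minus divide_inverse)
qed

lemma kern_measurable [measurable]: "kern : borel_measurable borel"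
 unfolding kern_def by measurable

lemma kern_antimono: "0 < |a| ==> |a| <= |b| ==> kern b <= kern a"
 unfolding kern_def using cg gam by (intro mult_left_mono powr_mono2') auto

lemma kern_ge: "0 < |d| ==> |d| <= 1 ==> cg <= kern d"
 using kern_antimono[of d 1] by (simp add: kern_def)

lemma kern_mult: "kern (r * d) = |r| powr (- \<gamma> - 1) * kern d"
 unfolding kern_def by (simp add: abs_mult powr_mult)

lemma kern_tendsto: "d ~= 0 ==> (f \<longlongrightarrow> d) F ==> ((%x. kern (f x)) \<longlongrightarrow> kern d) F"
 unfolding kern_def by (intro tendsto_intros) auto

lemma kern_square: "0 <= d ==> kern d * d^2 = cg * d powr (1 - \<gamma>)"
proof (cases "d = 0")
 case False
 assume "0 <= d"
 have "(- \<gamma> - 1) + 2 = 1 - \<gamma>" by simp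
 then have "d powr (1 - \<gamma>) = d powr (- \<gamma> - 1) * d powr 2"
  by (metis powr_add)
 then show ?thesis using False \<open>0 <= d\<close> by (simp add: kern_def)
qed simp

lemma jump_prob_kern: "jump_prob \<gamma> z = kern (real_of_int z)"
 by (simp add: jump_prob_def kern_def)

text \<open>The time change N^\<gamma> turns jump rates into the weights of a Riemann sum of
  \<open>kern\<close> with mesh 1/N. The additional factor N of the reservoirs at \<theta> = -1
  cancels that mesh, so the reservoir rates become values of \<open>kern\<close> itself.\<close>

lemma scaled_jump_prob:
 assumes "N >= 1"
 shows "real N powr \<gamma> * jump_prob \<gamma> z = kern (real_of_int z / real N) / real N"
proof -
 have "kern (real_of_int z / real N) = (1 / real N) powr (- \<gamma> - 1) * kern (real_of_int z)"
  using kern_mult[of "1 / real N" "real_of_int z"] assms by simp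
 also have "(1 / real N) powr (- \<gamma> - 1) = real N powr (\<gamma> + 1)"
  using assms by (simp add: powr_divide powr_minus_divide[symmetric] powr_minus inverse_eq_divide add.commute)
 also have "... = real N powr \<gamma> * real N" using assms by (simp add: powr_add)
 finally show ?thesis using assms by (simp add: jump_prob_kern field_simps)
qed

definition Vk :: "real => real" where "Vk q = kern q + kern (1 - q)"

lemma Vk_nonneg [simp]: "0 <= Vk q" by (simp add: Vk_def)

lemma Vk_V1: "0 < q ==> q < 1 ==> V1 \<gamma> q = Vk q"
 by (simp add: Vk_def V1_def kern_inverse algebra_simps)

lemma Vk_ge: "0 < q ==> q < 1 ==> cg <= Vk q"
 unfolding Vk_def using kern_ge[of q] kern_nonneg[of "1-q"] by linarith

text \<open>The near-diagonal part of the jump sum, after pairing \<open>x + z\<close> with \<open>x - z\<close>, is bounded by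
  this Riemann sum of the integrable function \<open>z powr (1 - \<gamma>)\<close>.\<close>

lemma near_sum_le:
 assumes "N >= 1"
 shows "1 / real N * (\<Sum>z=1..M. kern (real z / real N) * (real z / real N)^2)
  <= cg * (real M / real N) powr (2 - \<gamma>) / (2 - \<gamma>)"
proof -
 have "(\<Sum>z=1..M. kern (real z / real N) * (real z / real N)^2)
   = (\<Sum>z=1..M. cg * (real z powr ((2 - \<gamma>) - 1) / real N powr (1 - \<gamma>)))"
  by (intro sum.cong refl) (simp add: kern_square powr_divide)
 also have "... = cg / real N powr (1 - \<gamma>) * (\<Sum>z=1..M. real z powr ((2 - \<gamma>) - 1))"
  by (simp add: sum_distrib_left mult_ac)
 also have "... <= cg / real N powr (1 - \<gamma>) * (real M powr (2 - \<gamma>) / (2 - \<gamma>))"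
  using gam cg by (intro mult_left_mono sum_powr_le) auto
 finally have "1 / real N * (\<Sum>z=1..M. kern (real z / real N) * (real z / real N)^2)
  <= 1 / real N * (cg / real N powr (1 - \<gamma>) * (real M powr (2 - \<gamma>) / (2 - \<gamma>)))"
  by (intro mult_left_mono) auto
 also have "real N powr (2 - \<gamma>) = real N * real N powr (1 - \<gamma>)"
  using assms powr_add[of "real N" 1 "1 - \<gamma>"] by simp
 then have "1 / real N * (cg / real N powr (1 - \<gamma>) * (real M powr (2 - \<gamma>) / (2 - \<gamma>)))
  = cg * (real M / real N) powr (2 - \<gamma>) / (2 - \<gamma>)"
  by (simp add: powr_divide)
 finally show ?thesis .
qed

end

section \<open>The discrete operator and its energy form\<close>

lemma bulk_finite [simp]: "finite (bulk N)" by (simp add: bulk_def)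
lemma bulk_card: "card (bulk N) = N - 1" by (simp add: bulk_def)

text \<open>The weight 1/(N-1) is that of \<open>empirical\<close>. It is also the length of the N -
  1 equal cells introduced below, so that \<open>ip\<close> is exactly the L2 product of step
  functions.\<close>

definition ip :: "nat => (nat => real) => (nat => real) => real" where
 "ip N u v = 1 / (real N - 1) * (\<Sum>x\<in>bulk N. u x * v x)"

lemma ip_commute: "ip N u v = ip N v u" by (simp add: ip_def mult.commute)
lemma ip_add: "ip N (%x. u x + u' x) v = ip N u v + ip N u' v"
 by (simp add: ip_def algebra_simps sum.distrib add_divide_distrib)
lemma ip_diff: "ip N (%x. u x - u' x) v = ip N u v - ip N u' v"
 by (simp add: ip_def algebra_simps sum_subtractf diff_divide_distrib)
lemma ip_scale: "ip N (%x. c * u x) v = c * ip N u v"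
 by (simp add: ip_def sum_distrib_left mult_ac)
lemma ip_uminus: "ip N (%x. - u x) v = - ip N u v"
 by (simp add: ip_def sum_negf)
lemma ip_nonneg: "N >= 2 ==> 0 <= ip N u u"
 unfolding ip_def by (rule mult_nonneg_nonneg[OF _ sum_nonneg]) auto
lemma ip_le:
 assumes "N >= 2" "!!x. x : bulk N ==> u x * v x <= B"
 shows "ip N u v <= B"
proof -
 have "(\<Sum>x\<in>bulk N. u x * v x) <= of_nat (card (bulk N)) * B"
  using assms(2) by (intro sum_bounded_above) auto
 also have "... = (real N - 1) * B" using assms(1) by (simp add: bulk_card of_nat_diff)
 finally show ?thesis using assms(1) by (simp add: ip_def field_simps)
qed

lemma ip_cong: "(!!x. x : bulk N ==> u x = u' x) ==> (!!x. x : bulk N ==> v x = v' x) ==> ip N u v = ip N u' v'"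
 by (simp add: ip_def)

context frac_params begin

definition dLap :: "nat => (nat => real) => nat => real" where
 "dLap N v x = 1 / real N * (\<Sum>y\<in>bulk N. kern ((real x - real y) / real N) * (v y - v x))"

text \<open>Minus the linear part of the drift of the occupation means. The reservoirs contribute
  the killing potential here; their inhomogeneous part is kept apart as a source.\<close>

definition dA :: "nat => (nat => real) => nat => real" where
 "dA N v x = - dLap N v x + \<kappa> * Vk (real x / real N) * v x"

text \<open>The weights of \<open>ip\<close> and of \<open>dLap\<close> multiplied, so that
  summation by parts reads \<open>ip N (dLap N u) u = - dR N u / 2\<close>.\<close>

definition dR :: "nat => (nat => real) => real" where
 "dR N v = 1 / ((real N - 1) * real N) *
   (\<Sum>x\<in>bulk N. \<Sum>y\<in>bulk N. kern ((real x - real y) / real N) * (v x - v y)^2)"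

definition dE :: "nat => (nat => real) => real" where "dE N v = ip N (dA N v) v"

lemma dLap_linear: "dLap N (%x. a * u x + b * v x) x = a * dLap N u x + b * dLap N v x"
 unfolding dLap_def by (simp add: sum_distrib_left sum.distrib[symmetric] algebra_simps)

lemma dA_linear: "dA N (%x. a * u x + b * v x) x = a * dA N u x + b * dA N v x"
 by (simp add: dA_def dLap_linear algebra_simps)

lemma dA_diff: "dA N (%x. u x - v x) x = dA N u x - dA N v x"
 using dA_linear[of N 1 u "-1" v x] by simp

lemma ip_dLap:
 "ip N (dLap N u) v = - (1 / (2 * (real N - 1) * real N)) *
  (\<Sum>x\<in>bulk N. \<Sum>y\<in>bulk N. kern ((real x - real y) / real N) * ((u x - u y) * (v x - v y)))"
proof -
 define K where "K x y = kern ((real x - real y) / real N)" for x y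
 have Ks: "K x y = K y x" for x y
  using kern_minus[of "(real x - real y) / real N"] by (simp add: K_def minus_divide_left)
 let ?S = "\<Sum>x\<in>bulk N. \<Sum>y\<in>bulk N. K x y * (u y - u x) * v x"
 have a: "?S = (\<Sum>x\<in>bulk N. \<Sum>y\<in>bulk N. K x y * (u x - u y) * v y)"
  by (subst sum.swap) (simp add: Ks[of _ _] mult_ac cong: sum.cong)
 have "?S + ?S = (\<Sum>x\<in>bulk N. \<Sum>y\<in>bulk N. - (K x y * ((u x - u y) * (v x - v y))))"
  by (subst (2) a) (simp add: sum.distrib[symmetric] algebra_simps)
 then have "?S = - (\<Sum>x\<in>bulk N. \<Sum>y\<in>bulk N. K x y * ((u x - u y) * (v x - v y))) / 2"
  by (simp add: sum_negf)
 moreover have "ip N (dLap N u) v = 1 / (real N - 1) * (1 / real N * ?S)"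
  unfolding ip_def dLap_def K_def by (simp add: sum_distrib_left sum_distrib_right mult_ac)
 ultimately show ?thesis by (simp add: K_def)
qed

lemma ip_dLap_self: "ip N (dLap N u) u = - dR N u / 2"
 by (simp add: ip_dLap dR_def power2_eq_square)

lemma dE_eq: "dE N v = dR N v / 2 + \<kappa> * ip N (%x. Vk (real x / real N) * v x) v"
proof -
 have "dE N v = - ip N (dLap N v) v + ip N (%x. \<kappa> * (Vk (real x / real N) * v x)) v"
  unfolding dE_def dA_def ip_uminus[symmetric] ip_add[symmetric] by (simp add: mult_ac)
 then show ?thesis by (simp add: ip_dLap_self ip_scale)
qed

lemma ip_dA_sym: "ip N (dA N u) v = ip N u (dA N v)"
proof -
 have "ip N (dA N u) v = - ip N (dLap N u) v + ip N (%x. \<kappa> * Vk (real x / real N) * u x) v" for u v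
  unfolding dA_def by (simp add: ip_uminus[symmetric] ip_add[symmetric])
 moreover have "ip N (dLap N u) v = ip N (dLap N v) u"
  by (simp add: ip_dLap mult_ac)
 ultimately show ?thesis by (simp add: ip_commute[of N u] ip_def mult_ac)
qed

lemma dR_nonneg: "N >= 2 ==> 0 <= dR N v"
 unfolding dR_def by (intro mult_nonneg_nonneg sum_nonneg) auto

lemma killing_nonneg: "N >= 2 ==> 0 <= ip N (%x. Vk (real x / real N) * v x) v"
 unfolding ip_def by (rule mult_nonneg_nonneg[OF _ sum_nonneg]) (auto simp: mult.assoc)

lemma dE_nonneg: "N >= 2 ==> 0 <= dE N v"
 unfolding dE_eq using dR_nonneg killing_nonneg kap by (simp add: add_nonneg_nonneg)

lemma dE_bilin: "dE N (%x. a * u x + b * v x) = a^2 * dE N u + 2 * a * b * ip N (dA N u) v + b^2 * dE N v"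
proof -
 have "dE N (%x. a * u x + b * v x) = ip N (%x. a * dA N u x + b * dA N v x) (%x. a * u x + b * v x)"
  unfolding dE_def by (rule ip_cong) (auto simp: dA_linear)
 also have "... = a^2 * dE N u + a * b * ip N (dA N u) v + a * b * ip N (dA N v) u + b^2 * dE N v"
  unfolding dE_def ip_def by (simp add: sum_distrib_left sum.distrib[symmetric] algebra_simps power2_eq_square)
 finally show ?thesis using ip_dA_sym[of N v u] by (simp add: ip_commute)
qed

text \<open>Discriminant of the nonnegative quadratic polynomial t -> \<open>dE\<close> of u + t v,
  which may degenerate to an affine one.\<close>

lemma dE_CS:
 assumes "N >= 2"
 shows "(ip N (dA N u) v)^2 <= dE N u * dE N v"
proof -
 let ?b = "ip N (dA N u) v"
 have q: "0 <= dE N u + 2 * t * ?b + t^2 * dE N v" for t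
  using dE_nonneg[OF assms, of "%x. 1 * u x + t * v x"] by (simp only: dE_bilin) simp
 show ?thesis
 proof (cases "dE N v = 0")
  case True
  have "?b = 0"
  proof (rule ccontr)
   assume b: "?b ~= 0"
   \<comment> \<open>At this t the affine function \<open>dE N u + 2 * t * ?b\<close> would equal
     -1.\<close>
   show False using q[of "- (dE N u + 1) / (2 * ?b)"] b True by (simp add: field_simps)
  qed
  then show ?thesis using True by simp
 next
  case False
  then have p: "dE N v > 0" using dE_nonneg[OF assms, of v] by simp
  have "0 <= dE N u + 2 * (- ?b / dE N v) * ?b + (- ?b / dE N v)^2 * dE N v" by (rule q)
  also have "... = dE N u - ?b^2 / dE N v"
   using p by (simp add: power2_eq_square field_simps)
  finally show ?thesis using p by (simp add: field_simps)
 qed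
qed

end

section \<open>Smoothing estimates for the linear equation\<close>

lemma deriv_ip:
 assumes "!!x. x : bulk N ==> ((%t. u t x) has_real_derivative u' x) F"
  and "!!x. x : bulk N ==> ((%t. v t x) has_real_derivative v' x) F"
  and "F = at t within S"
 shows "((%t. ip N (u t) (v t)) has_real_derivative ip N u' (v t) + ip N (u t) v') F"
 unfolding ip_def assms(3)
 by (rule derivative_eq_intros assms(1)[unfolded assms(3)] assms(2)[unfolded assms(3)] refl | assumption)+
   (simp add: sum.distrib algebra_simps)

text \<open>Everything the energy estimates depend on: a solution of v' = f - A v with |v| <= 1 and
  a source bounded by C and constant in time. The resulting constants involve C and t but not
  N.\<close>

locale heat_flow = frac_params +
 fixes N :: nat and v :: "real => nat => real" and f :: "nat => real" and C :: real
 assumes N2: "N >= 2"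
  and dv: "!!t x. t >= 0 ==> x : bulk N \<Longrightarrow>
   ((%s. v s x) has_real_derivative (f x - dA N (v t) x)) (at t within {0..})"
  and vb: "!!t x. t >= 0 ==> x : bulk N ==> |v t x| <= 1"
  and fb: "!!x. x : bulk N ==> |f x| <= C" and C0: "0 <= C"
begin

text \<open>The time derivative of \<open>v\<close>. As the source does not depend on time, it
  solves the homogeneous equation, so its energy decreases.\<close>

definition w :: "real => nat => real" where "w t x = f x - dA N (v t) x"

lemma deriv_dA:
 assumes "!!x. x : bulk N ==> ((%s. u s x) has_real_derivative u' x) (at t within S)" "x : bulk N"
 shows "((%s. dA N (u s) x) has_real_derivative dA N u' x) (at t within S)"
 unfolding dA_def dLap_def
 by (rule derivative_eq_intros assms refl | assumption)+ (simp add: mult.commute)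

lemma dv': "t >= 0 ==> x : bulk N ==> ((%s. v s x) has_real_derivative w t x) (at t within {0..})"
 using dv by (simp add: w_def)

lemma dw: "t >= 0 ==> x : bulk N ==> ((%s. w s x) has_real_derivative - dA N (w t) x) (at t within {0..})"
 unfolding w_def[abs_def]
 by (rule derivative_eq_intros deriv_dA[OF dv'] refl | assumption)+ (simp add: w_def[abs_def])

lemma deriv_norm_v:
 assumes "t >= 0"
 shows "((%s. ip N (v s) (v s)) has_real_derivative 2 * ip N (v t) f - 2 * dE N (v t)) (at t within {0..})"
proof -
 have "((%s. ip N (v s) (v s)) has_real_derivative ip N (w t) (v t) + ip N (v t) (w t)) (at t within {0..})"
  using assms by (intro deriv_ip[where S="{0..}" and t=t]) (auto intro: dv')
 moreover have "ip N (w t) (v t) = ip N (v t) f - dE N (v t)"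
  unfolding w_def[abs_def] by (simp add: ip_diff dE_def ip_commute)
 ultimately show ?thesis by (simp add: ip_commute)
qed

lemma deriv_norm_w:
 assumes "t >= 0"
 shows "((%s. ip N (w s) (w s)) has_real_derivative - 2 * dE N (w t)) (at t within {0..})"
proof -
 have "((%s. ip N (w s) (w s)) has_real_derivative
   ip N (%x. - dA N (w t) x) (w t) + ip N (w t) (%x. - dA N (w t) x)) (at t within {0..})"
  using assms by (intro deriv_ip[where S="{0..}" and t=t]) (auto intro: dw)
 then show ?thesis by (simp add: ip_commute[of N "w t"] ip_uminus dE_def)
qed

lemma deriv_E:
 assumes "t >= 0" "!!x. x : bulk N ==> ((%s. u s x) has_real_derivative u' x) (at t within {0..})"
 shows "((%s. dE N (u s)) has_real_derivative 2 * ip N (dA N (u t)) u') (at t within {0..})"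
proof -
 have "((%s. dE N (u s)) has_real_derivative ip N (dA N u') (u t) + ip N (dA N (u t)) u') (at t within {0..})"
  unfolding dE_def using assms by (intro deriv_ip[where S="{0..}" and t=t]) (auto intro: deriv_dA)
 moreover have "ip N (dA N u') (u t) = ip N (dA N (u t)) u'"
  by (simp add: ip_dA_sym[of N u'] ip_commute[of N u'])
 ultimately show ?thesis by simp
qed

lemma ip_vf: "t >= 0 ==> ip N (v t) f <= C"
proof (rule ip_le[OF N2])
 fix x assume "t >= 0" "x : bulk N"
 then have "|v t x| * |f x| <= 1 * C" by (intro mult_mono) (auto intro: vb fb)
 then show "v t x * f x <= C" by (metis abs_le_D1 abs_mult mult_1)
qed

lemma ip_ff: "ip N f f <= C^2"
 using fb C0 by (intro ip_le[OF N2]) (metis abs_le_square_iff abs_of_nonneg power2_eq_square)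

lemma ip_vv: "t >= 0 ==> ip N (v t) (v t) <= 1"
 using vb by (intro ip_le[OF N2]) (metis abs_le_square_iff abs_1 power2_eq_square one_power2)

text \<open>Because \<open>dA\<close> of v is f - w, the derivative is 2 <f, w> - 2 |w|^2. Young's
  inequality spends half of the dissipation on the source and keeps the other half for the Lyapunov
  functional.\<close>

lemma deriv_Ev_le:
 assumes "t >= 0"
 obtains d where "((%s. dE N (v s)) has_real_derivative d) (at t within {0..})"
  and "d <= C^2 - ip N (w t) (w t)"
proof -
 let ?d = "2 * ip N (dA N (v t)) (w t)"
 have "ip N (%x. f x - w t x) (%x. f x - w t x) = ip N f f - 2 * ip N f (w t) + ip N (w t) (w t)"
  unfolding ip_def by (simp add: algebra_simps sum.distrib sum_subtractf sum_distrib_left)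
 then have "2 * ip N f (w t) <= C^2 + ip N (w t) (w t)"
  using ip_nonneg[OF N2, of "%x. f x - w t x"] ip_ff by linarith
 moreover have "ip N (dA N (v t)) (w t) = ip N f (w t) - ip N (w t) (w t)"
  unfolding ip_diff[symmetric] by (simp add: w_def)
 ultimately have "?d <= C^2 - ip N (w t) (w t)" by linarith
 moreover have "((%s. dE N (v s)) has_real_derivative ?d) (at t within {0..})"
  using assms dv' by (intro deriv_E) auto
 ultimately show ?thesis using that by blast
qed

lemma deriv_Ew_le:
 assumes "t >= 0"
 obtains d where "((%s. dE N (w s)) has_real_derivative d) (at t within {0..})" and "d <= 0"
proof -
 have "((%s. dE N (w s)) has_real_derivative 2 * ip N (dA N (w t)) (%x. - dA N (w t) x)) (at t within {0..})"
  using assms dw by (intro deriv_E) auto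
 moreover have "ip N (dA N (w t)) (%x. - dA N (w t) x) = - ip N (dA N (w t)) (dA N (w t))"
  by (simp only: ip_commute[of N "dA N (w t)" "%x. - dA N (w t) x"] ip_uminus)
 ultimately show ?thesis using that ip_nonneg[OF N2, of "dA N (w t)"] by fastforce
qed

lemma at_interior: "t > 0 ==> (g has_real_derivative d) (at t within {0::real..}) ==> (g has_real_derivative d) (at t)"
 by (metis at_within_interior atLeast_iff interior_real_atLeast greaterThan_iff)

text \<open>The weights \<open>t\<^sup>3\<close>, \<open>t\<^sup>2\<close>, \<open>t\<close> are chosen so that the dissipation of each term absorbs the derivative of
  the weight of the preceding one. This gives parabolic smoothing uniformly in \<open>N\<close>.\<close>

lemma lyapunov:
 assumes t: "t >= 0"
 shows "t^3 * dE N (w t) + 3/2 * (t^2 * ip N (w t) (w t) + 2 * t * dE N (v t))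
  <= 3/2 + 3 * (t^2 * C^2 / 2 + C * t)"
proof -
 let ?W = "%s. ip N (w s) (w s)"
 let ?P = "%s. s^3 * dE N (w s) + 3/2 * (s^2 * ?W s + 2 * s * dE N (v s) + ip N (v s) (v s))
   - 3 * (s^2 * C^2 / 2 + s * C)"
 have der: "\<exists>d. (?P has_real_derivative d) (at s within {0..}) & d <= 0" if s: "s >= 0" for s
 proof -
  obtain d1 where d1: "((%s. dE N (w s)) has_real_derivative d1) (at s within {0..})" "d1 <= 0"
   using deriv_Ew_le[OF s] .
  obtain d2 where d2: "((%s. dE N (v s)) has_real_derivative d2) (at s within {0..})"
   "d2 <= C^2 - ?W s" using deriv_Ev_le[OF s] .
  let ?d = "3 * s^2 * dE N (w s) + s^3 * d1 + 3/2 * (2 * s * ?W s + s^2 * (- 2 * dE N (w s))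
    + 2 * dE N (v s) + 2 * s * d2 + (2 * ip N (v s) f - 2 * dE N (v s))) - 3 * (s * C^2 + C)"
  have d3: "((%s. 3 * (s^2 * C^2 / 2 + s * C)) has_real_derivative 3 * (s * C^2 + C)) (at s within {0..})"
   by (rule derivative_eq_intros refl | simp)+
  have "(?P has_real_derivative ?d) (at s within {0..})"
   by (rule d3 d1(1) d2(1) deriv_norm_w[OF s] deriv_norm_v[OF s] derivative_eq_intros refl)+
     (simp add: ring_distribs mult_ac)
  moreover have "?d <= 0"
  proof -
   have "s^3 * d1 <= 0" using d1(2) s by (simp add: mult_nonneg_nonpos)
   moreover have "s * d2 <= s * (C^2 - ?W s)" using d2(2) s by (intro mult_left_mono)
   ultimately show ?thesis using ip_vf[OF s] by (simp add: algebra_simps)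
  qed
  ultimately show ?thesis by blast
 qed
 have "?P t <= ?P 0"
 proof (rule DERIV_nonpos_imp_decreasing_open[OF t])
  fix s assume s: "0 < s" "s < t"
  from der[OF less_imp_le[OF s(1)]] obtain d
   where "(?P has_real_derivative d) (at s within {0..})" "d <= 0" by blast
  then show "\<exists>y. (?P has_real_derivative y) (at s) & y <= 0"
   using at_interior[OF s(1)] by blast
 next
  have "?P differentiable_on {0..}"
   unfolding differentiable_on_def real_differentiable_def using der by blast
  then show "continuous_on {0..t} ?P"
   by (meson atLeast_iff atLeastAtMost_iff continuous_on_subset differentiable_imp_continuous_on subsetI)
 qed
 \<comment> \<open>At time 0 only 3/2 times the squared norm of \<open>v\<close> survives, which is
   at most 3/2. No energy of the initial profile enters the bound.\<close>
 then show ?thesis using ip_vv[of 0] ip_nonneg[OF N2, of "v t"] by (simp add: algebra_simps)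
qed

lemma continuous_Ev: "continuous_on {0..t} (%s. dE N (v s))"
proof -
 have "\<exists>d. ((%s. dE N (v s)) has_real_derivative d) (at s within {0..})" if "s >= 0" for s
  using deriv_Ev_le[OF that] by blast
 then have "(%s. dE N (v s)) differentiable_on {0..}"
  unfolding differentiable_on_def real_differentiable_def by blast
 then show ?thesis
  by (meson atLeast_iff atLeastAtMost_iff continuous_on_subset differentiable_imp_continuous_on subsetI)
qed

text \<open>The squared norm of \<open>v\<close> has derivative 2 <v, f> - 2 E and stays in [0, 1].
  Thus the energy is integrable down to time 0 uniformly in N, although it is not bounded uniformly
  there.\<close>

lemma integral_energy_le:
 assumes t: "t >= 0"
 shows "integral {0..t} (%s. dE N (v s)) <= 1/2 + C * t"
proof -
 let ?E = "%s. 2 * ip N (v s) f - 2 * dE N (v s)"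
 have a: "(?E has_integral ip N (v t) (v t) - ip N (v 0) (v 0)) {0..t}"
  using t
  by (intro fundamental_theorem_of_calculus)
    (auto simp: has_real_derivative_iff_has_vector_derivative[symmetric]
     intro!: DERIV_subset[OF deriv_norm_v])
 have b: "((%s. dE N (v s)) has_integral integral {0..t} (%s. dE N (v s))) {0..t}"
  using continuous_Ev by (intro integrable_integral integrable_continuous_real)
 have "((%s. ?E s + 2 * dE N (v s)) has_integral
   (ip N (v t) (v t) - ip N (v 0) (v 0) + 2 * integral {0..t} (%s. dE N (v s)))) {0..t}"
  by (intro has_integral_add a has_integral_mult_right b)
 moreover have "((%s. 2 * C) has_integral (t - 0) *\<^sub>R (2 * C)) {0..t}"
  using has_integral_const_real[of "2*C" 0 t] t by simp
 ultimately have "ip N (v t) (v t) - ip N (v 0) (v 0) + 2 * integral {0..t} (%s. dE N (v s)) <= (t - 0) *\<^sub>R (2 * C)"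
  by (rule has_integral_le) (use ip_vf in auto)
 then show ?thesis using ip_vv[of 0] ip_nonneg[OF N2, of "v t"] by (simp add: algebra_simps)
qed

text \<open>With u = v_t - v_s frozen, the mean value theorem for the real function r -> <A u, v_r>
  gives E(u) = (t - s) <A u, w_z>. Cauchy-Schwarz in the energy form then allows one factor E(u) to
  be cancelled.\<close>

lemma energy_increment:
 assumes "0 < a" "a <= s" "s <= t" and M: "!!r. a <= r ==> r <= t ==> dE N (w r) <= M"
 shows "dE N (%x. v t x - v s x) <= M * (t - s)^2"
proof (cases "s = t")
 case False
 define u where "u x = v t x - v s x" for x
 have "\<exists>z. s < z & z < t & ip N (dA N u) (v t) - ip N (dA N u) (v s) = (t - s) * ip N (dA N u) (w z)"
 proof (rule MVT2)
  show "s < t" using False assms by simp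
  fix r assume r: "s <= r" "r <= t"
  have "((%r. ip N (dA N u) (v r)) has_real_derivative ip N (%_. 0) (v r) + ip N (dA N u) (w r)) (at r within {0..})"
   using r assms dv' by (intro deriv_ip[where S="{0..}" and t=r]) auto
  then show "((%r. ip N (dA N u) (v r)) has_real_derivative ip N (dA N u) (w r)) (at r)"
   using r assms at_interior[of r] by (simp add: ip_def)
 qed
 then obtain z where z: "s < z" "z < t"
  "ip N (dA N u) (v t) - ip N (dA N u) (v s) = (t - s) * ip N (dA N u) (w z)" by blast
 have e: "dE N u = (t - s) * ip N (dA N u) (w z)"
  unfolding z(3)[symmetric] dE_def by (simp add: u_def[abs_def] ip_commute[of N "dA N _"] ip_diff)
 then have "(dE N u)^2 = (t - s)^2 * (ip N (dA N u) (w z))^2" by (simp add: power_mult_distrib)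
 also have "... <= (t - s)^2 * (dE N u * dE N (w z))" by (intro mult_left_mono dE_CS[OF N2]) auto
 also have "... <= (t - s)^2 * (dE N u * M)"
  using M[of z] z assms dE_nonneg[OF N2] by (intro mult_left_mono) auto
 finally have "dE N u * dE N u <= dE N u * (M * (t - s)^2)" by (simp add: power2_eq_square mult_ac)
 moreover have "0 <= M" using M[of t] assms dE_nonneg[OF N2, of "w t"] by linarith
 ultimately have "dE N u <= M * (t - s)^2"
  using dE_nonneg[OF N2, of u] by (cases "dE N u = 0") auto
 then show ?thesis by (simp add: u_def[abs_def])
qed (use M[of t] assms dE_nonneg[OF N2, of "w t"] in "auto simp: dE_def dA_def dLap_def ip_def")

end

section \<open>Semigroups on a finite state space\<close>

lemma expectation_finite_set:
 assumes "finite S" "set_pmf p \<subseteq> S"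
 shows "measure_pmf.expectation p f = (\<Sum>y\<in>S. pmf p y * f y)"
 using assms by (subst integral_measure_pmf_real[of S]) (auto simp: mult.commute)

locale finite_markov =
 fixes S :: "'c set" and A :: "('c => real) => 'c => real" and K :: "real => 'c => 'c pmf"
 assumes finS: "finite S" and tf: "transition_function S A K"
begin

abbreviation kex :: "real => 'c => ('c => real) => real" where
 "kex t x f \<equiv> measure_pmf.expectation (K t x) f"

lemma K_supp: "t >= 0 ==> x : S ==> set_pmf (K t x) \<subseteq> S"
 using tf unfolding transition_function_def by blast

lemma kex_sum: "t >= 0 ==> x : S ==> kex t x f = (\<Sum>y\<in>S. pmf (K t x) y * f y)"
 by (intro expectation_finite_set finS K_supp)

lemma kex_0: "x : S ==> kex 0 x f = f x"
 using tf unfolding transition_function_def by simp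

lemma kex_add:
 assumes "s >= 0" "t >= 0" "x : S"
 shows "kex (s + t) x f = kex s x (%y. kex t y f)"
proof -
 have "K (s + t) x = bind_pmf (K s x) (K t)"
  using tf assms unfolding transition_function_def by blast
 then have "kex (s + t) x f = (\<Sum>a\<in>S. pmf (K s x) a *\<^sub>R kex t a f)"
  using assms K_supp finS by (simp only:, intro pmf_expectation_bind) (auto intro: finite_subset)
 then show ?thesis using assms by (simp add: kex_sum)
qed

lemma kex_cong: "t >= 0 ==> x : S ==> (!!y. y : S ==> f y = g y) ==> kex t x f = kex t x g"
 by (simp add: kex_sum)

lemma kex_plus: "t >= 0 ==> x : S ==> kex t x (%y. f y + g y) = kex t x f + kex t x g"
 by (simp add: kex_sum algebra_simps sum.distrib)
lemma kex_minus: "t >= 0 ==> x : S ==> kex t x (%y. f y - g y) = kex t x f - kex t x g"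
 by (simp add: kex_sum algebra_simps sum_subtractf)
lemma kex_cmult: "t >= 0 ==> x : S ==> kex t x (%y. c * f y) = c * kex t x f"
 by (simp add: kex_sum sum_distrib_left mult_ac)
lemma kex_const [simp]: "kex t x (%y. c) = c"
 by simp
lemma kex_setsum: "t >= 0 ==> x : S ==> kex t x (%y. \<Sum>i\<in>I. f i y) = (\<Sum>i\<in>I. kex t x (f i))"
 by (simp add: kex_sum sum_distrib_left) (rule sum.swap)

lemma kex_mono: "t >= 0 ==> x : S ==> (!!y. y : S ==> f y <= g y) ==> kex t x f <= kex t x g"
 by (simp add: kex_sum sum_mono mult_left_mono)

lemma kex_abs_le:
 assumes "t >= 0" "x : S"
 shows "|kex t x f| <= (\<Sum>y\<in>S. |f y| )"
proof -
 have "|kex t x f| <= (\<Sum>y\<in>S. |pmf (K t x) y * f y| )" using assms by (simp add: kex_sum)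
 also have "... <= (\<Sum>y\<in>S. 1 * |f y| )"
  unfolding abs_mult by (intro sum_mono mult_right_mono) (auto simp: pmf_le_1)
 finally show ?thesis by simp
qed

lemma generator: "x : S ==> ((%h. (kex h x f - f x) / h) \<longlongrightarrow> A f x) (at_right 0)"
 using tf unfolding transition_function_def by blast

lemma kex_right_0: "x : S ==> ((%h. kex h x f - f x) \<longlongrightarrow> 0) (at_right 0)"
proof -
 assume x: "x : S"
 have "((%h. h * ((kex h x f - f x) / h)) \<longlongrightarrow> 0 * A f x) (at_right 0)"
  by (intro tendsto_mult generator x) (auto intro: tendsto_ident_at)
 then have "((%h. h * ((kex h x f - f x) / h)) \<longlongrightarrow> 0) (at_right 0)" by simp
 then show ?thesis
  by (rule Lim_transform_eventually) (auto simp: eventually_at_filter)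
qed

text \<open>Since K_t f = K_(t-h) K_h f, the increment is K_(t-h) applied to K_h f - f. It is
  bounded by a sum over the finite state space that does not see the moving time t - h.\<close>

lemma kex_left_cont:
 assumes "t > 0" "x : S"
 shows "((%h. kex (t - h) x f) \<longlongrightarrow> kex t x f) (at_right 0)"
proof -
 have "((%h. \<Sum>y\<in>S. |kex h y f - f y| ) \<longlongrightarrow> (\<Sum>y\<in>S. |0| )) (at_right 0)"
  by (intro tendsto_sum tendsto_rabs kex_right_0)
 then have z: "((%h. \<Sum>y\<in>S. |kex h y f - f y| ) \<longlongrightarrow> 0) (at_right 0)" by simp
 have "((%h. kex (t - h) x f - kex t x f) \<longlongrightarrow> 0) (at_right 0)"
 proof (rule Lim_null_comparison[OF _ z])
  have "eventually (%h. 0 < h & h < t) (at_right (0::real))"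
   using assms eventually_at_right_less eventually_at_right[of 0 t] by (auto simp: eventually_at_right_field)
  then show "eventually (%h. norm (kex (t - h) x f - kex t x f) <= (\<Sum>y\<in>S. |kex h y f - f y| )) (at_right 0)"
  proof eventually_elim
   case (elim h)
   have "kex t x f = kex (t - h) x (%y. kex h y f)"
    using kex_add[of "t - h" h x f] elim assms by simp
   then have "kex t x f - kex (t - h) x f = kex (t - h) x (%y. kex h y f - f y)"
    using elim assms by (simp add: kex_minus)
   then show ?case using kex_abs_le[of "t - h" x "%y. kex h y f - f y"] elim assms
    by (simp add: abs_minus_commute)
  qed
 qed
 then show ?thesis by (simp add: LIM_zero_iff)
qed

text \<open>The definition supplies only the right derivative at time 0. On the right of t one has
  K_(t+h) = K_t K_h with K_t fixed. On the left K_t = K_(t-h) K_h has a moving first factor, which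
  costs a uniform estimate of the difference quotients and left continuity of s -> K_s (A
  f).\<close>

lemma kex_deriv:
 assumes t: "t >= 0" and x: "x : S"
 shows "((%s. kex s x f) has_real_derivative kex t x (A f)) (at t within {0..})"
proof -
 have ev: "eventually (%h. 0 < h) (at_right (0::real))" by (simp add: eventually_at_right_less)
 have r: "((%h. (kex (h + t) x f - kex t x f) / (h + t - t)) \<longlongrightarrow> kex t x (A f)) (at_right 0)"
 proof (rule Lim_transform_eventually)
  show "((%h. \<Sum>y\<in>S. pmf (K t x) y * ((kex h y f - f y) / h)) \<longlongrightarrow> kex t x (A f)) (at_right 0)"
   unfolding kex_sum[OF t x, of "A f"] by (intro tendsto_sum tendsto_mult tendsto_const generator)
  show "eventually (%h. (\<Sum>y\<in>S. pmf (K t x) y * ((kex h y f - f y) / h)) =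
    (kex (h + t) x f - kex t x f) / (h + t - t)) (at_right 0)"
   using ev
  proof eventually_elim
   case (elim h)
   have "kex (h + t) x f = kex t x (%y. kex h y f)"
    using kex_add[of t h x f] elim t x by (simp add: add.commute)
   then have "(kex (h + t) x f - kex t x f) / h = kex t x (%y. (1 / h) * (kex h y f - f y))"
    unfolding kex_cmult[OF t x] kex_minus[OF t x] by simp
   also have "... = (\<Sum>y\<in>S. pmf (K t x) y * ((kex h y f - f y) / h))"
    unfolding kex_sum[OF t x] by simp
   finally show ?case by simp
  qed
 qed
 show ?thesis
 proof (cases "t = 0")
  case True
  have "((%y. (kex y x f - kex t x f) / (y - t)) \<longlongrightarrow> kex t x (A f)) (at_right 0)"
   using r True by simp
  then show ?thesis using True by (simp add: has_field_derivative_iff at_within_Ici_at_right)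
 next
  case False
  then have tp: "t > 0" using t by simp
  have l: "((%h. (kex (t - h) x f - kex t x f) / (t - h - t)) \<longlongrightarrow> kex t x (A f)) (at_right 0)"
  proof -
   let ?D = "%h. kex (t - h) x (A f)"
   have z: "((%h. \<Sum>y\<in>S. |(kex h y f - f y) / h - A f y| ) \<longlongrightarrow> 0) (at_right 0)"
    by (rule tendsto_null_sum, rule tendsto_rabs_zero, rule LIM_zero, rule generator)
   have "((%h. (kex (t - h) x f - kex t x f) / (t - h - t) - ?D h) \<longlongrightarrow> 0) (at_right 0)"
   proof (rule Lim_null_comparison[OF _ z])
    have "eventually (%h. 0 < h & h < t) (at_right (0::real))"
     using tp by (auto simp: eventually_at_right_field)
    then show "eventually (%h. norm ((kex (t - h) x f - kex t x f) / (t - h - t) - ?D h)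
      <= (\<Sum>y\<in>S. |(kex h y f - f y) / h - A f y| )) (at_right 0)"
    proof eventually_elim
     case (elim h)
     then have th: "t - h >= 0" by simp
     have "kex t x f = kex (t - h) x (%y. kex h y f)"
      using kex_add[of "t - h" h x f] elim x by simp
     then have "(kex t x f - kex (t - h) x f) / h - ?D h = kex (t - h) x (%y. (1 / h) * (kex h y f - f y) - A f y)"
      unfolding kex_minus[OF th x] kex_cmult[OF th x] by (simp add: kex_minus[OF th x])
     moreover have "(kex (t - h) x f - kex t x f) / (t - h - t) = (kex t x f - kex (t - h) x f) / h"
      using elim by (simp add: field_simps)
     ultimately show ?case using kex_abs_le[OF th x, of "%y. (1 / h) * (kex h y f - f y) - A f y"] by simp
    qed
   qed
   from tendsto_add[OF this kex_left_cont[OF tp x, of "A f"]] show ?thesis by simp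
  qed
  have "((%y. (kex y x f - kex t x f) / (y - t)) \<longlongrightarrow> kex t x (A f)) (at_right t)"
   unfolding filterlim_at_right_to_0[of _ _ t] using r .
  moreover have "((%y. (kex y x f - kex t x f) / (y - t)) \<longlongrightarrow> kex t x (A f)) (at_left t)"
   unfolding filterlim_at_left_to_right filterlim_at_right_to_0[of _ _ "- t"] using l by simp
  ultimately have "((%s. kex s x f) has_real_derivative kex t x (A f)) (at t)"
   unfolding has_field_derivative_iff by (simp add: filterlim_split_at)
  then show ?thesis by (rule has_field_derivative_at_within)
 qed
qed

end

text \<open>The Markov property with s = 0, integrated: the law at time t is \<mu> followed by K_t.
  Since the theorem concerns single times, the process enters the rest of the proof only through
  this formula and the generator.\<close>

lemma markov_process_law:
 assumes mp: "markov_process M S A \<mu> X" and fin: "finite S"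
 obtains K where "transition_function S A K"
  and "!!t B. t >= 0 ==> measure M {\<omega> : space M. X t \<omega> : B} = (\<integral>\<xi>. measure_pmf.prob (K t \<xi>) B \<partial>\<mu>)"
proof -
 from mp obtain K where tf: "transition_function S A K" and K: "!!s t f. s >= 0 ==> t >= 0 \<Longrightarrow>
   AE \<omega> in M. real_cond_exp M (natural_filtration M S X s) (%\<omega>. f (X (s + t) \<omega>)) \<omega>
      = measure_pmf.expectation (K t (X s \<omega>)) f"
  unfolding markov_process_def by auto
 have ps: "prob_space M" and X: "!!t. t >= 0 ==> X t : M \<rightarrow>\<^sub>M count_space S"
  and d: "distr M (count_space S) (X 0) = \<mu>"
  using mp unfolding markov_process_def by auto
 interpret prob_space M by fact
 let ?F = "natural_filtration M S X 0"
 let ?G = "{X r -` B \<inter> space M | r B. 0 <= r & r <= 0 & B \<subseteq> S}"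
 have G: "?G \<subseteq> sets M" using measurable_sets[OF X[of 0]] by auto
 have "subalgebra M ?F"
  unfolding subalgebra_def natural_filtration_def
  using G sets.sigma_sets_subset[OF G] sets.space_closed[of M]
  by (auto simp: space_measure_of_conv sets_measure_of_conv intro: order_trans)
 then interpret finite_measure_subalgebra M ?F by unfold_locales
 have "measure M {\<omega> : space M. X t \<omega> : B} = (\<integral>\<xi>. measure_pmf.prob (K t \<xi>) B \<partial>\<mu>)" if t: "t >= 0" for t B
 proof -
  have im: "(%\<omega>. indicator B (X t \<omega>) :: real) : borel_measurable M"
   using measurable_compose[OF X[OF t], of "indicator B" borel] by simp
  have int: "integrable M (%\<omega>. indicator B (X t \<omega>) :: real)"
   by (rule integrable_const_bound[where B=1]) (use im in "auto simp: indicator_def")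
  have s: "{\<omega> : space M. X t \<omega> : B} : sets M"
  proof -
   have "{\<omega> : space M. X t \<omega> : B} = X t -` (B \<inter> S) \<inter> space M"
    using measurable_space[OF X[OF t]] by auto
   then show ?thesis using measurable_sets[OF X[OF t], of "B \<inter> S"] by simp
  qed
  have "measure M {\<omega> : space M. X t \<omega> : B} = (\<integral>\<omega>. indicator {\<omega> : space M. X t \<omega> : B} \<omega> \<partial>M)"
   using s by simp
  also have "... = (\<integral>\<omega>. indicator B (X t \<omega>) \<partial>M)"
   by (intro Bochner_Integration.integral_cong) (auto simp: indicator_def)
  also have "... = (\<integral>\<omega>. real_cond_exp M ?F (%\<omega>. indicator B (X t \<omega>)) \<omega> \<partial>M)"
   using real_cond_exp_int(2)[OF int] by simp
  also have "... = (\<integral>\<omega>. measure_pmf.expectation (K t (X 0 \<omega>)) (indicator B) \<partial>M)"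
   using K[of 0 t "indicator B"] t
   by (intro integral_cong_AE) (auto intro!: measurable_compose[OF X[of 0]])
  also have "... = (\<integral>\<xi>. measure_pmf.expectation (K t \<xi>) (indicator B) \<partial>\<mu>)"
   unfolding d[symmetric] by (intro integral_distr[symmetric]) (use X[of 0] in auto)
  finally show ?thesis by simp
 qed
 with tf show ?thesis using that by blast
qed

section \<open>The generator on functions of one and two sites\<close>

lemma configs_finite [simp]: "finite (configs N)"
 unfolding configs_def by (intro finite_PiE) auto

lemma configs_cases: "\<eta> : configs N ==> x : bulk N ==> \<eta> x = 0 \<or> \<eta> x = 1"
 by (auto simp: configs_def PiE_def Pi_def)

text \<open>The square makes the positive part continuously differentiable, so that a maximum
  principle can be proved by differentiating a sum of squares.\<close>

lemma has_deriv_pos_part_sq: "((%x::real. (max 0 x)^2) has_real_derivative 2 * max 0 y) (at y)"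
proof (cases "y = 0")
 case True
 have "((%h::real. (max 0 h)^2 / h) \<longlongrightarrow> 0) (at 0)"
 proof (rule Lim_null_comparison)
  show "eventually (%h::real. norm ((max 0 h)^2 / h) <= |h| ) (at 0)"
   by (intro always_eventually) (auto simp: max_def power2_eq_square)
  show "((%h::real. |h| ) \<longlongrightarrow> 0) (at 0)" by (intro tendsto_rabs_zero tendsto_ident_at)
 qed
 then show ?thesis using True by (simp add: has_field_derivative_iff)
next
 case False
 show ?thesis
 proof (cases "y > 0")
  case True
  have "((%x::real. x^2) has_real_derivative 2 * y) (at y)" by (auto intro!: derivative_eq_intros)
  then have "((%x::real. (max 0 x)^2) has_real_derivative 2 * y) (at y)"
   by (rule DERIV_cong_ev[THEN iffD1, OF refl _ refl, rotated])
     (use True eventually_nhds_in_open[of "{0<..}" y] in "auto elim!: eventually_mono")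
  then show ?thesis using True by simp
 next
  case f: False
  have "((%x::real. 0) has_real_derivative 0) (at y)" by simp
  then have "((%x::real. (max 0 x)^2) has_real_derivative 0) (at y)"
   by (rule DERIV_cong_ev[THEN iffD1, OF refl _ refl, rotated])
     (use f False eventually_nhds_in_open[of "{..<0}" y] in "auto elim!: eventually_mono")
  then show ?thesis using f by simp
 qed
qed

text \<open>Symmetrizing, twice the sum equals minus the sum of K times
  \<open>(max 0 (c u) - max 0 (c y)) * (c u - c y)\<close>, which is nonnegative because the
  positive part is monotone.\<close>

lemma sum_pos_part_sym_le_0:
 fixes K :: "'a => 'a => real"
 assumes "!!u y. K u y = K y u" "!!u y. 0 <= K u y"
 shows "(\<Sum>u\<in>B. \<Sum>y\<in>B. K u y * (max 0 (c u) * (c y - c u))) <= 0"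
proof -
 let ?S = "\<Sum>u\<in>B. \<Sum>y\<in>B. K u y * (max 0 (c u) * (c y - c u))"
 have "?S = (\<Sum>u\<in>B. \<Sum>y\<in>B. K u y * (max 0 (c y) * (c u - c y)))"
  by (subst sum.swap) (intro sum.cong refl, simp add: assms(1))
 then have "?S + ?S = ?S + (\<Sum>u\<in>B. \<Sum>y\<in>B. K u y * (max 0 (c y) * (c u - c y)))" by simp
 also have "... = (\<Sum>u\<in>B. \<Sum>y\<in>B. K u y * ((max 0 (c u) - max 0 (c y)) * (c y - c u)))"
  by (simp add: sum.distrib[symmetric] algebra_simps)
 also have "... <= 0"
 proof (intro sum_nonpos, rule mult_nonneg_nonpos[OF assms(2)])
  fix u y
  have "(max 0 (c u) - max 0 (c y)) * (c u - c y) >= 0"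
   by (cases "c u <= c y") (auto intro: mult_nonpos_nonpos mult_nonneg_nonneg)
  then show "(max 0 (c u) - max 0 (c y)) * (c y - c u) <= 0" by (simp add: right_diff_distrib)
 qed
 finally show ?thesis by simp
qed

context frac_params begin

definition gen :: "nat => ((nat => nat) => real) => (nat => nat) => real" where
 "gen N f \<xi> = real N powr \<gamma> * exclusion_gen \<gamma> \<kappa> (-1) \<alpha> \<beta> N f \<xi>"

definition resv :: "nat => nat => real => real" where
 "resv N z m = \<kappa> * (kern (real z / real N) * (\<alpha> - m) + kern (1 - real z / real N) * (\<beta> - m))"

lemma jump_prob_minus: "jump_prob \<gamma> (a - b) = jump_prob \<gamma> (b - a)"
 by (simp add: jump_prob_kern kern_commute)

text \<open>An exchange that involves z appears once as (z, y) and once as (y, z); this cancels the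
  factor 1/2.\<close>

lemma bulk_gen_site:
 assumes "z : bulk N"
 shows "bulk_gen \<gamma> N (%\<eta>. real (\<eta> z)) \<eta> = (\<Sum>y\<in>bulk N. jump_prob \<gamma> (int z - int y) * (real (\<eta> y) - real (\<eta> z)))"
proof -
 have e: "real (exchange x y \<eta> z) - real (\<eta> z)
   = (if x = z then real (\<eta> y) - real (\<eta> z) else 0) + (if y = z then real (\<eta> x) - real (\<eta> z) else 0)" for x y
  by (auto simp: exchange_def)
 let ?s = "\<Sum>y\<in>bulk N. jump_prob \<gamma> (int z - int y) * (real (\<eta> y) - real (\<eta> z))"
 have "(\<Sum>x\<in>bulk N. \<Sum>y\<in>bulk N. jump_prob \<gamma> (int x - int y) * (real (exchange x y \<eta> z) - real (\<eta> z)))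
   = (\<Sum>x\<in>bulk N. if x = z then ?s else 0) +
    (\<Sum>x\<in>bulk N. \<Sum>y\<in>bulk N. if y = z then jump_prob \<gamma> (int x - int z) * (real (\<eta> x) - real (\<eta> z)) else 0)"
  unfolding e distrib_left sum.distrib
  by (intro arg_cong2[where f="(+)"] sum.cong refl) (auto intro: sum.cong)
 also have "... = ?s + ?s"
  using assms by (simp add: sum.delta jump_prob_minus[of "int z"])
 finally show ?thesis unfolding bulk_gen_def by simp
qed

text \<open>Exchanging u and v themselves preserves the product, so v is missing from the first sum
  and u from the second. The factor 1/2 cancels as for one site.\<close>

lemma bulk_gen_pair:
 assumes u: "u : bulk N" and v: "v : bulk N" and uv: "u ~= v"
 shows "bulk_gen \<gamma> N (%\<eta>. real (\<eta> u) * real (\<eta> v)) \<eta> =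
  (\<Sum>y\<in>bulk N - {v}. jump_prob \<gamma> (int u - int y) * (real (\<eta> y) * real (\<eta> v) - real (\<eta> u) * real (\<eta> v))) +
  (\<Sum>y\<in>bulk N - {u}. jump_prob \<gamma> (int v - int y) * (real (\<eta> u) * real (\<eta> y) - real (\<eta> u) * real (\<eta> v)))"
  (is "_ = ?s1 + ?s2")
proof -
 define a where "a y = real (\<eta> y) * real (\<eta> v) - real (\<eta> u) * real (\<eta> v)" for y
 define b where "b y = real (\<eta> u) * real (\<eta> y) - real (\<eta> u) * real (\<eta> v)" for y
 \<comment> \<open>An exchange changes the product only if exactly one of x, y lies in {u, v}; the
   four summands are the four ways this can happen.\<close>
 have e: "real (exchange x y \<eta> u) * real (exchange x y \<eta> v) - real (\<eta> u) * real (\<eta> v)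
   = (if x = u then if y : bulk N - {v} then a y else 0 else 0) + (if y = u then if x : bulk N - {v} then a x else 0 else 0)
   + (if x = v then if y : bulk N - {u} then b y else 0 else 0) + (if y = v then if x : bulk N - {u} then b x else 0 else 0)"
  if "x : bulk N" "y : bulk N" for x y
  using that uv u v by (auto simp: exchange_def a_def b_def algebra_simps)
 define Ta where "Ta y = (if y : bulk N - {v} then jump_prob \<gamma> (int u - int y) * a y else 0)" for y
 define Tb where "Tb y = (if y : bulk N - {u} then jump_prob \<gamma> (int v - int y) * b y else 0)" for y
 have e': "jump_prob \<gamma> (int x - int y) * (real (exchange x y \<eta> u) * real (exchange x y \<eta> v) - real (\<eta> u) * real (\<eta> v))
   = (if x = u then Ta y else 0) + (if y = u then Ta x else 0) + (if x = v then Tb y else 0) + (if y = v then Tb x else 0)"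
  if "x : bulk N" "y : bulk N" for x y
  unfolding e[OF that] distrib_left Ta_def Tb_def
  by (intro arg_cong2[where f="(+)"]) (auto simp: jump_prob_minus[of "int u"] jump_prob_minus[of "int v"])
 have s1: "(\<Sum>x\<in>bulk N. \<Sum>y\<in>bulk N. if x = w then T y else 0) = sum T (bulk N)"
  "(\<Sum>x\<in>bulk N. \<Sum>y\<in>bulk N. if y = w then T x else 0) = sum T (bulk N)"
  if "w : bulk N" for w and T :: "nat => real"
 proof -
  have "(\<Sum>x\<in>bulk N. \<Sum>y\<in>bulk N. if x = w then T y else 0) = (\<Sum>x\<in>bulk N. if x = w then sum T (bulk N) else 0)"
   by (intro sum.cong) auto
  then show "(\<Sum>x\<in>bulk N. \<Sum>y\<in>bulk N. if x = w then T y else 0) = sum T (bulk N)"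
   using that by simp
  show "(\<Sum>x\<in>bulk N. \<Sum>y\<in>bulk N. if y = w then T x else 0) = sum T (bulk N)"
   using that by simp
 qed
 have s2: "sum Ta (bulk N) = ?s1" "sum Tb (bulk N) = ?s2"
  unfolding Ta_def Tb_def a_def b_def by (subst sum.inter_restrict[symmetric]; auto intro: sum.cong)+
 have "(\<Sum>x\<in>bulk N. \<Sum>y\<in>bulk N. jump_prob \<gamma> (int x - int y) *
   (real (exchange x y \<eta> u) * real (exchange x y \<eta> v) - real (\<eta> u) * real (\<eta> v)))
  = (?s1 + ?s1) + (?s2 + ?s2)"
  using u v by (simp add: e' sum.distrib s1 s2 cong: sum.cong)
 then show ?thesis unfolding bulk_gen_def by simp
qed

text \<open>For an occupation number in {0, 1}, the flip rate times 1 - 2 \<eta>(x) equals r -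
  \<eta>(x). Hence the reservoir drift is affine in the occupation numbers and the moment equations
  close.\<close>

lemma reservoir_gen_eq:
 assumes N: "N >= 1" and \<eta>: "\<eta> : configs N"
  and f: "!!x. x : bulk N ==> f (flip x \<eta>) - f \<eta> = (1 - 2 * real (\<eta> x)) * d x"
 shows "real N powr \<gamma> * reservoir_gen \<gamma> \<kappa> (-1) \<alpha> \<beta> N f \<eta> = (\<Sum>x\<in>bulk N. resv N x (real (\<eta> x)) * d x)"
proof -
 have fl: "flip_rate x \<eta> r * (f (flip x \<eta>) - f \<eta>) = (r - real (\<eta> x)) * d x" if "x : bulk N" for x r
  unfolding f[OF that] flip_rate_def using configs_cases[OF \<eta> that] by auto
 have k0: "real N powr \<gamma> * (\<kappa> * real N * jump_prob \<gamma> (int 0 - int x)) = \<kappa> * kern (real x / real N)" for x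
  using scaled_jump_prob[OF N, of "int 0 - int x"] N by (simp add: field_simps)
 have kN: "real N powr \<gamma> * (\<kappa> * real N * jump_prob \<gamma> (int N - int x)) = \<kappa> * kern (1 - real x / real N)" for x
  using scaled_jump_prob[OF N, of "int N - int x"] N by (simp add: field_simps)
 have "real N powr \<gamma> * reservoir_gen \<gamma> \<kappa> (-1) \<alpha> \<beta> N f \<eta> =
  (\<Sum>x\<in>bulk N. real N powr \<gamma> * (\<kappa> * real N * jump_prob \<gamma> (int 0 - int x)) * (flip_rate x \<eta> \<alpha> * (f (flip x \<eta>) - f \<eta>)))
  + (\<Sum>x\<in>bulk N. real N powr \<gamma> * (\<kappa> * real N * jump_prob \<gamma> (int N - int x)) * (flip_rate x \<eta> \<beta> * (f (flip x \<eta>) - f \<eta>)))"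
  using N by (simp add: reservoir_gen_def sum_distrib_left distrib_left mult_ac)
 also have "... = (\<Sum>x\<in>bulk N. resv N x (real (\<eta> x)) * d x)"
  unfolding k0 kN sum.distrib[symmetric] resv_def
  by (intro sum.cong refl) (simp only: fl, simp add: algebra_simps)
 finally show ?thesis .
qed

lemma gen_site:
 assumes N: "N >= 1" and \<eta>: "\<eta> : configs N" and z: "z : bulk N"
 shows "gen N (%\<eta>. real (\<eta> z)) \<eta> = dLap N (%y. real (\<eta> y)) z + resv N z (real (\<eta> z))"
proof -
 have "real N powr \<gamma> * reservoir_gen \<gamma> \<kappa> (-1) \<alpha> \<beta> N (%\<eta>. real (\<eta> z)) \<eta> =
   (\<Sum>x\<in>bulk N. resv N x (real (\<eta> x)) * (if x = z then 1 else 0))"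
  by (intro reservoir_gen_eq N \<eta>) (use configs_cases[OF \<eta> z] in "auto simp: flip_def")
 also have "... = resv N z (real (\<eta> z))" using z by (simp add: if_distrib cong: if_cong)
 finally have b: "real N powr \<gamma> * reservoir_gen \<gamma> \<kappa> (-1) \<alpha> \<beta> N (%\<eta>. real (\<eta> z)) \<eta> = resv N z (real (\<eta> z))" .
 have "real N powr \<gamma> * bulk_gen \<gamma> N (%\<eta>. real (\<eta> z)) \<eta> = dLap N (%y. real (\<eta> y)) z"
  unfolding bulk_gen_site[OF z] dLap_def sum_distrib_left mult.assoc[symmetric] scaled_jump_prob[OF N]
  by simp
 then show ?thesis unfolding gen_def exclusion_gen_def distrib_left b by simp
qed

lemma gen_pair:
 assumes N: "N >= 1" and \<eta>: "\<eta> : configs N" and u: "u : bulk N" and v: "v : bulk N" and uv: "u ~= v"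
 shows "gen N (%\<eta>. real (\<eta> u) * real (\<eta> v)) \<eta> =
  1 / real N * (\<Sum>y\<in>bulk N - {v}. kern ((real u - real y) / real N) * (real (\<eta> y) * real (\<eta> v) - real (\<eta> u) * real (\<eta> v))) +
  1 / real N * (\<Sum>y\<in>bulk N - {u}. kern ((real v - real y) / real N) * (real (\<eta> u) * real (\<eta> y) - real (\<eta> u) * real (\<eta> v))) +
  resv N u (real (\<eta> u)) * real (\<eta> v) + resv N v (real (\<eta> v)) * real (\<eta> u)"
proof -
 have "real N powr \<gamma> * reservoir_gen \<gamma> \<kappa> (-1) \<alpha> \<beta> N (%\<eta>. real (\<eta> u) * real (\<eta> v)) \<eta> =
   (\<Sum>x\<in>bulk N. resv N x (real (\<eta> x)) * ((if x = u then real (\<eta> v) else 0) + (if x = v then real (\<eta> u) else 0)))"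
  using uv configs_cases[OF \<eta> u] configs_cases[OF \<eta> v]
  by (intro reservoir_gen_eq N \<eta>) (auto simp: flip_def)
 also have "... = resv N u (real (\<eta> u)) * real (\<eta> v) + resv N v (real (\<eta> v)) * real (\<eta> u)"
  using u v by (simp add: distrib_left sum.distrib if_distrib[of "(*) _"] cong: if_cong)
 finally have b: "real N powr \<gamma> * reservoir_gen \<gamma> \<kappa> (-1) \<alpha> \<beta> N (%\<eta>. real (\<eta> u) * real (\<eta> v)) \<eta> =
  resv N u (real (\<eta> u)) * real (\<eta> v) + resv N v (real (\<eta> v)) * real (\<eta> u)" .
 show ?thesis unfolding gen_def exclusion_gen_def distrib_left b bulk_gen_pair[OF u v uv]
  unfolding sum_distrib_left mult.assoc[symmetric] scaled_jump_prob[OF N] by simp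
qed

end

section \<open>Negative correlations and concentration\<close>

locale exclusion = frac_params +
 fixes N :: nat and K :: "real => (nat => nat) => (nat => nat) pmf" and \<xi> :: "nat => nat"
 assumes N2: "N >= 2" and tfK: "transition_function (configs N) (gen N) K" and \<xi>: "\<xi> : configs N"
begin

sublocale finite_markov "configs N" "gen N" K
 by unfold_locales (auto intro: tfK)

lemma N1: "N >= 1" using N2 by simp

definition m :: "real => nat => real" where "m t x = kex t \<xi> (%\<eta>. real (\<eta> x))"
definition pair :: "real => nat => nat => real" where "pair t x y = kex t \<xi> (%\<eta>. real (\<eta> x) * real (\<eta> y))"
definition cov :: "real => nat => nat => real" where "cov t x y = pair t x y - m t x * m t y"

lemma m_0: "m 0 x = real (\<xi> x)" by (simp add: m_def kex_0[OF \<xi>])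

lemma m_range: "t >= 0 ==> x : bulk N ==> 0 <= m t x & m t x <= 1"
 using kex_mono[OF _ \<xi>, of t "%_. 0" "%\<eta>. real (\<eta> x)"] kex_mono[OF _ \<xi>, of t "%\<eta>. real (\<eta> x)" "%_. 1"]
  configs_cases[of _ N x] by (fastforce simp: m_def)

lemmas lin = kex_plus[OF _ \<xi>] kex_minus[OF _ \<xi>] kex_cmult[OF _ \<xi>] kex_setsum[OF _ \<xi>]

lemma m_deriv:
 assumes t: "t >= 0" and z: "z : bulk N"
 shows "((%s. m s z) has_real_derivative dLap N (m t) z + resv N z (m t z)) (at t within {0..})"
proof -
 have "kex t \<xi> (gen N (%\<eta>. real (\<eta> z))) = kex t \<xi> (%\<eta>. dLap N (%y. real (\<eta> y)) z + resv N z (real (\<eta> z)))"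
  by (intro kex_cong t \<xi> gen_site N1 z)
 also have "... = dLap N (m t) z + resv N z (m t z)"
  unfolding dLap_def resv_def m_def using t by (simp add: lin)
 finally show ?thesis using kex_deriv[OF t \<xi>, of "%\<eta>. real (\<eta> z)"] by (simp add: m_def)
qed

lemma pair_deriv:
 assumes t: "t >= 0" and u: "u : bulk N" and v: "v : bulk N" and uv: "u ~= v"
 shows "((%s. pair s u v) has_real_derivative
  1 / real N * (\<Sum>y\<in>bulk N - {v}. kern ((real u - real y) / real N) * (pair t y v - pair t u v)) +
  1 / real N * (\<Sum>y\<in>bulk N - {u}. kern ((real v - real y) / real N) * (pair t u y - pair t u v)) +
  \<kappa> * (kern (real u / real N) * (\<alpha> * m t v - pair t u v) + kern (1 - real u / real N) * (\<beta> * m t v - pair t u v)) +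
  \<kappa> * (kern (real v / real N) * (\<alpha> * m t u - pair t u v) + kern (1 - real v / real N) * (\<beta> * m t u - pair t u v)))
  (at t within {0..})" (is "(_ has_real_derivative ?d) _")
proof -
 let ?e = "%x \<eta>. real ((\<eta> :: nat => nat) x)"
 have "kex t \<xi> (gen N (%\<eta>. ?e u \<eta> * ?e v \<eta>)) = kex t \<xi> (%\<eta>.
  1 / real N * (\<Sum>y\<in>bulk N - {v}. kern ((real u - real y) / real N) * (?e y \<eta> * ?e v \<eta> - ?e u \<eta> * ?e v \<eta>)) +
  1 / real N * (\<Sum>y\<in>bulk N - {u}. kern ((real v - real y) / real N) * (?e u \<eta> * ?e y \<eta> - ?e u \<eta> * ?e v \<eta>)) +
  \<kappa> * (kern (real u / real N) * (\<alpha> * ?e v \<eta> - ?e u \<eta> * ?e v \<eta>) + kern (1 - real u / real N) * (\<beta> * ?e v \<eta> - ?e u \<eta> * ?e v \<eta>)) +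
  \<kappa> * (kern (real v / real N) * (\<alpha> * ?e u \<eta> - ?e u \<eta> * ?e v \<eta>) + kern (1 - real v / real N) * (\<beta> * ?e u \<eta> - ?e u \<eta> * ?e v \<eta>)))"
 proof (intro kex_cong t \<xi>)
  fix \<eta> assume "\<eta> : configs N"
  show "gen N (%\<eta>. ?e u \<eta> * ?e v \<eta>) \<eta> =
  1 / real N * (\<Sum>y\<in>bulk N - {v}. kern ((real u - real y) / real N) * (?e y \<eta> * ?e v \<eta> - ?e u \<eta> * ?e v \<eta>)) +
  1 / real N * (\<Sum>y\<in>bulk N - {u}. kern ((real v - real y) / real N) * (?e u \<eta> * ?e y \<eta> - ?e u \<eta> * ?e v \<eta>)) +
  \<kappa> * (kern (real u / real N) * (\<alpha> * ?e v \<eta> - ?e u \<eta> * ?e v \<eta>) + kern (1 - real u / real N) * (\<beta> * ?e v \<eta> - ?e u \<eta> * ?e v \<eta>)) +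
  \<kappa> * (kern (real v / real N) * (\<alpha> * ?e u \<eta> - ?e u \<eta> * ?e v \<eta>) + kern (1 - real v / real N) * (\<beta> * ?e u \<eta> - ?e u \<eta> * ?e v \<eta>))"
   unfolding gen_pair[OF N1 \<open>\<eta> : configs N\<close> u v uv] resv_def by (simp add: algebra_simps)
 qed
 also have "... = ?d" unfolding m_def pair_def using t by (simp add: lin)
 finally show ?thesis using kex_deriv[OF t \<xi>, of "%\<eta>. ?e u \<eta> * ?e v \<eta>"] by (simp add: pair_def)
qed

text \<open>The exchange \<open>u \<leftrightarrow> v\<close> leaves the product \<open>\<eta>(u) \<eta>(v)\<close> invariant but moves the product of the means;
  this produces the last, negative term.\<close>

lemma cov_deriv:
 assumes t: "t >= 0" and u: "u : bulk N" and v: "v : bulk N" and uv: "u ~= v"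
 shows "((%s. cov s u v) has_real_derivative
  1 / real N * (\<Sum>y\<in>bulk N - {v}. kern ((real u - real y) / real N) * (cov t y v - cov t u v)) +
  1 / real N * (\<Sum>y\<in>bulk N - {u}. kern ((real v - real y) / real N) * (cov t u y - cov t u v))
  - \<kappa> * (Vk (real u / real N) + Vk (real v / real N)) * cov t u v
  - 1 / real N * kern ((real u - real v) / real N) * (m t u - m t v)^2)
  (at t within {0..})" (is "(_ has_real_derivative ?d) _")
proof -
 define k where "k x y = kern ((real x - real y) / real N)" for x y
 have ks: "k x y = k y x" for x y
  using kern_minus[of "(real x - real y) / real N"] by (simp add: k_def minus_divide_left)
 have split: "(\<Sum>y\<in>bulk N. k x y * (m t y - m t x)) * c =
   (\<Sum>y\<in>bulk N - {w}. k x y * (m t y * c - m t x * c)) + k x w * (m t w - m t x) * c"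
  if "w : bulk N" for x w c
  by (subst sum.remove[OF bulk_finite that]) (simp add: sum_distrib_left algebra_simps)
 have "((%s. cov s u v) has_real_derivative (
  1 / real N * (\<Sum>y\<in>bulk N - {v}. k u y * (pair t y v - pair t u v)) +
  1 / real N * (\<Sum>y\<in>bulk N - {u}. k v y * (pair t u y - pair t u v)) +
  \<kappa> * (kern (real u / real N) * (\<alpha> * m t v - pair t u v) + kern (1 - real u / real N) * (\<beta> * m t v - pair t u v)) +
  \<kappa> * (kern (real v / real N) * (\<alpha> * m t u - pair t u v) + kern (1 - real v / real N) * (\<beta> * m t u - pair t u v)))
  - ((1 / real N * (\<Sum>y\<in>bulk N. k u y * (m t y - m t u)) + resv N u (m t u)) * m t v
   + (1 / real N * (\<Sum>y\<in>bulk N. k v y * (m t y - m t v)) + resv N v (m t v)) * m t u)) (at t within {0..})"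
  (is "(_ has_real_derivative ?d') _")
  unfolding cov_def k_def
  by (intro DERIV_diff pair_deriv assms DERIV_cong[OF DERIV_mult'[OF m_deriv[OF t u] m_deriv[OF t v]]])
    (simp add: dLap_def)
 moreover have "?d' = ?d"
 proof -
  have a: "(\<Sum>y\<in>bulk N. k u y * (m t y - m t u)) * m t v =
    (\<Sum>y\<in>bulk N - {v}. k u y * (m t y * m t v - m t u * m t v)) + k u v * (m t v - m t u) * m t v"
   by (rule split[OF v])
  have b: "(\<Sum>y\<in>bulk N. k v y * (m t y - m t v)) * m t u =
    (\<Sum>y\<in>bulk N - {u}. k v y * (m t y * m t u - m t v * m t u)) + k u v * (m t u - m t v) * m t u"
   using split[OF u, of v "m t u"] by (simp add: ks[of u])
  have c: "(\<Sum>y\<in>bulk N - {v}. k u y * (cov t y v - cov t u v)) =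
   (\<Sum>y\<in>bulk N - {v}. k u y * (pair t y v - pair t u v)) - (\<Sum>y\<in>bulk N - {v}. k u y * (m t y * m t v - m t u * m t v))"
   by (simp add: cov_def sum_subtractf[symmetric] algebra_simps)
  have d: "(\<Sum>y\<in>bulk N - {u}. k v y * (cov t u y - cov t u v)) =
   (\<Sum>y\<in>bulk N - {u}. k v y * (pair t u y - pair t u v)) - (\<Sum>y\<in>bulk N - {u}. k v y * (m t y * m t u - m t v * m t u))"
   by (simp add: cov_def sum_subtractf[symmetric] algebra_simps)
  show ?thesis
   unfolding k_def[symmetric] distrib_right mult.assoc a b c d
   by (simp add: resv_def Vk_def cov_def algebra_simps power2_eq_square add_divide_distrib diff_divide_distrib)
 qed
 ultimately show ?thesis by simp
qed

text \<open>A maximum principle in energy form: the sum of squared positive parts over off-diagonal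
  pairs is 0 initially, since the start is a fixed configuration, and cannot grow. The jump terms
  contribute a nonpositive sum by symmetry; killing and the last term of \<open>cov_deriv\<close>
  have the right sign. The sums in \<open>cov_deriv\<close> never reach the diagonal, where
  covariances are nonnegative.\<close>

lemma cov_nonpos:
 assumes t: "t >= 0" and "u : bulk N" "v : bulk N" "u ~= v"
 shows "cov t u v <= 0"
proof -
 define D where "D s u v =
  1 / real N * (\<Sum>y\<in>bulk N - {v}. kern ((real u - real y) / real N) * (cov s y v - cov s u v)) +
  1 / real N * (\<Sum>y\<in>bulk N - {u}. kern ((real v - real y) / real N) * (cov s u y - cov s u v))
  - \<kappa> * (Vk (real u / real N) + Vk (real v / real N)) * cov s u v
  - 1 / real N * kern ((real u - real v) / real N) * (m s u - m s v)^2" for s u v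
 have ks: "kern ((real x - real y) / real N) = kern ((real y - real x) / real N)" for x y
  using kern_minus[of "(real x - real y) / real N"] by (simp add: minus_divide_left)
 let ?P = "%s. \<Sum>u\<in>bulk N. \<Sum>v\<in>bulk N - {u}. (max 0 (cov s u v))^2"
 let ?P' = "%s. \<Sum>u\<in>bulk N. \<Sum>v\<in>bulk N - {u}. 2 * max 0 (cov s u v) * D s u v"
 have der: "(?P has_real_derivative ?P' s) (at s within {0..})" if s: "s >= 0" for s
 proof (intro DERIV_sum)
  fix u v assume "u : bulk N" "v : bulk N - {u}"
  then have "((%s. cov s u v) has_real_derivative D s u v) (at s within {0..})"
   unfolding D_def using cov_deriv[OF s, of u v] by auto
  from DERIV_chain2[OF has_deriv_pos_part_sq this]
  show "((%s. (max 0 (cov s u v))^2) has_real_derivative 2 * max 0 (cov s u v) * D s u v) (at s within {0..})" .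
 qed
 have neg: "?P' s <= 0" for s
 proof -
  let ?k = "%x y. kern ((real x - real y) / real N)"
  let ?c = "cov s"
  have le: "2 * max 0 (?c u v) * D s u v <= 2 / real N * (\<Sum>y\<in>bulk N - {v}. ?k u y * (max 0 (?c u v) * (?c y v - ?c u v)))
    + 2 / real N * (\<Sum>y\<in>bulk N - {u}. ?k v y * (max 0 (?c u v) * (?c u y - ?c u v)))" (is "?l <= ?r") for u v
  proof -
   have "?l = ?r - 2 * max 0 (?c u v) * (\<kappa> * (Vk (real u / real N) + Vk (real v / real N)) * ?c u v)
     - 2 * max 0 (?c u v) * (1 / real N * ?k u v * (m s u - m s v)^2)"
    unfolding D_def by (simp add: sum_distrib_left algebra_simps)
   moreover have "0 <= max 0 (?c u v) * (\<kappa> * (Vk (real u / real N) + Vk (real v / real N)) * ?c u v)"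
   proof (cases "?c u v <= 0")
    case False then show ?thesis using kap by (intro mult_nonneg_nonneg add_nonneg_nonneg) auto
   qed simp
   moreover have "0 <= max 0 (?c u v) * (1 / real N * ?k u v * (m s u - m s v)^2)"
    by (intro mult_nonneg_nonneg) auto
   ultimately show ?thesis by linarith
  qed
  have sw: "(\<Sum>u\<in>bulk N. \<Sum>v\<in>bulk N - {u}. g u v) = (\<Sum>v\<in>bulk N. \<Sum>u\<in>bulk N - {v}. g u v)" for g :: "nat => nat => real"
  proof -
   have r: "(\<Sum>v\<in>bulk N - {u}. g' v) = (\<Sum>v\<in>bulk N. if u = v then 0 else g' v)" if "u : bulk N" for u and g' :: "nat => real"
    by (rule sum.mono_neutral_cong_left) auto
   have "(\<Sum>u\<in>bulk N. \<Sum>v\<in>bulk N - {u}. g u v) = (\<Sum>u\<in>bulk N. \<Sum>v\<in>bulk N. if u = v then 0 else g u v)"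
    by (intro sum.cong refl r)
   also have "... = (\<Sum>v\<in>bulk N. \<Sum>u\<in>bulk N. if v = u then 0 else g u v)"
    by (subst sum.swap) (intro sum.cong refl, auto)
   also have "... = (\<Sum>v\<in>bulk N. \<Sum>u\<in>bulk N - {v}. g u v)"
    by (intro sum.cong refl r[symmetric])
   finally show ?thesis .
  qed
  have "?P' s <= (\<Sum>u\<in>bulk N. \<Sum>v\<in>bulk N - {u}. 2 / real N * (\<Sum>y\<in>bulk N - {v}. ?k u y * (max 0 (?c u v) * (?c y v - ?c u v))))
    + (\<Sum>u\<in>bulk N. \<Sum>v\<in>bulk N - {u}. 2 / real N * (\<Sum>y\<in>bulk N - {u}. ?k v y * (max 0 (?c u v) * (?c u y - ?c u v))))"
   unfolding sum.distrib[symmetric] by (intro sum_mono le)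
  also have "... <= 0 + 0"
  proof (rule add_mono)
   show "(\<Sum>u\<in>bulk N. \<Sum>v\<in>bulk N - {u}. 2 / real N * (\<Sum>y\<in>bulk N - {v}. ?k u y * (max 0 (?c u v) * (?c y v - ?c u v)))) <= 0"
    by (subst sw, unfold sum_distrib_left[symmetric]) (intro mult_nonneg_nonpos sum_nonpos sum_pos_part_sym_le_0[of ?k], auto intro: ks)
   show "(\<Sum>u\<in>bulk N. \<Sum>v\<in>bulk N - {u}. 2 / real N * (\<Sum>y\<in>bulk N - {u}. ?k v y * (max 0 (?c u v) * (?c u y - ?c u v)))) <= 0"
    unfolding sum_distrib_left[symmetric]
    by (intro mult_nonneg_nonpos sum_nonpos sum_pos_part_sym_le_0[of ?k "%v. ?c _ v"]) (auto intro: ks)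
  qed
  finally show ?thesis by simp
 qed
 have "?P t <= ?P 0"
 proof (rule DERIV_nonpos_imp_decreasing_open[OF t])
  fix s assume s: "0 < s" "s < t"
  have "(?P has_real_derivative ?P' s) (at s)"
   using der[of s] s by (simp add: at_within_interior[of s "{0..}"])
  then show "\<exists>y. (?P has_real_derivative y) (at s) & y <= 0" using neg by blast
 next
  have "?P differentiable_on {0..}"
   unfolding differentiable_on_def real_differentiable_def using der by blast
  then show "continuous_on {0..t} ?P"
   by (meson atLeast_iff atLeastAtMost_iff continuous_on_subset differentiable_imp_continuous_on subsetI)
 qed
 also have "?P 0 = 0"
  by (intro sum.neutral ballI) (simp add: cov_def pair_def m_def kex_0[OF \<xi>])
 finally have "?P t <= 0" .
 moreover have "0 <= ?P t" by (intro sum_nonneg) auto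
 ultimately have z: "?P t = 0" by (rule antisym)
 then have "(\<Sum>v\<in>bulk N - {u}. (max 0 (cov t u v))^2) = 0"
  using assms(2) by (subst (asm) sum_nonneg_eq_0_iff) (auto intro!: sum_nonneg)
 then have "(max 0 (cov t u v))^2 = 0"
  using assms(3,4) by (subst (asm) sum_nonneg_eq_0_iff) auto
 then show ?thesis by simp
qed

lemma cov_diag: "t >= 0 ==> u : bulk N ==> cov t u u <= 1"
proof -
 assume t: "t >= 0" and u: "u : bulk N"
 have "pair t u u = m t u"
  unfolding pair_def m_def using configs_cases[OF _ u] by (intro kex_cong t \<xi>) fastforce
 then show ?thesis using m_range[OF t u] by (simp add: cov_def) (smt (verit) zero_le_square)
qed

definition em :: "real => (real => real) => real" where
 "em t G = 1 / (real N - 1) * (\<Sum>x\<in>bulk N. G (real x / real N) * m t x)"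

text \<open>With nonnegative weights the off-diagonal terms only lower the variance. The N - 1
  diagonal terms, each at most B^2, meet the prefactor 1/(N-1)^2.\<close>

lemma variance_nonneg_fun:
 assumes t: "t >= 0" and G: "!!x. x : bulk N ==> 0 <= G (real x / real N) & G (real x / real N) <= B"
 shows "kex t \<xi> (%\<eta>. (empirical N G \<eta> - em t G)^2) <= B^2 / (real N - 1)"
proof -
 let ?g = "%x. G (real x / real N)"
 have "(empirical N G \<eta> - em t G)^2 = (1 / (real N - 1))^2 * (\<Sum>x\<in>bulk N. \<Sum>y\<in>bulk N. ?g x * ?g y * 
   (real (\<eta> x) * real (\<eta> y) - m t y * real (\<eta> x) - m t x * real (\<eta> y) + m t x * m t y))" for \<eta>
 proof -
  have "empirical N G \<eta> - em t G = 1 / (real N - 1) * (\<Sum>x\<in>bulk N. ?g x * (real (\<eta> x) - m t x))"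
   unfolding empirical_def em_def by (simp add: sum_subtractf right_diff_distrib diff_divide_distrib)
  then show ?thesis
   unfolding power_mult_distrib power2_eq_square[of "sum _ _"] sum_product
   by (simp only: power_mult_distrib power2_eq_square[of "sum _ _"] sum_product) (simp add: algebra_simps)
 qed
 then have "kex t \<xi> (%\<eta>. (empirical N G \<eta> - em t G)^2) = (1 / (real N - 1))^2 * (\<Sum>x\<in>bulk N. \<Sum>y\<in>bulk N. ?g x * ?g y * 
   (pair t x y - m t y * m t x - m t x * m t y + m t x * m t y))"
  using t by (simp only: lin kex_const) (simp only: m_def pair_def)
 also have "... = (1 / (real N - 1))^2 * (\<Sum>x\<in>bulk N. \<Sum>y\<in>bulk N. ?g x * ?g y * cov t x y)"
  by (simp add: cov_def mult.commute)
 also have "... <= (1 / (real N - 1))^2 * (\<Sum>x\<in>bulk N. \<Sum>y\<in>bulk N. if x = y then B^2 else 0)"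
 proof (intro mult_left_mono sum_mono)
  fix x y assume x: "x : bulk N" and y: "y : bulk N"
  show "?g x * ?g y * cov t x y <= (if x = y then B^2 else 0)"
  proof (cases "x = y")
   case True
   have "?g x * ?g x * cov t x x <= ?g x * ?g x * 1"
    using G[OF x] cov_diag[OF t x] by (intro mult_left_mono) auto
   also have "... <= B * B * 1" using G[OF x] by (intro mult_right_mono mult_mono) auto
   finally show ?thesis using True by (simp add: power2_eq_square)
  next
   case False
   then show ?thesis using G[OF x] G[OF y] cov_nonpos[OF t x y] by (simp add: mult_nonneg_nonpos)
  qed
 qed auto
 also have "... = (1 / (real N - 1))^2 * ((real N - 1) * B^2)"
  using N2 by (simp add: bulk_card of_nat_diff)
 also have "... = B^2 / (real N - 1)" by (simp add: power2_eq_square)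
 finally show ?thesis .
qed

text \<open>Chebyshev's inequality. A signed G is written as (G + B) - B, both nonnegative with
  bounds 2 B and B; from (a - b)^2 <= 2 a^2 + 2 b^2 the constant is 2 * 4 + 2 = 10.\<close>

lemma concentration:
 assumes t: "t >= 0" and G: "!!x. x : bulk N ==> |G (real x / real N)| <= B" and B: "0 <= B" and d: "dl > 0"
 shows "measure_pmf.prob (K t \<xi>) {\<eta>. |empirical N G \<eta> - em t G| > dl} <= 10 * B^2 / ((real N - 1) * dl^2)"
proof -
 let ?G1 = "%q. G q + B" and ?G2 = "%q. B"
 let ?v = "%G \<eta>. (empirical N G \<eta> - em t G)^2"
 let ?A = "{\<eta>. |empirical N G \<eta> - em t G| > dl}"
 have lin1: "empirical N G \<eta> = empirical N ?G1 \<eta> - empirical N ?G2 \<eta>" for \<eta>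
  unfolding empirical_def by (simp add: distrib_right sum.distrib add_divide_distrib)
 have lin2: "em t G = em t ?G1 - em t ?G2"
  unfolding em_def by (simp add: distrib_right sum.distrib add_divide_distrib)
 have sq: "?v G \<eta> <= 2 * ?v ?G1 \<eta> + 2 * ?v ?G2 \<eta>" for \<eta>
 proof -
  define a b where "a = empirical N ?G1 \<eta> - em t ?G1" and "b = empirical N ?G2 \<eta> - em t ?G2"
  have "?v G \<eta> = (a - b)^2" unfolding lin1 lin2 a_def b_def by (simp add: algebra_simps)
  also have "... <= 2 * a^2 + 2 * b^2"
   using zero_le_power2[of "a + b"] by (simp add: power2_sum power2_diff)
  finally show ?thesis by (simp only: a_def b_def)
 qed
 have "measure_pmf.prob (K t \<xi>) ?A = kex t \<xi> (indicator ?A)" by simp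
 also have "... <= kex t \<xi> (%\<eta>. (1 / dl^2) * (2 * ?v ?G1 \<eta> + 2 * ?v ?G2 \<eta>))"
 proof (intro kex_mono t \<xi>)
  fix \<eta>
  show "indicator ?A \<eta> <= (1 / dl^2) * (2 * ?v ?G1 \<eta> + 2 * ?v ?G2 \<eta>)"
  proof (cases "\<eta> : ?A")
   case True
   then have "dl^2 <= ?v G \<eta>" using d by (metis mem_Collect_eq abs_le_square_iff abs_of_pos less_imp_le)
   then show ?thesis using True sq[of \<eta>] d by (simp add: field_simps)
  qed simp
 qed
 also have "... = (1 / dl^2) * (2 * kex t \<xi> (?v ?G1) + 2 * kex t \<xi> (?v ?G2))"
  using t by (simp only: lin)
 also have "... <= (1 / dl^2) * (2 * ((2 * B)^2 / (real N - 1)) + 2 * (B^2 / (real N - 1)))"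
 proof (intro mult_left_mono add_mono variance_nonneg_fun t)
  fix x assume "x : bulk N"
  then show "0 <= G (real x / real N) + B & G (real x / real N) + B <= 2 * B" using G[of x] by auto
 qed (use B in auto)
 also have "... = 10 * B^2 / ((real N - 1) * dl^2)" by (simp add: power_mult_distrib add_divide_distrib)
 finally show ?thesis .
qed

end

section \<open>Step functions on the unit interval\<close>

abbreviation UI :: "real measure" where "UI \<equiv> lebesgue_on {0<..<1}"

abbreviation mUI :: "(real => 'b::topological_space) set" where "mUI == borel_measurable UI"
abbreviation iUI :: "(real => real) => bool" where "iUI == integrable UI"
abbreviation lebesgue_UI (binder "IU " 10) where "lebesgue_UI f == integral\<^sup>L UI (f :: real => real)"
abbreviation nn_lebesgue_UI (binder "NU " 10) where "nn_lebesgue_UI f == integral\<^sup>N UI f"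

lemma prob_space_UI: "prob_space UI"
 by (intro prob_spaceI) (simp add: emeasure_restrict_space)

interpretation UI: prob_space UI by (rule prob_space_UI)

lemma AE_UI_neq: "AE v in UI. v ~= a"
proof -
 have "AE v in lebesgue. v ~= a"
  using negligible_sing[of a] by (intro AE_I'[of "{a}"]) (auto simp: negligible_iff_null_sets)
 then show ?thesis by (subst AE_restrict_space_iff) (auto elim: AE_mp)
qed

lemma AE_UI_I: "(!!q. 0 < q ==> q < 1 ==> P q) ==> AE q in UI. P q"
 by (rule AE_I2) simp

lemma borel_UI: "f : borel_measurable borel ==> f : mUI"
 proof -
 assume "f : borel_measurable borel"
 then have "f : borel_measurable lebesgue" by (simp add: measurable_completion)
 then show ?thesis by (rule measurable_restrict_space1)
qed

lemma indicator_UI: "A : sets borel ==> (indicator A :: real => real) : mUI"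
 by (rule borel_UI, rule borel_measurable_indicator)

lemma shift_measurable: "(%v. q - v) : borel_measurable borel" for q :: real
 by (rule borel_measurable_continuous_onI) (intro continuous_intros)

lemma LINT_UI: "(LINT q:{0<..<1}|lebesgue. f q) = (IU q. f q)" for f :: "real => real"
 unfolding set_lebesgue_integral_def by (subst integral_restrict_space) auto

lemma measurable_UI_iff: "f : mUI \<longleftrightarrow> (%q. indicator {0<..<1} q * f q) : borel_measurable lebesgue"
 for f :: "real => real"
 by (subst borel_measurable_restrict_space_iff) (auto simp: mult.commute)

lemma measurable_UI_closed:
 fixes f :: "real => real"
 shows "f : mUI \<longleftrightarrow> f : borel_measurable (lebesgue_on {0..1})"
proof -
 have s: "{0::real} : sets lebesgue" "{1::real} : sets lebesgue" by auto
 have e1: "(%q. indicator {0..1} q * f q) = (%q. indicator {0<..<1} q * f q + (f 0 * indicator {0} q + f 1 * indicator {1} q))"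
  by (auto simp: indicator_def fun_eq_iff)
 have e2: "(%q. indicator {0<..<1} q * f q) = (%q. indicator {0..1} q * f q - (f 0 * indicator {0} q + f 1 * indicator {1} q))"
  by (auto simp: indicator_def fun_eq_iff)
 have m: "(%q. f 0 * indicator {0} q + f 1 * indicator {1} q :: real) : borel_measurable lebesgue"
  using s by (intro borel_measurable_add borel_measurable_times borel_measurable_indicator) auto
 have "f : borel_measurable (lebesgue_on {0..1}) \<longleftrightarrow> (%q. indicator {0..1} q * f q) : borel_measurable lebesgue"
  by (subst borel_measurable_restrict_space_iff) (auto simp: mult.commute)
 moreover have "(%q. indicator {0..1} q * f q) : borel_measurable lebesgue"
  if "(%q. indicator {0<..<1} q * f q) : borel_measurable lebesgue"
  unfolding e1 by (rule borel_measurable_add[OF that m])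
 moreover have "(%q. indicator {0<..<1} q * f q) : borel_measurable lebesgue"
  if "(%q. indicator {0..1} q * f q) : borel_measurable lebesgue"
  unfolding e2 by (rule borel_measurable_diff[OF that m])
 ultimately show ?thesis unfolding measurable_UI_iff by blast
qed

text \<open>Weak solutions mix integrals over \<open>{0..1}\<close> and \<open>{0<..<1}\<close>. The
  endpoints are null sets, so all of them can be read on the probability space
  \<open>UI\<close>.\<close>

lemma LINT_closed_UI:
 fixes f :: "real => real"
 assumes "f : mUI"
 shows "(LINT q:{0..1}|lebesgue. f q) = (IU q. f q)"
proof -
 have "(%q. indicator {0..1} q * f q) : borel_measurable lebesgue"
  using assms unfolding measurable_UI_closed
  by (subst (asm) borel_measurable_restrict_space_iff) (auto simp: mult.commute)
 moreover have "(%q. indicator {0<..<1} q * f q) : borel_measurable lebesgue"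
  using assms unfolding measurable_UI_iff .
 moreover have "AE q in lebesgue. indicator {0..1} q * f q = indicator {0<..<1} q * f q"
 proof (rule AE_I'[of "{0,1}"])
  show "{0,1} : null_sets lebesgue" using negligible_finite[of "{0,1::real}"] by (simp add: negligible_iff_null_sets)
 qed (auto simp: indicator_def)
 ultimately have "(LINT q:{0..1}|lebesgue. f q) = (LINT q:{0<..<1}|lebesgue. f q)"
  unfolding set_lebesgue_integral_def by (intro integral_cong_AE) auto
 then show ?thesis by (simp add: LINT_UI)
qed

text \<open>The number of the cell containing q when (0,1) is cut into N - 1 equal cells, one per
  site of \<open>bulk N\<close>. Functions on sites become step functions q -> u
  (\<open>idx N q\<close>), and \<open>idx (Suc m)\<close> cuts the interval into m cells.\<close>

definition idx :: "nat => real => nat" where "idx N q = nat \<lfloor>(real N - 1) * q\<rfloor> + 1"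

lemma idx_bulk: "N >= 2 ==> 0 < q ==> q < 1 ==> idx N q : bulk N"
proof -
 assume a: "N >= 2" "0 < q" "q < 1"
 have "(real N - 1) * q < (real N - 1) * 1" using a by (intro mult_strict_left_mono) auto
 then have "\<lfloor>(real N - 1) * q\<rfloor> < int N - 1" by (simp add: floor_less_iff)
 then show ?thesis unfolding idx_def bulk_def using a by auto
qed

lemma idx_bounds:
 assumes "N >= 2" "0 < q"
 shows "(real N - 1) * q < real (idx N q)" "real (idx N q) <= (real N - 1) * q + 1"
proof -
 have "0 <= \<lfloor>(real N - 1) * q\<rfloor>" using assms by simp
 then have "real (idx N q) = of_int \<lfloor>(real N - 1) * q\<rfloor> + 1" by (simp add: idx_def)
 then show "(real N - 1) * q < real (idx N q)" "real (idx N q) <= (real N - 1) * q + 1" by linarith+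
qed

lemma idx_dist:
 assumes "N >= 2" "0 < q" "q < 1"
 shows "|real (idx N q) / real N - q| <= 1 / real N"
proof -
 have "real (idx N q) - real N * q <= 1" "- 1 <= real (idx N q) - real N * q"
  using idx_bounds[OF assms(1,2)] assms by (simp_all add: left_diff_distrib)
 then have "|(real (idx N q) - real N * q) / real N| <= 1 / real N"
  unfolding abs_divide using assms by (simp add: divide_right_mono abs_le_iff)
 then show ?thesis using assms by (simp add: diff_divide_distrib)
qed

lemma tendsto_inverse_nat: "filterlim r at_top sequentially ==> (%k. c / real (r k)) ----> 0"
 by (rule real_tendsto_divide_at_top[OF tendsto_const])
   (rule filterlim_compose[OF filterlim_real_sequentially])

lemma idx_tendsto:
 assumes "filterlim r at_top sequentially" "0 < q" "q < 1"
 shows "(%k. real (idx (r k) q) / real (r k)) ----> q"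
proof -
 have "(%k. real (idx (r k) q) / real (r k) - q) ----> 0"
 proof (rule Lim_null_comparison)
  have "eventually (%k. r k >= 2) sequentially" using assms(1) by (simp add: filterlim_at_top)
  then show "eventually (%k. norm (real (idx (r k) q) / real (r k) - q) <= 1 / real (r k)) sequentially"
   by eventually_elim (use idx_dist assms in auto)
  show "(%k. 1 / real (r k)) ----> 0" by (rule tendsto_inverse_nat) fact
 qed
 then show ?thesis by (simp add: LIM_zero_iff)
qed

lemma idx_measurable [measurable]: "idx N : borel \<rightarrow>\<^sub>M count_space UNIV"
 unfolding idx_def[abs_def] by measurable

lemma idx_measurable_UI: "(%q. F (idx N q)) : mUI"
 for F :: "nat => 'b :: topological_space"
proof -
 have "(%q. F (idx N q)) : borel_measurable borel" by measurable
 then have "(%q. F (idx N q)) : borel_measurable lebesgue" by (simp add: measurable_completion)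
 then show ?thesis by (rule measurable_restrict_space1)
qed

lemma emeasure_cell:
 assumes N: "N >= 2" and x: "x : bulk N"
 shows "emeasure UI {q : {0<..<1}. idx N q = x} = ennreal (1 / (real N - 1))"
proof -
 define n where "n = real N - 1"
 have n: "n > 0" "n >= 1" using N by (auto simp: n_def)
 let ?A = "{q : {0<..<1}. idx N q = x}"
 let ?l = "(real x - 1) / n" and ?u = "real x / n"
 have xb: "1 <= real x" "real x <= n" using x N by (auto simp: bulk_def n_def)
 have lu: "0 <= ?l" "?u <= 1" "?l <= ?u" using xb n by (auto simp: field_simps)
 have sub1: "{?l<..<?u} \<subseteq> ?A"
 proof
  fix q assume q: "q : {?l<..<?u}"
  then have q01: "0 < q" "q < 1" using lu by auto
  have "real x - 1 < n * q" "n * q < real x" using q n by (auto simp: field_simps)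
  then have "\<lfloor>n * q\<rfloor> = int x - 1" by (intro floor_unique) auto
  then show "q : ?A" using q01 xb by (auto simp: idx_def n_def[symmetric])
 qed
 have sub2: "?A \<subseteq> {?l..?u}"
 proof
  fix q assume "q : ?A"
  then have q: "0 < q" "q < 1" "idx N q = x" by auto
  show "q : {?l..?u}"
   using idx_bounds[OF N q(1)] q n by (auto simp: field_simps n_def[symmetric])
 qed
 have A: "?A : sets UI"
 proof -
  have "?A = {q : space UI. real (idx N q) = real x}" by auto
  then show ?thesis using borel_measurable_eq[OF idx_measurable_UI[of real N] borel_measurable_const[of "real x"]] by simp
 qed
 then have A': "?A : sets lebesgue" by (simp add: sets_restrict_space_iff)
 have e: "emeasure UI ?A = emeasure lebesgue ?A"
  using A' by (intro emeasure_restrict_space) auto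
 have "emeasure lebesgue {?l<..<?u} <= emeasure lebesgue ?A" by (intro emeasure_mono sub1 A')
 moreover have "emeasure lebesgue ?A <= emeasure lebesgue {?l..?u}" by (intro emeasure_mono sub2) auto
 moreover have "?u - ?l = 1 / n" by (simp add: diff_divide_distrib)
 ultimately show ?thesis using lu e by (simp add: n_def[symmetric])
qed

lemma idx_sum_indicator:
 fixes F :: "nat => 'b :: {comm_semiring_1}"
 assumes "N >= 2" "q : {0<..<1}"
 shows "F (idx N q) = (\<Sum>x\<in>bulk N. F x * indicator {q : {0<..<1}. idx N q = x} q)"
proof -
 have "(\<Sum>x\<in>bulk N. F x * indicator {q : {0<..<1}. idx N q = x} q) = (\<Sum>x\<in>bulk N. if x = idx N q then F x else 0)"
  using assms by (intro sum.cong) (auto simp: indicator_def)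
 then show ?thesis using idx_bulk[of N q] assms by simp
qed

lemma cell_sets: "{q : {0<..<1}. idx N q = x} : sets UI"
proof -
 have "{q : {0<..<1}. idx N q = x} = {q : space UI. real (idx N q) = real x}" by auto
 then show ?thesis using borel_measurable_eq[OF idx_measurable_UI[of real N] borel_measurable_const[of "real x"]] by simp
qed

lemma nn_integral_idx:
 assumes N: "N >= 2"
 shows "(NU q. F (idx N q)) = ennreal (1 / (real N - 1)) * (\<Sum>x\<in>bulk N. F x)"
proof -
 have "(NU q. F (idx N q)) = (NU q. (\<Sum>x\<in>bulk N. F x * indicator {q : {0<..<1}. idx N q = x} q))"
  using N by (intro nn_integral_cong idx_sum_indicator) auto
 also have "... = (\<Sum>x\<in>bulk N. F x * emeasure UI {q : {0<..<1}. idx N q = x})"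
  using cell_sets by (subst nn_integral_sum) (auto simp: nn_integral_cmult_indicator intro!: sum.cong)
 also have "... = (\<Sum>x\<in>bulk N. F x * ennreal (1 / (real N - 1)))"
  by (intro sum.cong refl arg_cong2[where f="(*)"] emeasure_cell[OF N])
 finally show ?thesis by (simp add: sum_distrib_right[symmetric] mult.commute)
qed

lemma integrable_idx: "iUI (%q. F (idx N q))" for F :: "nat => real"
proof (cases "N >= 2")
 case N: True
 show ?thesis
 proof (rule UI.integrable_const_bound)
  show "AE q in UI. norm (F (idx N q)) <= (\<Sum>x\<in>bulk N. |F x| )"
   using N idx_bulk by (intro AE_UI_I) (auto intro!: member_le_sum)
 qed (rule idx_measurable_UI)
next
 case False
 \<comment> \<open>For N = 0 or 1 the floor is at most 0 and \<open>nat\<close> truncates it, so the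
   step function is constant.\<close>
 have "idx N q = 1" if "0 < q" "q < 1" for q
 proof -
  have "(real N - 1) * q <= 0" using False that by (auto intro!: mult_nonpos_nonneg)
  then show ?thesis by (simp add: idx_def)
 qed
 then show ?thesis
  by (intro UI.integrable_const_bound[where B="|F 1|"] AE_UI_I) (auto intro: idx_measurable_UI)
qed

lemma integral_idx:
 fixes F :: "nat => real"
 assumes N: "N >= 2"
 shows "(IU q. F (idx N q)) = 1 / (real N - 1) * (\<Sum>x\<in>bulk N. F x)"
proof -
 have "(IU q. F (idx N q)) = (IU q. (\<Sum>x\<in>bulk N. F x * indicator {q : {0<..<1}. idx N q = x} q))"
  using N by (intro Bochner_Integration.integral_cong idx_sum_indicator) auto
 also have "... = (\<Sum>x\<in>bulk N. (IU q. F x * indicator {q : {0<..<1}. idx N q = x} q))"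
  using cell_sets by (intro Bochner_Integration.integral_sum integrable_mult_right integrable_real_indicator)
   (auto simp: UI.emeasure_eq_measure)
 also have "... = (\<Sum>x\<in>bulk N. F x * measure UI {q : {0<..<1}. idx N q = x})"
  by (auto intro!: sum.cong arg_cong[where f="measure UI"])
 also have "... = (\<Sum>x\<in>bulk N. F x * (1 / (real N - 1)))"
  using N by (intro sum.cong refl arg_cong2[where f="(*)"]) (simp only: measure_def emeasure_cell[OF N], simp)
 finally show ?thesis by (simp add: sum_divide_distrib)
qed

lemma ip_integral: "N >= 2 ==> ip N u v = (IU q. u (idx N q) * v (idx N q))"
 by (simp add: integral_idx[of N "%x. u x * v x"] ip_def)

text \<open>\<open>B\<close> controls the second derivative; the last condition expresses that \<open>G'\<close> vanishes at
  both endpoints.\<close>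

definition taylor_bound :: "(real => real) => (real => real) => real => bool" where
 "taylor_bound G G1 B \<longleftrightarrow> continuous_on {0..1} G & 0 <= B \<and>
   (\<forall>p\<in>{0..1}. \<forall>q\<in>{0..1}. |G q - G p - G1 p * (q - p)| <= B * (q - p)^2) \<and>
   (\<forall>q\<in>{0..1}. |G1 q| <= B * q & |G1 q| <= B * (1 - q))"

section \<open>Consistency of the discrete operator with the regional Laplacian\<close>

lemma mvt_bound:
 fixes f f' :: "real => real"
 assumes "!!q. q : {0..1} ==> (f has_real_derivative f' q) (at q within {0..1})"
  and p: "p : {0..1}" "q : {0..1}"
 shows "\<exists>x\<in>{0..1}. min p q <= x & x <= max p q & f q - f p = f' x * (q - p)"
proof -
 have "\<exists>x\<in>{a..b}. f b - f a = (%h. h * f' x) (b - a)" if "a <= b" "a : {0..1}" "b : {0..1}" for a b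
 proof (rule mvt_very_simple[OF that(1)])
  fix x assume "a <= x" "x <= b"
  then have "(f has_real_derivative f' x) (at x within {a..b})"
   using that by (intro DERIV_subset[OF assms(1)]) auto
  then show "(f has_derivative (%h. h * f' x)) (at x within {a..b})"
   by (simp add: has_field_derivative_def mult_commute_abs)
 qed
 then have w: "\<exists>x\<in>{a..b}. f b - f a = f' x * (b - a)" if "a <= b" "a : {0..1}" "b : {0..1}" for a b
  using that by (auto simp: mult.commute)
 show ?thesis
 proof (cases "p <= q")
  case True
  from w[OF True p] obtain x where "x : {p..q}" "f q - f p = f' x * (q - p)" by blast
  then show ?thesis using True p by (intro bexI[of _ x]) auto
 next
  case False
  then have "q <= p" by simp
  from w[OF this p(2,1)] obtain x where x: "x : {q..p}" "f p - f q = f' x * (p - q)" by blast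
  have "f q - f p = f' x * (q - p)" using x(2) by (simp add: algebra_simps)
  then show ?thesis using x(1) False p by (intro bexI[of _ x]) auto
 qed
qed

lemma taylor_boundI:
 assumes G: "!!q. q : {0..1} ==> (G has_real_derivative G1 q) (at q within {0..1})"
  and G1: "!!q. q : {0..1} ==> (G1 has_real_derivative G2 q) (at q within {0..1})"
  and B: "!!q. q : {0..1} ==> |G2 q| <= B" and z: "G1 0 = 0" "G1 1 = 0"
 shows "taylor_bound G G1 B"
proof -
 have lip: "|G1 q - G1 p| <= B * |q - p|" if pq: "p : {0..1}" "q : {0..1}" for p q
 proof -
  obtain x where "x : {0..1}" "G1 q - G1 p = G2 x * (q - p)"
   using mvt_bound[where f=G1 and f'=G2, OF G1 pq] by blast
  then show ?thesis using B[of x] by (simp add: abs_mult mult_right_mono)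
 qed
 have "|G q - G p - G1 p * (q - p)| <= B * (q - p)^2" if pq: "p : {0..1}" "q : {0..1}" for p q
 proof -
  obtain x where x: "x : {0..1}" "min p q <= x" "x <= max p q" "G q - G p = G1 x * (q - p)"
   using mvt_bound[where f=G and f'=G1, OF G pq] by blast
  have "|G1 x - G1 p| <= B * |x - p|" using lip[OF pq(1) x(1)] .
  also have "... <= B * |q - p|"
   using x(2,3) B[of 0] by (intro mult_left_mono) (auto simp: min_def max_def split: if_splits)
  finally have "|G1 x - G1 p| * |q - p| <= B * |q - p| * |q - p|" by (intro mult_right_mono) auto
  moreover have "G q - G p - G1 p * (q - p) = (G1 x - G1 p) * (q - p)" using x(4) by (simp add: algebra_simps)
  ultimately show ?thesis by (simp add: abs_mult power2_eq_square abs_mult_self_eq mult.assoc)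
 qed
 moreover have "continuous_on {0..1} G" using G by (rule DERIV_continuous_on)
 moreover have "|G1 q| <= B * q & |G1 q| <= B * (1 - q)" if "q : {0..1}" for q
  using lip[of 0 q] lip[of 1 q] that z by (simp add: abs_minus_commute)
 moreover have "0 <= B" using B[of 0] by simp
 ultimately show ?thesis unfolding taylor_bound_def by blast
qed

lemma bounded_cont01:
 assumes "continuous_on {0..1::real} (G :: real => real)"
 obtains C where "C >= 0" "!!q. q : {0..1} ==> |G q| <= C"
proof -
 have "bounded (G ` {0..1})" by (intro compact_imp_bounded compact_continuous_image assms) auto
 then obtain C where C: "\<forall>y\<in>G ` {0..1}. norm y <= C" unfolding bounded_iff by blast
 show ?thesis
 proof (rule that)
  show "0 <= |C|" by simp
  show "|G q| <= |C|" if "q : {0..1}" for q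
   using C that by (metis abs_ge_self image_eqI order_trans real_norm_def)
 qed
qed

lemma cont_measurable_UI: "continuous_on {0..1::real} (G :: real => real) ==> G : mUI"
 unfolding measurable_UI_closed by (rule continuous_imp_measurable_on_sets_lebesgue, assumption, simp)

context frac_params begin

abbreviation "samp N G \<equiv> (%x::nat. G (real x / real N) :: real)"

text \<open>This is 2 B times the integral of \<open>kern z * z^2\<close> over (0, dl). It is finite
  and vanishes with dl because \<gamma> < 2; dl = 1 bounds the whole operator.\<close>

definition near_err :: "real => real => real" where
 "near_err B dl = 2 * B * cg * dl powr (2 - \<gamma>) / (2 - \<gamma>)"

lemma near_err_mono: "0 <= B ==> 0 <= d ==> d <= d' ==> near_err B d <= near_err B d'"
 unfolding near_err_def using gam cg
 by (intro divide_right_mono mult_left_mono powr_mono2) auto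

lemma near_err_tendsto: "((%d. near_err B d) \<longlongrightarrow> 0) (at_right 0)"
proof -
 have "((%d::real. d powr (2 - \<gamma>)) \<longlongrightarrow> 0) (at_right 0)"
  using gam by (intro tendsto_zero_powrI[where b="2-\<gamma>"] tendsto_ident_at tendsto_const) (auto simp: eventually_at_filter)
 from tendsto_mult_left[OF this, of "2 * B * cg / (2 - \<gamma>)"] show ?thesis
  by (simp add: near_err_def[abs_def])
qed

text \<open>Pairing y = x + z with y = x - z cancels the gradient, leaving second differences of
  order z^2. If one partner falls outside the bulk, then x/N is within z/N of an endpoint; there the
  gradient is at most B times the distance to it, so the remaining single difference is again of
  order z^2.\<close>

lemma near_part_bound:
 assumes tb: "taylor_bound G G1 B" and x: "x : bulk N" and d: "0 <= dl"
 shows "|1 / real N * (\<Sum>y\<in>{y\<in>bulk N. |real x - real y| / real N <= dl}.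
   kern ((real x - real y) / real N) * (samp N G y - samp N G x))| <= near_err B dl"
proof -
 define M where "M = nat \<lfloor>dl * real N\<rfloor>"
 define h where "h y = kern ((real x - real y) / real N) * (samp N G y - samp N G x)" for y
 have N: "N >= 1" using x by (auto simp: bulk_def)
 have B: "0 <= B" using tb by (simp add: taylor_bound_def)
 have Mle: "z <= M \<longleftrightarrow> real z <= dl * real N" for z :: nat
  unfolding M_def using d by (simp add: le_nat_iff le_floor_iff)
 have sets: "{y\<in>bulk N. |real x - real y| / real N <= dl} =
  insert x ({y\<in>bulk N. x < y & y <= x + M} \<union> {y\<in>bulk N. y < x & x <= y + M})"
 proof (intro set_eqI iffI)
  fix y assume "y : {y\<in>bulk N. |real x - real y| / real N <= dl}"
  then have y: "y : bulk N" "|real x - real y| <= dl * real N" using N by (auto simp: divide_le_eq)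
  then show "y : insert x ({y\<in>bulk N. x < y & y <= x + M} \<union> {y\<in>bulk N. y < x & x <= y + M})"
   using Mle[of "y - x"] Mle[of "x - y"] by (cases x y rule: linorder_cases) (auto simp: of_nat_diff)
 next
  fix y assume y: "y : insert x ({y\<in>bulk N. x < y & y <= x + M} \<union> {y\<in>bulk N. y < x & x <= y + M})"
  then have "|real x - real y| <= dl * real N"
   using Mle[of "y - x"] Mle[of "x - y"] d by (auto simp: of_nat_diff)
  then show "y : {y\<in>bulk N. |real x - real y| / real N <= dl}"
   using N x y by (auto simp: divide_le_eq)
 qed
 have up: "sum h {y\<in>bulk N. x < y & y <= x + M} = (\<Sum>z=1..M. if x + z < N then h (x + z) else 0)"
  unfolding sum.inter_filter[OF finite_atLeastAtMost, symmetric]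
  by (rule sum.reindex_bij_witness[where i="%z. x + z" and j="%y. y - x"]) (auto simp: bulk_def)
 have dn: "sum h {y\<in>bulk N. y < x & x <= y + M} = (\<Sum>z=1..M. if z < x then h (x - z) else 0)"
  unfolding sum.inter_filter[OF finite_atLeastAtMost, symmetric]
  by (rule sum.reindex_bij_witness[where i="%z. x - z" and j="%y. x - y"]) (use x in "auto simp: bulk_def")
 have "sum h {y\<in>bulk N. |real x - real y| / real N <= dl} =
   sum h ({y\<in>bulk N. x < y & y <= x + M} \<union> {y\<in>bulk N. y < x & x <= y + M})"
  unfolding sets by (subst sum.insert) (auto simp: h_def)
 also have "... = sum h {y\<in>bulk N. x < y & y <= x + M} + sum h {y\<in>bulk N. y < x & x <= y + M}"
  by (rule sum.union_disjoint) auto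
 also have "... = (\<Sum>z=1..M. (if x + z < N then h (x + z) else 0) + (if z < x then h (x - z) else 0))"
  unfolding up dn sum.distrib ..
 finally have eq: "sum h {y\<in>bulk N. |real x - real y| / real N <= dl} = ..." .
 have bracket: "|(if x + z < N then h (x + z) else 0) + (if z < x then h (x - z) else 0)|
   <= 2 * B * (kern (real z / real N) * (real z / real N)^2)" if z: "z : {1..M}" for z
 proof -
  define p t where "p = real x / real N" and "t = real z / real N"
  have p: "p : {0..1}" "0 <= t" using x N by (auto simp: p_def t_def bulk_def divide_le_eq)
  have T: "|G q - G p - G1 p * (q - p)| <= B * (q - p)^2" if "q : {0..1}" for q
   using tb p(1) that by (auto simp: taylor_bound_def)
  have G1: "|G1 p| <= B * p" "|G1 p| <= B * (1 - p)" using tb p(1) by (auto simp: taylor_bound_def)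
  have hp: "h (x + z) = kern t * (G (p + t) - G p)"
  proof -
   have "(real x - real (x + z)) / real N = - t" by (simp add: t_def)
   moreover have "real (x + z) / real N = p + t" by (simp add: p_def t_def add_divide_distrib)
   ultimately show ?thesis by (simp only: h_def kern_minus) (simp add: p_def)
  qed
  have hm: "h (x - z) = kern t * (G (p - t) - G p)" if "z < x"
  proof -
   have "(real x - real (x - z)) / real N = t" using that by (simp add: t_def of_nat_diff)
   moreover have "real (x - z) / real N = p - t" using that by (simp add: p_def t_def diff_divide_distrib of_nat_diff)
   ultimately show ?thesis by (simp only: h_def) (simp add: p_def)
  qed
  have up_in: "p + t : {0..1}" if "x + z < N"
   using that p unfolding p_def t_def by (simp add: add_divide_distrib[symmetric] divide_le_eq)
  have dn_in: "p - t : {0..1}" if "z < x"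
   using that p by (auto simp: p_def t_def diff_divide_distrib[symmetric] divide_le_eq)
  have k2: "|kern t * e| <= 2 * B * (kern t * t^2)" if "|e| <= 2 * B * t^2" for e
  proof -
   have "|kern t * e| = kern t * |e|" by (simp add: abs_mult)
   also have "... <= kern t * (2 * B * t^2)" by (intro mult_left_mono that) auto
   finally show ?thesis by (simp add: mult_ac)
  qed
  consider "x + z < N" "z < x" | "x + z < N" "\<not> z < x" | "\<not> x + z < N" "z < x" | "\<not> x + z < N" "\<not> z < x" by blast
  then show ?thesis
  proof cases
   case 1
   have "|(G (p + t) - G p) + (G (p - t) - G p)| <= 2 * B * t^2"
    using T[OF up_in[OF 1(1)]] T[OF dn_in[OF 1(2)]] by simp
   from k2[OF this] show ?thesis using 1
    by (simp only: hp hm[OF 1(2)] if_True distrib_left[symmetric] t_def[symmetric])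
  next
   case 2
   then have "p <= t" by (simp add: p_def t_def divide_right_mono)
   then have "B * p * t <= B * t * t" using B p by (intro mult_right_mono mult_left_mono) auto
   moreover have "|G1 p * t| <= B * p * t" using G1 p by (simp add: abs_mult mult_right_mono)
   ultimately have "|G (p + t) - G p| <= 2 * B * t^2"
    using T[OF up_in[OF 2(1)]] by (simp add: power2_eq_square)
   from k2[OF this] show ?thesis using 2 by (simp add: hp t_def)
  next
   case 3
   then have "real N <= real x + real z" by simp
   then have "1 <= p + t" using N by (simp add: p_def t_def add_divide_distrib[symmetric] le_divide_eq)
   then have "1 - p <= t" by simp
   then have "B * (1 - p) * t <= B * t * t" using B p by (intro mult_right_mono mult_left_mono) auto
   moreover have "|G1 p * t| <= B * (1 - p) * t" using G1 p by (simp add: abs_mult mult_right_mono)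
   ultimately have "|G (p - t) - G p| <= 2 * B * t^2"
    using T[OF dn_in[OF 3(2)]] by (simp add: power2_eq_square)
   from k2[OF this] show ?thesis using 3 by (simp add: hm t_def)
  next
   case 4
   then show ?thesis using B by simp
  qed
 qed
 have "|1 / real N * sum h {y\<in>bulk N. |real x - real y| / real N <= dl}|
   <= 1 / real N * (\<Sum>z=1..M. 2 * B * (kern (real z / real N) * (real z / real N)^2))"
  unfolding eq abs_mult by (auto intro!: mult_left_mono order_trans[OF sum_abs] sum_mono bracket divide_right_mono)
 also have "... = 2 * B * (1 / real N * (\<Sum>z=1..M. kern (real z / real N) * (real z / real N)^2))"
  by (simp add: sum_distrib_left mult_ac)
 also have "... <= 2 * B * (cg * (real M / real N) powr (2 - \<gamma>) / (2 - \<gamma>))"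
  using B by (intro mult_left_mono near_sum_le N) auto
 also have "... = near_err B (real M / real N)" by (simp add: near_err_def)
 also have "... <= near_err B dl"
  using Mle[of M] N B by (intro near_err_mono) (auto simp: divide_le_eq)
 finally show ?thesis by (simp add: h_def)
qed

definition far :: "nat => real => (real => real) => nat => real" where
 "far N dl G x = 1 / real N * (\<Sum>y\<in>bulk N. (if dl < |real x - real y| / real N then
   kern ((real x - real y) / real N) * (samp N G y - samp N G x) else 0))"

lemma dLap_far:
 assumes "taylor_bound G G1 B" "x : bulk N" "0 <= dl"
 shows "|dLap N (samp N G) x - far N dl G x| <= near_err B dl"
proof -
 have "dLap N (samp N G) x - far N dl G x = 1 / real N * (\<Sum>y\<in>bulk N. (if |real x - real y| / real N <= dl then
   kern ((real x - real y) / real N) * (samp N G y - samp N G x) else 0))"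
  unfolding dLap_def far_def right_diff_distrib[symmetric] sum_subtractf[symmetric]
  by (intro arg_cong2[where f="(*)"] sum.cong refl) auto
 also have "... = 1 / real N * (\<Sum>y\<in>{y\<in>bulk N. |real x - real y| / real N <= dl}.
   kern ((real x - real y) / real N) * (samp N G y - samp N G x))"
  by (simp add: sum.inter_filter)
 finally show ?thesis using near_part_bound[OF assms] by simp
qed

lemma dLap_bound:
 assumes "taylor_bound G G1 B" "x : bulk N"
 shows "|dLap N (samp N G) x| <= near_err B 1"
proof -
 have "far N 1 G x = 0"
  unfolding far_def using assms(2) by (auto simp: bulk_def divide_less_eq intro!: sum.neutral)
 then show ?thesis using dLap_far[OF assms, of 1] by simp
qed

text \<open>The truncated operator with \<open>cg\<close> absorbed into \<open>kern\<close>. The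
  strict inequality matches \<open>far\<close>; the closed truncation in
  \<open>regional_frac_lap\<close> differs from it only on a null set.\<close>

definition trunc :: "real => (real => real) => real => real" where
 "trunc dl G q = (IU v. indicator {v. dl < |q - v| } v * (kern (q - v) * (G v - G q)))"

text \<open>Dominated convergence for step functions: beyond distance dl the kernel is at most
  \<open>kern dl\<close>.\<close>

lemma far_tendsto:
 assumes r: "filterlim r at_top sequentially" and G: "continuous_on {0..1} G"
  and q: "0 < q" "q < 1" and d: "0 < dl"
 shows "(%k. far (r k) dl G (idx (r k) q)) ----> trunc dl G q"
proof -
 obtain C where C: "C >= 0" "!!q. q : {0..1} ==> |G q| <= C" using bounded_cont01[OF G] by blast
 define f where "f N v = (if dl < |real (idx N q) - real (idx N v)| / real N then
   kern ((real (idx N q) - real (idx N v)) / real N) * (samp N G (idx N v) - samp N G (idx N q)) else 0)" for N v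
 have ev: "eventually (%k. r k >= 2) sequentially" using r by (simp add: filterlim_at_top)
 have "(%k. (IU v. f (r k) v)) ----> trunc dl G q"
  unfolding trunc_def
 proof (rule integral_dominated_convergence[where w="%_. kern dl * (2 * C)"])
  show "(%v. f (r k) v) : mUI" for k
   unfolding f_def by (rule idx_measurable_UI)
  show "(%v. indicator {v. dl < |q - v| } v * (kern (q - v) * (G v - G q))) : mUI"
  proof -
   have "{v. dl < |q - v| } : sets borel"
    by (auto intro!: borel_open open_Collect_less continuous_intros)
   then have i: "(indicator {v. dl < |q - v| } :: real => real) : mUI"
    by (rule indicator_UI)
   have k: "(%v. kern (q - v)) : mUI"
    by (rule borel_UI[OF measurable_compose[OF shift_measurable kern_measurable]])
   show ?thesis
    by (rule borel_measurable_times[OF i borel_measurable_times[OF k borel_measurable_diff[OF cont_measurable_UI[OF G]]]]) simp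
  qed
  show "iUI (%_. kern dl * (2 * C))" by simp
  have fb: "|f N v| <= kern dl * (2 * C)" if "N >= 2 \<or> N = 0" "0 < v" "v < 1" for N v
  proof (cases "dl < |real (idx N q) - real (idx N v)| / real N")
   case True
   then have N: "N >= 2" using that d by auto
   have "kern ((real (idx N q) - real (idx N v)) / real N) <= kern dl"
    using True d by (intro kern_antimono) auto
   moreover have "|samp N G (idx N v) - samp N G (idx N q)| <= 2 * C"
    using C(2)[of "real (idx N v) / real N"] C(2)[of "real (idx N q) / real N"]
     idx_bulk[OF N q] idx_bulk[OF N that(2,3)] by (auto simp: bulk_def divide_le_eq)
   ultimately show ?thesis using True C(1) by (auto simp: f_def abs_mult intro!: mult_mono)
  qed (use C in "auto simp: f_def")
  \<comment> \<open>The cutoff jumps where |q - v| = dl; these two points are discarded.\<close>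
  show "AE v in UI. (%k. f (r k) v) ----> indicator {v. dl < |q - v| } v * (kern (q - v) * (G v - G q))"
   using AE_UI_neq[of "q - dl"] AE_UI_neq[of "q + dl"] AE_space[of UI]
  proof eventually_elim
   case (elim v)
   then have v: "0 < v" "v < 1" "|q - v| ~= dl" by auto
   let ?D = "%k. (real (idx (r k) q) - real (idx (r k) v)) / real (r k)"
   have D: "?D ----> q - v"
    using tendsto_diff[OF idx_tendsto[OF r q] idx_tendsto[OF r v(1,2)]] by (simp add: diff_divide_distrib)
   have Dabs: "(%k. |?D k| ) ----> |q - v|" by (intro tendsto_rabs D)
   have Gc: "(%k. samp (r k) G (idx (r k) p)) ----> G p" if p: "0 < p" "p < 1" for p
   proof (rule continuous_on_tendsto_compose[OF G idx_tendsto[OF r p]])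
    show "eventually (%k. real (idx (r k) p) / real (r k) : {0..1}) sequentially"
     using ev by eventually_elim (use idx_bulk p in "force simp: bulk_def divide_le_eq")
   qed (use p in auto)
   show ?case
   proof (cases "dl < |q - v|")
    case True
    then have evd: "eventually (%k. dl < |?D k| ) sequentially" using order_tendstoD(1)[OF Dabs] by blast
    have "(%k. kern (?D k) * (samp (r k) G (idx (r k) v) - samp (r k) G (idx (r k) q)))
      ----> kern (q - v) * (G v - G q)"
     using True d by (intro tendsto_mult kern_tendsto D tendsto_diff Gc q v) auto
    then have "(%k. f (r k) v) ----> kern (q - v) * (G v - G q)"
     by (rule Lim_transform_eventually) (use evd in "eventually_elim, simp add: f_def abs_divide")
    then show ?thesis using True by simp
   next
    case False
    then have "|q - v| < dl" using v(3) by simp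
    then have "eventually (%k. |?D k| < dl) sequentially" using order_tendstoD(2)[OF Dabs] by blast
    then have "(%k. f (r k) v) ----> 0"
     by (intro tendsto_eventually) (auto elim!: eventually_mono simp: f_def abs_divide)
    then show ?thesis using False by simp
   qed
  qed
  show "AE v in UI. norm (f (r k) v) <= kern dl * (2 * C)" for k
  \<comment> \<open>\<open>r\<close> may take the values 0 and 1 finitely often, while the
    domination is stated for all k. For the value 1 \<open>idx\<close> is constant, so no distance
    exceeds dl.\<close>
  proof (cases "r k = 1")
   case True
   have "idx (Suc 0) p = Suc 0" for p by (simp add: idx_def)
   then show ?thesis using True C d by (intro AE_UI_I) (auto simp: f_def)
  next
   case False
   then have "r k >= 2 \<or> r k = 0" by auto
   then show ?thesis using fb by (intro AE_UI_I) auto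
  qed
 qed
 \<comment> \<open>\<open>far\<close> carries the weight 1/N, whereas the cells have length
   1/(N-1).\<close>
 moreover have "(%k. (real (r k) - 1) / real (r k)) ----> 1"
 proof -
  have "(%k. 1 - 1 / real (r k)) ----> 1 - 0" by (intro tendsto_intros tendsto_inverse_nat r)
  then have "(%k. 1 - 1 / real (r k)) ----> 1" by simp
  then show ?thesis
   by (rule Lim_transform_eventually) (use ev in "eventually_elim, simp add: diff_divide_distrib")
 qed
 ultimately have "(%k. (real (r k) - 1) / real (r k) * (IU v. f (r k) v)) ----> 1 * trunc dl G q"
  by (intro tendsto_mult)
 moreover have "eventually (%k. (real (r k) - 1) / real (r k) * (IU v. f (r k) v) = far (r k) dl G (idx (r k) q)) sequentially"
  using ev
 proof eventually_elim
  case (elim k)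
  show ?case unfolding f_def far_def using elim
   by (subst integral_idx[where F="%y. if dl < |real (idx (r k) q) - real y| / real (r k) then
    kern ((real (idx (r k) q) - real y) / real (r k)) * (samp (r k) G y - samp (r k) G (idx (r k) q)) else 0"]) auto
 qed
 ultimately show ?thesis by (simp add: Lim_transform_eventually)
qed

text \<open>The principal value is not known to exist beforehand. The discrete operators form a
  Cauchy sequence: their near parts are at most \<open>near_err\<close> uniformly in N, and their
  far parts converge.\<close>

lemma dLap_limit_ex:
 assumes tb: "taylor_bound G G1 B" and q: "0 < q" "q < 1"
 obtains l where "!!r. filterlim r at_top sequentially ==> (%k. dLap (r k) (samp (r k) G) (idx (r k) q)) ----> l"
  and "!!dl. 0 < dl ==> |l - trunc dl G q| <= near_err B dl"
proof -
 have G: "continuous_on {0..1} G" and B: "0 <= B" using tb by (auto simp: taylor_bound_def)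
 let ?X = "%N. dLap N (samp N G) (idx N q)"
 have le: "|?X N - far N dl G (idx N q)| <= near_err B dl" if "N >= 2" "0 < dl" for N dl
  using dLap_far[OF tb idx_bulk[OF that(1) q]] that by simp
 have fi: "filterlim (%n::nat. n) at_top sequentially" by (rule filterlim_ident)
 have "Cauchy ?X"
 proof (rule metric_CauchyI)
  fix e :: real assume e: "e > 0"
  have "eventually (%d. near_err B d < e / 3 & 0 < d) (at_right 0)"
   using order_tendstoD(2)[OF near_err_tendsto[of B], of "e/3"] e
   by (auto simp: eventually_at_right_less eventually_conj_iff)
  then obtain d where d: "near_err B d < e / 3" "0 < d"
   using eventually_happens[of _ "at_right (0::real)"] by auto
  have "Cauchy (%N. far N d G (idx N q))"
   using far_tendsto[OF fi G q d(2)] by (intro LIMSEQ_imp_Cauchy)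
  then obtain M where M: "!!m n. m >= M ==> n >= M ==> dist (far m d G (idx m q)) (far n d G (idx n q)) < e / 3"
   using e unfolding Cauchy_def by (metis divide_pos_pos zero_less_numeral)
  show "\<exists>M. \<forall>m\<ge>M. \<forall>n\<ge>M. dist (?X m) (?X n) < e"
  proof (intro exI[of _ "max M 2"] allI impI)
   fix m n assume "m >= max M 2" "n >= max M 2"
   then have mn: "m >= M" "n >= M" "m >= 2" "n >= 2" by auto
   let ?F = "%n. far n d G (idx n q)"
   have "|?X m - ?X n| <= |?X m - ?F m| + |?F m - ?F n| + |?X n - ?F n|" by (simp add: abs_if)
   also have "... < e / 3 + e / 3 + e / 3"
    using M[OF mn(1,2)] le[OF mn(3) d(2)] le[OF mn(4) d(2)] d(1) by (simp only: dist_real_def)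
   finally show "dist (?X m) (?X n) < e" by (simp add: dist_real_def)
  qed
 qed
 then obtain l where l: "?X ----> l" using Cauchy_convergent convergent_def by blast
 show ?thesis
 proof
  show "(%k. ?X (r k)) ----> l" if "filterlim r at_top sequentially" for r
   using filterlim_compose[OF l that] .
  show "|l - trunc dl G q| <= near_err B dl" if d: "0 < dl" for dl
  proof (rule tendsto_upperbound)
   show "(%N. |?X N - far N dl G (idx N q)| ) ----> |l - trunc dl G q|"
    by (intro tendsto_intros l far_tendsto[OF fi] G q d)
   show "eventually (%N. |?X N - far N dl G (idx N q)| <= near_err B dl) sequentially"
    using eventually_ge_at_top[of 2] by eventually_elim (use le d in auto)
  qed simp
 qed
qed

lemma trunc_eq:
 assumes G: "G : mUI" and d: "0 < \<epsilon>"
 shows "cg * (LINT v:{0..1}|lebesgue. indicator {v. |q - v| >= \<epsilon>} v * ((G v - G q) / |q - v| powr (1 + \<gamma>)))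
  = trunc \<epsilon> G q"
proof -
 let ?f = "%v. indicator {v. |q - v| >= \<epsilon>} v * ((G v - G q) / |q - v| powr (1 + \<gamma>))"
 have s: "{v. |q - v| >= \<epsilon>} : sets borel" "{v. \<epsilon> < |q - v| } : sets borel"
  by (auto intro!: borel_closed closed_Collect_le borel_open open_Collect_less continuous_intros)
 note i = indicator_UI
 have k: "(%v. kern (q - v)) : mUI"
  by (rule borel_UI[OF measurable_compose[OF shift_measurable kern_measurable]])
 have "(%d::real. |d| powr (1 + \<gamma>)) : borel_measurable borel" by measurable
 then have k2: "(%v. |q - v| powr (1 + \<gamma>)) : mUI"
  by (rule borel_UI[OF measurable_compose[OF shift_measurable]])
 have fm: "?f : mUI"
  by (rule borel_measurable_times[OF i[OF s(1)] borel_measurable_divide[OF borel_measurable_diff[OF G] k2]]) simp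
 have "cg * (LINT v:{0..1}|lebesgue. ?f v) = (IU v. cg * ?f v)"
  unfolding LINT_closed_UI[OF fm] by (rule integral_mult_right_zero[symmetric])
 also have "... = trunc \<epsilon> G q" unfolding trunc_def
 proof (rule integral_cong_AE)
  show "AE v in UI. cg * ?f v = indicator {v. \<epsilon> < |q - v| } v * (kern (q - v) * (G v - G q))"
   using AE_UI_neq[of "q - \<epsilon>"] AE_UI_neq[of "q + \<epsilon>"]
   by eventually_elim (auto simp: indicator_def kern_inverse)
 show "(%v. indicator {v. \<epsilon> < |q - v| } v * (kern (q - v) * (G v - G q))) : mUI"
   by (rule borel_measurable_times[OF i[OF s(2)] borel_measurable_times[OF k borel_measurable_diff[OF G]]]) simp
  show "(%v. cg * ?f v) : mUI" by (rule borel_measurable_times[OF _ fm]) simp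
 qed
 finally show ?thesis .
qed

text \<open>The limit of the discrete operators lies within \<open>near_err B dl\<close> of each
  truncated integral, hence is also the limit of these as dl tends to 0. This shows that the
  \<open>Lim\<close> in \<open>regional_frac_lap\<close> is a genuine limit.\<close>

theorem regional_consistency:
 assumes tb: "taylor_bound G G1 B" and q: "0 < q" "q < 1"
 shows "filterlim r at_top sequentially \<Longrightarrow>
   (%k. dLap (r k) (samp (r k) G) (idx (r k) q)) ----> regional_frac_lap \<gamma> G q"
  and "0 < dl ==> |regional_frac_lap \<gamma> G q - trunc dl G q| <= near_err B dl"
  and "|regional_frac_lap \<gamma> G q| <= near_err B 1"
proof -
 have G: "G : mUI" using tb by (auto simp: taylor_bound_def intro: cont_measurable_UI)
 obtain l where l: "!!r. filterlim r at_top sequentially ==> (%k. dLap (r k) (samp (r k) G) (idx (r k) q)) ----> l"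
  and le: "!!dl. 0 < dl ==> |l - trunc dl G q| <= near_err B dl"
  using dLap_limit_ex[OF tb q] by blast
 have "((%d. trunc d G q - l) \<longlongrightarrow> 0) (at_right 0)"
 proof (rule Lim_null_comparison[OF _ near_err_tendsto[of B]])
  have "eventually (%d::real. 0 < d) (at_right 0)" by (simp add: eventually_at_right_less)
  then show "eventually (%d. norm (trunc d G q - l) <= near_err B d) (at_right 0)"
   by eventually_elim (use le in "auto simp: abs_minus_commute")
 qed
 then have t: "((%d. trunc d G q / cg) \<longlongrightarrow> l / cg) (at_right 0)"
  using cg by (intro tendsto_divide tendsto_const) (auto simp: LIM_zero_iff)
 have "((%\<epsilon>. LINT v:{0..1}|lebesgue.
    indicator {v. |q - v| >= \<epsilon>} v * ((G v - G q) / |q - v| powr (1 + \<gamma>))) \<longlongrightarrow> l / cg) (at_right 0)"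
 proof (rule Lim_transform_eventually[OF t])
  have "eventually (%d::real. 0 < d) (at_right 0)" by (simp add: eventually_at_right_less)
  then show "eventually (%\<epsilon>. trunc \<epsilon> G q / cg = (LINT v:{0..1}|lebesgue.
    indicator {v. |q - v| >= \<epsilon>} v * ((G v - G q) / |q - v| powr (1 + \<gamma>)))) (at_right 0)"
   by eventually_elim (use trunc_eq[OF G, of _ q] cg in "simp add: field_simps")
 qed
 then have e: "regional_frac_lap \<gamma> G q = l"
  unfolding regional_frac_lap_def using cg by (subst tendsto_Lim) auto
 show "filterlim r at_top sequentially \<Longrightarrow>
   (%k. dLap (r k) (samp (r k) G) (idx (r k) q)) ----> regional_frac_lap \<gamma> G q" using l e by simp
 show "0 < dl ==> |regional_frac_lap \<gamma> G q - trunc dl G q| <= near_err B dl" using le e by simp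
 have "(%N. dLap N (samp N G) (idx N q)) ----> l" using l[of "%n. n"] by (simp add: filterlim_ident)
 moreover have "eventually (%N. |dLap N (samp N G) (idx N q)| <= near_err B 1) sequentially"
  using eventually_ge_at_top[of 2] by eventually_elim (use dLap_bound[OF tb idx_bulk] q in auto)
 ultimately show "|regional_frac_lap \<gamma> G q| <= near_err B 1"
  unfolding e by (intro tendsto_upperbound[OF tendsto_rabs]) auto
qed

lemma regional_measurable:
 assumes "taylor_bound G G1 B"
 shows "regional_frac_lap \<gamma> G : mUI"
proof (rule borel_measurable_LIMSEQ_real)
 show "(%N. dLap N (samp N G) (idx N q)) ----> regional_frac_lap \<gamma> G q" if "q : space UI" for q
  using regional_consistency(1)[OF assms, of q "%n. n"] that by (simp add: filterlim_ident)
qed (rule idx_measurable_UI)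

text \<open>The support of a test function may vary with time, so its distance to the boundary gives
  no uniform bound. Vanishing to third order does: \<open>kern q * q^3\<close> equals
  \<open>cg * q powr (2 - \<gamma>)\<close>, which is at most \<open>cg\<close> on [0,1] because
  \<gamma> < 2.\<close>

definition boundary_flat :: "(real => real) => real => bool" where
 "boundary_flat G B \<longleftrightarrow> 0 <= B & (\<forall>q\<in>{0..1}. |G q| <= B * q ^ 3 & |G q| <= B * (1 - q) ^ 3)"

lemma kern_cubic:
 assumes "0 <= q" "q <= 1" "|g| <= B * q ^ 3" and B: "0 <= B"
 shows "|kern q * g| <= cg * B"
proof (cases "q = 0")
 case False
  
 have "|kern q * g| <= kern q * (B * q ^ 3)" unfolding abs_mult using assms by (intro mult_mono) auto
 also have "... = B * (kern q * q^2) * q" by (simp add: power3_eq_cube power2_eq_square)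
 also have "... = B * cg * (q powr (1 - \<gamma>) * q powr 1)" using assms by (simp add: kern_square)
 also have "... = B * cg * q powr (2 - \<gamma>)" by (simp only: powr_add[symmetric]) simp
 also have "... <= B * cg * 1"
  using B cg gam assms by (intro mult_left_mono powr_le1) auto
 finally show ?thesis by (simp add: mult.commute)
qed (use B cg in simp)

lemma Vk_flat:
 assumes "boundary_flat G B" "q : {0..1}"
 shows "|Vk q * G q| <= 2 * cg * B"
 using kern_cubic[of q "G q" B] kern_cubic[of "1 - q" "G q" B] assms
 by (auto simp: boundary_flat_def Vk_def distrib_right)

lemma dA_samp_bound:
 assumes "taylor_bound G G1 B" "boundary_flat G B" "x : bulk N"
 shows "|dA N (samp N G) x| <= near_err B 1 + \<kappa> * (2 * cg * B)"
proof -
 have "|\<kappa> * (Vk (real x / real N) * samp N G x)| <= \<kappa> * (2 * cg * B)"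
  unfolding abs_mult[of \<kappa>] using kap assms(3) Vk_flat[OF assms(2), of "real x / real N"]
  by (auto simp: bulk_def divide_le_eq intro!: mult_left_mono)
 then show ?thesis using dLap_bound[OF assms(1,3)] unfolding dA_def by (simp add: mult.assoc)
qed

lemma dA_samp_tendsto:
 assumes tb: "taylor_bound G G1 B" and q: "0 < q" "q < 1" and r: "filterlim r at_top sequentially"
 shows "(%k. dA (r k) (samp (r k) G) (idx (r k) q)) ----> - L_op \<gamma> \<kappa> G q"
proof -
 have G: "continuous_on {0..1} G" using tb by (auto simp: taylor_bound_def)
 have ev: "eventually (%k. r k >= 2) sequentially" using r by (simp add: filterlim_at_top)
 have i: "(%k. real (idx (r k) q) / real (r k)) ----> q" by (rule idx_tendsto[OF r q])
 have Gc: "(%k. samp (r k) G (idx (r k) q)) ----> G q"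
 proof (rule continuous_on_tendsto_compose[OF G i])
  show "eventually (%k. real (idx (r k) q) / real (r k) : {0..1}) sequentially"
   using ev by eventually_elim (use idx_bulk q in "force simp: bulk_def divide_le_eq")
 qed (use q in auto)
 have V: "(%k. Vk (real (idx (r k) q) / real (r k))) ----> Vk q"
  unfolding Vk_def using q by (intro tendsto_add kern_tendsto i tendsto_diff tendsto_const) auto
 have "(%k. dA (r k) (samp (r k) G) (idx (r k) q)) ----> - regional_frac_lap \<gamma> G q + \<kappa> * Vk q * G q"
  unfolding dA_def by (intro tendsto_intros regional_consistency(1)[OF tb q r] Gc V)
 then show ?thesis using Vk_V1[OF q] by (simp add: L_op_def)
qed

lemma L_op_measurable: "taylor_bound G G1 B ==> L_op \<gamma> \<kappa> G : mUI"
proof (rule borel_measurable_LIMSEQ_real)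
 assume tb: "taylor_bound G G1 B"
 show "(%N. - dA N (samp N G) (idx N q)) ----> L_op \<gamma> \<kappa> G q" if "q : space UI" for q
  using tendsto_minus[OF dA_samp_tendsto[OF tb, of q "%n. n"]] that by (simp add: filterlim_ident)
qed (rule idx_measurable_UI)

lemma L_op_bound:
 assumes "taylor_bound G G1 B" "boundary_flat G B" "0 < q" "q < 1"
 shows "|L_op \<gamma> \<kappa> G q| <= near_err B 1 + \<kappa> * (2 * cg * B)"
proof -
 have "|\<kappa> * (Vk q * G q)| <= \<kappa> * (2 * cg * B)"
  unfolding abs_mult[of \<kappa>] using kap assms Vk_flat[OF assms(2), of q]
  by (auto intro!: mult_left_mono)
 then show ?thesis using regional_consistency(3)[OF assms(1,3,4)] Vk_V1[OF assms(3,4)] unfolding L_op_def by (simp add: mult.assoc)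
qed

end

section \<open>Lower semicontinuity of the energies\<close>

lemma prob_UI [simp]: "measure UI {0<..<1} = 1"
 using UI.prob_space by simp

lemma L1_AE_subseq:
 fixes u :: "nat => real => real"
 assumes "!!k. iUI (u k)" "iUI f" "(%k. (IU q. |u k q - f q| )) ----> 0"
 obtains s where "strict_mono s" "AE q in UI. (%k. u (s k) q) ----> f q"
proof -
 have "\<exists>s::nat=>nat. strict_mono s & (AE q in UI. (%k. u (s k) q - f q) ----> 0)"
  using assms by (intro tendsto_L1_AE_subseq[of UI "%k q. u k q - f q"]) auto
 then show ?thesis using that by (auto simp: LIM_zero_iff)
qed

text \<open>Lower semicontinuity along a.e.\ convergent sequences extends to \<open>L\<^sup>1\<close>-convergent ones.\<close>

lemma L1_liminf:
 fixes u :: "nat => real => real" and e :: "nat => ennreal"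
 assumes u: "!!k. iUI (u k)" and f: "iUI f" and L1: "(%k. (IU q. |u k q - f q| )) ----> 0"
  and lsc: "!!s. strict_mono s ==> AE q in UI. (%k. u (s k) q) ----> f q ==> X <= liminf (%k. e (s k))"
 shows "X <= liminf e"
proof (rule ccontr)
 assume "\<not> X <= liminf e"
 then obtain y where y: "y < X" "\<not> eventually (%k. y < e k) sequentially"
  unfolding le_Liminf_iff by blast
 have "infinite {k. e k <= y}"
  using y(2) unfolding eventually_sequentially infinite_nat_iff_unbounded_le by (auto simp: not_less)
 then obtain s :: "nat => nat" where s: "strict_mono s" "!!n. e (s n) <= y"
  using infinite_enumerate[of "{k. e k <= y}"] by auto
 have "(%k. (IU q. |u (s k) q - f q| )) ----> 0"
  using LIMSEQ_subseq_LIMSEQ[OF L1 s(1)] by (simp add: o_def)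
 then obtain s' where s': "strict_mono s'" "AE q in UI. (%k. u (s (s' k)) q) ----> f q"
  using L1_AE_subseq[of "%k. u (s k)" f] u f by blast
 have "X <= liminf (%k. e (s (s' k)))"
  using lsc[of "s \<circ> s'"] s s' by (simp add: strict_mono_o)
 also have "... <= y"
 proof -
  have "liminf (%k. e (s (s' k))) <= liminf (%k. y)"
   by (intro Liminf_mono always_eventually allI s(2))
  then show ?thesis by (simp add: Liminf_const)
 qed
 finally show False using y(1) by simp
qed

context frac_params begin

text \<open>Twice the squared seminorm of the Sobolev space. Values in \<open>ennreal\<close> keep
  infinite energy meaningful.\<close>

definition reg :: "(real => real) => ennreal" where
 "reg f = (NU q. (NU v. ennreal (kern (q - v) * (f q - f v)^2)))"

definition kil :: "(real => real) => ennreal" where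
 "kil f = (NU q. ennreal (Vk q * (f q)^2))"

definition dK :: "nat => nat => nat => real" where "dK N x y = kern ((real x - real y) / real N)"

lemma nn_dR:
 assumes N: "N >= 2"
 shows "(NU q. (NU p. ennreal (dK N (idx N q) (idx N p) * (v (idx N q) - v (idx N p))^2)))
  = ennreal (real N / (real N - 1) * dR N v)"
proof -
 let ?k = "%x y. dK N x y * (v x - v y)^2"
 have k: "0 <= ?k x y" for x y by (simp add: dK_def)
 have c: "0 <= 1 / (real N - 1)" using N by simp
 have inner: "(NU p. ennreal (?k x (idx N p))) = ennreal (1 / (real N - 1) * (\<Sum>y\<in>bulk N. ?k x y))" for x
  unfolding nn_integral_idx[OF N, of "%y. ennreal (?k x y)"]
  by (simp only: sum_ennreal[OF k] ennreal_mult'[OF c])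
 have "(NU q. (NU p. ennreal (?k (idx N q) (idx N p))))
   = (NU q. ennreal (1 / (real N - 1) * (\<Sum>y\<in>bulk N. ?k (idx N q) y)))"
  unfolding inner ..
 also have "... = ennreal (1 / (real N - 1)) * (\<Sum>x\<in>bulk N. ennreal (1 / (real N - 1) * (\<Sum>y\<in>bulk N. ?k x y)))"
  by (rule nn_integral_idx[OF N])
 also have "... = ennreal (1 / (real N - 1) * (\<Sum>x\<in>bulk N. 1 / (real N - 1) * (\<Sum>y\<in>bulk N. ?k x y)))"
  by (subst sum_ennreal) (use N in "auto intro!: mult_nonneg_nonneg sum_nonneg simp: c k ennreal_mult'[OF c, symmetric] dK_def simp del: times_divide_eq_left")
 also have "1 / (real N - 1) * (\<Sum>x\<in>bulk N. 1 / (real N - 1) * (\<Sum>y\<in>bulk N. ?k x y)) = real N / (real N - 1) * dR N v"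
  unfolding dR_def dK_def sum_distrib_left[symmetric] using N by simp
 finally show ?thesis .
qed

lemma dK_tendsto:
 assumes "filterlim r at_top sequentially" "0 < q" "q < 1" "0 < p" "p < 1" "q ~= p"
 shows "(%k. dK (r k) (idx (r k) q) (idx (r k) p)) ----> kern (q - p)"
proof -
 have "(%k. (real (idx (r k) q) - real (idx (r k) p)) / real (r k)) ----> q - p"
  using tendsto_diff[OF idx_tendsto[OF assms(1-3)] idx_tendsto[OF assms(1,4,5)]] by (simp add: diff_divide_distrib)
 then show ?thesis unfolding dK_def using assms by (intro kern_tendsto) auto
qed

text \<open>Fatou's lemma in both variables, off the diagonal. The factor 2 absorbs N/(N-1), which
  arises from cells of length 1/(N-1) against the weights of \<open>dR\<close>.\<close>

lemma reg_fatou: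
 assumes r: "filterlim r at_top sequentially" "!!k. r k >= 2"
  and cv: "AE q in UI. (%k. v k (idx (r k) q)) ----> f q"
 shows "reg f <= liminf (%k. ennreal (2 * dR (r k) (v k)))"
proof -
 let ?g = "%k x y. ennreal (dK (r k) x y * (v k x - v k y)^2)"
 have lim: "ennreal (kern (q - p) * (f q - f p)^2) = liminf (%k. ?g k (idx (r k) q) (idx (r k) p))"
  if "(%k. v k (idx (r k) q)) ----> f q" "(%k. v k (idx (r k) p)) ----> f p" "0 < q" "q < 1" "0 < p" "p < 1" "q ~= p" for q p
  by (rule lim_imp_Liminf[symmetric]) (auto intro!: tendsto_ennrealI tendsto_intros dK_tendsto that r(1))
 have "reg f <= (NU q. liminf (%k. (NU p. ?g k (idx (r k) q) (idx (r k) p))))"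
  unfolding reg_def
 proof (rule nn_integral_mono_AE)
  show "AE q in UI. (NU p. ennreal (kern (q - p) * (f q - f p)^2))
    <= liminf (%k. (NU p. ?g k (idx (r k) q) (idx (r k) p)))"
   using cv AE_space[of UI]
  proof eventually_elim
   case (elim q)
   have "(NU p. ennreal (kern (q - p) * (f q - f p)^2)) <= (NU p. liminf (%k. ?g k (idx (r k) q) (idx (r k) p)))"
   proof (rule nn_integral_mono_AE)
    show "AE p in UI. ennreal (kern (q - p) * (f q - f p)^2) <= liminf (%k. ?g k (idx (r k) q) (idx (r k) p))"
     using cv AE_space[of UI] AE_UI_neq[of q]
    proof eventually_elim
     case (elim p)
     then show ?case using lim[of q p] \<open>q : space UI\<close> \<open>(%k. v k (idx (r k) q)) ----> f q\<close> by auto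
    qed
   qed
   also have "... <= liminf (%k. (NU p. ?g k (idx (r k) q) (idx (r k) p)))"
    by (rule nn_integral_liminf) (rule idx_measurable_UI)
   finally show ?case .
  qed
 qed
 also have "... <= liminf (%k. (NU q. (NU p. ?g k (idx (r k) q) (idx (r k) p))))"
  by (rule nn_integral_liminf) (rule idx_measurable_UI)
 also have "... = liminf (%k. ennreal (real (r k) / (real (r k) - 1) * dR (r k) (v k)))"
  by (simp only: nn_dR[OF r(2)])
 also have "... <= liminf (%k. ennreal (2 * dR (r k) (v k)))"
 proof (intro Liminf_mono always_eventually allI ennreal_leI mult_right_mono dR_nonneg r(2))
  fix k show "real (r k) / (real (r k) - 1) <= 2" using r(2)[of k] by (simp add: divide_le_eq)
 qed
 finally show ?thesis .
qed

lemma kil_fatou: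
 assumes r: "filterlim r at_top sequentially" "!!k. r k >= 2"
  and cv: "AE q in UI. (%k. v k (idx (r k) q)) ----> f q"
 shows "kil f <= liminf (%k. ennreal (ip (r k) (%x. Vk (real x / real (r k)) * v k x) (v k)))"
proof -
 let ?g = "%k x. Vk (real x / real (r k)) * (v k x)^2"
 have "kil f <= (NU q. liminf (%k. ennreal (?g k (idx (r k) q))))"
  unfolding kil_def
 proof (rule nn_integral_mono_AE)
  show "AE q in UI. ennreal (Vk q * (f q)^2) <= liminf (%k. ennreal (?g k (idx (r k) q)))"
   using cv AE_space[of UI]
  proof eventually_elim
   case (elim q)
   then have q: "0 < q" "q < 1" by auto
   have "(%k. ?g k (idx (r k) q)) ----> Vk q * (f q)^2"
    unfolding Vk_def using q elim
    by (intro tendsto_mult tendsto_add kern_tendsto tendsto_diff tendsto_const tendsto_power idx_tendsto r(1)) auto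
   then show ?case by (subst lim_imp_Liminf) (auto intro: tendsto_ennrealI)
  qed
 qed
 also have "... <= liminf (%k. (NU q. ennreal (?g k (idx (r k) q))))"
  by (rule nn_integral_liminf) (rule idx_measurable_UI)
 also have "(%k. (NU q. ennreal (?g k (idx (r k) q)))) = (%k. ennreal (ip (r k) (%x. Vk (real x / real (r k)) * v k x) (v k)))"
 proof
  fix k
  have c: "0 <= 1 / (real (r k) - 1)" using r(2)[of k] by simp
  have n: "0 <= ?g k x" for x by simp
  show "(NU q. ennreal (?g k (idx (r k) q))) = ennreal (ip (r k) (%x. Vk (real x / real (r k)) * v k x) (v k))"
   unfolding nn_integral_idx[OF r(2), of "%x. ennreal (?g k x)"] sum_ennreal[OF n] ennreal_mult'[OF c, symmetric]
   by (simp add: ip_def power2_eq_square mult.assoc)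
 qed
 finally show ?thesis .
qed

subsection \<open>Strong compactness\<close>

text \<open>The mean of u over the j-th of m equal cells, whose length is 1/m.\<close>

definition coarse :: "nat => (real => real) => nat => real" where
 "coarse m u j = real m * (IU p. (if idx (Suc m) p = j then u p else 0))"

text \<open>The price in a Poincare inequality on coarse cells: two sites seen from one cell are at
  most 2/m apart, where the kernel is at least \<open>kern (2 / real m)\<close>. The quotient is a
  multiple of m^(-\<gamma>).\<close>

definition cerr :: "nat => real" where "cerr m = real m / kern (2 / real m)"

lemma cerr_tendsto: "cerr ----> 0"
proof -
 have "eventually (%m. 2 powr (\<gamma> + 1) / cg * (real m powr (- \<gamma>)) = cerr m) sequentially"
  using eventually_gt_at_top[of 0]
 proof eventually_elim
  case (elim m)
  define A B where "A = real m powr (- \<gamma> - 1)" and "B = 2 powr (- \<gamma> - 1 :: real)"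
  have p: "A > 0" "B > 0" using elim by (auto simp: A_def B_def)
  have "kern (2 / real m) = cg * (2 powr (- \<gamma> - 1) / real m powr (- \<gamma> - 1))"
   using elim by (simp add: kern_def powr_divide)
  moreover have "real m powr (- \<gamma>) = real m * real m powr (- \<gamma> - 1)"
   using elim powr_add[of "real m" 1 "- \<gamma> - 1"] by simp
  moreover have "2 powr (\<gamma> + 1) * 2 powr (- \<gamma> - 1) = (1::real)" by (simp add: powr_add[symmetric])
  ultimately have "kern (2 / real m) = cg * (B / A)" "real m powr (- \<gamma>) = real m * A" "2 powr (\<gamma> + 1) = 1 / B"
   using p by (auto simp: A_def[symmetric] B_def[symmetric] eq_divide_eq)
  then show ?case using cg elim p by (simp add: cerr_def)
 qed
 moreover have "(%m. 2 powr (\<gamma> + 1) / cg * (real m powr (- \<gamma>))) ----> 2 powr (\<gamma> + 1) / cg * 0"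
  using gam by (intro tendsto_mult tendsto_const tendsto_neg_powr filterlim_real_sequentially) auto
 ultimately show ?thesis by (simp add: Lim_transform_eventually)
qed

lemma integrable_bounded_UI:
 fixes f :: "real => real"
 assumes "f : mUI" "!!q. 0 < q ==> q < 1 ==> |f q| <= B"
 shows "iUI f"
 by (rule UI.integrable_const_bound[where B=B]) (use assms in "auto intro!: AE_UI_I")

text \<open>A Poincare inequality in L1. The deviation from a cell mean is at most the mean of |u(q)
  - u(p)| over the cell; Young's inequality with parameter s trades this for the squared difference,
  and the kernel is bounded below inside a cell.\<close>

lemma coarse_error:
 assumes N: "N >= 2" "N >= m" and m: "m >= 1" and s: "s > 0"
 shows "(IU q. |v (idx N q) - coarse m (%p. v (idx N p)) (idx (Suc m) q)| )
   <= s / 2 + cerr m / s * dR N v"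
proof -
 let ?u = "%q. v (idx N q)" and ?j = "idx (Suc m)"
 let ?S = "%q p. if ?j p = ?j q then 1 else 0 :: real"
 have vb: "|v x| <= (\<Sum>x\<in>bulk N. |v x| )" if "x : bulk N" for x
  using that by (intro member_le_sum) auto
 have meas2: "(%p. F (idx N p) (?j p)) : mUI" for F :: "nat => nat => real"
 proof -
  have "(%p. F (idx N p) (?j p)) : borel_measurable borel"
   by (rule measurable_compose_countable[where g="idx N" and f="%x p. F x (?j p)"],
     rule measurable_compose[OF idx_measurable], simp, rule idx_measurable)
  then show ?thesis by (rule borel_UI)
 qed
 have int2: "iUI (%p. F (idx N p) (?j p))" for F :: "nat => nat => real"
 proof (rule integrable_bounded_UI[OF meas2])
  fix q :: real assume q: "0 < q" "q < 1"
  have "idx N q : bulk N" "?j q : bulk (Suc m)" using q m N by (auto intro!: idx_bulk)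
  then have "|F (idx N q) (?j q)| <= (\<Sum>y\<in>bulk (Suc m). |F (idx N q) y| )" by (intro member_le_sum) auto
  also have "... <= (\<Sum>x\<in>bulk N. \<Sum>y\<in>bulk (Suc m). |F x y| )"
   using \<open>idx N q : bulk N\<close> by (intro member_le_sum[where f="%x. \<Sum>y\<in>bulk (Suc m). |F x y|"]) (auto intro: sum_nonneg)
  finally show "|F (idx N q) (?j q)| <= (\<Sum>x\<in>bulk N. \<Sum>y\<in>bulk (Suc m). |F x y| )" .
 qed
 have one: "real m * (IU p. ?S q p) = 1" if q: "0 < q" "q < 1" for q
 proof -
  have "(IU p. ?S q p) = 1 / (real (Suc m) - 1) * (\<Sum>x\<in>bulk (Suc m). if x = ?j q then 1 else 0)"
   using m by (intro integral_idx[of "Suc m" "%x. if x = ?j q then 1 else 0"]) auto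
  also have "(\<Sum>x\<in>bulk (Suc m). if x = ?j q then 1 else 0 :: real) = 1"
   using idx_bulk[of "Suc m" q] q m by simp
  finally show ?thesis using m by simp
 qed
 let ?D = "%q p. dK N (idx N q) (idx N p) * (?u q - ?u p)^2"
 have kpos: "0 < kern (2 / real m)" using kern_def cg m by simp
 have dom: "?S q p * |?u q - ?u p| <= ?S q p * (s / 2) + 1 / (2 * s * kern (2 / real m)) * ?D q p"
  if q: "0 < q" "q < 1" and p: "0 < p" "p < 1" for q p
 proof (cases "?j p = ?j q & idx N q ~= idx N p")
  case True
  \<comment> \<open>Points of one coarse cell are at most 1/m apart; rounding to sites adds at most
    1/N <= 1/m.\<close>
  have "|q - p| * real m <= 1"
   using idx_bounds[of "Suc m" q] idx_bounds[of "Suc m" p] q p m True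
   by (auto simp: abs_if algebra_simps)
  then have a: "|q - p| <= 1 / real m" using m by (simp add: le_divide_eq)
  have "|real (idx N q) / real N - real (idx N p) / real N| <= 1 / real m + 1 / real N"
  proof -
   have "|real (idx N q) - real (idx N p)| <= (real N - 1) * |q - p| + 1"
    proof -
    have "|(real N - 1) * q - (real N - 1) * p| = (real N - 1) * |q - p|"
     unfolding right_diff_distrib[symmetric] abs_mult using N by simp
    then show ?thesis using idx_bounds[OF N(1) q(1)] idx_bounds[OF N(1) p(1)] by linarith
   qed
   also have "... <= real N * |q - p| + 1" by (simp add: left_diff_distrib)
   also have "... <= real N * (1 / real m) + 1" by (intro add_right_mono mult_left_mono a) auto
   finally have "|real (idx N q) - real (idx N p)| / real N <= (real N * (1 / real m) + 1) / real N"
    by (intro divide_right_mono) auto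
   then show ?thesis using N by (simp add: diff_divide_distrib[symmetric] add_divide_distrib)
  qed
  also have "... <= 1 / real m + 1 / real m" using N m by (intro add_left_mono divide_left_mono) auto
  finally have b: "|(real (idx N q) - real (idx N p)) / real N| <= |2 / real m|" by (simp add: diff_divide_distrib)
  have k: "kern (2 / real m) <= dK N (idx N q) (idx N p)"
   unfolding dK_def using True N by (intro kern_antimono b) auto
  have "kern (2 / real m) * (?u q - ?u p)^2 <= ?D q p" by (intro mult_right_mono k) auto
  then have c: "(?u q - ?u p)^2 / (2 * s) <= 1 / (2 * s * kern (2 / real m)) * ?D q p"
   using kpos s by (simp add: field_simps)
  have "0 <= ( |?u q - ?u p| - s)^2 / (2 * s)" using s by simp
  also have "... = (?u q - ?u p)^2 / (2 * s) - |?u q - ?u p| + s / 2"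
   using s by (simp add: power2_diff field_simps power2_eq_square)
  finally show ?thesis using c True by simp
 next
  case False
  then show ?thesis using s kpos by (auto simp: dK_def intro!: add_nonneg_nonneg divide_nonneg_nonneg mult_nonneg_nonneg)
 qed
 have step: "|?u q - coarse m ?u (?j q)| <= s / 2 + real m * (1 / (2 * s * kern (2 / real m))) * (IU p. ?D q p)"
  if q: "0 < q" "q < 1" for q
 proof -
  have i1: "iUI (%p. ?S q p)" using int2[of "%x y. if y = ?j q then 1 else 0"] .
  have i2: "iUI (%p. ?S q p * (?u q - ?u p))" using int2[of "%x y. (if y = ?j q then 1 else 0) * (?u q - v x)"] .
  have i3: "iUI (%p. ?D q p)" using int2[of "%x y. dK N (idx N q) x * (?u q - v x)^2"] .
  have i4: "iUI (%p. ?S q p * |?u q - ?u p| )" using int2[of "%x y. (if y = ?j q then 1 else 0) * |?u q - v x|"] .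
  have i5: "iUI (%p. if ?j p = ?j q then ?u p else 0)" using int2[of "%x y. if y = ?j q then v x else 0"] .
  have "?u q - coarse m ?u (?j q) = real m * (IU p. ?S q p) * ?u q - real m * (IU p. (if ?j p = ?j q then ?u p else 0))"
   using one[OF q] by (simp add: coarse_def)
  also have "... = real m * ((IU p. ?S q p * ?u q) - (IU p. (if ?j p = ?j q then ?u p else 0)))"
   by (simp add: right_diff_distrib)
  also have "... = real m * (IU p. ?S q p * ?u q - (if ?j p = ?j q then ?u p else 0))"
   using i1 i5 by (subst Bochner_Integration.integral_diff) auto
  also have "... = real m * (IU p. ?S q p * (?u q - ?u p))"
   by (intro arg_cong2[where f="(*)"] Bochner_Integration.integral_cong) auto
  finally have "|?u q - coarse m ?u (?j q)| = real m * |(IU p. ?S q p * (?u q - ?u p))|"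
   by (simp add: abs_mult)
  also have "... <= real m * (IU p. |?S q p * (?u q - ?u p)| )"
   by (intro mult_left_mono integral_abs_bound) auto
  also have "... = real m * (IU p. ?S q p * |?u q - ?u p| )"
   by (intro arg_cong2[where f="(*)"] Bochner_Integration.integral_cong) auto
  also have "... <= real m * (IU p. ?S q p * (s / 2) + 1 / (2 * s * kern (2 / real m)) * ?D q p)"
   using dom q by (intro mult_left_mono integral_mono i4 Bochner_Integration.integrable_add integrable_mult_left integrable_mult_right i1 i3) auto
  also have "... = real m * ((IU p. ?S q p) * (s / 2) + 1 / (2 * s * kern (2 / real m)) * (IU p. ?D q p))"
   by (subst Bochner_Integration.integral_add) (auto intro!: integrable_mult_left integrable_mult_right i1 i3 simp del: times_divide_eq_left times_divide_eq_right)
  also have "... = (real m * (IU p. ?S q p)) * (s / 2) + real m * (1 / (2 * s * kern (2 / real m))) * (IU p. ?D q p)"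
   by (simp only: distrib_left mult.assoc)
  finally show ?thesis by (simp only: one[OF q] mult_1)
 qed
 let ?F = "%x. 1 / (real N - 1) * (\<Sum>y\<in>bulk N. dK N x y * (v x - v y)^2)"
 have F: "(IU p. ?D q p) = ?F (idx N q)" for q
  by (rule integral_idx[OF N(1), of "%y. dK N (idx N q) y * (v (idx N q) - v y)^2"])
 have IF: "(IU q. ?F (idx N q)) = real N / (real N - 1) * dR N v"
  proof -
  have "(IU q. ?F (idx N q)) = 1 / (real N - 1) * (\<Sum>x\<in>bulk N. ?F x)" by (rule integral_idx[OF N(1)])
  also have "... = real N / (real N - 1) * dR N v"
   unfolding dR_def dK_def sum_distrib_left[symmetric] using N by simp
  finally show ?thesis .
 qed
 have aff: "(IU q. a + c * G (idx N q)) = a + c * (IU q. G (idx N q))"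
  for a c :: real and G :: "nat => real"
  using integrable_idx[of G N] by simp
 have "(IU q. |?u q - coarse m ?u (?j q)| ) <= (IU q. s / 2 + real m * (1 / (2 * s * kern (2 / real m))) * ?F (idx N q))"
 proof (rule integral_mono)
  show "iUI (%q. |?u q - coarse m ?u (?j q)| )" using int2[of "%x y. |v x - coarse m ?u y|"] .
  show "iUI (%q. s / 2 + real m * (1 / (2 * s * kern (2 / real m))) * ?F (idx N q))"
   using int2[of "%x y. s / 2 + real m * (1 / (2 * s * kern (2 / real m))) * ?F x"] .
 qed (use step F in auto)
 also have "... = s / 2 + real m * (1 / (2 * s * kern (2 / real m))) * (real N / (real N - 1) * dR N v)"
  by (simp only: aff[of "s / 2" _ ?F] IF)
 also have "real m * (1 / (2 * s * kern (2 / real m))) * (real N / (real N - 1) * dR N v)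
   <= real m * (1 / (2 * s * kern (2 / real m))) * (2 * dR N v)"
 proof (intro mult_left_mono mult_right_mono dR_nonneg N)
  show "real N / (real N - 1) <= 2" using N by (simp add: divide_le_eq)
 qed (use s kpos in auto)
 also have "real m * (1 / (2 * s * kern (2 / real m))) * (2 * dR N v) = cerr m / s * dR N v"
  by (simp add: cerr_def)
 finally show ?thesis by simp
qed

text \<open>Compactness in the style of Kolmogorov and Riesz: the energy bound makes all step
  functions uniformly close in L1 to their averages over m cells, and these are finitely many
  numbers, each convergent by hypothesis. Hence the whole sequence is Cauchy in L1.\<close>

lemma strong_compactness:
 assumes r: "filterlim r at_top sequentially" "!!k. r k >= 2"
  and vb: "!!k x. x : bulk (r k) ==> |v k x| <= 1"
  and M: "!!k. dR (r k) (v k) <= M"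
  and cc: "!!m j. convergent (%k. coarse m (%q. v k (idx (r k) q)) j)"
 obtains f where "f : mUI" "!!q. |f q| <= 1"
  "(%k. (IU q. |v k (idx (r k) q) - f q| )) ----> 0"
proof -
 let ?u = "%k q. v k (idx (r k) q)"
 have ui: "iUI (?u k)" for k by (rule integrable_idx)
 have ub: "|?u k q| <= 1" if "0 < q" "q < 1" for k q using vb[OF idx_bulk[OF r(2) that]] .
 have M0: "0 <= M" using M[of 0] dR_nonneg[OF r(2)[of 0], of "v 0"] by linarith
 have C: "\<exists>n0. \<forall>i\<ge>n0. \<forall>j\<ge>n0. (IU q. norm (?u i q - ?u j q)) < e" if e: "e > 0" for e
 proof -
  \<comment> \<open>Error budget: e/2 from the two terms s/2, e/4 from the energy terms, e/8 from
    the averages, together less than e.\<close>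
  define s where "s = e / 2"
  have s: "s > 0" using e by (simp add: s_def)
  have "(%m. cerr m / s * M) ----> 0 / s * M" by (intro tendsto_intros cerr_tendsto) (use s in auto)
  from order_tendstoD(2)[OF this, of "e / 8"] e
  have "eventually (%m. cerr m / s * M < e / 8) sequentially" by simp
  then have "eventually (%m. cerr m / s * M < e / 8 & m >= 1) sequentially"
   using eventually_ge_at_top[of 1] by eventually_elim auto
  then obtain m where m: "cerr m / s * M < e / 8" "m >= 1"
   unfolding eventually_sequentially by blast
  let ?P = "%k. coarse m (?u k)"
  have "(%k. (\<Sum>j\<in>bulk (Suc m). |?P k j - lim (%k. ?P k j)| )) ----> (\<Sum>j\<in>bulk (Suc m). |lim (%k. ?P k j) - lim (%k. ?P k j)| )"
   using cc by (intro tendsto_intros) (auto simp: convergent_LIMSEQ_iff)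
  then have "eventually (%k. (\<Sum>j\<in>bulk (Suc m). |?P k j - lim (%k. ?P k j)| ) < e / 16) sequentially"
   using order_tendstoD(2)[of _ 0 sequentially "e/16"] e by simp
  moreover have "eventually (%k. r k >= m) sequentially" using r(1) by (simp add: filterlim_at_top)
  ultimately have "eventually (%k. (\<Sum>j\<in>bulk (Suc m). |?P k j - lim (%k. ?P k j)| ) < e / 16 & r k >= m) sequentially"
   by eventually_elim auto
  then obtain n0 where n0: "!!k. k >= n0 ==> (\<Sum>j\<in>bulk (Suc m). |?P k j - lim (%k. ?P k j)| ) < e / 16 & r k >= m"
   unfolding eventually_sequentially by blast
  have err: "(IU q. |?u k q - ?P k (idx (Suc m) q)| ) <= s / 2 + e / 8" if "k >= n0" for k
  proof -
   have "(IU q. |?u k q - ?P k (idx (Suc m) q)| ) <= s / 2 + cerr m / s * dR (r k) (v k)"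
    using n0[OF that] m r(2) s by (intro coarse_error) auto
   also have "... <= s / 2 + cerr m / s * M"
    using M s by (intro add_left_mono mult_left_mono) (auto simp: cerr_def)
   finally show ?thesis using m by linarith
  qed
  have Pi: "iUI (%q. ?P k (idx (Suc m) q))" for k by (rule integrable_idx)
  show ?thesis
  proof (intro exI[of _ n0] allI impI)
   fix i j assume ij: "i >= n0" "j >= n0"
   let ?a = "%k q. |?u k q - ?P k (idx (Suc m) q)|"
   let ?b = "%k q. |?P k (idx (Suc m) q) - lim (%k. ?P k (idx (Suc m) q))|"
   have ai: "iUI (?a k)" for k using ui Pi by auto
   have bi: "iUI (?b k)" for k by (rule integrable_idx)
   have b: "(IU q. ?b k q) <= e / 16" if "k >= n0" for k
   proof -
    have "(IU q. ?b k q) <= (IU q. e / 16)"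
    proof (rule integral_mono[OF bi])
     fix q assume "q : space UI"
     then have "idx (Suc m) q : bulk (Suc m)" using m by (intro idx_bulk) auto
     then have "?b k q <= (\<Sum>j\<in>bulk (Suc m). |?P k j - lim (%k. ?P k j)| )"
      by (intro member_le_sum[of _ _ "%j. |?P k j - lim (%k. ?P k j)|"]) auto
     then show "?b k q <= e / 16" using n0[OF that] by linarith
    qed simp
    then show ?thesis by simp
   qed
   have "(IU q. |?u i q - ?u j q| ) <= (IU q. (?a i q + ?a j q) + (?b i q + ?b j q))"
    by (intro integral_mono Bochner_Integration.integrable_add ai bi integrable_abs Bochner_Integration.integrable_diff ui) linarith
   also have "... = ((IU q. ?a i q) + (IU q. ?a j q)) + ((IU q. ?b i q) + (IU q. ?b j q))"
    using ai bi by (simp only: Bochner_Integration.integral_add Bochner_Integration.integrable_add)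
   also have "... <= ((s / 2 + e / 8) + (s / 2 + e / 8)) + (e / 16 + e / 16)"
    by (intro add_mono err b ij)
   also have "... < e" using e by (simp add: s_def)
   finally show "(IU q. norm (?u i q - ?u j q)) < e" by simp
  qed
 qed
 obtain s where s: "strict_mono s" "AE q in UI. Cauchy (%i. ?u (s i) q)"
  using cauchy_L1_AE_cauchy_subseq[of UI ?u, OF ui C] by blast
 \<comment> \<open>Clipping makes the bound hold everywhere and not just almost everywhere.\<close>
 define f where "f q = max (-1) (min 1 (lim (%i. ?u (s i) q)))" for q
 have fm: "f : mUI"
 proof -
  have "(%q. lim (%i. ?u (s i) q)) : mUI"
   by (rule borel_measurable_lim_metric) (rule idx_measurable_UI)
  then show ?thesis unfolding f_def by (intro borel_measurable_max borel_measurable_min) auto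
 qed
 have fb: "|f q| <= 1" for q unfolding f_def by (auto simp: max_def min_def)
 have cv: "AE q in UI. (%i. ?u (s i) q) ----> f q"
  using s(2) AE_space[of UI]
 proof eventually_elim
  case (elim q)
  then have l: "(%i. ?u (s i) q) ----> lim (%i. ?u (s i) q)" (is "_ ----> ?l")
   by (simp add: Cauchy_convergent_iff convergent_LIMSEQ_iff)
  have "|?l| <= 1"
  proof (rule tendsto_upperbound[OF tendsto_rabs[OF l]])
   show "eventually (%i. |?u (s i) q| <= 1) sequentially" using ub elim by (intro always_eventually) auto
  qed simp
  then have "f q = ?l" unfolding f_def by (auto simp: max_def min_def)
  then show ?case using l by simp
 qed
 have fi: "iUI f" by (rule integrable_bounded_UI[OF fm fb])
 have sub: "(%i. (IU q. |?u (s i) q - f q| )) ----> 0"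
 proof -
  have "(%i. (IU q. |?u (s i) q - f q| )) ----> (IU q. 0)"
  proof (rule integral_dominated_convergence[where w="%_. 2"])
   show "AE q in UI. (%i. |?u (s i) q - f q| ) ----> 0"
    using cv by eventually_elim (intro tendsto_rabs_zero LIM_zero)
   show "AE q in UI. norm |?u (s i) q - f q| <= 2" for i
   proof (rule AE_UI_I)
    fix q :: real assume q: "0 < q" "q < 1"
    show "norm |?u (s i) q - f q| <= 2" using ub[OF q, of "s i"] fb[of q] unfolding real_norm_def by linarith
   qed
   show "(%q. |?u (s i) q - f q| ) : mUI" for i
    using ui fi by (intro borel_measurable_integrable) auto
  qed auto
  then show ?thesis by simp
 qed
 have "(%k. (IU q. |?u k q - f q| )) ----> 0"
 proof (rule LIMSEQ_I)
  fix e :: real assume e: "e > 0"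
  obtain n1 where n1: "!!i j. i >= n1 ==> j >= n1 ==> (IU q. norm (?u i q - ?u j q)) < e / 2"
   using C[of "e/2"] e by auto
  obtain n2 where n2: "!!i. i >= n2 ==> (IU q. |?u (s i) q - f q| ) < e / 2"
   using LIMSEQ_D[OF sub, of "e/2"] e by auto
  show "\<exists>n0. \<forall>k\<ge>n0. norm ((IU q. |?u k q - f q| ) - 0) < e"
  proof (intro exI[of _ n1] allI impI)
   fix k assume k: "k >= n1"
   define i where "i = max n1 n2"
   have si: "s i >= n1" using seq_suble[OF s(1), of i] by (simp add: i_def)
   have "(IU q. |?u k q - f q| ) <= (IU q. |?u k q - ?u (s i) q| + |?u (s i) q - f q| )"
    using ui fi by (intro integral_mono) auto
   also have "... = (IU q. |?u k q - ?u (s i) q| ) + (IU q. |?u (s i) q - f q| )"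
    using ui fi by (intro Bochner_Integration.integral_add) auto
   also have "... < e / 2 + e / 2"
    using n1[OF k si] n2[of i] by (intro add_strict_mono) (auto simp: i_def)
   finally show "norm ((IU q. |?u k q - f q| ) - 0) < e" by simp
  qed
 qed
 then show ?thesis using that fm fb by blast
qed

end

section \<open>Test functions and the limiting quadratic form\<close>

lemma filterlim_plus2: "filterlim (%k::nat. k + 2) at_top sequentially"
 by (rule filterlim_subseq) (simp add: strict_mono_def)

lemma derivs_vanish:
 fixes D :: "nat => real => real"
 assumes D: "!!k q. q : {0..1} ==> (D k has_real_derivative D (Suc k) q) (at q within {0..1})"
  and C: "closed C" "!!q. q : {0..1} - C ==> D 0 q = 0"
 shows "q : {0..1} - C ==> D k q = 0"
proof (induction k arbitrary: q)
 case (Suc k)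
 have q: "q : {0..1}" "q : - C" using Suc.prems by auto
 have "eventually (%y. y : - C) (at q within {0..1})"
  using C(1) q by (intro eventually_at_topological[THEN iffD2] exI[of _ "- C"]) auto
 moreover have "eventually (%y. y : {0..1}) (at q within {0..1})" by (simp add: eventually_at_filter)
 ultimately have "eventually (%y. 0 = (D k y - D k q) / (y - q)) (at q within {0..1})"
  by eventually_elim (use Suc in auto)
 then have "((%y. (D k y - D k q) / (y - q)) \<longlongrightarrow> 0) (at q within {0..1})"
  by (rule Lim_transform_eventually[OF tendsto_const])
 moreover have "((%y. (D k y - D k q) / (y - q)) \<longlongrightarrow> D (Suc k) q) (at q within {0..1})"
  using D[OF q(1)] by (simp add: has_field_derivative_iff)
 moreover have "at q within {0..1} ~= bot"
  using q(1) by (simp add: trivial_limit_within connected_imp_perfect)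
 ultimately show ?case using tendsto_unique by blast
qed (use C in auto)

text \<open>All derivatives vanish at the endpoints, so three applications of the mean value theorem
  starting from \<open>D 3\<close> give the cubic bounds. Only sup norms of derivatives enter, not
  the support.\<close>

lemma flat_taylor:
 fixes D :: "nat => real => real"
 assumes D: "!!k q. q : {0..1} ==> (D k has_real_derivative D (Suc k) q) (at q within {0..1})"
  and C: "compact C" "C \<subseteq> {0<..<1}" "!!q. q : {0..1} - C ==> D 0 q = 0"
  and B: "!!q. q : {0..1} ==> |D 2 q| <= B" "!!q. q : {0..1} ==> |D 3 q| <= B"
 shows "taylor_bound (D 0) (D 1) B" and "0 <= B"
  and "q : {0..1} ==> |D 0 q| <= B * q ^ 3 & |D 0 q| <= B * (1 - q) ^ 3"
proof -
 have z: "D k 0 = 0" "D k 1 = 0" for k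
  proof -
  have "0 : {0..1} - C" "1 : {0..1} - C" using C(2) by auto
  then show "D k 0 = 0" "D k 1 = 0"
   using derivs_vanish[of D C _ k, OF D compact_imp_closed[OF C(1)] C(3)] by blast+
 qed
 have D': "(D (Suc (Suc 0)) has_real_derivative D (Suc (Suc (Suc 0))) q) (at q within {0..1})"
  "(D (Suc 0) has_real_derivative D (Suc (Suc 0)) q) (at q within {0..1})" if "q : {0..1}" for q
  using D[OF that] by blast+
 show "taylor_bound (D 0) (D 1) B"
  using D[of _ 0] D[of _ 1] B(1) z by (intro taylor_boundI[where ?G2.0="D 2"]) (auto simp: numeral_2_eq_2)
 show B0: "0 <= B" using B(1)[of 0] by simp
 have up: "|D k q| <= B * q ^ Suc j" if q: "q : {0..1}" and h: "!!x. x : {0..1} ==> |D (Suc k) x| <= B * x ^ j" for k j q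
 proof -
  obtain x where x: "x : {0..1}" "min 0 q <= x" "x <= max 0 q" "D k q - D k 0 = D (Suc k) x * (q - 0)"
   using mvt_bound[where f="D k" and f'="D (Suc k)" and p=0 and q=q, OF D] q by auto
  have "|D k q| = |D (Suc k) x| * q" using x(4) z q by (simp add: abs_mult)
  also have "... <= (B * x ^ j) * q" using h[OF x(1)] q by (intro mult_right_mono) auto
  also have "... <= (B * q ^ j) * q"
   using x q B0 by (intro mult_right_mono mult_left_mono power_mono) auto
  finally show ?thesis by (simp add: mult_ac)
 qed
 have dn: "|D k q| <= B * (1 - q) ^ Suc j" if q: "q : {0..1}" and h: "!!x. x : {0..1} ==> |D (Suc k) x| <= B * (1 - x) ^ j" for k j q
 proof -
  obtain x where x: "x : {0..1}" "min 1 q <= x" "x <= max 1 q" "D k q - D k 1 = D (Suc k) x * (q - 1)"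
   using mvt_bound[where f="D k" and f'="D (Suc k)" and p=1 and q=q, OF D] q by auto
  have "|D k q| = |D (Suc k) x| * (1 - q)" using x(4) z q by (simp add: abs_mult)
  also have "... <= (B * (1 - x) ^ j) * (1 - q)" using h[OF x(1)] q by (intro mult_right_mono) auto
  also have "... <= (B * (1 - q) ^ j) * (1 - q)"
   using x q B0 by (intro mult_right_mono mult_left_mono power_mono) auto
  finally show ?thesis by (simp add: mult_ac)
 qed
 have b3: "|D (Suc (Suc (Suc 0))) x| <= B * x ^ 0" "|D (Suc (Suc (Suc 0))) x| <= B * (1 - x) ^ 0" if "x : {0..1}" for x
  using B(2)[OF that] by (simp_all add: numeral_3_eq_3)
 show "|D 0 q| <= B * q ^ 3 & |D 0 q| <= B * (1 - q) ^ 3" if "q : {0..1}"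
  using up[OF that up[OF _ up[OF _ b3(1)]]] dn[OF that dn[OF _ dn[OF _ b3(2)]]] by (simp add: numeral_3_eq_3)
qed

text \<open>The time-independent counterpart of \<open>test_functions\<close>, with the same
  one-sided derivatives at the endpoints.\<close>

definition ctest :: "(real => real) => bool" where
 "ctest \<phi> \<longleftrightarrow> (\<exists>D. D 0 = \<phi> & (\<forall>k. \<forall>q\<in>{0..1}. (D k has_real_derivative D (Suc k) q) (at q within {0..1}))) \<and>
   (\<exists>C. compact C & C \<subseteq> {0<..<1} & (\<forall>q\<in>{0..1} - C. \<phi> q = 0))"

lemma ctest_zero: "ctest (%_. 0)"
 unfolding ctest_def by (rule conjI, rule exI[of _ "%_ _. 0"], simp, rule exI[of _ "{}"], simp)

lemma ctest_lincomb:
 assumes "ctest f" "ctest g"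
 shows "ctest (%q. a * f q + b * g q)"
proof -
 obtain D C where D: "D 0 = f" "!!k q. q : {0..1} ==> (D k has_real_derivative D (Suc k) q) (at q within {0..1})"
  and C: "compact C" "C \<subseteq> {0<..<1}" "!!q. q : {0..1} - C ==> f q = 0"
  using assms(1) unfolding ctest_def by blast
 obtain D' C' where D': "D' 0 = g" "!!k q. q : {0..1} ==> (D' k has_real_derivative D' (Suc k) q) (at q within {0..1})"
  and C': "compact C'" "C' \<subseteq> {0<..<1}" "!!q. q : {0..1} - C' ==> g q = 0"
  using assms(2) unfolding ctest_def by blast
 show ?thesis unfolding ctest_def
 proof (intro conjI exI)
  show "(%k q. a * D k q + b * D' k q) 0 = (%q. a * f q + b * g q)" using D D' by simp
  show "\<forall>k. \<forall>q\<in>{0..1}. ((%q. a * D k q + b * D' k q) has_real_derivative a * D (Suc k) q + b * D' (Suc k) q) (at q within {0..1})"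
   by (intro allI ballI DERIV_add DERIV_cmult D(2) D'(2))
  show "compact (C \<union> C')" using C C' by auto
  show "C \<union> C' \<subseteq> {0<..<1}" using C C' by auto
  show "\<forall>q\<in>{0..1} - (C \<union> C'). a * f q + b * g q = 0" using C C' by auto
 qed
qed

context frac_params begin

text \<open>A single constant serves all times, by compactness of
  \<open>{0..T} \<times> {0..1}\<close> and continuity of the derivatives there.\<close>

lemma test_function_bounds:
 assumes T: "T > 0" and G: "G : test_functions T"
 obtains B G1 where "B >= 0" "!!s. s : {0..T} ==> taylor_bound (G s) (G1 s) B"
  "!!s. s : {0..T} ==> boundary_flat (G s) B"
  "!!s q. s : {0..T} ==> q : {0..1} ==> |G s q| <= B"
  "!!s q. s : {0..T} ==> q : {0..1} ==> |vector_derivative (%r. G r q) (at s within {0..T})| <= B"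
proof -
 obtain D where D: "D 0 = G" and dD: "!!k s q. s : {0..T} ==> q : {0..1} ==> (D k s has_real_derivative D (Suc k) s q) (at q within {0..1})"
  and cD: "!!k. continuous_on ({0..T} \<times> {0..1}) (%(s, q). D k s q)"
  and supp: "!!s. s : {0..T} ==> \<exists>C. compact C & C \<subseteq> {0<..<1} & (\<forall>q\<in>{0..1} - C. G s q = 0)"
  and cv: "continuous_on ({0..T} \<times> {0..1}) (%(s, q). vector_derivative (%r. G r q) (at s within {0..T}))"
  using G unfolding test_functions_def by blast
 have bd: "\<exists>B. \<forall>s\<in>{0..T}. \<forall>q\<in>{0..1}. |h s q| <= B" if "continuous_on ({0..T} \<times> {0..1}) (%(s, q). h s q)" for h :: "real => real => real"
 proof -
  have "bounded ((%(s, q). h s q) ` ({0..T} \<times> {0..1}))"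
   by (intro compact_imp_bounded compact_continuous_image that compact_Times) auto
  then obtain B where "\<forall>y\<in>(%(s, q). h s q) ` ({0..T} \<times> {0..1}). norm y <= B" unfolding bounded_iff by blast
  then show ?thesis by (intro exI[of _ B]) auto
 qed
 obtain B0 where B0: "!!s q. s : {0..T} ==> q : {0..1} ==> |D 0 s q| <= B0" using bd[OF cD[of 0]] by blast
 obtain B2 where B2: "!!s q. s : {0..T} ==> q : {0..1} ==> |D 2 s q| <= B2" using bd[OF cD[of 2]] by blast
 obtain B3 where B3: "!!s q. s : {0..T} ==> q : {0..1} ==> |D 3 s q| <= B3" using bd[OF cD[of 3]] by blast
 obtain Bv where Bv: "!!s q. s : {0..T} ==> q : {0..1} ==> |vector_derivative (%r. G r q) (at s within {0..T})| <= Bv"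
  using bd[OF cv] by blast
 define B where "B = max (max B0 B2) (max B3 Bv)"
 have ft: "taylor_bound (G s) (D 1 s) B & 0 <= B & boundary_flat (G s) B" if s: "s : {0..T}" for s
 proof -
  obtain C where C: "compact C" "C \<subseteq> {0<..<1}" "!!q. q : {0..1} - C ==> G s q = 0" using supp[OF s] by blast
  have b2: "|D 2 s q| <= B" "|D 3 s q| <= B" if "q : {0..1}" for q
   using B2[OF s that] B3[OF s that] by (auto simp: B_def)
  note ft = flat_taylor[where D="%k. D k s" and C=C and B=B, OF dD[OF s] C(1,2) _ b2]
  show ?thesis using ft C(3) D unfolding boundary_flat_def by auto
 qed
 show ?thesis
 proof (rule that[of B "D 1"])
  show "0 <= B" using ft[of 0] T by auto
  show "!!s. s : {0..T} ==> taylor_bound (G s) (D 1 s) B" using ft by blast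
  show "!!s. s : {0..T} ==> boundary_flat (G s) B" using ft by blast
  show "!!s q. s : {0..T} ==> q : {0..1} ==> |G s q| <= B" using B0 D by (force simp: B_def)
  show "!!s q. s : {0..T} ==> q : {0..1} ==> |vector_derivative (%r. G r q) (at s within {0..T})| <= B"
   using Bv by (force simp: B_def)
 qed
qed

lemma vector_derivative_const_within:
 assumes "T > 0" "s : {0..T::real}"
 shows "vector_derivative (%r. c::real) (at s within {0..T}) = 0"
 using assms by (intro vector_derivative_within_cbox[of 0 T, simplified] ) auto

lemma ctest_test_function:
 assumes "ctest \<phi>" "T > 0"
 shows "(%s. \<phi>) : test_functions T"
proof -
 obtain D C where D: "D 0 = \<phi>" "!!k q. q : {0..1} ==> (D k has_real_derivative D (Suc k) q) (at q within {0..1})"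
  and C: "compact C" "C \<subseteq> {0<..<1}" "!!q. q : {0..1} - C ==> \<phi> q = 0"
  using assms(1) unfolding ctest_def by blast
 have c: "continuous_on {0..1} (D k)" for k using D(2) by (rule DERIV_continuous_on)
 have cc: "continuous_on ({0..T} \<times> {0..1}) (%(s, q). D k q)" for k
  unfolding case_prod_beta by (rule continuous_on_compose2[OF c]) (auto intro!: continuous_intros)
 have v: "continuous_on ({0..T} \<times> {0..1}) (%(s, q). vector_derivative (%r. \<phi> q) (at s within {0..T}))"
  by (rule continuous_on_cong[THEN iffD2, OF refl _ continuous_on_const[of _ 0]])
    (auto simp: vector_derivative_const_within[OF assms(2)])
 show ?thesis unfolding test_functions_def
 proof (intro CollectI conjI)
  show "\<forall>q\<in>{0..1}. (%s. \<phi> q) differentiable_on {0..T}" by simp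
  show "continuous_on ({0..T} \<times> {0..1}) (%(s, q). vector_derivative (%r. \<phi> q) (at s within {0..T}))" by (rule v)
  show "\<exists>D. D 0 = (%s. \<phi>) \<and>
    (\<forall>k. \<forall>s\<in>{0..T}. \<forall>q\<in>{0..1}. (D k s has_real_derivative D (Suc k) s q) (at q within {0..1})) \<and>
    (\<forall>k. continuous_on ({0..T} \<times> {0..1}) (%(s, q). D k s q))"
   by (rule exI[of _ "%k s. D k"]) (use D cc in auto)
  show "\<forall>s\<in>{0..T}. \<exists>C. compact C & C \<subseteq> {0<..<1} & (\<forall>q\<in>{0..1} - C. \<phi> q = 0)" using C by blast
 qed
qed

lemma ctest_bounds:
 assumes "ctest \<phi>"
 obtains B G1 where "B >= 0" "taylor_bound \<phi> G1 B" "boundary_flat \<phi> B" "!!q. q : {0..1} ==> |\<phi> q| <= B"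
proof -
 have "\<exists>B G1. B >= 0 & taylor_bound \<phi> G1 B & boundary_flat \<phi> B & (\<forall>q\<in>{0..1}. |\<phi> q| <= B)"
  using test_function_bounds[OF zero_less_one ctest_test_function[OF assms zero_less_one]]
  by (metis atLeastAtMost_iff order_refl zero_le_one)
 then show ?thesis using that by blast
qed

lemma ctest_cont: "ctest \<phi> ==> continuous_on {0..1} \<phi>"
 using ctest_bounds[of \<phi>] unfolding taylor_bound_def by metis

lemma ctest_measurable: "ctest \<phi> ==> \<phi> : mUI"
 by (intro cont_measurable_UI ctest_cont)

lemma ctest_bounded: "ctest \<phi> ==> \<exists>B. \<forall>q. 0 < q --> q < 1 --> |\<phi> q| <= B"
 using ctest_bounds[of \<phi>] by (metis atLeastAtMost_iff less_imp_le)

lemma ctest_L_op: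
 assumes "ctest \<phi>"
 shows "L_op \<gamma> \<kappa> \<phi> : mUI" and "\<exists>B. \<forall>q. 0 < q --> q < 1 --> |L_op \<gamma> \<kappa> \<phi> q| <= B"
 using ctest_bounds[OF assms] L_op_measurable L_op_bound by metis+

lemma integrable_mult_bounded:
 fixes f g :: "real => real"
 assumes "f : mUI" "\<exists>B. \<forall>q. 0 < q --> q < 1 --> |f q| <= B"
  and "g : mUI" "\<exists>B. \<forall>q. 0 < q --> q < 1 --> |g q| <= B"
 shows "iUI (%q. f q * g q)"
proof -
 obtain A where A: "!!q. 0 < q ==> q < 1 ==> |f q| <= A" using assms(2) by blast
 obtain B where B: "!!q. 0 < q ==> q < 1 ==> |g q| <= B" using assms(4) by blast
 show ?thesis
 proof (rule integrable_bounded_UI)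
  show "(%q. f q * g q) : mUI" using assms by (intro borel_measurable_times)
  fix q :: real assume "0 < q" "q < 1"
  then show "|f q * g q| <= A * B" using A[of q] B[of q] by (auto simp: abs_mult intro!: mult_mono)
 qed
qed

lemma samp_in: "x : bulk N ==> real x / real N : {0..1}"
 by (auto simp: bulk_def divide_le_eq)

lemma samp_tendsto:
 assumes r: "filterlim r at_top sequentially" "!!k. r k >= 2" and G: "continuous_on {0..1} G" and q: "0 < q" "q < 1"
 shows "(%k. samp (r k) G (idx (r k) q)) ----> G q"
proof (rule continuous_on_tendsto_compose[OF G idx_tendsto[OF r(1) q]])
 show "eventually (%k. real (idx (r k) q) / real (r k) : {0..1}) sequentially"
  by (intro always_eventually allI samp_in idx_bulk r(2) q)
qed (use q in auto)

definition Q :: "(real => real) => (real => real) => real" where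
 "Q \<phi> \<psi> = - (IU q. L_op \<gamma> \<kappa> \<phi> q * \<psi> q)"

text \<open>Symmetry and positivity of the limiting quadratic form are inherited from the discrete one.\<close>

lemma Q_limit:
 assumes "ctest \<phi>" "ctest \<psi>"
 shows "(%k. ip (k + 2) (dA (k + 2) (samp (k + 2) \<phi>)) (samp (k + 2) \<psi>)) ----> Q \<phi> \<psi>"
proof -
 let ?r = "%k::nat. k + 2"
 have r: "filterlim ?r at_top sequentially" "!!k. ?r k >= 2" by (auto intro: filterlim_plus2[simplified])
 obtain B G1 where B: "B >= 0" "taylor_bound \<phi> G1 B" "boundary_flat \<phi> B" using ctest_bounds[OF assms(1)] by metis
 obtain B' where B': "B' >= 0" "!!q. q : {0..1} ==> |\<psi> q| <= B'" using ctest_bounds[OF assms(2)] by metis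
 let ?F = "%k q. dA (?r k) (samp (?r k) \<phi>) (idx (?r k) q) * samp (?r k) \<psi> (idx (?r k) q)"
 let ?C = "(near_err B 1 + \<kappa> * (2 * cg * B)) * B'"
 have "(%k. (IU q. ?F k q)) ----> (IU q. - L_op \<gamma> \<kappa> \<phi> q * \<psi> q)"
 proof (rule integral_dominated_convergence[where w="%_. ?C"])
  show "(%q. - L_op \<gamma> \<kappa> \<phi> q * \<psi> q) : mUI"
   using ctest_L_op(1)[OF assms(1)] ctest_measurable[OF assms(2)]
   by (intro borel_measurable_times borel_measurable_uminus)
  show "?F k : mUI" for k by (rule idx_measurable_UI)
  show "AE q in UI. (%k. ?F k q) ----> - L_op \<gamma> \<kappa> \<phi> q * \<psi> q"
   by (intro AE_UI_I tendsto_mult dA_samp_tendsto[OF B(2)] samp_tendsto r ctest_cont assms)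
  show "AE q in UI. norm (?F k q) <= ?C" for k
  proof (rule AE_UI_I)
   fix q :: real assume q: "0 < q" "q < 1"
   have x: "idx (?r k) q : bulk (?r k)" using q by (intro idx_bulk) auto
   show "norm (?F k q) <= ?C"
    unfolding real_norm_def abs_mult
    using dA_samp_bound[OF B(2,3) x] B'(2)[OF samp_in[OF x]] by (intro mult_mono) auto
  qed
 qed simp
 then show ?thesis unfolding Q_def by (simp add: ip_integral)
qed

lemma Q_sym:
 assumes "ctest \<phi>" "ctest \<psi>"
 shows "Q \<phi> \<psi> = Q \<psi> \<phi>"
proof -
 have "ip N (dA N u) v = ip N (dA N v) u" for N u v
  using ip_dA_sym[of N u v] by (simp add: ip_commute)
 then have "(%k. ip (k + 2) (dA (k + 2) (samp (k + 2) \<phi>)) (samp (k + 2) \<psi>)) ----> Q \<psi> \<phi>"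
  using Q_limit[OF assms(2,1)] by simp
 then show ?thesis using Q_limit[OF assms] LIMSEQ_unique by blast
qed

text \<open>The killing potential is at least \<open>cg\<close> on all of (0,1). The resulting
  control of the L2 norm makes the dual norm in the uniqueness proof finite.\<close>

lemma Q_coercive:
 assumes "ctest \<phi>"
 shows "\<kappa> * cg * (IU q. (\<phi> q)^2) <= Q \<phi> \<phi>"
proof (rule LIMSEQ_le[OF _ Q_limit[OF assms assms]])
 let ?r = "%k::nat. k + 2"
 have r: "filterlim ?r at_top sequentially" "!!k. ?r k >= 2" by (auto intro: filterlim_plus2[simplified])
 obtain B where B: "B >= 0" "!!q. q : {0..1} ==> |\<phi> q| <= B" using ctest_bounds[OF assms] by metis
 have "(%k. (IU q. (samp (?r k) \<phi> (idx (?r k) q))^2)) ----> (IU q. (\<phi> q)^2)"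
 proof (rule integral_dominated_convergence[where w="%_. B^2"])
  show "AE q in UI. (%k. (samp (?r k) \<phi> (idx (?r k) q))^2) ----> (\<phi> q)^2"
   by (intro AE_UI_I tendsto_power samp_tendsto r ctest_cont assms)
  show "AE q in UI. norm ((samp (?r k) \<phi> (idx (?r k) q))^2) <= B^2" for k
  proof (rule AE_UI_I)
   fix q :: real assume "0 < q" "q < 1"
   then have "idx (?r k) q : bulk (?r k)" by (intro idx_bulk) auto
   from B(2)[OF samp_in[OF this]]
   have "|samp (?r k) \<phi> (idx (?r k) q)| <= |B|" using B(1) by simp
   then show "norm ((samp (?r k) \<phi> (idx (?r k) q))^2) <= B^2"
    unfolding abs_le_square_iff by simp
  qed
  show "(%q. (\<phi> q)^2) : mUI" using ctest_measurable[OF assms] by (rule borel_measurable_power)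
  show "(%q. (samp (?r k) \<phi> (idx (?r k) q))^2) : mUI" for k by (rule idx_measurable_UI)
 qed simp
 then show "(%k. \<kappa> * cg * ip (?r k) (samp (?r k) \<phi>) (samp (?r k) \<phi>)) ----> \<kappa> * cg * (IU q. (\<phi> q)^2)"
  by (intro tendsto_mult tendsto_const) (simp add: ip_integral power2_eq_square)
 show "\<exists>n. \<forall>k\<ge>n. \<kappa> * cg * ip (?r k) (samp (?r k) \<phi>) (samp (?r k) \<phi>)
   <= ip (?r k) (dA (?r k) (samp (?r k) \<phi>)) (samp (?r k) \<phi>)"
 proof (intro exI allI impI)
  fix k
  let ?N = "?r k" and ?v = "samp (?r k) \<phi>"
  have "cg * ip ?N ?v ?v = ip ?N (%x. cg * ?v x) ?v" by (rule ip_scale[symmetric])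
  also have "... <= ip ?N (%x. Vk (real x / real ?N) * ?v x) ?v"
   unfolding ip_def
  proof (intro mult_left_mono sum_mono)
   fix x assume "x : bulk ?N"
   then have "cg <= Vk (real x / real ?N)" by (intro Vk_ge) (auto simp: bulk_def divide_less_eq)
   then have "cg * (?v x * ?v x) <= Vk (real x / real ?N) * (?v x * ?v x)" by (intro mult_right_mono) auto
   then show "cg * ?v x * ?v x <= Vk (real x / real ?N) * ?v x * ?v x" by (simp only: mult.assoc)
  qed simp
  finally have "\<kappa> * (cg * ip ?N ?v ?v) <= \<kappa> * ip ?N (%x. Vk (real x / real ?N) * ?v x) ?v"
   using kap by (intro mult_left_mono) simp_all
  also have "... <= dE ?N ?v" unfolding dE_eq using dR_nonneg[of ?N ?v] by simp
  finally show "\<kappa> * cg * ip ?N ?v ?v <= ip ?N (dA ?N ?v) ?v" by (simp add: dE_def mult.assoc)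
 qed
qed

lemma Q_nonneg: "ctest \<phi> ==> 0 <= Q \<phi> \<phi>"
 by (rule order_trans[OF _ Q_coercive]) (use kap cg in "auto intro!: mult_nonneg_nonneg integral_nonneg_AE AE_I2")

text \<open>\<open>regional_frac_lap\<close> is defined through \<open>Lim\<close>, which is
  additive only for convergent limits. Linearity is inherited from the discrete operators
  instead.\<close>

lemma L_op_linear:
 assumes "ctest f" "ctest g" "0 < q" "q < 1"
 shows "L_op \<gamma> \<kappa> (%q. a * f q + b * g q) q = a * L_op \<gamma> \<kappa> f q + b * L_op \<gamma> \<kappa> g q"
proof -
 obtain B G1 where B: "taylor_bound f G1 B" using ctest_bounds[OF assms(1)] by metis
 obtain B' G1' where B': "taylor_bound g G1' B'" using ctest_bounds[OF assms(2)] by metis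
 obtain B'' G1'' where B'': "taylor_bound (%q. a * f q + b * g q) G1'' B''"
  using ctest_bounds[OF ctest_lincomb[OF assms(1,2), of a b]] by metis
 have fi: "filterlim (%n::nat. n) at_top sequentially" by (rule filterlim_ident)
 have "(%N. - dA N (samp N (%q. a * f q + b * g q)) (idx N q)) ----> L_op \<gamma> \<kappa> (%q. a * f q + b * g q) q"
  using tendsto_minus[OF dA_samp_tendsto[OF B'' assms(3,4) fi]] by simp
 moreover have "(%N. a * (- dA N (samp N f) (idx N q)) + b * (- dA N (samp N g) (idx N q))) ----> a * L_op \<gamma> \<kappa> f q + b * L_op \<gamma> \<kappa> g q"
  using tendsto_minus[OF dA_samp_tendsto[OF B assms(3,4) fi]] tendsto_minus[OF dA_samp_tendsto[OF B' assms(3,4) fi]]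
  by (intro tendsto_intros) auto
 moreover have "a * (- dA N (samp N f) (idx N q)) + b * (- dA N (samp N g) (idx N q)) = - dA N (samp N (%q. a * f q + b * g q)) (idx N q)" for N
  by (simp add: dA_linear)
 ultimately show ?thesis using LIMSEQ_unique by simp
qed

lemma Q_expand:
 assumes f: "ctest f" and g: "ctest g"
 shows "Q (%q. f q + b * g q) (%q. f q + b * g q) = Q f f + 2 * b * Q f g + b^2 * Q g g"
proof -
 have i: "iUI (%q. L_op \<gamma> \<kappa> \<phi> q * \<psi> q)" if "ctest \<phi>" "ctest \<psi>" for \<phi> \<psi>
  by (rule integrable_mult_bounded[OF ctest_L_op[OF that(1)] ctest_measurable[OF that(2)] ctest_bounded[OF that(2)]])
 have "Q (%q. f q + b * g q) (%q. f q + b * g q) =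
  - (IU q. (L_op \<gamma> \<kappa> f q * f q + b * (L_op \<gamma> \<kappa> f q * g q)) + (b * (L_op \<gamma> \<kappa> g q * f q) + b^2 * (L_op \<gamma> \<kappa> g q * g q)))"
  unfolding Q_def
  by (intro arg_cong[where f=uminus] Bochner_Integration.integral_cong refl)
    (use L_op_linear[OF f g, of _ 1 b] in "simp add: algebra_simps power2_eq_square")
 also have "... = Q f f + b * Q f g + (b * Q g f + b^2 * Q g g)"
  unfolding Q_def using f g i by simp
 finally show ?thesis using Q_sym[OF f g] by simp
qed

lemma far_sum_0: "(\<Sum>x\<in>bulk N. far N dl G x) = 0"
proof -
 define K where "K x y = (if dl < |real x - real y| / real N then kern ((real x - real y) / real N) else 0)" for x y
 have ks: "K y x = K x y" for x y
  using kern_minus[of "(real x - real y) / real N"] by (simp add: K_def minus_divide_left abs_minus_commute)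
 let ?S = "\<Sum>x\<in>bulk N. \<Sum>y\<in>bulk N. K x y * (samp N G y - samp N G x)"
 have "?S = (\<Sum>x\<in>bulk N. \<Sum>y\<in>bulk N. K y x * (samp N G x - samp N G y))" by (rule sum.swap)
 also have "... = (\<Sum>x\<in>bulk N. \<Sum>y\<in>bulk N. - (K x y * (samp N G y - samp N G x)))"
  by (intro sum.cong refl) (simp add: ks algebra_simps)
 also have "... = - ?S" by (simp add: sum_negf)
 finally have "?S = 0" by simp
 moreover have "(\<Sum>x\<in>bulk N. far N dl G x) = 1 / real N * ?S"
  unfolding far_def sum_distrib_left[symmetric] K_def
  by (intro arg_cong2[where f="(*)"] sum.cong refl) auto
 ultimately show ?thesis by simp
qed

lemma trunc_measurable:
 assumes "continuous_on {0..1} G" "0 < dl"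
 shows "trunc dl G : mUI"
proof (rule borel_measurable_LIMSEQ_real)
 show "(%N. far N dl G (idx N q)) ----> trunc dl G q" if "q : space UI" for q
  using far_tendsto[of "%n. n" G q dl] assms that by (simp add: filterlim_ident)
qed (rule idx_measurable_UI)

lemma far_bound:
 assumes "x : bulk N" "0 < dl" "!!q. q : {0..1} ==> |G q| <= C"
 shows "|far N dl G x| <= kern dl * (2 * C)"
proof -
 have N: "N >= 2" using assms(1) by (auto simp: bulk_def)
 have C: "0 <= C" using assms(3)[of 0] by simp
 have "|far N dl G x| <= 1 / real N * (\<Sum>y\<in>bulk N. kern dl * (2 * C))"
  unfolding far_def abs_mult[of "1 / real N"]
 proof (intro mult_mono order_trans[OF sum_abs] sum_mono)
  fix y assume y: "y : bulk N"
  show "|if dl < |real x - real y| / real N then kern ((real x - real y) / real N) * (samp N G y - samp N G x) else 0|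
    <= kern dl * (2 * C)"
  proof (cases "dl < |real x - real y| / real N")
   case True
   have "kern ((real x - real y) / real N) <= kern dl" using True assms(2) by (intro kern_antimono) auto
   moreover have "|samp N G y - samp N G x| <= 2 * C"
    using assms(3)[OF samp_in[OF y]] assms(3)[OF samp_in[OF assms(1)]] by linarith
   ultimately show ?thesis using True by (auto simp: abs_mult intro!: mult_mono)
  qed (use C in auto)
 qed auto
 also have "... = real (N - 1) / real N * (kern dl * (2 * C))" by (simp add: bulk_card)
 also have "... <= 1 * (kern dl * (2 * C))" using C N by (intro mult_right_mono) auto
 finally show ?thesis by simp
qed

text \<open>The integrand is antisymmetric in its two variables. The identity is obtained as a limit
  of \<open>far_sum_0\<close>.\<close>

lemma trunc_integral_0:
 assumes G: "continuous_on {0..1} G" and d: "0 < dl"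
 shows "(IU q. trunc dl G q) = 0"
proof -
 obtain C where C: "C >= 0" "!!q. q : {0..1} ==> |G q| <= C" using bounded_cont01[OF G] by blast
 let ?r = "%k::nat. k + 2"
 have r: "filterlim ?r at_top sequentially" by (auto intro: filterlim_plus2[simplified])
 have "(%k. (IU q. far (?r k) dl G (idx (?r k) q))) ----> (IU q. trunc dl G q)"
 proof (rule integral_dominated_convergence[where w="%_. kern dl * (2 * C)"])
  show "trunc dl G : mUI" by (rule trunc_measurable[OF G d])
  show "(%q. far (?r k) dl G (idx (?r k) q)) : mUI" for k by (rule idx_measurable_UI)
  show "AE q in UI. (%k. far (?r k) dl G (idx (?r k) q)) ----> trunc dl G q"
   by (intro AE_UI_I far_tendsto r G d)
  show "AE q in UI. norm (far (?r k) dl G (idx (?r k) q)) <= kern dl * (2 * C)" for k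
   by (intro AE_UI_I) (auto intro!: far_bound idx_bulk d C)
 qed simp
 moreover have "(IU q. far (?r k) dl G (idx (?r k) q)) = 0" for k
  using integral_idx[of "?r k" "far (?r k) dl G"] far_sum_0[of "?r k" dl G] by simp
 ultimately show ?thesis by (simp add: LIMSEQ_const_iff)
qed

lemma trunc_integrable_kernel:
 assumes G: "continuous_on {0..1} G" and d: "0 < dl" and q: "0 < q" "q < 1"
 shows "iUI (%v. indicator {v. dl < |q - v| } v * (kern (q - v) * (G v - G q)))"
proof -
 obtain C where C: "C >= 0" "!!q. q : {0..1} ==> |G q| <= C" using bounded_cont01[OF G] by blast
 have "{v. dl < |q - v| } : sets borel"
  by (auto intro!: borel_open open_Collect_less continuous_intros)
 then have i: "(indicator {v. dl < |q - v| } :: real => real) : mUI"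
  by (rule indicator_UI)
 have k: "(%v. kern (q - v)) : mUI"
  by (rule borel_UI[OF measurable_compose[OF shift_measurable kern_measurable]])
 show ?thesis
 proof (rule integrable_bounded_UI)
  show "(%v. indicator {v. dl < |q - v| } v * (kern (q - v) * (G v - G q))) : mUI"
   by (rule borel_measurable_times[OF i borel_measurable_times[OF k borel_measurable_diff[OF cont_measurable_UI[OF G]]]]) simp
  fix v :: real assume v: "0 < v" "v < 1"
  show "|indicator {v. dl < |q - v| } v * (kern (q - v) * (G v - G q))| <= kern dl * (2 * C)"
  proof (cases "dl < |q - v|")
   case True
   have "kern (q - v) <= kern dl" using True d by (intro kern_antimono) auto
   moreover have "|G v - G q| <= 2 * C" using C(2)[of v] C(2)[of q] v q by auto
   ultimately show ?thesis using True by (auto simp: abs_mult intro!: mult_mono)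
  qed (use C in auto)
 qed
qed

text \<open>Here \<open>(\<phi> v - \<phi> q)\<^sup>2 = (\<phi>\<^sup>2 v - \<phi>\<^sup>2 q) - 2 \<phi> q (\<phi> v - \<phi> q)\<close>, and the first summand integrates to \<open>0\<close>
  by antisymmetry.\<close>

lemma Q_le_energy:
 assumes "ctest \<phi>"
 shows "ennreal (Q \<phi> \<phi>) <= reg \<phi> + ennreal \<kappa> * kil \<phi>"
proof (cases "reg \<phi> = \<infinity>")
 case False
 obtain B G1 where B: "B >= 0" "taylor_bound \<phi> G1 B" "boundary_flat \<phi> B" "!!q. q : {0..1} ==> |\<phi> q| <= B"
  using ctest_bounds[OF assms] by blast
 have c: "continuous_on {0..1} \<phi>" by (rule ctest_cont[OF assms])
 have c2: "continuous_on {0..1} (%q. (\<phi> q)^2)" using c by (intro continuous_intros)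
 have m: "\<phi> : mUI" by (rule ctest_measurable[OF assms])
 have bd: "\<exists>B. \<forall>q. 0 < q --> q < 1 --> |\<phi> q| <= B" by (rule ctest_bounded[OF assms])
 let ?R = "regional_frac_lap \<gamma> \<phi>"
 have Rm: "?R : mUI" by (rule regional_measurable[OF B(2)])
 have Rb: "\<exists>B. \<forall>q. 0 < q --> q < 1 --> |?R q| <= B" using regional_consistency(3)[OF B(2)] by blast
 have Ri: "iUI (%q. ?R q * \<phi> q)" by (rule integrable_mult_bounded[OF Rm Rb m bd])
 have main: "ennreal (- 2 * (IU q. ?R q * \<phi> q) - 2 * near_err B dl * B) <= reg \<phi>" if d: "0 < dl" for dl
 proof -
  have tm: "trunc dl \<phi> : mUI" by (rule trunc_measurable[OF c d])
  have tb: "|trunc dl \<phi> q| <= near_err B 1 + near_err B dl" if "0 < q" "q < 1" for q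
   using regional_consistency(2)[OF B(2) that d] regional_consistency(3)[OF B(2) that] by linarith
  have ti: "iUI (%q. trunc dl \<phi> q * \<phi> q)"
   using tb by (intro integrable_mult_bounded[OF tm _ m bd]) blast
  have t2i: "iUI (trunc dl (%q. (\<phi> q)^2))"
  proof (rule integrable_bounded_UI[OF trunc_measurable[OF c2 d]])
   fix q :: real assume q: "0 < q" "q < 1"
   have "(%N. |far N dl (%q. (\<phi> q)^2) (idx N q)| ) ----> |trunc dl (%q. (\<phi> q)^2) q|"
    by (intro tendsto_rabs far_tendsto filterlim_ident c2 q d)
   moreover have "eventually (%N. |far N dl (%q. (\<phi> q)^2) (idx N q)| <= kern dl * (2 * B^2)) sequentially"
    using eventually_ge_at_top[of 2]
   proof eventually_elim
    case (elim N)
    show ?case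
    proof (intro far_bound idx_bulk elim q d)
     fix p :: real assume "p : {0..1}"
     then have "|\<phi> p| <= |B|" using B(4)[of p] B(1) by simp
     then show "|(\<phi> p)^2| <= B^2" unfolding abs_le_square_iff by simp
    qed
   qed
   ultimately show "|trunc dl (%q. (\<phi> q)^2) q| <= kern dl * (2 * B^2)"
    by (rule tendsto_upperbound) simp
  qed
  let ?g = "%q. trunc dl (%q. (\<phi> q)^2) q - 2 * (trunc dl \<phi> q * \<phi> q)"
  have g: "?g q = (IU v. indicator {v. dl < |q - v| } v * (kern (q - v) * (\<phi> q - \<phi> v)^2))" if q: "0 < q" "q < 1" for q
  proof -
   have "?g q = (IU v. indicator {v. dl < |q - v| } v * (kern (q - v) * ((\<phi> v)^2 - (\<phi> q)^2))
     - 2 * \<phi> q * (indicator {v. dl < |q - v| } v * (kern (q - v) * (\<phi> v - \<phi> q))))"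
    unfolding trunc_def using trunc_integrable_kernel[OF c d q] trunc_integrable_kernel[OF c2 d q] by simp
   also have "... = (IU v. indicator {v. dl < |q - v| } v * (kern (q - v) * (\<phi> q - \<phi> v)^2))"
    by (intro Bochner_Integration.integral_cong refl) (simp add: power2_eq_square algebra_simps)
   finally show ?thesis .
  qed
  have gi: "iUI ?g" using ti t2i by auto
  have g0: "0 <= ?g q" if "0 < q" "q < 1" for q
   unfolding g[OF that] by (intro integral_nonneg_AE AE_I2 mult_nonneg_nonneg) auto
  have "(IU q. ?g q) = - 2 * (IU q. trunc dl \<phi> q * \<phi> q)"
   using ti t2i trunc_integral_0[OF c2 d] by simp
  moreover have "|(IU q. ?R q * \<phi> q) - (IU q. trunc dl \<phi> q * \<phi> q)| <= near_err B dl * B"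
  proof -
   have "(IU q. ?R q * \<phi> q) - (IU q. trunc dl \<phi> q * \<phi> q) = (IU q. (?R q - trunc dl \<phi> q) * \<phi> q)"
    using Ri ti by (simp add: left_diff_distrib)
   also have "|...| <= (IU q. |(?R q - trunc dl \<phi> q) * \<phi> q| )" by (rule integral_abs_bound)
   also have "... <= (IU q. near_err B dl * B)"
   proof (rule integral_mono)
    have "iUI (%q. ?R q * \<phi> q - trunc dl \<phi> q * \<phi> q)" using Ri ti by auto
    then show "iUI (%q. |(?R q - trunc dl \<phi> q) * \<phi> q| )" by (simp add: left_diff_distrib)
    fix q assume "q : space UI"
    then have q: "0 < q" "q < 1" by auto
    show "|(?R q - trunc dl \<phi> q) * \<phi> q| <= near_err B dl * B"
     unfolding abs_mult using regional_consistency(2)[OF B(2) q d] B(4)[of q] q by (intro mult_mono) auto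
   qed simp
   finally show ?thesis by simp
  qed
  ultimately have "- 2 * (IU q. ?R q * \<phi> q) - 2 * near_err B dl * B <= (IU q. ?g q)" by linarith
  then have "ennreal (- 2 * (IU q. ?R q * \<phi> q) - 2 * near_err B dl * B) <= ennreal (IU q. ?g q)" by (rule ennreal_leI)
  also have "... = (NU q. ennreal (?g q))" using g0 gi by (intro nn_integral_eq_integral[symmetric] AE_UI_I)
  also have "... <= reg \<phi>" unfolding reg_def
  proof (intro nn_integral_mono)
   fix q assume "q : space UI"
   then have q: "0 < q" "q < 1" by auto
   have "ennreal (?g q) <= (NU v. ennreal (indicator {v. dl < |q - v| } v * (kern (q - v) * (\<phi> q - \<phi> v)^2)))"
   proof -
    have "iUI (%v. indicator {v. dl < |q - v| } v * (kern (q - v) * ((\<phi> v)^2 - (\<phi> q)^2))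
     - 2 * \<phi> q * (indicator {v. dl < |q - v| } v * (kern (q - v) * (\<phi> v - \<phi> q))))"
     using trunc_integrable_kernel[OF c d q] trunc_integrable_kernel[OF c2 d q] by auto
    then have "iUI (%v. indicator {v. dl < |q - v| } v * (kern (q - v) * (\<phi> q - \<phi> v)^2))"
     by (rule Bochner_Integration.integrable_cong[THEN iffD1, OF refl, rotated]) (simp add: power2_eq_square algebra_simps)
    then show ?thesis unfolding g[OF q] by (subst nn_integral_eq_integral) auto
   qed
   also have "... <= (NU v. ennreal (kern (q - v) * (\<phi> q - \<phi> v)^2))"
    by (intro nn_integral_mono ennreal_leI) (auto simp: indicator_def)
   finally show "ennreal (?g q) <= (NU v. ennreal (kern (q - v) * (\<phi> q - \<phi> v)^2))" .
  qed
  finally show ?thesis .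
 qed
 obtain a where a: "reg \<phi> = ennreal a" "0 <= a" using False by (cases "reg \<phi>") auto
 have "- 2 * (IU q. ?R q * \<phi> q) - 2 * near_err B dl * B <= a" if "0 < dl" for dl
  using main[OF that] unfolding a(1) ennreal_le_iff[OF a(2)] .
 then have ev: "eventually (%dl. - 2 * (IU q. ?R q * \<phi> q) - 2 * near_err B dl * B <= a) (at_right 0)"
  by (intro eventually_mono[OF eventually_at_right_less[of 0]]) auto
 have "((%dl. - 2 * (IU q. ?R q * \<phi> q) - 2 * near_err B dl * B) \<longlongrightarrow> - 2 * (IU q. ?R q * \<phi> q) - 2 * 0 * B) (at_right 0)"
  by (intro tendsto_intros near_err_tendsto)
 \<comment> \<open>The limit gives that -2 times the integral is at most a; a factor 2 is given
   away.\<close>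
 from tendsto_upperbound[OF this ev] have le: "- (IU q. ?R q * \<phi> q) <= a" using a by simp
 have Vm: "Vk : mUI" unfolding Vk_def[abs_def]
  by (intro borel_measurable_add borel_UI kern_measurable measurable_compose[OF shift_measurable kern_measurable])
 have Ki: "iUI (%q. (Vk q * \<phi> q) * \<phi> q)"
  using Vk_flat[OF B(3)] by (intro integrable_mult_bounded[OF borel_measurable_times[OF Vm m] _ m bd]) (meson atLeastAtMost_iff less_imp_le)
 have "Q \<phi> \<phi> = - (IU q. ?R q * \<phi> q - \<kappa> * ((Vk q * \<phi> q) * \<phi> q))"
  unfolding Q_def
  by (intro arg_cong[where f=uminus] Bochner_Integration.integral_cong refl) (simp add: L_op_def Vk_V1 left_diff_distrib)
 also have "... = - (IU q. ?R q * \<phi> q) + \<kappa> * (IU q. (Vk q * \<phi> q) * \<phi> q)"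
  using Ri Ki by (subst Bochner_Integration.integral_diff) auto
 also have "... <= a + \<kappa> * (IU q. (Vk q * \<phi> q) * \<phi> q)" using le by simp
 finally have "ennreal (Q \<phi> \<phi>) <= ennreal (a + \<kappa> * (IU q. (Vk q * \<phi> q) * \<phi> q))" by (rule ennreal_leI)
 also have "... = ennreal a + ennreal \<kappa> * ennreal (IU q. (Vk q * \<phi> q) * \<phi> q)"
  using a kap by (subst ennreal_plus) (auto intro!: mult_nonneg_nonneg integral_nonneg_AE AE_I2 simp: ennreal_mult mult.assoc)
 also have "ennreal (IU q. (Vk q * \<phi> q) * \<phi> q) = kil \<phi>"
  unfolding kil_def using Ki by (subst nn_integral_eq_integral[symmetric]) (auto simp: power2_eq_square mult.assoc)
 finally show ?thesis using a by simp
qed simp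

end

subsection \<open>A smooth mollifier\<close>

definition smooth :: "(real => real) => bool" where
 "smooth f \<longleftrightarrow> (\<exists>D. D 0 = f & (\<forall>k x. (D k has_real_derivative D (Suc k) x) (at x)))"

text \<open>Coinduction with a class of functions closed under differentiation. It avoids formulas
  for the k-th derivatives of products and of \<open>flatexp\<close>.\<close>

lemma smooth_coinduct:
 assumes "P f" and step: "!!f. P f ==> \<exists>f'. P f' & (\<forall>x. (f has_real_derivative f' x) (at x))"
 shows "smooth f"
proof -
 obtain nx where nx: "!!f. P f ==> P (nx f) & (\<forall>x. (f has_real_derivative nx f x) (at x))"
  using step by metis
 have "P ((nx ^^ k) f)" for k by (induction k) (use assms(1) nx in auto)
 then show ?thesis unfolding smooth_def
  by (intro exI[of _ "%k. (nx ^^ k) f"]) (use nx in auto)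
qed

lemma smooth_mult:
 assumes "smooth f" "smooth g"
 shows "smooth (%x. f x * g x)"
proof -
 obtain A where A: "A 0 = f" "!!k x. (A k has_real_derivative A (Suc k) x) (at x)"
  using assms(1) unfolding smooth_def by blast
 obtain B where B: "B 0 = g" "!!k x. (B k has_real_derivative B (Suc k) x) (at x)"
  using assms(2) unfolding smooth_def by blast
 \<comment> \<open>A list of index pairs stands for a sum of products of derivatives. The product
   rule maps such lists to such lists, with repetitions in place of binomial coefficients.\<close>
 define S where "S l x = (\<Sum>p\<leftarrow>l. A (fst p) x * B (snd p) x)" for l :: "(nat \<times> nat) list" and x
 define d where "d l = concat (map (%p. [(Suc (fst p), snd p), (fst p, Suc (snd p))]) l)" for l :: "(nat \<times> nat) list"
 have der: "(S l has_real_derivative S (d l) x) (at x)" for l x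
 proof (induction l)
  case (Cons p l)
  have "((%x. A (fst p) x * B (snd p) x + S l x) has_real_derivative
    (A (fst p) x * B (Suc (snd p)) x + A (Suc (fst p)) x * B (snd p) x) + S (d l) x) (at x)"
   by (intro DERIV_add DERIV_mult' A B Cons)
  moreover have "S (p # l) = (%x. A (fst p) x * B (snd p) x + S l x)" by (simp add: S_def fun_eq_iff)
  ultimately show ?case by (simp add: S_def d_def algebra_simps)
 qed (simp add: S_def[abs_def] d_def)
 show ?thesis
 proof (rule smooth_coinduct[of "%h. \<exists>l. h = S l"])
  show "\<exists>l. (%x. f x * g x) = S l" by (rule exI[of _ "[(0,0)]"]) (simp add: S_def fun_eq_iff A B)
  fix h assume "\<exists>l. h = S l"
  then show "\<exists>f'. (\<exists>l. f' = S l) & (\<forall>x. (h has_real_derivative f' x) (at x))" using der by blast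
 qed
qed

lemma smooth_affine:
 assumes "smooth f"
 shows "smooth (%x. c * f (a * x + b))"
proof -
 obtain A where A: "A 0 = f" "!!k x. (A k has_real_derivative A (Suc k) x) (at x)"
  using assms(1) unfolding smooth_def by blast
 have "((%x. c * (a ^ k * A k (a * x + b))) has_real_derivative c * (a ^ Suc k * A (Suc k) (a * x + b))) (at x)" for k x
 proof -
  have "((%x. a * x + b) has_real_derivative a) (at x)" by (auto intro!: derivative_eq_intros)
  from DERIV_cmult[OF DERIV_cmult[OF DERIV_chain2[OF A(2) this, of k], of "a ^ k"], of c] show ?thesis by (simp add: mult_ac)
 qed
 then show ?thesis unfolding smooth_def
  by (intro exI[of _ "%k x. c * (a ^ k * A k (a * x + b))"]) (simp add: A)
qed

lemma smooth_continuous: "smooth f ==> continuous_on S f"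
 unfolding smooth_def by (meson DERIV_isCont continuous_at_imp_continuous_on)

definition flatexp :: "real => real" where "flatexp x = (if x > 0 then exp (- (1 / x)) else 0)"

lemma smooth_flatexp: "smooth flatexp"
proof -
 define E where "E p x = (if x > 0 then poly p (1 / x) * exp (- (1 / x)) else 0)" for p :: "real poly" and x :: real
 \<comment> \<open>With y = 1/x one has y' = -y^2, so p(y) e^(-y) differentiates to y^2 (p - p')(y)
   e^(-y).\<close>
 define d where "d p = [:0, 0, 1:] * (p - pderiv p)" for p :: "real poly"
 have lim: "((%h. E p h / h) \<longlongrightarrow> 0) (at_right 0)" for p
 proof -
  have 1: "((%y. (\<Sum>i\<le>degree p. coeff p i * (y ^ Suc i / exp y))) \<longlongrightarrow> (\<Sum>i\<le>degree p. coeff p i * 0)) at_top"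
   by (intro tendsto_intros tendsto_power_div_exp_0)
  have 2: "(\<Sum>i\<le>degree p. coeff p i * (y ^ Suc i / exp y)) = poly p y * exp (- y) * y" for y :: real
   by (simp add: poly_altdef sum_distrib_left sum_distrib_right exp_minus field_simps sum_divide_distrib)
  from 1 have 3: "((%y. poly p y * exp (- y) * y) \<longlongrightarrow> 0) at_top" unfolding 2 by simp
  have "((%h. poly p (inverse h) * exp (- inverse h) * inverse h) \<longlongrightarrow> 0) (at_right 0)"
   by (rule filterlim_compose[OF 3 filterlim_inverse_at_top_right])
  then show ?thesis
   by (rule Lim_transform_eventually)
     (use eventually_at_right_less[of "0::real"] in "eventually_elim, simp add: E_def inverse_eq_divide")
 qed
 have der: "(E p has_real_derivative E (d p) x) (at x)" for p x
 proof (cases x "0::real" rule: linorder_cases)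
  case less
  have "((%_::real. 0::real) has_real_derivative 0) (at x)" by simp
  then have "(E p has_real_derivative 0) (at x)"
   by (rule has_field_derivative_transform_within_open[where S="{..<0}"]) (use less in "auto simp: E_def")
  then show ?thesis using less by (simp add: E_def)
 next
  case greater
  have "((%x. poly p (1 / x) * exp (- (1 / x))) has_real_derivative
    poly (pderiv p) (1 / x) * (- (1 / x^2)) * exp (- (1 / x)) + poly p (1 / x) * (exp (- (1 / x)) * (1 / x^2))) (at x)"
  proof -
   have i: "((%x. 1 / x) has_real_derivative - (1 / x^2)) (at x)"
    using greater by (auto intro!: derivative_eq_intros simp: power2_eq_square)
   have e: "((%x. exp (- (1 / x))) has_real_derivative exp (- (1 / x)) * - (- (1 / x^2))) (at x)"
    by (rule DERIV_chain2[OF DERIV_exp DERIV_minus[OF i]])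
   have p: "((%x. poly p (1 / x)) has_real_derivative poly (pderiv p) (1 / x) * (- (1 / x^2))) (at x)"
    by (rule DERIV_chain2[OF poly_DERIV i])
   show ?thesis by (rule DERIV_cong[OF DERIV_mult'[OF p e]]) simp
  qed
  then have "(E p has_real_derivative
    poly (pderiv p) (1 / x) * (- (1 / x^2)) * exp (- (1 / x)) + poly p (1 / x) * (exp (- (1 / x)) * (1 / x^2))) (at x)"
   by (rule has_field_derivative_transform_within_open[where S="{0<..}"]) (use greater in "auto simp: E_def")
  moreover have "E (d p) x = poly (pderiv p) (1 / x) * (- (1 / x^2)) * exp (- (1 / x)) + poly p (1 / x) * (exp (- (1 / x)) * (1 / x^2))"
   using greater by (simp add: E_def d_def algebra_simps power2_eq_square)
  ultimately show ?thesis by simp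
 next
  case equal
  have l: "((%h. E p h / h) \<longlongrightarrow> 0) (at_left 0)"
   by (rule tendsto_eventually) (auto simp: eventually_at_filter E_def)
  have "((%h. E p h / h) \<longlongrightarrow> 0) (at 0)" using l lim by (simp add: filterlim_split_at)
  then show ?thesis using equal by (simp add: has_field_derivative_iff E_def)
 qed
 show ?thesis
 proof (rule smooth_coinduct[of "%h. \<exists>p. h = E p"])
  show "\<exists>p. flatexp = E p" by (rule exI[of _ 1]) (simp add: flatexp_def E_def fun_eq_iff)
  fix h assume "\<exists>p. h = E p"
  then show "\<exists>f'. (\<exists>p. f' = E p) & (\<forall>x. (h has_real_derivative f' x) (at x))" using der by blast
 qed
qed

lemma mollifier_exists:
 obtains \<rho> :: "real => real" where "smooth \<rho>" "!!x. 0 <= \<rho> x" "!!x. |x| >= 1 ==> \<rho> x = 0"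
  "integrable lborel \<rho>" "(\<integral>x. \<rho> x \<partial>lborel) = 1"
proof -
 define b where "b x = flatexp (1 * x + 1) * flatexp ((-1) * x + 1)" for x
 have sb: "smooth b" unfolding b_def
  using smooth_mult[OF smooth_affine[OF smooth_flatexp, of 1 1 1] smooth_affine[OF smooth_flatexp, of 1 "-1" 1]] by simp
 have f0: "0 <= flatexp x" "flatexp x <= 1" for x by (auto simp: flatexp_def)
 have b0: "0 <= b x" "b x <= 1" for x unfolding b_def using f0 by (auto intro: mult_le_one)
 have bz: "b x = 0" if "|x| >= 1" for x using that by (auto simp: b_def flatexp_def abs_if split: if_splits)
 have bm: "b : borel_measurable borel" by (intro borel_measurable_continuous_onI smooth_continuous[OF sb])
 have bi: "integrable lborel b"
 proof (rule Bochner_Integration.integrable_bound)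
  show "integrable lborel (indicator {-1..1} :: real => real)" by simp
  show "AE x in lborel. norm (b x) <= norm (indicator {-1..1} x :: real)"
   using b0 bz by (intro AE_I2) (auto simp: indicator_def abs_le_iff)
 qed (use bm in simp)
 \<comment> \<open>For |x| <= 1/2 both arguments are at least 1/2, whence exp(-2) twice. This makes
   the integral positive and normalization possible.\<close>
 have low: "exp (-2) * exp (-2) * indicator {-1/2..1/2} x <= b x" for x
 proof (cases "x : {-1/2..1/2}")
  case True
  have "exp (-2) <= flatexp y" if "y >= 1/2" for y
   using that by (simp add: flatexp_def divide_le_eq)
  then have "exp (-2) * exp (-2) <= b x" unfolding b_def using True f0 by (intro mult_mono) auto
  then show ?thesis using True by simp
 qed (use b0 in simp)
 have "(\<integral>x. exp (-2) * exp (-2) * indicator {-1/2..1/2::real} x \<partial>lborel) <= (\<integral>x. b x \<partial>lborel)"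
  using low bi by (intro integral_mono) auto
 then have "exp (-2) * exp (-2) <= (\<integral>x. b x \<partial>lborel)" by simp
 moreover have "(0::real) < exp (-2) * exp (-2)" by simp
 ultimately have pos: "0 < (\<integral>x. b x \<partial>lborel)" by linarith
 define c where "c = 1 / (\<integral>x. b x \<partial>lborel)"
 show ?thesis
 proof (rule that[of "%x. c * b x"])
  show "smooth (%x. c * b x)" using smooth_affine[OF sb, of c 1 0] by simp
  show "0 <= c * b x" for x using pos b0 by (simp add: c_def)
  show "|x| >= 1 ==> c * b x = 0" for x using bz by simp
  show "integrable lborel (%x. c * b x)" using bi by simp
  show "(\<integral>x. c * b x \<partial>lborel) = 1" using pos by (simp add: c_def)
 qed
qed

text \<open>Differentiation under the integral sign: \<sigma> is Lipschitz with constant B, so the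
  difference quotients are dominated by B |F|.\<close>

lemma conv_deriv:
 fixes F \<sigma> \<sigma>' :: "real => real"
 assumes F: "integrable lborel F" and d: "!!x. (\<sigma> has_real_derivative \<sigma>' x) (at x)"
  and b: "!!x. |\<sigma> x| <= B" "!!x. |\<sigma>' x| <= B" and c': "continuous_on UNIV \<sigma>'"
 shows "((%q. \<integral>v. F v * \<sigma> (q - v) \<partial>lborel) has_real_derivative (\<integral>v. F v * \<sigma>' (q - v) \<partial>lborel)) (at q)"
proof -
 have c: "continuous_on UNIV \<sigma>" using d by (meson DERIV_isCont continuous_at_imp_continuous_on)
 have Fm: "F : borel_measurable borel" using F by simp
 have m: "(%v. F v * s (x - v)) : borel_measurable lborel" if "continuous_on UNIV s" for s x
 proof -
  have "continuous_on UNIV (%v. s (x - v))"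
   by (rule continuous_on_compose2[OF that]) (auto intro: continuous_intros)
  then show ?thesis using Fm by (intro borel_measurable_times) (auto intro: borel_measurable_continuous_onI)
 qed
 have i: "integrable lborel (%v. F v * s (x - v))" if "continuous_on UNIV s" "!!x. |s x| <= B" for s x
  by (rule Bochner_Integration.integrable_bound[OF integrable_mult_left[OF F, of B] m[OF that(1)]])
    (auto intro!: AE_I2 mult_left_mono that(2) order_trans[OF that(2)] simp: abs_mult)
 have lip: "|\<sigma> x - \<sigma> y| <= B * |x - y|" for x y
 proof -
  have "norm (\<sigma> x - \<sigma> y) <= B * norm (x - y)"
   by (rule field_differentiable_bound[of UNIV \<sigma> \<sigma>']) (use d b in auto)
  then show ?thesis by simp
 qed
 let ?I = "%q. \<integral>v. F v * \<sigma> (q - v) \<partial>lborel"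
 show ?thesis unfolding has_field_derivative_iff tendsto_at_iff_sequentially
 proof (intro allI impI)
  fix X assume X: "\<forall>i. X i : UNIV - {q}" "X ----> q"
  let ?G = "%i v. F v * ((\<sigma> (X i - v) - \<sigma> (q - v)) / (X i - q))"
  have "(%i. \<integral>v. ?G i v \<partial>lborel) ----> (\<integral>v. F v * \<sigma>' (q - v) \<partial>lborel)"
  proof (rule integral_dominated_convergence[where w="%v. |F v| * B"])
   show "(%v. F v * \<sigma>' (q - v)) : borel_measurable lborel" by (rule m[OF c'])
   show "?G i : borel_measurable lborel" for i
   proof -
    have "(%v. (F v * \<sigma> (X i - v) - F v * \<sigma> (q - v)) / (X i - q)) : borel_measurable lborel"
     using m[OF c] by (intro borel_measurable_divide borel_measurable_diff) auto
    then show ?thesis by (simp add: right_diff_distrib)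
   qed
   show "integrable lborel (%v. |F v| * B)" using F by auto
   show "AE v in lborel. (%i. ?G i v) ----> F v * \<sigma>' (q - v)"
   proof (intro AE_I2 tendsto_mult tendsto_const)
    fix v
    have "((%y. (\<sigma> y - \<sigma> (q - v)) / (y - (q - v))) \<longlongrightarrow> \<sigma>' (q - v)) (at (q - v))"
     using d[of "q - v"] by (simp add: has_field_derivative_iff)
    moreover have "(%i. X i - v) ----> q - v" using X(2) by (intro tendsto_intros)
    moreover have "\<forall>i. X i - v : UNIV - {q - v}" using X(1) by auto
    ultimately have "((%y. (\<sigma> y - \<sigma> (q - v)) / (y - (q - v))) \<circ> (%i. X i - v)) ----> \<sigma>' (q - v)"
     using tendsto_at_iff_sequentially[THEN iffD1, THEN spec, of _ "\<sigma>' (q - v)" "q - v" UNIV "%i. X i - v"] by blast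
    then show "(%i. (\<sigma> (X i - v) - \<sigma> (q - v)) / (X i - q)) ----> \<sigma>' (q - v)" by (simp add: o_def)
   qed
   show "AE v in lborel. norm (?G i v) <= |F v| * B" for i
   proof (intro AE_I2)
    fix v
    have "|\<sigma> (X i - v) - \<sigma> (q - v)| <= B * |X i - q|" using lip[of "X i - v" "q - v"] by simp
    then have "|(\<sigma> (X i - v) - \<sigma> (q - v)) / (X i - q)| <= B" using X(1) by (simp add: abs_divide divide_le_eq)
    then show "norm (?G i v) <= |F v| * B" unfolding real_norm_def abs_mult by (intro mult_left_mono) auto
   qed
  qed
  moreover have "(\<integral>v. ?G i v \<partial>lborel) = (?I (X i) - ?I q) / (X i - q)" for i
  proof -
   have "(\<integral>v. ?G i v \<partial>lborel) = (\<integral>v. (F v * \<sigma> (X i - v) - F v * \<sigma> (q - v)) / (X i - q) \<partial>lborel)"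
    by (simp add: right_diff_distrib)
   then show ?thesis using i[OF c b(1)] by simp
  qed
  ultimately show "((%y. (?I y - ?I q) / (y - q)) \<circ> X) ----> (\<integral>v. F v * \<sigma>' (q - v) \<partial>lborel)" by (simp only: o_def)
 qed
qed

lemma smooth_compact_support_bounds:
 fixes D :: "nat => real => real"
 assumes D: "!!k x. (D k has_real_derivative D (Suc k) x) (at x)" and z: "!!x. |x| > r ==> D 0 x = 0"
 shows "\<exists>B. \<forall>x. |D k x| <= B"
proof -
 have zk: "|x| > r ==> D k x = 0" for x
 proof (induction k arbitrary: x)
  case (Suc k)
  have o: "open {x. |x| > r}" by (intro open_Collect_less continuous_intros)
  have "((%_::real. 0::real) has_real_derivative 0) (at x)" by simp
  then have "(D k has_real_derivative 0) (at x)"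
   by (rule has_field_derivative_transform_within_open[OF _ o]) (use Suc in auto)
  then show ?case using D[of k x] DERIV_unique by blast
 qed (use z in auto)
 have "continuous_on {-r..r} (D k)" using D by (meson DERIV_isCont continuous_at_imp_continuous_on)
 then have "bounded (D k ` {-r..r})" by (intro compact_imp_bounded compact_continuous_image) auto
 then obtain B where B: "\<forall>y\<in>D k ` {-r..r}. norm y <= B" unfolding bounded_iff by blast
 have "|D k x| <= |B|" for x
 proof (cases "|x| > r")
  case False
  then have "x : {-r..r}" by auto
  then have "norm (D k x) <= B" using B by blast
  then show ?thesis by simp
 qed (simp add: zk)
 then show ?thesis by blast
qed

subsection \<open>Approximation by test functions with bounded energy\<close>

locale molly = frac_params +
 fixes \<rho> :: "real => real" and f :: "real => real"
 assumes rho: "smooth \<rho>" "!!x. 0 <= \<rho> x" "!!x. |x| >= 1 ==> \<rho> x = 0" "integrable lborel \<rho>" "(\<integral>x. \<rho> x \<partial>lborel) = 1"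
  and fm: "f : borel_measurable borel" and fb: "!!x. |f x| <= 1" and fz: "!!x. x \<notin> {0<..<1} ==> f x = 0"
begin

text \<open>Mollification is written as an expectation over a random shift u, so that Jensen's
  inequality and Fubini apply directly.\<close>

definition R where "R = density lborel (%u. ennreal (\<rho> u))"

lemma rho_measurable [measurable]: "\<rho> : borel_measurable borel"
 using rho(1) by (intro borel_measurable_continuous_onI smooth_continuous)

lemmas fm [measurable]

lemma prob_R: "prob_space R"
proof
 have "emeasure R (space R) = (NL u. ennreal (\<rho> u))"
  unfolding R_def by (subst emeasure_density) auto
 also have "... = 1" using rho by (subst nn_integral_eq_integral) auto
 finally show "emeasure R (space R) = 1" .
qed

sublocale R: prob_space R by (rule prob_R)

lemma sets_R [simp, measurable_cong]: "sets R = sets borel" by (simp add: R_def)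
lemma space_R [simp]: "space R = UNIV" by (simp add: R_def)

lemma nn_integral_R_le:
 assumes "g : borel_measurable borel" "!!u. |u| <= 1 ==> g u <= C"
 shows "(\<integral>\<^sup>+u. g u \<partial>R) <= C"
proof -
 have "(\<integral>\<^sup>+u. g u \<partial>R) = (NL u. ennreal (\<rho> u) * g u)"
  unfolding R_def using assms(1) by (subst nn_integral_density) auto
 also have "... <= (NL u. ennreal (\<rho> u) * C)"
 proof (intro nn_integral_mono)
  fix u show "ennreal (\<rho> u) * g u <= ennreal (\<rho> u) * C"
   using assms(2)[of u] rho(3)[of u] by (cases "|u| <= 1") (auto intro: mult_left_mono)
 qed
 also have "... = (NL u. ennreal (\<rho> u)) * C" by (subst nn_integral_multc) auto
 also have "... = C" using rho by (subst nn_integral_eq_integral) auto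
 finally show ?thesis .
qed

text \<open>f is first contracted into (2 dl, 1 - 2 dl). Mollifying at scale dl then leaves a
  support inside [dl, 1 - dl].\<close>

definition dil :: "real => real => real" where "dil dl q = f ((q - 2 * dl) / (1 - 4 * dl))"

definition S :: "real => real => real" where "S dl q = (\<integral>u. dil dl (q - dl * u) \<partial>R)"

lemma dil_measurable [measurable]: "dil dl : borel_measurable borel" unfolding dil_def by measurable
lemma dil_bound: "|dil dl q| <= 1" by (simp add: dil_def fb)
lemma dil_zero: "0 < dl ==> dl <= 1/8 ==> q \<notin> {2*dl<..<1-2*dl} ==> dil dl q = 0"
 unfolding dil_def by (rule fz) (auto simp: divide_less_eq zero_less_divide_iff)

lemma dil_scale: "dl <= 1/8 ==> dil dl (2 * dl + (1 - 4 * dl) * t) = f t"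
 unfolding dil_def by simp

lemma integrable_R_bounded: "g : borel_measurable borel ==> (!!u. |g u| <= B) ==> integrable R g" for g :: "real => real"
 by (rule R.integrable_const_bound[where B=B]) (auto simp: measurable_def)

lemma S_integrable: "integrable R (%u. dil dl (q - dl * u))"
 by (rule integrable_R_bounded[where B=1]) (auto simp: dil_bound)

lemma S_bound: "|S dl q| <= 1"
proof -
 have "|S dl q| <= (\<integral>u. |dil dl (q - dl * u)| \<partial>R)" unfolding S_def by (rule integral_abs_bound)
 also have "... <= (\<integral>u. 1 \<partial>R)" using S_integrable by (intro integral_mono) (auto simp: dil_bound)
 finally show ?thesis using R.prob_space by simp
qed

text \<open>The substitution v = q - dl u moves the dependence on q from \<open>dil\<close> to the
  smooth factor.\<close>

lemma S_conv:
 assumes "0 < dl"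
 shows "S dl q = (\<integral>v. dil dl v * ((1 / dl) * \<rho> ((1 / dl) * (q - v) + 0)) \<partial>lborel)"
proof -
 have "(\<integral>v. dil dl v * ((1 / dl) * \<rho> ((1 / dl) * (q - v) + 0)) \<partial>lborel)
   = |- dl| *\<^sub>R (\<integral>u. dil dl (q + (- dl) * u) * ((1 / dl) * \<rho> ((1 / dl) * (q - (q + (- dl) * u)) + 0)) \<partial>lborel)"
  by (rule lborel_integral_real_affine) (use assms in simp)
 also have "... = (\<integral>u. \<rho> u *\<^sub>R dil dl (q - dl * u) \<partial>lborel)"
  using assms by (simp add: mult.commute)
 also have "... = S dl q" unfolding S_def R_def
  by (rule integral_density[symmetric]) (auto simp: rho)
 finally show ?thesis by simp
qed

lemma dil_integrable: "0 < dl ==> dl <= 1/8 ==> integrable lborel (dil dl)"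
proof (rule Bochner_Integration.integrable_bound)
 assume d: "0 < dl" "dl <= 1/8"
 show "integrable lborel (indicator {0..1} :: real => real)" by simp
 show "AE x in lborel. norm (dil dl x) <= norm (indicator {0..1} x :: real)"
 proof (intro AE_I2)
  fix x
  show "norm (dil dl x) <= norm (indicator {0..1} x :: real)"
   using dil_bound[of dl x] dil_zero[OF d, of x] d by (cases "x : {0..1}") auto
 qed
qed simp

lemma S_ctest:
 assumes d: "0 < dl" "dl <= 1/8"
 shows "ctest (S dl)"
proof -
 obtain D where D: "D 0 = (%x. (1 / dl) * \<rho> ((1 / dl) * x + 0))" "!!k x. (D k has_real_derivative D (Suc k) x) (at x)"
  using smooth_affine[OF rho(1), of "1/dl" "1/dl" 0] unfolding smooth_def by blast
 have z: "D 0 x = 0" if "|x| > dl" for x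
 proof -
  have "1 <= |(1 / dl) * x|" using that d by (simp add: abs_mult)
  then show ?thesis unfolding D(1) using rho(3)[of "(1 / dl) * x"] by simp
 qed
 have bd: "\<exists>B. \<forall>x. |D k x| <= B" for k using smooth_compact_support_bounds[of D dl k] D(2) z by blast
 have c: "continuous_on UNIV (D k)" for k using D(2) by (meson DERIV_isCont continuous_at_imp_continuous_on)
 define G where "G k q = (\<integral>v. dil dl v * D k (q - v) \<partial>lborel)" for k q
 have G: "(G k has_real_derivative G (Suc k) q) (at q)" for k q
 proof -
  obtain B1 B2 where B: "!!x. |D k x| <= B1" "!!x. |D (Suc k) x| <= B2" using bd by metis
  show ?thesis unfolding G_def[abs_def]
  proof (rule conv_deriv[OF dil_integrable[OF d] D(2)])
   show "|D k x| <= max B1 B2" "|D (Suc k) x| <= max B1 B2" for x using B[of x] by auto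
  qed (rule c)
 qed
 show ?thesis unfolding ctest_def
 proof (intro conjI exI)
  show "G 0 = S dl" unfolding G_def D(1) using S_conv[OF d(1)] by (simp add: fun_eq_iff)
  show "\<forall>k. \<forall>q\<in>{0..1}. (G k has_real_derivative G (Suc k) q) (at q within {0..1})"
   using G by (blast intro: has_field_derivative_at_within)
  show "compact {dl..1-dl}" by simp
  show "{dl..1-dl} \<subseteq> {0<..<1}" using d by auto
  show "\<forall>q\<in>{0..1} - {dl..1-dl}. S dl q = 0"
  proof
   fix q assume q: "q : {0..1} - {dl..1-dl}"
   have "dil dl v * D 0 (q - v) = 0" for v
   proof (cases "|q - v| > dl")
    case False
    then have "v \<notin> {2*dl<..<1-2*dl}" using q by auto
    then show ?thesis using dil_zero[OF d] by simp
   qed (simp add: z)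
   then have e0: "(%v. dil dl v * D 0 (q - v)) = (%v. 0)" by (rule ext)
   have "G 0 q = 0" unfolding G_def e0 by simp
   then show "S dl q = 0" using \<open>G 0 = S dl\<close> by simp
  qed
 qed
qed

lemma jensen:
 fixes g :: "real => real"
 assumes g: "g : borel_measurable borel" "!!u. |g u| <= B"
 shows "ennreal ((\<integral>u. g u \<partial>R)^2) <= (\<integral>\<^sup>+u. ennreal ((g u)^2) \<partial>R)"
proof -
 let ?c = "\<integral>u. g u \<partial>R"
 have i: "integrable R g" by (rule integrable_R_bounded[OF g])
 have i2: "integrable R (%u. (g u)^2)"
 proof (rule integrable_R_bounded)
  show "(%u. (g u)^2) : borel_measurable borel" using g(1) by measurable
  show "|(g u)^2| <= B^2" for u
  proof -
   have "|g u| <= |B|" using g(2)[of u] by simp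
   then show ?thesis unfolding abs_le_square_iff by simp
  qed
 qed
 have "0 <= (\<integral>u. (g u - ?c)^2 \<partial>R)" by (intro integral_nonneg_AE AE_I2) simp
 also have "... = (\<integral>u. (g u)^2 - 2 * ?c * g u + ?c^2 \<partial>R)" by (simp add: power2_diff algebra_simps)
 also have "... = (\<integral>u. (g u)^2 \<partial>R) - ?c^2" using i i2 R.prob_space by (simp add: power2_eq_square)
 finally have "ennreal (?c^2) <= ennreal (\<integral>u. (g u)^2 \<partial>R)" by (intro ennreal_leI) simp
 also have "... = (\<integral>\<^sup>+u. ennreal ((g u)^2) \<partial>R)" using i2 by (intro nn_integral_eq_integral[symmetric]) auto
 finally show ?thesis .
qed

lemma nn_UI: "(NU q. h q) = (NL q. h q * indicator {0<..<1} q)"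
 by (subst nn_integral_restrict_space) (simp_all add: nn_integral_completion)

lemma swap_R:
 assumes "case_prod h : borel_measurable (borel \<Otimes>\<^sub>M borel)"
 shows "(NL q. (\<integral>\<^sup>+u. h q u \<partial>R)) = (\<integral>\<^sup>+u. (NL q. h q u) \<partial>R)"
proof -
 interpret P: pair_sigma_finite R lborel by unfold_locales
 have "(%(x, y). h y x) : borel_measurable (R \<Otimes>\<^sub>M lborel)"
  proof -
  have "(%p. case_prod h (snd p, fst p)) : borel_measurable (borel \<Otimes>\<^sub>M borel)"
   by (rule measurable_compose[OF _ assms]) measurable
  then show ?thesis by (simp add: case_prod_beta' cong: measurable_cong_sets)
 qed
 from P.Fubini'[OF this] show ?thesis by simp
qed

abbreviation ind where "ind A q \<equiv> (indicator A q :: ennreal)"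

definition J where "J dl = {2*dl<..<1-2*dl}"
text \<open>A weight by the distances to the ends of \<open>J dl\<close>. It majorizes the killing
  potential at points shifted by at most dl, and also the interaction of a point of
  \<open>J dl\<close> with any point outside.\<close>

definition Y where "Y dl q = ind (J dl) q * ennreal ((kern (q - 2*dl) + kern (1 - 2*dl - q)) * (dil dl q)^2)"

lemma Y_measurable [measurable]: "Y dl : borel_measurable borel"
 unfolding Y_def J_def by measurable

text \<open>Contraction by a in [1/2, 1] enlarges the kernel by a^(-\<gamma>-1) <= 2^3; this is the
  8 in the estimates below.\<close>

lemma kern_scale_le:
 assumes "1/2 <= a" "a <= 1"
 shows "kern (a * d) <= 8 * kern d"
proof -
 have "- \<gamma> - 1 = - (\<gamma> + 1)" by simp
 then have "a powr (- \<gamma> - 1) = 1 / a powr (\<gamma> + 1)" by (simp only: powr_minus_divide)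
 also have "... <= 1 / (1/2) powr (\<gamma> + 1)"
  using assms gam by (intro divide_left_mono powr_mono2) auto
 also have "... = 2 powr (\<gamma> + 1)" by (simp add: powr_divide)
 also have "... <= 2 powr 3" using gam by (intro powr_mono) auto
 finally have "a powr (- \<gamma> - 1) <= 8" by simp
 then show ?thesis unfolding kern_mult using assms by (intro mult_right_mono) auto
qed

lemma Y_integral:
 assumes d: "0 < dl" "dl <= 1/8"
 shows "(NL q. Y dl q) <= 8 * kil f"
proof -
 define a where "a = 1 - 4 * dl"
 have a: "1/2 <= a" "a <= 1" using d by (auto simp: a_def)
 have "(NL q. Y dl q) = ennreal |a| * (NL t. Y dl (2 * dl + a * t))"
  using a by (intro nn_integral_real_affine) auto
 also have "... <= 1 * (NL t. 8 * (ennreal (Vk t * (f t)^2) * ind {0<..<1} t))"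
 proof (intro mult_mono nn_integral_mono)
  fix t
  have J: "2 * dl + a * t : J dl \<longleftrightarrow> t : {0<..<1}"
  proof -
   have "2 * dl + a * t < 1 - 2 * dl \<longleftrightarrow> a * t < a * 1" by (auto simp: a_def)
   also have "... \<longleftrightarrow> t < 1" using a by (intro mult_less_cancel_left_pos) simp
   finally show ?thesis using a by (auto simp: J_def zero_less_mult_iff)
  qed
  have e: "1 - 2 * dl - (2 * dl + a * t) = a * (1 - t)" by (simp add: a_def algebra_simps)
  have "(kern (a * t) + kern (a * (1 - t))) * (f t)^2 <= 8 * (Vk t * (f t)^2)"
   using kern_scale_le[OF a, of t] kern_scale_le[OF a, of "1 - t"]
   unfolding Vk_def mult.assoc[symmetric] distrib_left by (intro mult_right_mono add_mono) auto
  then have "ennreal ((kern (a * t) + kern (a * (1 - t))) * (f t)^2) <= 8 * ennreal (Vk t * (f t)^2)"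
   by (metis ennreal_leI ennreal_mult' ennreal_numeral zero_le_numeral)
  then show "Y dl (2 * dl + a * t) <= 8 * (ennreal (Vk t * (f t)^2) * ind {0<..<1} t)"
   unfolding Y_def e using J dil_scale[OF d(2), of t] by (auto simp: a_def[symmetric] indicator_def)
 qed (use a in auto)
 also have "... = 8 * kil f" unfolding kil_def nn_UI
  by (simp, subst nn_integral_cmult) (auto simp: Vk_def)
 finally show ?thesis .
qed

text \<open>Jensen's inequality inside the average over shifts, then a translation by dl u. Shifted
  points of \<open>J dl\<close> stay farther from 0 and 1 than the unshifted ones are from the ends
  of \<open>J dl\<close>.\<close>

lemma kil_S:
 assumes d: "0 < dl" "dl <= 1/8"
 shows "kil (S dl) <= 8 * kil f"
proof -
 have Sm: "S dl : borel_measurable borel"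
  unfolding S_def[abs_def] by (rule R.borel_measurable_lebesgue_integral) measurable
 have Vm [measurable]: "Vk : borel_measurable borel" unfolding Vk_def[abs_def] by measurable
 have "kil (S dl) <= (NL q. (\<integral>\<^sup>+u. ind {0<..<1} q * ennreal (Vk q * (dil dl (q - dl * u))^2) \<partial>R))"
  unfolding kil_def nn_UI
 proof (rule nn_integral_mono)
  fix q
  have "ennreal ((S dl q)^2) <= (\<integral>\<^sup>+u. ennreal ((dil dl (q - dl * u))^2) \<partial>R)"
   unfolding S_def by (rule jensen[where B=1]) (auto simp: dil_bound)
  then have "ennreal (Vk q) * ennreal ((S dl q)^2) * ind {0<..<1} q <= ennreal (Vk q) * (\<integral>\<^sup>+u. ennreal ((dil dl (q - dl * u))^2) \<partial>R) * ind {0<..<1} q"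
   by (intro mult_right_mono mult_left_mono) auto
  also have "... = (\<integral>\<^sup>+u. ind {0<..<1} q * ennreal (Vk q * (dil dl (q - dl * u))^2) \<partial>R)"
   by (subst nn_integral_cmult[symmetric], simp, subst nn_integral_multc[symmetric])
     (auto simp: ennreal_mult mult.commute intro!: nn_integral_cong)
  finally show "ennreal (Vk q * (S dl q)^2) * ind {0<..<1} q <= (\<integral>\<^sup>+u. ind {0<..<1} q * ennreal (Vk q * (dil dl (q - dl * u))^2) \<partial>R)"
   by (simp add: ennreal_mult)
 qed
 also have "... = (\<integral>\<^sup>+u. (NL q. ind {0<..<1} q * ennreal (Vk q * (dil dl (q - dl * u))^2)) \<partial>R)"
  by (rule swap_R) measurable
 also have "... <= (NL q. Y dl q)"
 proof (rule nn_integral_R_le)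
  show "(%u. (NL q. ind {0<..<1} q * ennreal (Vk q * (dil dl (q - dl * u))^2))) : borel_measurable borel" by measurable
  fix u :: real assume u: "|u| <= 1"
  have "(NL q. ind {0<..<1} q * ennreal (Vk q * (dil dl (q - dl * u))^2))
   = ennreal |1| * (NL q. ind {0<..<1} (dl * u + 1 * q) * ennreal (Vk (dl * u + 1 * q) * (dil dl (dl * u + 1 * q - dl * u))^2))"
   by (rule nn_integral_real_affine) auto
  also have "... <= 1 * (NL q. Y dl q)"
  proof (intro mult_mono nn_integral_mono)
   fix q
   have du: "|dl * u| <= dl" using u d by (simp add: abs_mult)
   show "ind {0<..<1} (dl * u + 1 * q) * ennreal (Vk (dl * u + 1 * q) * (dil dl (dl * u + 1 * q - dl * u))^2) <= Y dl q"
   proof (cases "q : J dl")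
    case True
    then have q: "2 * dl < q" "q < 1 - 2 * dl" by (auto simp: J_def)
    have k: "kern (e + q) <= kern (q - 2*dl)" "kern (1 - (e + q)) <= kern (1 - 2*dl - q)" if "|e| <= dl" for e
     using q that d by (auto intro!: kern_antimono)
    have "Vk (dl * u + q) <= kern (q - 2*dl) + kern (1 - 2*dl - q)"
     unfolding Vk_def by (intro add_mono k du)
    then have "Vk (dl * u + q) * (dil dl q)^2 <= (kern (q - 2*dl) + kern (1 - 2*dl - q)) * (dil dl q)^2"
     by (intro mult_right_mono) auto
    then show ?thesis using True by (auto simp: Y_def indicator_def intro: ennreal_leI)
   next
    case False
    then show ?thesis using dil_zero[OF d, of q] by (simp add: J_def Y_def)
   qed
  qed auto
  finally show "(NL q. ind {0<..<1} q * ennreal (Vk q * (dil dl (q - dl * u))^2)) <= (NL q. Y dl q)" by simp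
 qed
 also have "... <= 8 * kil f" by (rule Y_integral[OF d])
 finally show ?thesis .
qed

definition En :: "real set => (real => real) => ennreal" where
 "En A F = (NL q. (NL v. ind A q * ind A v * ennreal (kern (q - v) * (F q - F v)^2)))"

lemma reg_En:
 assumes [measurable]: "F : borel_measurable borel"
 shows "reg F = En {0<..<1} F"
 unfolding reg_def nn_UI En_def
proof (intro nn_integral_cong)
 fix q
 show "(NL v. ennreal (kern (q - v) * (F q - F v)^2) * ind {0<..<1} v) * ind {0<..<1} q
  = (NL v. ind {0<..<1} q * ind {0<..<1} v * ennreal (kern (q - v) * (F q - F v)^2))"
  by (subst nn_integral_multc[symmetric]) (auto intro!: nn_integral_cong simp: mult_ac)
qed

text \<open>The window (-1, 2) contains all translates that occur in the average over shifts. Pairs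
  inside \<open>J dl\<close> rescale to \<open>8 * reg f\<close>. Pairs with one point outside are
  bounded by \<open>Y\<close>; integrating the other point over length 3, for the two orders of the
  pair, gives 2 * 3 * 8 = 48 times \<open>kil f\<close>.\<close>

lemma En_dil:
 assumes d: "0 < dl" "dl <= 1/8"
 shows "En {-1<..<2} (dil dl) <= 8 * reg f + 48 * kil f"
proof -
 let ?K = "%q v. ennreal (kern (q - v) * (dil dl q - dil dl v)^2)"
 let ?A = "{-1<..<2::real}"
 define a where "a = 1 - 4 * dl"
 have a: "1/2 <= a" "a <= 1" using d by (auto simp: a_def)
 have Jm [measurable]: "J dl : sets borel" by (simp add: J_def)
 have pt: "ind ?A q * ind ?A v * ?K q v <= ind (J dl) q * ind (J dl) v * ?K q v + (Y dl q * ind ?A v + Y dl v * ind ?A q)" for q v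
 proof -
  have half: "ind ?A q * ind ?A v * ?K q v <= Y dl q * ind ?A v" if q: "q : J dl" and v: "v \<notin> J dl" for q v
  proof (cases "v : ?A")
   case True
   have dv: "dil dl v = 0" using dil_zero[OF d] v by (simp add: J_def)
   have "kern (q - v) <= kern (q - 2*dl) + kern (1 - 2*dl - q)"
   proof (cases "v <= 2 * dl")
    case True
    then have "kern (q - v) <= kern (q - 2*dl)" using q by (intro kern_antimono) (auto simp: J_def)
    then show ?thesis using kern_nonneg[of "1 - 2*dl - q"] by linarith
   next
    case False
    then have "kern (q - v) <= kern (1 - 2*dl - q)" using q v by (intro kern_antimono) (auto simp: J_def)
    then show ?thesis using kern_nonneg[of "q - 2*dl"] by linarith
   qed
   then have "kern (q - v) * (dil dl q - dil dl v)^2 <= (kern (q - 2*dl) + kern (1 - 2*dl - q)) * (dil dl q)^2"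
    unfolding dv by (intro mult_mono) auto
   then have "?K q v <= ennreal ((kern (q - 2*dl) + kern (1 - 2*dl - q)) * (dil dl q)^2)" by (rule ennreal_leI)
   then show ?thesis using True q by (auto simp: Y_def indicator_def)
  qed simp
  consider "q : J dl" "v : J dl" | "q : J dl" "v \<notin> J dl" | "q \<notin> J dl" "v : J dl" | "q \<notin> J dl" "v \<notin> J dl" by blast
  then show ?thesis
  proof cases
   case 1
   then have "ind ?A q * ind ?A v * ?K q v <= ind (J dl) q * ind (J dl) v * ?K q v" by (auto simp: indicator_def)
   then show ?thesis by (meson add_increasing2 zero_le order_trans)
  next
   case 2
   from half[OF this] have "ind ?A q * ind ?A v * ?K q v <= Y dl q * ind ?A v + Y dl v * ind ?A q"
    by (meson add_increasing2 zero_le order_trans)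
   then show ?thesis by (meson add_increasing zero_le order_trans)
  next
   case 3
   from half[OF this(2,1)] have "ind ?A q * ind ?A v * ?K q v <= Y dl v * ind ?A q"
    by (simp add: kern_commute[of v q] power2_commute[of "dil dl v"] mult_ac)
   then have "ind ?A q * ind ?A v * ?K q v <= Y dl q * ind ?A v + Y dl v * ind ?A q"
    by (meson add_increasing zero_le order_trans)
   then show ?thesis by (meson add_increasing zero_le order_trans)
  next
   case 4
   then have "?K q v = 0" using dil_zero[OF d] by (simp add: J_def)
   then have "ind ?A q * ind ?A v * ?K q v = 0" by (simp only: mult_zero_right)
   then show ?thesis by (simp only: zero_le)
  qed
 qed
 have inA: "(NL v. ind ?A v) = 3" by simp
 have X: "(NL q. (NL v. ind (J dl) q * ind (J dl) v * ?K q v)) <= 8 * reg f"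
 proof -
  have J: "2 * dl + a * t : J dl \<longleftrightarrow> t : {0<..<1}" for t
  proof -
   have "2 * dl + a * t < 1 - 2 * dl \<longleftrightarrow> a * t < a * 1" by (auto simp: a_def)
   also have "... \<longleftrightarrow> t < 1" using a by (intro mult_less_cancel_left_pos) simp
   finally show ?thesis using a by (auto simp: J_def zero_less_mult_iff)
  qed
  have iJ: "ind (J dl) (2 * dl + a * t) = ind {0<..<1} t" for t using J[of t] by (simp add: indicator_def)
  have ds: "dil dl (2 * dl + a * t) = f t" for t using dil_scale[OF d(2), of t] by (simp add: a_def)
  let ?L = "%q v. ind (J dl) q * ind (J dl) v * ?K q v"
  have "(NL q. (NL v. ?L q v)) = ennreal |a| * (NL t. (NL v. ?L (2 * dl + a * t) v))"
   using a by (intro nn_integral_real_affine) (auto intro!: borel_measurable_times)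
  also have "... = ennreal |a| * (NL t. ennreal |a| * (NL s. ?L (2 * dl + a * t) (2 * dl + a * s)))"
   using a by (intro arg_cong2[where f="(*)"] refl nn_integral_cong nn_integral_real_affine) auto
  also have "... <= (NL t. (NL s. ?L (2 * dl + a * t) (2 * dl + a * s)))"
  proof -
   have a1: "ennreal |a| * X <= X" for X
    using a mult_right_mono[of "ennreal |a|" 1 X] by (simp add: ennreal_le_1)
   show ?thesis by (rule order_trans[OF a1 nn_integral_mono[OF a1]])
  qed
  also have "... <= (NL t. (NL s. 8 * (ind {0<..<1} t * ind {0<..<1} s * ennreal (kern (t - s) * (f t - f s)^2))))"
  proof (intro nn_integral_mono)
   fix t s
   have e: "2 * dl + a * t - (2 * dl + a * s) = a * (t - s)" by (simp add: algebra_simps)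
   have "kern (a * (t - s)) * (f t - f s)^2 <= 8 * (kern (t - s) * (f t - f s)^2)"
    unfolding mult.assoc[symmetric] using kern_scale_le[OF a] by (intro mult_right_mono) auto
   then have "ennreal (kern (a * (t - s)) * (f t - f s)^2) <= 8 * ennreal (kern (t - s) * (f t - f s)^2)"
    by (metis ennreal_leI ennreal_mult' ennreal_numeral zero_le_numeral)
   then have "ind {0<..<1} t * ind {0<..<1} s * ennreal (kern (a * (t - s)) * (f t - f s)^2)
    <= ind {0<..<1} t * ind {0<..<1} s * (8 * ennreal (kern (t - s) * (f t - f s)^2))" by (intro mult_left_mono) auto
   then show "?L (2 * dl + a * t) (2 * dl + a * s) <= 8 * (ind {0<..<1} t * ind {0<..<1} s * ennreal (kern (t - s) * (f t - f s)^2))"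
    unfolding iJ e ds by (simp add: mult_ac)
  qed
  also have "... = 8 * reg f"
   unfolding reg_En[OF fm] En_def by (simp add: nn_integral_cmult)
  finally show ?thesis .
 qed
 have "En ?A (dil dl) <= (NL q. (NL v. ind (J dl) q * ind (J dl) v * ?K q v + (Y dl q * ind ?A v + Y dl v * ind ?A q)))"
  unfolding En_def by (intro nn_integral_mono pt)
 also have "... = (NL q. (NL v. ind (J dl) q * ind (J dl) v * ?K q v) + (Y dl q * 3 + (NL v. Y dl v) * ind ?A q))"
  by (intro nn_integral_cong) (simp add: nn_integral_add nn_integral_cmult nn_integral_multc)
 also have "... = (NL q. (NL v. ind (J dl) q * ind (J dl) v * ?K q v)) + ((NL v. Y dl v) * 3 + (NL v. Y dl v) * 3)"
  by (simp add: nn_integral_add nn_integral_cmult nn_integral_multc)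
 also have "... <= 8 * reg f + ((8 * kil f) * 3 + (8 * kil f) * 3)"
  by (intro add_mono X mult_right_mono Y_integral d) auto
 also have "(8 * kil f) * 3 + (8 * kil f) * 3 = 48 * kil f"
 proof -
  have "(8 * k) * 3 + (8 * k) * 3 = k * (24 + 24)" for k :: ennreal
   unfolding distrib_left by (simp add: mult.commute[of 8 k] mult.assoc)
  then show ?thesis by (simp add: mult.commute)
 qed
 finally show ?thesis .
qed

lemma S_measurable: "S dl : borel_measurable borel"
 unfolding S_def[abs_def] by (rule R.borel_measurable_lebesgue_integral) measurable

lemma reg_S:
 assumes d: "0 < dl" "dl <= 1/8"
 shows "reg (S dl) <= 8 * reg f + 48 * kil f"
proof -
 let ?A = "{0<..<1::real}"
 let ?D = "%q v u. ind ?A q * ind ?A v * ennreal (kern (q - v) * (dil dl (q - dl * u) - dil dl (v - dl * u))^2)"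
 have "reg (S dl) <= (NL q. (NL v. (\<integral>\<^sup>+u. ?D q v u \<partial>R)))"
  unfolding reg_En[OF S_measurable] En_def
 proof (intro nn_integral_mono)
  fix q v
  have "S dl q - S dl v = (\<integral>u. dil dl (q - dl * u) - dil dl (v - dl * u) \<partial>R)"
   unfolding S_def using S_integrable by simp
  moreover have "ennreal ((\<integral>u. dil dl (q - dl * u) - dil dl (v - dl * u) \<partial>R)^2) \<le>
   (\<integral>\<^sup>+u. ennreal ((dil dl (q - dl * u) - dil dl (v - dl * u))^2) \<partial>R)"
  proof (rule jensen[where B=2])
   show "|dil dl (q - dl * u) - dil dl (v - dl * u)| <= 2" for u
    using dil_bound[of dl "q - dl * u"] dil_bound[of dl "v - dl * u"] by linarith
  qed measurable
  ultimately have "ind ?A q * ind ?A v * (ennreal (kern (q - v)) * ennreal ((S dl q - S dl v)^2)) \<le>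
    ind ?A q * ind ?A v * (ennreal (kern (q - v)) * (\<integral>\<^sup>+u. ennreal ((dil dl (q - dl * u) - dil dl (v - dl * u))^2) \<partial>R))"
   by (intro mult_left_mono) auto
  also have "... = (\<integral>\<^sup>+u. ?D q v u \<partial>R)"
   by (simp add: nn_integral_cmult[symmetric] ennreal_mult)
  finally show "ind ?A q * ind ?A v * ennreal (kern (q - v) * (S dl q - S dl v)^2) <= (\<integral>\<^sup>+u. ?D q v u \<partial>R)"
   by (simp add: ennreal_mult)
 qed
 also have "... = (NL q. (\<integral>\<^sup>+u. (NL v. ?D q v u) \<partial>R))"
  by (intro nn_integral_cong swap_R) measurable
 also have "... = (\<integral>\<^sup>+u. (NL q. (NL v. ?D q v u)) \<partial>R)"
  by (rule swap_R) measurable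
 also have "... <= En {-1<..<2} (dil dl)"
 proof (rule nn_integral_R_le)
  show "(%u. (NL q. (NL v. ?D q v u))) : borel_measurable borel" by measurable
  fix u :: real assume u: "|u| <= 1"
  have du: "|dl * u| <= 1" using u d mult_mono[of dl 1 "|u|" 1] by (simp add: abs_mult)
  have "(NL q. (NL v. ?D q v u)) = ennreal |1| * (NL q. (NL v. ?D (dl * u + 1 * q) v u))"
   by (rule nn_integral_real_affine) auto
  also have "... = ennreal |1| * (NL q. ennreal |1| * (NL v. ?D (dl * u + 1 * q) (dl * u + 1 * v) u))"
   by (intro arg_cong2[where f="(*)"] refl nn_integral_cong nn_integral_real_affine) auto
  also have "... = (NL q. (NL v. ?D (dl * u + 1 * q) (dl * u + 1 * v) u))" by simp
  also have "... <= (NL q. (NL v. ind {-1<..<2} q * ind {-1<..<2} v * ennreal (kern (q - v) * (dil dl q - dil dl v)^2)))"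
  proof (intro nn_integral_mono)
   fix q v
   have i: "ind ?A (dl * u + 1 * q) <= ind {-1<..<2} q" for q using du by (auto simp: indicator_def abs_le_iff)
   show "?D (dl * u + 1 * q) (dl * u + 1 * v) u <= ind {-1<..<2} q * ind {-1<..<2} v * ennreal (kern (q - v) * (dil dl q - dil dl v)^2)"
    using i[of q] i[of v] by (simp add: mult_mono)
  qed
  finally show "(NL q. (NL v. ?D q v u)) <= En {-1<..<2} (dil dl)" unfolding En_def by simp
 qed
 also have "... <= 8 * reg f + 48 * kil f" by (rule En_dil[OF d])
 finally show ?thesis .
qed

text \<open>Three terms: f - h1 at the displaced point, h1 at the displaced point against h1 at q,
  and h1 - f at q. The first is controlled because the displacement is an affine change of variables
  that does not increase the integral.\<close>

lemma S_converges_approx: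
 fixes e :: real
 assumes h: "continuous_on UNIV h" "!!x. |h x| <= 1" and e: "(NU q. ennreal |f q - h q| ) <= e" and e0: "0 < e"
  and d: "!!j. 0 < dl j" "!!j. dl j <= 1/8" "dl ----> 0"
 shows "eventually (%j. (NU q. ennreal |S (dl j) q - f q| ) <= 3 * e) sequentially"
proof -
 \<comment> \<open>Cut off like f. The cut is invisible in the limit, since displaced points of
   (0,1) end up inside (0,1).\<close>
 define h1 where "h1 x = h x * indicator {0<..<1} x" for x :: real
 have [measurable]: "h : borel_measurable borel" using h(1) by (rule borel_measurable_continuous_onI)
 have [measurable]: "h1 : borel_measurable borel" unfolding h1_def[abs_def] by measurable
 have h1b: "|h1 x| <= 1" for x using h(2)[of x] by (simp add: h1_def indicator_def)
 have fh: "(NL q. ennreal |f q - h1 q| ) <= e"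
 proof -
  have "(NL q. ennreal |f q - h1 q| ) = (NL q. ennreal |f q - h q| * ind {0<..<1} q)"
   by (intro nn_integral_cong) (use fz in "auto simp: h1_def indicator_def")
  then show ?thesis using e unfolding nn_UI by simp
 qed
 \<comment> \<open>The point at which \<open>S (dl j) q\<close> evaluates f for the shift u.\<close>
 define T where "T j q u = (q - dl j * u - 2 * dl j) / (1 - 4 * dl j)" for j q u
 have Tm [measurable]: "(%p. T j (fst p) (snd p)) : borel_measurable (borel \<Otimes>\<^sub>M borel)" for j unfolding T_def by measurable
 have Tu [measurable]: "(%u. T j q u) : borel_measurable borel" for j q unfolding T_def by measurable
 define I where "I j q = (\<integral>\<^sup>+u. ennreal |h1 (T j q u) - h1 q| \<partial>R)" for j q
 have Im: "I j : borel_measurable borel" for j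
  unfolding I_def[abs_def] by (rule R.borel_measurable_nn_integral) measurable
 have I1: "(%j. I j q) ----> 0" if q: "0 < q" "q < 1" for q
 proof -
  have "(%j. \<integral>\<^sup>+u. ennreal |h1 (T j q u) - h1 q| \<partial>R) ----> (\<integral>\<^sup>+u. 0 \<partial>R)"
  proof (rule nn_integral_dominated_convergence[where w="%_. 2"])
   show "AE u in R. (%j. ennreal |h1 (T j q u) - h1 q| ) ----> 0"
   proof (rule AE_I2)
    fix u
    have t: "(%j. T j q u) ----> (q - 0 * u - 2 * 0) / (1 - 4 * 0)"
     unfolding T_def by (intro tendsto_intros d(3)) auto
    then have t: "(%j. T j q u) ----> q" by simp
    have "eventually (%j. T j q u : {0<..<1}) sequentially"
     using t q by (intro topological_tendstoD) auto
    then have ev: "eventually (%j. h (T j q u) = h1 (T j q u)) sequentially"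
     by eventually_elim (simp add: h1_def)
    have "(%j. h (T j q u)) ----> h q"
     by (rule continuous_on_tendsto_compose[OF h(1) t]) auto
    then have "(%j. h1 (T j q u)) ----> h1 q"
     using Lim_transform_eventually[OF _ ev, of "h q"] q by (simp add: h1_def)
    then have "(%j. |h1 (T j q u) - h1 q| ) ----> 0" by (intro tendsto_rabs_zero LIM_zero)
    then show "(%j. ennreal |h1 (T j q u) - h1 q| ) ----> 0" using tendsto_ennrealI by fastforce
   qed
   show "AE u in R. ennreal |h1 (T j q u) - h1 q| <= 2" for j
   proof (rule AE_I2)
    fix u
    have "|h1 (T j q u) - h1 q| <= 2" using h1b[of "T j q u"] h1b[of q] by linarith
    then show "ennreal |h1 (T j q u) - h1 q| <= 2" using ennreal_leI by fastforce
   qed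
   show "(\<integral>\<^sup>+u. 2 \<partial>R) < \<infinity>" using R.emeasure_space_1 by simp
  qed measurable
  then show ?thesis by (simp add: I_def)
 qed
 have Ib: "I j q <= 2" for j q
 proof -
  have "I j q <= (\<integral>\<^sup>+u. 2 \<partial>R)" unfolding I_def
  proof (rule nn_integral_mono)
   fix u
   have "|h1 (T j q u) - h1 q| <= 2" using h1b[of "T j q u"] h1b[of q] by linarith
   then show "ennreal |h1 (T j q u) - h1 q| <= 2" using ennreal_leI by fastforce
  qed
  then show ?thesis using R.emeasure_space_1 by simp
 qed
 have "(%j. (NU q. I j q)) ----> (NU q. 0)"
 proof (rule nn_integral_dominated_convergence[where w="%_. 2"])
  show "I j : mUI" for j
   using Im by (intro measurable_restrict_space1) (simp add: measurable_completion)
  show "AE q in UI. (%j. I j q) ----> 0" by (intro AE_UI_I I1)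
  show "(NU q. 2) < \<infinity>" using UI.emeasure_space_1 by simp
  show "AE q in UI. I j q <= 2" for j by (intro AE_I2 Ib)
 qed auto
 then have "(%j. (NU q. I j q)) ----> 0" by simp
 then have "eventually (%j. (NU q. I j q) < ennreal e) sequentially"
  using e0 by (intro order_tendstoD(2)) auto
 then show ?thesis
 proof eventually_elim
  case (elim j)
  note dj = d(1)[of j] d(2)[of j]
  have pt: "ennreal |S (dl j) q - f q| <= (\<integral>\<^sup>+u. ennreal |f (T j q u) - h1 (T j q u)| \<partial>R) + I j q + ennreal |f q - h1 q|" for q
  proof -
   have "S (dl j) q - f q = (\<integral>u. f (T j q u) - f q \<partial>R)"
    unfolding S_def using S_integrable[of "dl j" q] R.prob_space by (simp add: dil_def T_def)
   then have "|S (dl j) q - f q| <= (\<integral>u. |f (T j q u) - f q| \<partial>R)" by (simp only: integral_abs_bound)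
   then have "ennreal |S (dl j) q - f q| <= ennreal (\<integral>u. |f (T j q u) - f q| \<partial>R)" by (rule ennreal_leI)
   also have "... = (\<integral>\<^sup>+u. ennreal |f (T j q u) - f q| \<partial>R)"
   proof (rule nn_integral_eq_integral[symmetric])
    show "integrable R (%u. |f (T j q u) - f q| )"
    proof (rule integrable_R_bounded[where B=2])
     show "||f (T j q u) - f q|| <= 2" for u using fb[of "T j q u"] fb[of q] by linarith
    qed measurable
   qed simp
   also have "... <= (\<integral>\<^sup>+u. (ennreal |f (T j q u) - h1 (T j q u)| + ennreal |h1 (T j q u) - h1 q| ) + ennreal |f q - h1 q| \<partial>R)"
    by (intro nn_integral_mono) (simp add: ennreal_plus[symmetric] del: ennreal_plus)
   also have "... = (\<integral>\<^sup>+u. ennreal |f (T j q u) - h1 (T j q u)| \<partial>R) + I j q + ennreal |f q - h1 q|"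
    unfolding I_def using R.emeasure_space_1 by (simp add: nn_integral_add)
   finally show ?thesis .
  qed
  define X where "X q = (\<integral>\<^sup>+u. ennreal |f (T j q u) - h1 (T j q u)| \<partial>R)" for q
  have Xm: "X : borel_measurable borel"
   unfolding X_def[abs_def] by (rule R.borel_measurable_nn_integral) measurable
  have toUI: "g : borel_measurable borel ==> g : mUI" for g :: "real => ennreal"
   by (rule measurable_restrict_space1) (simp add: measurable_completion)
  have X: "(NU q. X q) <= e"
  proof -
   have "(NU q. X q) <= (NL q. X q)"
    unfolding nn_UI by (intro nn_integral_mono) (auto simp: indicator_def)
   also have "... = (\<integral>\<^sup>+u. (NL q. ennreal |f (T j q u) - h1 (T j q u)| ) \<partial>R)"
    unfolding X_def by (rule swap_R) (unfold T_def, measurable)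
   also have "... <= e"
   proof (rule nn_integral_R_le)
    show "(%u. (NL q. ennreal |f (T j q u) - h1 (T j q u)| )) : borel_measurable borel"
     unfolding T_def by measurable
    fix u :: real
    have "(NL q. ennreal |f (T j q u) - h1 (T j q u)| )
     = ennreal |1 - 4 * dl j| * (NL t. ennreal |f (T j ((dl j * u + 2 * dl j) + (1 - 4 * dl j) * t) u) - h1 (T j ((dl j * u + 2 * dl j) + (1 - 4 * dl j) * t) u)| )"
     using dj by (intro nn_integral_real_affine) (auto simp: T_def)
    also have "... = ennreal |1 - 4 * dl j| * (NL t. ennreal |f t - h1 t| )"
    proof -
     have "T j ((dl j * u + 2 * dl j) + (1 - 4 * dl j) * t) u = t" for t using dj by (simp add: T_def)
     then show ?thesis by (simp only:)
    qed
    also have "ennreal |1 - 4 * dl j| * (NL t. ennreal |f t - h1 t| ) <= 1 * ennreal e"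
     using dj by (intro mult_mono fh) (auto simp: ennreal_le_1)
    finally show "(NL q. ennreal |f (T j q u) - h1 (T j q u)| ) <= e" by simp
   qed
   finally show ?thesis .
  qed
  have fhm: "(%q. ennreal |f q - h1 q| ) : mUI" by (rule toUI) measurable
  have "(NU q. ennreal |S (dl j) q - f q| ) <= (NU q. X q + I j q + ennreal |f q - h1 q| )"
   unfolding X_def by (intro nn_integral_mono pt)
  also have "... = (NU q. X q) + (NU q. I j q) + (NU q. ennreal |f q - h1 q| )"
   using toUI[OF Xm] toUI[OF Im] fhm by (simp add: nn_integral_add)
  also have "... <= ennreal e + ennreal e + ennreal e"
  proof (intro add_mono X less_imp_le[OF elim])
   have "(NU q. ennreal |f q - h1 q| ) <= (NL q. ennreal |f q - h1 q| )"
    unfolding nn_UI by (intro nn_integral_mono) (auto simp: indicator_def)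
   then show "(NU q. ennreal |f q - h1 q| ) <= ennreal e" using fh by simp
  qed
  also have "... = ennreal (3 * e)" using e0 by (simp add: ennreal_plus[symmetric] del: ennreal_plus)
  finally show ?case by simp
 qed
qed

text \<open>A Lebesgue measurable function is an almost everywhere limit of continuous ones; after
  clipping, dominated convergence applies.\<close>

lemma continuous_approx:
 assumes e: "0 < e"
 obtains h where "continuous_on UNIV h" "!!x. |h x| <= 1" "(NU q. ennreal |f q - h q| ) <= ennreal e"
proof -
 have "f : borel_measurable lebesgue" using fm by (simp add: measurable_completion)
 then have "f measurable_on UNIV" by (rule lebesgue_measurable_imp_measurable_on) simp
 then obtain N g where N: "negligible N" and g: "!!n. continuous_on UNIV (g n)" and lim: "!!x. x \<notin> N ==> (%n. g n x) ----> f x"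
  unfolding measurable_on_def by auto
 define h where "h n x = max (-1) (min 1 (g n x))" for n :: nat and x
 have hc: "continuous_on UNIV (h n)" for n unfolding h_def using g by (intro continuous_intros)
 have hb: "|h n x| <= 1" for n x unfolding h_def by (auto simp: max_def min_def)
 have [measurable]: "h n : borel_measurable borel" for n using hc by (rule borel_measurable_continuous_onI)
 have "AE x in lebesgue. x \<notin> N" using N by (intro AE_I'[of N]) (auto simp: negligible_iff_null_sets)
 then have N': "AE x in UI. x \<notin> N" by (subst AE_restrict_space_iff) (auto elim: AE_mp)
 have "(%n. (NU q. ennreal |f q - h n q| )) ----> (NU q. 0)"
 proof (rule nn_integral_dominated_convergence[where w="%_. 2"])
  show "(%q. ennreal |f q - h n q| ) : mUI" for n
  proof -
   have "(%q. |f q - h n q| ) : borel_measurable borel" by measurable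
   then show ?thesis by (rule measurable_compose[OF borel_UI measurable_ennreal])
  qed
  show "AE q in UI. (%n. ennreal |f q - h n q| ) ----> 0"
   using N'
  proof eventually_elim
   case (elim q)
   have "(%n. h n q) ----> max (-1) (min 1 (f q))" unfolding h_def by (intro tendsto_intros lim elim)
   moreover have "max (-1) (min 1 (f q)) = f q" using fb[of q] by (auto simp: max_def min_def)
   ultimately have "(%n. |f q - h n q| ) ----> |f q - f q|" by (intro tendsto_intros) simp
   then have "(%n. |f q - h n q| ) ----> 0" by simp
   then show ?case using tendsto_ennrealI by fastforce
  qed
  show "(NU q. 2) < \<infinity>" using UI.emeasure_space_1 by simp
  show "AE q in UI. ennreal |f q - h n q| <= 2" for n
  proof (rule AE_I2)
   fix q
   have "|f q - h n q| <= 2" using fb[of q] hb[of n q] by linarith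
   then show "ennreal |f q - h n q| <= 2" using ennreal_leI by fastforce
  qed
 qed auto
 then have "(%n. (NU q. ennreal |f q - h n q| )) ----> 0" by simp
 then have "eventually (%n. (NU q. ennreal |f q - h n q| ) < ennreal e) sequentially"
  using e by (intro order_tendstoD(2)) auto
 then obtain n where "(NU q. ennreal |f q - h n q| ) < ennreal e" unfolding eventually_sequentially by blast
 then show ?thesis using that[of "h n"] hc hb by (simp add: less_imp_le)
qed

lemma S_converges:
 assumes d: "!!j. 0 < dl j" "!!j. dl j <= 1/8" "dl ----> 0"
 shows "(%j. (IU q. |S (dl j) q - f q| )) ----> 0"
proof (rule LIMSEQ_I)
 fix r :: real assume r: "0 < r"
 obtain h where h: "continuous_on UNIV h" "!!x. |h x| <= 1" "(NU q. ennreal |f q - h q| ) <= ennreal (r / 4)"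
  using continuous_approx[of "r/4"] r by auto
 have "eventually (%j. (NU q. ennreal |S (dl j) q - f q| ) <= ennreal (3 * (r / 4))) sequentially"
  using S_converges_approx[OF h _ d] r by simp
 then obtain n where n: "!!j. j >= n ==> (NU q. ennreal |S (dl j) q - f q| ) <= ennreal (3 * (r / 4))"
  unfolding eventually_sequentially by blast
 have i: "iUI (%q. |S (dl j) q - f q| )" for j
 proof (rule integrable_bounded_UI)
  show "(%q. |S (dl j) q - f q| ) : mUI"
   using S_measurable fm by (intro borel_UI) auto
  show "||S (dl j) q - f q|| <= 2" for q using S_bound[of "dl j" q] fb[of q] by linarith
 qed
 show "\<exists>no. \<forall>j\<ge>no. norm ((IU q. |S (dl j) q - f q| ) - 0) < r"
 proof (intro exI allI impI)
  fix j assume j: "j >= n"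
  have "ennreal (IU q. |S (dl j) q - f q| ) = (NU q. ennreal |S (dl j) q - f q| )"
   using i by (intro nn_integral_eq_integral[symmetric]) auto
  also have "... <= ennreal (3 * (r / 4))" by (rule n[OF j])
  finally have "(IU q. |S (dl j) q - f q| ) <= 3 * (r / 4)" using r by (subst (asm) ennreal_le_iff) auto
  then show "norm ((IU q. |S (dl j) q - f q| ) - 0) < r" using r by simp
 qed
qed

end

context frac_params begin

lemma reg_cong_AE:
 assumes "AE q in UI. f q = g q"
 shows "reg f = reg g" and "kil f = kil g"
proof -
 have inner: "(NU v. ennreal (kern (q - v) * (f q - f v)^2)) = (NU v. ennreal (kern (q - v) * (g q - g v)^2))" if "f q = g q" for q
  proof (rule nn_integral_cong_AE)
  show "AE v in UI. ennreal (kern (q - v) * (f q - f v)^2) = ennreal (kern (q - v) * (g q - g v)^2)"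
   using assms by eventually_elim (simp add: that)
 qed
 have "AE q in UI. (NU v. ennreal (kern (q - v) * (f q - f v)^2)) = (NU v. ennreal (kern (q - v) * (g q - g v)^2))"
  using assms
 proof eventually_elim
  case (elim q)
  then show ?case by (rule inner)
 qed
 then show "reg f = reg g" unfolding reg_def by (rule nn_integral_cong_AE)
 have "AE q in UI. ennreal (Vk q * (f q)^2) = ennreal (Vk q * (g q)^2)"
  using assms by eventually_elim simp
 then show "kil f = kil g" unfolding kil_def by (rule nn_integral_cong_AE)
qed

lemma borel_version:
 fixes f :: "real => real"
 assumes m: "f : mUI" and b: "!!q. 0 < q ==> q < 1 ==> |f q| <= 1"
 obtains g where "g : borel_measurable borel" "!!q. |g q| <= 1" "!!q. q \<notin> {0<..<1} ==> g q = 0"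
  "AE q in UI. f q = g q"
proof -
 have "(%q. indicator {0<..<1} q * f q) : borel_measurable (completion lborel)"
  using m unfolding measurable_UI_iff .
 then obtain g' where g': "g' : borel_measurable lborel" "AE q in lborel. indicator {0<..<1} q * f q = g' q"
  using completion_ex_borel_measurable_real by blast
 have [measurable]: "g' : borel_measurable borel" using g'(1) by simp
 define g where "g q = max (-1) (min 1 (g' q)) * indicator {0<..<1} q" for q
 show ?thesis
 proof (rule that[of g])
  show "g : borel_measurable borel" unfolding g_def[abs_def] by measurable
  show "|g q| <= 1" for q unfolding g_def by (auto simp: max_def min_def indicator_def)
  show "q \<notin> {0<..<1} ==> g q = 0" for q by (simp add: g_def)
  have "AE q in lebesgue. indicator {0<..<1} q * f q = g' q" using g'(2) by (rule AE_completion)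
  then have "AE q in lebesgue. q : {0<..<1} --> f q = g q"
  proof eventually_elim
   case (elim q)
   show ?case
   proof
    assume q: "q : {0<..<1}"
    then have "g' q = f q" using elim by simp
    then show "f q = g q" using b[of q] q by (auto simp: g_def max_def min_def)
   qed
  qed
  then show "AE q in UI. f q = g q" by (subst AE_restrict_space_iff) auto
 qed
qed

text \<open>Energies along the sequence are merely bounded and convergence is only in L1. In the
  uniqueness proof the approximants are paired with bounded functions, for which this suffices. The
  constant collects \<open>8 * reg\<close>, \<open>48 * kil\<close> and
  \<open>\<kappa> * 8 * kil\<close>.\<close>

theorem test_approximation:
 assumes m: "f : mUI" and b: "!!q. 0 < q ==> q < 1 ==> |f q| <= 1"
 obtains \<psi> :: "nat => real => real" where "!!j. ctest (\<psi> j)" "!!j q. |\<psi> j q| <= 1"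
  "(%j. (IU q. |\<psi> j q - f q| )) ----> 0"
  "!!j. ennreal (Q (\<psi> j) (\<psi> j)) <= ennreal (48 + 8 * \<kappa>) * (reg f + kil f)"
proof -
 obtain g where g: "g : borel_measurable borel" "!!q. |g q| <= 1" "!!q. q \<notin> {0<..<1} ==> g q = 0" "AE q in UI. f q = g q"
  using borel_version[OF m b] by blast
 obtain \<rho> :: "real => real" where "smooth \<rho>" "!!x. 0 <= \<rho> x" "!!x. |x| >= 1 ==> \<rho> x = 0"
  "integrable lborel \<rho>" "(\<integral>x. \<rho> x \<partial>lborel) = 1"
  using mollifier_exists by blast
 then interpret m: molly \<gamma> \<kappa> \<alpha> \<beta> \<rho> g by unfold_locales (use g in auto)
 \<comment> \<open>dl <= 1/8 keeps the contraction factor 1 - 4 dl at least 1/2.\<close>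
 define dl where "dl j = 1 / (8 * real (Suc j))" for j
 have d: "0 < dl j" "dl j <= 1/8" for j by (auto simp: dl_def divide_le_eq)
 have dl: "dl ----> 0"
 proof -
  have "(%j. (1/8) * (1 / real (Suc j))) ----> (1/8) * 0" by (intro tendsto_intros LIMSEQ_Suc[OF lim_1_over_n])
  then show ?thesis by (simp add: dl_def[abs_def])
 qed
 show ?thesis
 proof (rule that[of "%j. m.S (dl j)"])
  show "ctest (m.S (dl j))" for j by (rule m.S_ctest[OF d])
  show "|m.S (dl j) q| <= 1" for j q by (rule m.S_bound)
  have "(IU q. |m.S (dl j) q - f q| ) = (IU q. |m.S (dl j) q - g q| )" for j
  proof (rule integral_cong_AE)
   have "m.S (dl j) : mUI" "g : mUI"
    using m.S_measurable g(1) by (auto intro: borel_UI)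
   then show "(%q. |m.S (dl j) q - f q| ) : mUI" "(%q. |m.S (dl j) q - g q| ) : mUI"
    using m by (auto intro!: borel_measurable_abs borel_measurable_diff)
   show "AE q in UI. |m.S (dl j) q - f q| = |m.S (dl j) q - g q|"
    using g(4) by eventually_elim simp
  qed
  then show "(%j. (IU q. |m.S (dl j) q - f q| )) ----> 0" using m.S_converges[OF d dl] by simp
  fix j
  have "ennreal (Q (m.S (dl j)) (m.S (dl j))) <= reg (m.S (dl j)) + ennreal \<kappa> * kil (m.S (dl j))"
   by (rule Q_le_energy[OF m.S_ctest[OF d]])
  also have "... <= (8 * reg g + 48 * kil g) + ennreal \<kappa> * (8 * kil g)"
   by (intro add_mono mult_left_mono m.reg_S m.kil_S d) auto
  also have "... <= ennreal (48 + 8 * \<kappa>) * reg g + ennreal (48 + 8 * \<kappa>) * kil g"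
  proof -
   have "8 * reg g <= ennreal (48 + 8 * \<kappa>) * reg g"
   proof (rule mult_right_mono)
    show "8 <= ennreal (48 + 8 * \<kappa>)" using kap by (subst ennreal_numeral[symmetric], intro ennreal_leI) auto
   qed simp
   moreover have "48 * kil g + ennreal \<kappa> * (8 * kil g) = ennreal (48 + 8 * \<kappa>) * kil g"
    using kap by (simp add: ennreal_plus ennreal_mult algebra_simps)
   ultimately show ?thesis by (metis add.assoc add_right_mono)
  qed
  finally show "ennreal (Q (m.S (dl j)) (m.S (dl j))) <= ennreal (48 + 8 * \<kappa>) * (reg f + kil f)"
   using reg_cong_AE[OF g(4)] by (simp add: distrib_left)
 qed
qed

end

section \<open>Measurability of functionals on the Sobolev space\<close>

lemma AE_lebesgue_on_measurable:
 fixes f g :: "real => real"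
 assumes f: "f : borel_measurable (lebesgue_on S)" and ae: "AE x in lebesgue_on S. f x = g x" and S: "S : sets lebesgue"
 shows "g : borel_measurable (lebesgue_on S)"
proof -
 have "(%x. f x * indicator S x) : borel_measurable lebesgue"
  using f S by (subst (asm) borel_measurable_restrict_space_iff) (auto simp: mult.commute)
 moreover have "AE x in lebesgue. f x * indicator S x = g x * indicator S x"
 proof -
  have "AE x in lebesgue. x : S --> f x = g x" using ae S by (subst (asm) AE_restrict_space_iff) auto
  then show ?thesis by eventually_elim (auto simp: indicator_def)
 qed
 ultimately have "(%x. g x * indicator S x) : borel_measurable lebesgue" by (rule borel_measurable_AE)
 then show ?thesis using S by (subst borel_measurable_restrict_space_iff) (auto simp: mult.commute)
qed

text \<open>The coefficient of \<open>a^2\<close> can be brought as close to 1 as desired; this is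
  what turns the inequality into upper semicontinuity of quadratic functionals.\<close>

lemma sq_split:
 fixes a b l :: real
 assumes "0 < l"
 shows "b^2 <= (1 + l) * a^2 + (1 + 1 / l) * (a - b)^2"
proof -
 have "0 <= (l * a - (b - a))^2 / l" using assms by simp
 also have "... = l * a^2 - 2 * a * (b - a) + (b - a)^2 / l"
  using assms by (simp add: power2_eq_square field_simps)
 also have "... = (1 + l) * a^2 + (1 + 1 / l) * (a - b)^2 - b^2"
  using assms by (simp add: power2_eq_square field_simps)
 finally show ?thesis by simp
qed

context frac_params begin

definition l2 :: "(real => real) => ennreal" where "l2 f = (NU q. ennreal ((f q)^2))"

lemma nn_set_UI: "(\<integral>\<^sup>+q\<in>{0<..<1}. h q \<partial>lebesgue) = (NU q. h q)"
 by (subst nn_integral_restrict_space) simp_all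

lemma kern_UI: "(%v. kern (q - v)) : mUI"
 by (rule borel_UI[OF measurable_compose[OF shift_measurable kern_measurable]])

text \<open>f is only Lebesgue measurable, so joint measurability of the integrand is delicate. The
  inner f is replaced by a Borel version g, and the value f q enters as the second argument of a
  Borel function on the plane.\<close>

lemma reg_inner_measurable:
 assumes f: "f : mUI"
 shows "(%q. (NU v. ennreal (kern (q - v) * (f q - f v)^2))) : mUI"
proof -
 have "(%q. indicator {0<..<1} q * f q) : borel_measurable (completion lborel)"
  using f unfolding measurable_UI_iff .
 then obtain g where g: "g : borel_measurable lborel" "AE q in lborel. indicator {0<..<1} q * f q = g q"
  using completion_ex_borel_measurable_real by blast
 have [measurable]: "g : borel_measurable borel" using g(1) by simp
 have "AE q in lebesgue. indicator {0<..<1} q * f q = g q" using g(2) by (rule AE_completion)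
 then have "AE q in lebesgue. q : {0<..<1} --> f q = g q" by eventually_elim auto
 then have ae: "AE q in UI. f q = g q" by (subst AE_restrict_space_iff) auto
 define \<Phi> where "\<Phi> p = (NL v. ennreal (kern (fst p - v) * (snd p - g v)^2) * indicator {0<..<1} v)" for p :: "real \<times> real"
 have "\<Phi> : borel_measurable (borel \<Otimes>\<^sub>M borel)"
  unfolding \<Phi>_def[abs_def] by (rule lborel.borel_measurable_nn_integral) measurable
 moreover have "(%q. (q, f q)) : UI \<rightarrow>\<^sub>M borel \<Otimes>\<^sub>M borel"
  by (rule measurable_Pair[OF _ f], rule borel_UI) simp
 ultimately have "(%q. \<Phi> (q, f q)) : mUI" by (rule measurable_compose[rotated])
 moreover have "\<Phi> (q, f q) = (NU v. ennreal (kern (q - v) * (f q - f v)^2))" for q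
 proof -
  have "\<Phi> (q, f q) = (NU v. ennreal (kern (q - v) * (f q - g v)^2))"
   unfolding \<Phi>_def by (subst nn_integral_restrict_space) (simp_all add: nn_integral_completion)
  also have "... = (NU v. ennreal (kern (q - v) * (f q - f v)^2))"
  proof (rule nn_integral_cong_AE)
   show "AE v in UI. ennreal (kern (q - v) * (f q - g v)^2) = ennreal (kern (q - v) * (f q - f v)^2)"
    using ae by eventually_elim simp
  qed
  finally show ?thesis .
 qed
 ultimately show ?thesis by simp
qed

lemma reg_integrand_measurable:
 assumes f: "f : mUI"
 shows "(%v. ennreal (kern (q - v) * (f q - f v)^2)) : mUI"
proof -
 have "(%v. (f q - f v)^2) : mUI" using f by (intro borel_measurable_power borel_measurable_diff) auto
 from borel_measurable_times[OF kern_UI this] show ?thesis by (rule measurable_compose[OF _ measurable_ennreal])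
qed

lemma sobolev_norm_reg:
 assumes f: "f : mUI"
 shows "sobolev_norm_sq \<gamma> f = l2 f + ennreal (1/2) * reg f"
proof -
 let ?h = "%q v. ennreal ((f q - f v)^2 / |q - v| powr (1 + \<gamma>))"
 have e: "ennreal (kern (q - v) * (f q - f v)^2) = ennreal cg * ?h q v" for q v
  using cg by (subst ennreal_mult[symmetric]) (auto simp: kern_inverse)
 have hm: "(%v. ?h q v) : mUI" for q
 proof -
  have "(%v. ennreal (1 / cg) * ennreal (kern (q - v) * (f q - f v)^2)) : mUI"
   by (rule borel_measurable_times_ennreal[OF borel_measurable_const reg_integrand_measurable[OF f]])
  moreover have "ennreal (1 / cg) * ennreal (kern (q - v) * (f q - f v)^2) = ?h q v" for v
   using cg by (subst ennreal_mult[symmetric]) (auto simp: kern_inverse)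
  ultimately show ?thesis by simp
 qed
 have in1: "(NU v. ennreal (kern (q - v) * (f q - f v)^2)) = ennreal cg * (NU v. ?h q v)" for q
  unfolding e using hm by (rule nn_integral_cmult)
 have in2: "(NU v. ?h q v) = ennreal (1 / cg) * (NU v. ennreal (kern (q - v) * (f q - f v)^2))" for q
  unfolding in1 mult.assoc[symmetric] using cg by (subst ennreal_mult[symmetric]) auto
 have "(NU q. (NU v. ?h q v)) = ennreal (1 / cg) * reg f"
  unfolding in2 reg_def by (rule nn_integral_cmult[OF reg_inner_measurable[OF f]])
 then have "ennreal (cg / 2) * (NU q. (NU v. ?h q v)) = ennreal (1/2) * reg f"
  using cg by (simp add: mult.assoc[symmetric] ennreal_mult[symmetric])
 then show ?thesis unfolding sobolev_norm_sq_def nn_set_UI l2_def by simp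
qed

lemma ennreal_sq_split:
 assumes "0 < l" "0 <= k"
 shows "ennreal (k * b^2) <= ennreal (1 + l) * ennreal (k * a^2) + ennreal (1 + 1 / l) * ennreal (k * (a - b)^2)"
proof -
 have "k * b^2 <= k * ((1 + l) * a^2 + (1 + 1 / l) * (a - b)^2)" by (intro mult_left_mono sq_split assms)
 then have "ennreal (k * b^2) <= ennreal ((1 + l) * (k * a^2) + (1 + 1 / l) * (k * (a - b)^2))"
  by (intro ennreal_leI) (simp add: algebra_simps)
 also have "... = ennreal (1 + l) * ennreal (k * a^2) + ennreal (1 + 1 / l) * ennreal (k * (a - b)^2)"
  using assms by (subst ennreal_plus) (auto simp: ennreal_mult)
 finally show ?thesis .
qed

lemma weighted_l2_split:
 assumes f: "f : mUI" and h: "h : mUI" and k: "k : mUI" "!!q. 0 <= k q" and l: "0 < l"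
 shows "(NU q. ennreal (k q * (h q)^2)) <= ennreal (1 + l) * (NU q. ennreal (k q * (f q)^2))
   + ennreal (1 + 1 / l) * (NU q. ennreal (k q * (f q - h q)^2))"
proof -
 have m: "(%q. ennreal (k q * (g q)^2)) : mUI" if "g : mUI" for g
  using borel_measurable_times[OF k(1) borel_measurable_power[OF that]] by (rule measurable_compose[OF _ measurable_ennreal])
 have "(NU q. ennreal (k q * (h q)^2)) <= (NU q. ennreal (1 + l) * ennreal (k q * (f q)^2) + ennreal (1 + 1 / l) * ennreal (k q * (f q - h q)^2))"
  by (intro nn_integral_mono ennreal_sq_split l k)
 also have "... = ennreal (1 + l) * (NU q. ennreal (k q * (f q)^2)) + ennreal (1 + 1 / l) * (NU q. ennreal (k q * (f q - h q)^2))"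
  using m[OF f] m[OF borel_measurable_diff[OF f h]] by (subst nn_integral_add) (auto simp: nn_integral_cmult)
 finally show ?thesis .
qed

lemma reg_split:
 assumes f: "f : mUI" and h: "h : mUI" and l: "0 < l"
 shows "reg h <= ennreal (1 + l) * reg f + ennreal (1 + 1 / l) * reg (%q. f q - h q)"
proof -
 have d: "(%q. f q - h q) : mUI" using f h by simp
 have "reg h <= (NU q. (NU v. ennreal (1 + l) * ennreal (kern (q - v) * (f q - f v)^2)
   + ennreal (1 + 1 / l) * ennreal (kern (q - v) * ((f q - h q) - (f v - h v))^2)))"
  unfolding reg_def
 proof (intro nn_integral_mono)
  fix q v
  have "ennreal (kern (q - v) * (h q - h v)^2) <= ennreal (1 + l) * ennreal (kern (q - v) * (f q - f v)^2)
   + ennreal (1 + 1 / l) * ennreal (kern (q - v) * ((f q - f v) - (h q - h v))^2)"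
   by (rule ennreal_sq_split[OF l]) simp
  moreover have "(f q - f v) - (h q - h v) = (f q - h q) - (f v - h v)" by simp
  ultimately show "ennreal (kern (q - v) * (h q - h v)^2) <= ennreal (1 + l) * ennreal (kern (q - v) * (f q - f v)^2)
   + ennreal (1 + 1 / l) * ennreal (kern (q - v) * ((f q - h q) - (f v - h v))^2)" by simp
 qed
 also have "... = (NU q. ennreal (1 + l) * (NU v. ennreal (kern (q - v) * (f q - f v)^2))
   + ennreal (1 + 1 / l) * (NU v. ennreal (kern (q - v) * ((f q - h q) - (f v - h v))^2)))"
  using reg_integrand_measurable[OF f] reg_integrand_measurable[OF d]
  by (intro nn_integral_cong, subst nn_integral_add) (auto simp: nn_integral_cmult)
 also have "... = ennreal (1 + l) * reg f + ennreal (1 + 1 / l) * reg (%q. f q - h q)"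
  unfolding reg_def using reg_inner_measurable[OF f] reg_inner_measurable[OF d]
  by (subst nn_integral_add) (auto simp: nn_integral_cmult)
 finally show ?thesis .
qed

lemma sobolev_measurable: "f : sobolev \<gamma> ==> f : mUI" by (simp add: sobolev_def)

lemma sobolev_norm_split:
 assumes f: "f : sobolev \<gamma>" and h: "h : sobolev \<gamma>" and l: "0 < l"
 shows "sobolev_norm_sq \<gamma> h <= ennreal (1 + l) * sobolev_norm_sq \<gamma> f + ennreal (1 + 1 / l) * sobolev_norm_sq \<gamma> (%q. f q - h q)"
proof -
 note fm = sobolev_measurable[OF f] and hm = sobolev_measurable[OF h]
 have dm: "(%q. f q - h q) : mUI" using fm hm by simp
 have "l2 h <= ennreal (1 + l) * l2 f + ennreal (1 + 1 / l) * l2 (%q. f q - h q)"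
  using weighted_l2_split[OF fm hm _ _ l, of "%_. 1"] by (simp add: l2_def)
 moreover have "ennreal (1/2) * reg h <= ennreal (1/2) * (ennreal (1 + l) * reg f + ennreal (1 + 1 / l) * reg (%q. f q - h q))"
  by (intro mult_left_mono reg_split fm hm l) simp
 ultimately have "sobolev_norm_sq \<gamma> h <= (ennreal (1 + l) * l2 f + ennreal (1 + 1 / l) * l2 (%q. f q - h q))
   + ennreal (1/2) * (ennreal (1 + l) * reg f + ennreal (1 + 1 / l) * reg (%q. f q - h q))"
  unfolding sobolev_norm_reg[OF hm] by (rule add_mono)
 then show ?thesis unfolding sobolev_norm_reg[OF fm] sobolev_norm_reg[OF dm]
  by (simp add: distrib_left mult_ac add_ac)
qed

lemma sobolev_borel_space: "space (sobolev_borel \<gamma>) = sobolev \<gamma>"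
 unfolding sobolev_borel_def by (subst space_measure_of) (auto simp: sobolev_open_def)

lemma sobolev_open_sets: "sobolev_open \<gamma> U ==> U : sets (sobolev_borel \<gamma>)"
 unfolding sobolev_borel_def by (subst sets_measure_of) (auto simp: sobolev_open_def intro: sigma_sets.Basic)

text \<open>The splitting inequality with small l makes sublevel sets open, and open sets generate
  \<open>sobolev_borel\<close>.\<close>

lemma sobolev_functional_measurable:
 assumes C: "0 <= C" and split: "!!f h l. f : sobolev \<gamma> ==> h : sobolev \<gamma> ==> 0 < l \<Longrightarrow>
   \<Phi> h <= ennreal (1 + l) * \<Phi> f + ennreal (1 + 1 / l) * (ennreal C * sobolev_norm_sq \<gamma> (%q. f q - h q))"
 shows "\<Phi> : borel_measurable (sobolev_borel \<gamma>)"
proof (rule borel_measurableI_less)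
 fix y :: ennreal
 have "sobolev_open \<gamma> {h : sobolev \<gamma>. \<Phi> h < y}"
  unfolding sobolev_open_def
 proof (intro conjI ballI)
  fix f assume "f : {h : sobolev \<gamma>. \<Phi> h < y}"
  then have f: "f : sobolev \<gamma>" "\<Phi> f < y" by auto
  obtain c where c: "\<Phi> f < ennreal c" "ennreal c <= y" "0 <= c"
  proof -
   obtain z where z: "\<Phi> f < z" "z < y" using f(2) dense by blast
   then obtain c where "z = ennreal c" "0 <= c" by (cases z) auto
   then show ?thesis using z that[of c] by auto
  qed
  obtain a where a: "\<Phi> f = ennreal a" "0 <= a" using c(1) by (cases "\<Phi> f") auto
  have ac: "a < c" using c a by (simp add: ennreal_less_iff)
  \<comment> \<open>l uses up half of the gap c - a between the value at f and the level;
    \<open>e2\<close> below keeps the remainder under the other half.\<close>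
  define l where "l = (c - a) / 2 / (a + 1)"
  have l: "0 < l" using ac a by (simp add: l_def)
  have l': "l * (a + 1) = (c - a) / 2" unfolding l_def using a by (subst nonzero_eq_divide_eq[symmetric]) auto
  have la: "(1 + l) * a <= (a + c) / 2"
  proof -
   have "l * a <= l * (a + 1)" using l by simp
   also note l'
   finally show ?thesis by (simp add: algebra_simps)
  qed
  define e2 where "e2 = (c - a) / 4 / ((1 + 1 / l) * (C + 1))"
  have e2: "0 < e2" unfolding e2_def using ac l C by (intro divide_pos_pos mult_pos_pos add_pos_nonneg add_nonneg_pos) auto
  have le: "(1 + 1 / l) * (C * e2) < (c - a) / 2"
  proof -
   have "(1 + 1 / l) * (C * e2) <= (1 + 1 / l) * ((C + 1) * e2)" using l e2 by (intro mult_left_mono) auto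
   also have "... = (c - a) / 4"
   proof -
    have "(1 + 1 / l) * (C + 1) ~= 0" using l C by (simp add: add_nonneg_eq_0_iff)
    then have "e2 * ((1 + 1 / l) * (C + 1)) = (c - a) / 4" unfolding e2_def by (rule nonzero_eq_divide_eq[THEN iffD1, OF _ refl])
    then show ?thesis by (simp only: mult_ac)
   qed
   finally show ?thesis by (rule le_less_trans) (use ac in simp)
  qed
  show "\<exists>e>0. \<forall>h\<in>sobolev \<gamma>. sobolev_norm_sq \<gamma> (%q. f q - h q) < ennreal (e^2) --> h : {h : sobolev \<gamma>. \<Phi> h < y}"
  proof (intro exI[of _ "sqrt e2"] conjI ballI impI)
   show "0 < sqrt e2" using e2 by simp
   fix h assume h: "h : sobolev \<gamma>" and n: "sobolev_norm_sq \<gamma> (%q. f q - h q) < ennreal ((sqrt e2)^2)"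
   have "\<Phi> h <= ennreal (1 + l) * ennreal a + ennreal (1 + 1 / l) * (ennreal C * sobolev_norm_sq \<gamma> (%q. f q - h q))"
    using split[OF f(1) h l] a by simp
   also have "... <= ennreal (1 + l) * ennreal a + ennreal (1 + 1 / l) * (ennreal C * ennreal e2)"
    using n e2 by (intro add_mono mult_left_mono) auto
   also have "... = ennreal ((1 + l) * a + (1 + 1 / l) * (C * e2))"
    using l a C e2 by (simp add: ennreal_mult[symmetric] ennreal_plus[symmetric] del: ennreal_plus)
   also have "... < ennreal c"
    proof (rule ennreal_lessI)
    show "0 < c" using ac a(2) by simp
    have "(a + c) / 2 + (c - a) / 2 = c" by (simp add: field_simps)
    then show "(1 + l) * a + (1 + 1 / l) * (C * e2) < c" using add_le_less_mono[OF la le] by simp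
   qed
   finally show "h : {h : sobolev \<gamma>. \<Phi> h < y}" using c(2) h by auto
  qed
 qed auto
 then show "{x : space (sobolev_borel \<gamma>). \<Phi> x < y} : sets (sobolev_borel \<gamma>)"
  unfolding sobolev_borel_space by (rule sobolev_open_sets)
qed

lemma sobolev_norm_measurable: "sobolev_norm_sq \<gamma> : borel_measurable (sobolev_borel \<gamma>)"
 by (rule sobolev_functional_measurable[where C=1]) (use sobolev_norm_split in simp_all)

lemma l2_le_sobolev: "f : mUI ==> l2 f <= sobolev_norm_sq \<gamma> f"
 by (simp add: sobolev_norm_reg)

lemma l2_integrable:
 assumes "f : mUI" "l2 f < \<infinity>"
 shows "iUI (%q. (f q)^2)" "iUI f" "(IU q. (f q)^2) = enn2real (l2 f)"
proof -
 show i: "iUI (%q. (f q)^2)"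
  using assms by (intro integrableI_nonneg) (auto simp: l2_def)
 show "(IU q. (f q)^2) = enn2real (l2 f)"
  unfolding l2_def using assms(1) by (intro integral_eq_nn_integral) auto
 show "iUI f"
 proof (rule Bochner_Integration.integrable_bound)
  show "iUI (%q. 1 + (f q)^2)" using i by auto
  show "AE q in UI. norm (f q) <= norm (1 + (f q)^2)"
  proof (rule AE_I2)
   fix q
   have "0 <= ( |f q| - 1)^2" by simp
   then have "2 * |f q| <= 1 + (f q)^2" by (simp add: power2_diff)
   then show "norm (f q) <= norm (1 + (f q)^2)" using abs_ge_zero[of "f q"] unfolding real_norm_def by linarith
  qed
 qed fact
qed

text \<open>For bounded F the functional is continuous already in L2, so its sublevel sets are open
  in the Sobolev space.\<close>

lemma integral_functional_measurable:
 assumes F: "F : mUI" "!!q. 0 < q ==> q < 1 ==> |F q| <= B"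
 shows "(%h. (IU q. h q * F q)) : borel_measurable (sobolev_borel \<gamma>)"
proof (rule borel_measurableI_less)
 fix y :: real
 define B' where "B' = |B| + 1"
 have B': "B' > 0" "!!q. 0 < q ==> q < 1 ==> |F q| <= B'" unfolding B'_def using order_trans[OF F(2), of _ "|B| + 1"] by auto
 have int: "iUI (%q. h q * F q)" if "iUI h" for h
 proof (rule Bochner_Integration.integrable_bound)
  show "iUI (%q. h q * B')" using that by simp
  show "(%q. h q * F q) : mUI" using that F(1) by auto
  show "AE q in UI. norm (h q * F q) <= norm (h q * B')"
   proof (rule AE_UI_I)
   fix q :: real assume "0 < q" "q < 1"
   then have "|F q| <= B'" by (rule B'(2))
   then have "|h q| * |F q| <= |h q| * B'" by (intro mult_left_mono) auto
   then show "norm (h q * F q) <= norm (h q * B')" using B'(1) by (simp add: abs_mult)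
  qed
 qed
 have sob: "iUI h & l2 h < \<infinity>" if "h : sobolev \<gamma>" for h
  proof -
  have h: "h : mUI" "sobolev_norm_sq \<gamma> h < \<infinity>" using that by (auto simp: sobolev_def)
  have "l2 h < \<infinity>" by (rule le_less_trans[OF l2_le_sobolev[OF h(1)] h(2)])
  then show ?thesis using l2_integrable(2)[OF h(1)] by simp
 qed
 have "sobolev_open \<gamma> {h : sobolev \<gamma>. (IU q. h q * F q) < y}"
  unfolding sobolev_open_def
 proof (intro conjI ballI)
  fix f assume "f : {h : sobolev \<gamma>. (IU q. h q * F q) < y}"
  then have f: "f : sobolev \<gamma>" "(IU q. f q * F q) < y" by auto
  define e where "e = (y - (IU q. f q * F q)) / (2 * B')"
  have e: "0 < e" using f(2) B' by (simp add: e_def)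
  show "\<exists>e>0. \<forall>h\<in>sobolev \<gamma>. sobolev_norm_sq \<gamma> (%q. f q - h q) < ennreal (e^2) --> h : {h : sobolev \<gamma>. (IU q. h q * F q) < y}"
  proof (intro exI[of _ e] conjI ballI impI e)
   fix h assume h: "h : sobolev \<gamma>" and n: "sobolev_norm_sq \<gamma> (%q. f q - h q) < ennreal (e^2)"
   have fi: "iUI f" "iUI h" using sob f h by auto
   have dm: "(%q. f q - h q) : mUI" using fi by auto
   have l: "l2 (%q. f q - h q) < ennreal (e^2)" using l2_le_sobolev[OF dm] n by (rule le_less_trans)
   then have l': "l2 (%q. f q - h q) < \<infinity>" by (simp add: less_top order.strict_trans)
   note d = l2_integrable[OF dm l']
   have d2: "(IU q. (f q - h q)^2) <= e^2"
    unfolding d(3) using l by (intro enn2real_leI) auto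
   have "(IU q. h q * F q) - (IU q. f q * F q) = (IU q. (h q - f q) * F q)"
    using int fi by (simp add: left_diff_distrib)
   also have "... <= (IU q. B' * (e / 2 + (f q - h q)^2 / (2 * e)))"
   proof (rule integral_mono)
    show "iUI (%q. (h q - f q) * F q)" using fi by (intro int) auto
    show "iUI (%q. B' * (e / 2 + (f q - h q)^2 / (2 * e)))" using d(1) by auto
    fix q assume "q : space UI"
    then have q: "0 < q" "q < 1" by auto
    have "0 <= ( |f q - h q| - e)^2 / (2 * e)" using e by simp
    also have "... = (f q - h q)^2 / (2 * e) - |f q - h q| + e / 2"
     using e by (simp add: power2_diff field_simps power2_eq_square)
    finally have a: "|h q - f q| <= e / 2 + (f q - h q)^2 / (2 * e)" by (simp add: abs_minus_commute)
    have "(h q - f q) * F q <= |h q - f q| * |F q|" by (metis abs_ge_self abs_mult)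
    also have "... <= (e / 2 + (f q - h q)^2 / (2 * e)) * B'" using a B'(2)[OF q] by (intro mult_mono) auto
    finally show "(h q - f q) * F q <= B' * (e / 2 + (f q - h q)^2 / (2 * e))" by (simp add: mult.commute)
   qed
   also have "... = B' * (e / 2 + (IU q. (f q - h q)^2) / (2 * e))" using d(1) by simp
   also have "... <= B' * (e / 2 + e^2 / (2 * e))"
    using d2 e B' by (intro mult_left_mono add_left_mono divide_right_mono) auto
   also have "... = e * B'" using e by (simp add: power2_eq_square)
   also have "... = (y - (IU q. f q * F q)) / 2" using B'(1) by (simp add: e_def)
   finally show "h : {h : sobolev \<gamma>. (IU q. h q * F q) < y}" using f(2) h by auto
  qed
 qed auto
 then show "{x : space (sobolev_borel \<gamma>). (IU q. x q * F q) < y} : sets (sobolev_borel \<gamma>)"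
  unfolding sobolev_borel_space by (rule sobolev_open_sets)
qed

definition bdry :: "(real => real) => ennreal" where
 "bdry f = (NU q. ennreal ((\<alpha> - f q)^2 / q powr (1 + \<gamma>) + (\<beta> - f q)^2 / (1 - q) powr (1 + \<gamma>)))"

lemma bdry_part_measurable:
 assumes p: "p : mUI" "!!q. 0 <= p q" "!!q. p q <= P"
 shows "(%f. (NU q. ennreal (p q * (c - f q)^2))) : borel_measurable (sobolev_borel \<gamma>)"
proof (rule sobolev_functional_measurable)
 show "0 <= P" using p(2,3) order_trans by blast
 fix f h l assume f: "f : sobolev \<gamma>" and h: "h : sobolev \<gamma>" and l: "0 < (l::real)"
 note fm = sobolev_measurable[OF f] and hm = sobolev_measurable[OF h]
 have m: "(%q. c - f q) : mUI" "(%q. c - h q) : mUI" using fm hm by auto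
 have "(NU q. ennreal (p q * (c - h q)^2)) <= ennreal (1 + l) * (NU q. ennreal (p q * (c - f q)^2))
   + ennreal (1 + 1 / l) * (NU q. ennreal (p q * ((c - f q) - (c - h q))^2))"
  by (rule weighted_l2_split[OF m p(1,2) l])
 also have "(NU q. ennreal (p q * ((c - f q) - (c - h q))^2)) <= (NU q. ennreal P * ennreal ((f q - h q)^2))"
 proof (intro nn_integral_mono)
  fix q
  have "p q * ((c - f q) - (c - h q))^2 <= P * (f q - h q)^2"
  proof -
   have "((c - f q) - (c - h q))^2 = (f q - h q)^2" by (simp add: power2_commute)
   then show ?thesis using p(3)[of q] by (simp add: mult_right_mono)
  qed
  then have "ennreal (p q * ((c - f q) - (c - h q))^2) <= ennreal (P * (f q - h q)^2)" by (rule ennreal_leI)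
  then show "ennreal (p q * ((c - f q) - (c - h q))^2) <= ennreal P * ennreal ((f q - h q)^2)"
   using p(2,3)[of q] by (subst ennreal_mult[symmetric]) auto
 qed
 also have "... = ennreal P * l2 (%q. f q - h q)" unfolding l2_def using fm hm by (subst nn_integral_cmult) auto
 also have "... <= ennreal P * sobolev_norm_sq \<gamma> (%q. f q - h q)" using fm hm by (intro mult_left_mono l2_le_sobolev) auto
 finally show "(NU q. ennreal (p q * (c - h q)^2)) <= ennreal (1 + l) * (NU q. ennreal (p q * (c - f q)^2))
   + ennreal (1 + 1 / l) * (ennreal P * sobolev_norm_sq \<gamma> (%q. f q - h q))"
  by (simp add: mult_left_mono add_left_mono)
qed

text \<open>The boundary weights are unbounded, so the splitting inequality is not directly
  available; the functional is the increasing limit of those with truncated weights.\<close>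

lemma bdry_whole_measurable:
 assumes p: "p : mUI" "!!q. 0 <= p q"
 shows "(%f. (NU q. ennreal (p q * (c - f q)^2))) : borel_measurable (sobolev_borel \<gamma>)"
proof (rule borel_measurable_LIMSEQ_order)
 show "(%f. (NU q. ennreal (min (p q) (real n) * (c - f q)^2))) : borel_measurable (sobolev_borel \<gamma>)" for n
  using p by (intro bdry_part_measurable[where P="real n"] borel_measurable_min) auto
 fix f assume "f : space (sobolev_borel \<gamma>)"
 then have fm: "f : mUI" using sobolev_measurable by (simp add: sobolev_borel_space)
 show "(%n. (NU q. ennreal (min (p q) (real n) * (c - f q)^2))) ----> (NU q. ennreal (p q * (c - f q)^2))"
 proof (rule nn_integral_LIMSEQ)
  show "incseq (%n q. ennreal (min (p q) (real n) * (c - f q)^2))"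
   by (intro incseq_SucI le_funI ennreal_leI mult_right_mono) auto
  show "(%q. ennreal (min (p q) (real n) * (c - f q)^2)) : mUI" for n
  proof -
   have "(%q. min (p q) (real n) * (c - f q)^2) : mUI"
    using p fm by (intro borel_measurable_times borel_measurable_min borel_measurable_power borel_measurable_diff) auto
   then show ?thesis by (rule measurable_compose[OF _ measurable_ennreal])
  qed
  fix q
  have "eventually (%n. real n >= p q) sequentially"
   using filterlim_real_sequentially by (simp add: filterlim_at_top)
  then have "eventually (%n. ennreal (min (p q) (real n) * (c - f q)^2) = ennreal (p q * (c - f q)^2)) sequentially"
   by eventually_elim (simp add: min_def)
  then show "(%n. ennreal (min (p q) (real n) * (c - f q)^2)) ----> ennreal (p q * (c - f q)^2)" by (rule tendsto_eventually)
 qed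
qed

lemma powr_weight_UI: "(%q. 1 / q powr (1 + \<gamma>)) : mUI" "(%q. 1 / (1 - q) powr (1 + \<gamma>)) : mUI"
 by (rule borel_UI, measurable)+

lemma bdry_eq:
 assumes "f : mUI"
 shows "bdry f = (NU q. ennreal (1 / q powr (1 + \<gamma>) * (\<alpha> - f q)^2)) + (NU q. ennreal (1 / (1 - q) powr (1 + \<gamma>) * (\<beta> - f q)^2))"
proof -
 have m: "(%q. ennreal (p q * (c - f q)^2)) : mUI" if "p : mUI" for p and c :: real
 proof -
  have "(%q. p q * (c - f q)^2) : mUI" using that assms by (intro borel_measurable_times borel_measurable_power borel_measurable_diff) auto
  then show ?thesis by (rule measurable_compose[OF _ measurable_ennreal])
 qed
 have "bdry f = (NU q. ennreal (1 / q powr (1 + \<gamma>) * (\<alpha> - f q)^2) + ennreal (1 / (1 - q) powr (1 + \<gamma>) * (\<beta> - f q)^2))"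
  unfolding bdry_def by (intro nn_integral_cong) (simp add: ennreal_plus[symmetric] del: ennreal_plus)
 also have "... = (NU q. ennreal (1 / q powr (1 + \<gamma>) * (\<alpha> - f q)^2)) + (NU q. ennreal (1 / (1 - q) powr (1 + \<gamma>) * (\<beta> - f q)^2))"
  by (rule nn_integral_add[OF m[OF powr_weight_UI(1)] m[OF powr_weight_UI(2)]])
 finally show ?thesis .
qed

lemma bdry_measurable: "bdry : borel_measurable (sobolev_borel \<gamma>)"
proof -
 have "(%f. (NU q. ennreal (1 / q powr (1 + \<gamma>) * (\<alpha> - f q)^2)) + (NU q. ennreal (1 / (1 - q) powr (1 + \<gamma>) * (\<beta> - f q)^2)))
   : borel_measurable (sobolev_borel \<gamma>)"
  by (rule borel_measurable_add[OF bdry_whole_measurable bdry_whole_measurable]) (auto intro: powr_weight_UI)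
 then show ?thesis
  by (rule measurable_cong[THEN iffD1, rotated]) (simp add: bdry_eq sobolev_measurable sobolev_borel_space)
qed

text \<open>Both functions are close to \<alpha> at 0 and to \<beta> at 1 in the weighted sense of
  \<open>bdry\<close>, so their difference has finite killing energy. This is how the boundary
  condition enters uniqueness.\<close>

lemma kil_diff_le:
 assumes f: "f : mUI" and h: "h : mUI"
 shows "kil (%q. f q - h q) <= ennreal (2 * cg) * (bdry f + bdry h)"
proof -
 have m: "(%q. ennreal ((\<alpha> - f q)^2 / q powr (1 + \<gamma>) + (\<beta> - f q)^2 / (1 - q) powr (1 + \<gamma>))) : mUI" if "f : mUI" for f
 proof -
  have "(%q. 1 / q powr (1 + \<gamma>) * (\<alpha> - f q)^2 + 1 / (1 - q) powr (1 + \<gamma>) * (\<beta> - f q)^2) : mUI"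
   by (rule borel_measurable_add[OF borel_measurable_times[OF powr_weight_UI(1) borel_measurable_power[OF borel_measurable_diff[OF borel_measurable_const that]]]
    borel_measurable_times[OF powr_weight_UI(2) borel_measurable_power[OF borel_measurable_diff[OF borel_measurable_const that]]]])
  then have "(%q. (\<alpha> - f q)^2 / q powr (1 + \<gamma>) + (\<beta> - f q)^2 / (1 - q) powr (1 + \<gamma>)) : mUI" by simp
  then show ?thesis by (rule measurable_compose[OF _ measurable_ennreal])
 qed
 let ?b = "%f q. (\<alpha> - f q)^2 / q powr (1 + \<gamma>) + (\<beta> - f q)^2 / (1 - q) powr (1 + \<gamma>)"
 have "kil (%q. f q - h q) <= (NU q. ennreal (2 * cg) * (ennreal (?b f q) + ennreal (?b h q)))"
  unfolding kil_def
 proof (rule nn_integral_mono)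
  fix q assume "q : space UI"
  then have q: "0 < q" "q < 1" by auto
  have s: "(f q - h q)^2 <= 2 * ((a - f q)^2 + (a - h q)^2)" for a
  proof -
   have "(f q - h q)^2 = ((a - h q) - (a - f q))^2" by simp
   also have "... <= 2 * ((a - f q)^2 + (a - h q)^2)"
    using zero_le_power2[of "(a - h q) + (a - f q)"] by (simp add: power2_eq_square algebra_simps)
   finally show ?thesis .
  qed
  have "Vk q * (f q - h q)^2 = cg * ((f q - h q)^2 / q powr (1 + \<gamma>) + (f q - h q)^2 / (1 - q) powr (1 + \<gamma>))"
   using q by (simp add: Vk_def kern_inverse algebra_simps)
  also have "... <= cg * (2 * ((\<alpha> - f q)^2 + (\<alpha> - h q)^2) / q powr (1 + \<gamma>) + 2 * ((\<beta> - f q)^2 + (\<beta> - h q)^2) / (1 - q) powr (1 + \<gamma>))"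
   using cg by (intro mult_left_mono add_mono divide_right_mono s) auto
  also have "... = 2 * cg * (?b f q + ?b h q)" by (simp add: algebra_simps add_divide_distrib)
  finally have "ennreal (Vk q * (f q - h q)^2) <= ennreal (2 * cg * (?b f q + ?b h q))" by (rule ennreal_leI)
  also have "... = ennreal (2 * cg) * (ennreal (?b f q) + ennreal (?b h q))"
   using cg by (simp add: ennreal_mult ennreal_plus[symmetric] del: ennreal_plus)
  finally show "ennreal (Vk q * (f q - h q)^2) <= ennreal (2 * cg) * (ennreal (?b f q) + ennreal (?b h q))" .
 qed
 also have "... = ennreal (2 * cg) * (bdry f + bdry h)"
  unfolding bdry_def using m[OF f] m[OF h] by (subst nn_integral_cmult) (auto simp: nn_integral_add)
 finally show ?thesis .
qed

subsection \<open>Uniqueness\<close>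

lemma ex_test_approximation:
 assumes "f : mUI" and "!!q. 0 < q ==> q < 1 ==> |f q| <= 1"
 shows "\<exists>\<psi>. (\<forall>j. ctest (\<psi> j)) & (%j. (IU q. |\<psi> j q - f q| )) ----> 0
  & (\<forall>j. ennreal (Q (\<psi> j) (\<psi> j)) <= ennreal (48 + 8 * \<kappa>) * (reg f + kil f))"
proof (rule test_approximation[OF assms])
 fix \<psi> :: "nat => real => real"
 assume "!!j. ctest (\<psi> j)" "(%j. (IU q. |\<psi> j q - f q| )) ----> 0"
  "!!j. ennreal (Q (\<psi> j) (\<psi> j)) <= ennreal (48 + 8 * \<kappa>) * (reg f + kil f)"
 then show ?thesis by (intro exI[of _ \<psi>] conjI allI) simp_all
qed

text \<open>The squared dual norm \<open>sup\<^sub>\<phi> (2 \<langle>w\<^sub>t, \<phi>\<rangle> - Q(\<phi>, \<phi>))\<close> of the difference of two solutions decreases at rate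
  \<open>2 \<parallel>w\<^sub>t\<parallel>\<^sup>2\<close>. Near-optimal test functions \<open>\<phi>\<close> take the place of the inverse of the operator applied
  to \<open>w\<^sub>t\<close>.\<close>

lemma dual_norm_uniqueness:
 fixes T :: real and w :: "real => real => real"
 assumes T: "T > 0"
  and w1: "!!t. t : {0..T} ==> w t : mUI" "!!t q. t : {0..T} ==> 0 < q ==> q < 1 ==> |w t q| <= 1"
  and w2: "!!F B. F : mUI ==> (!!q. 0 < q ==> q < 1 ==> |F q| <= B) \<Longrightarrow>
    (%s. (IU q. w s q * F q)) : borel_measurable (lebesgue_on {0..T})"
  and w3: "!!t \<phi>. t : {0..T} ==> ctest \<phi> \<Longrightarrow>
    (IU q. w t q * \<phi> q) = (\<integral>s. indicator {0..<t} s * (IU q. w s q * L_op \<gamma> \<kappa> \<phi> q) \<partial>lebesgue_on {0..T})"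
  and w4: "integrable (lebesgue_on {0..T}) M" "AE s in lebesgue_on {0..T}. reg (w s) + kil (w s) <= ennreal (M s)"
   "!!s. 0 <= M s"
  and t: "t : {0..T}"
 shows "AE q in UI. w t q = 0"
proof -
 let ?X = "lebesgue_on {0..T}"
 interpret X: finite_measure ?X by (rule finite_measure_lebesgue_on) (rule lmeasurable_cbox[of 0 T, unfolded cbox_interval])
 define I where "I t F = (IU q. w t q * F q)" for t F
 define \<Lambda> where "\<Lambda> \<phi> s = I s (L_op \<gamma> \<kappa> \<phi>)" for \<phi> s
 have wb: "\<exists>B. \<forall>q. 0 < q --> q < 1 --> |w t q| <= B" if "t : {0..T}" for t using w1(2)[OF that] by blast
 have Ib: "|I t F| <= (IU q. |F q| )" if t: "t : {0..T}" and F: "iUI F" for t F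
 proof -
  have m: "(%q. w t q * F q) : mUI" using w1(1)[OF t] F by auto
  have le: "|w t q * F q| <= |F q|" if "0 < q" "q < 1" for q
   unfolding abs_mult using w1(2)[OF t that] by (simp add: mult_left_le_one_le)
  have i: "iUI (%q. w t q * F q)"
   by (rule Bochner_Integration.integrable_bound[OF F m]) (use le in "auto intro!: AE_UI_I")
  have "|I t F| <= (IU q. |w t q * F q| )" unfolding I_def by (rule integral_abs_bound)
  also have "... <= (IU q. |F q| )" using i F le by (intro integral_mono) auto
  finally show ?thesis .
 qed
 have Ibb: "|I t F| <= B" if t: "t : {0..T}" and F: "F : mUI" "!!q. 0 < q ==> q < 1 ==> |F q| <= B" for t F B
 proof -
  have i: "iUI F" by (rule integrable_bounded_UI[OF F])
  have "(IU q. |F q| ) <= (IU q. B)" using i F(2) by (intro integral_mono) auto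
  then show ?thesis using Ib[OF t i] by simp
 qed
 have \<Lambda>m: "\<Lambda> \<phi> : borel_measurable ?X" if "ctest \<phi>" for \<phi>
 proof -
  obtain B where "\<forall>q. 0 < q --> q < 1 --> |L_op \<gamma> \<kappa> \<phi> q| <= B" using ctest_L_op(2)[OF \<open>ctest \<phi>\<close>] by blast
  then show ?thesis unfolding \<Lambda>_def I_def using w2[OF ctest_L_op(1)[OF that]] by blast
 qed
 have \<Lambda>b: "\<exists>B. \<forall>s\<in>{0..T}. |\<Lambda> \<phi> s| <= B" if c: "ctest \<phi>" for \<phi>
 proof -
  obtain B where "\<forall>q. 0 < q --> q < 1 --> |L_op \<gamma> \<kappa> \<phi> q| <= B" using ctest_L_op(2)[OF c] by blast
  then show ?thesis unfolding \<Lambda>_def using Ibb[OF _ ctest_L_op(1)[OF c]] by blast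
 qed
 have indm: "(indicator {a..<b} :: real => real) : borel_measurable ?X" for a b
  by (intro measurable_restrict_space1 measurable_completion) simp
 have bint: "integrable ?X (%s. indicator {a..<b} s * g s)" if g: "g : borel_measurable ?X" "\<exists>B. \<forall>s\<in>{0..T}. |g s| <= B" for a b and g :: "real => real"
 proof -
  obtain B where B: "!!s. s : {0..T} ==> |g s| <= B" using g(2) by blast
  show ?thesis
  proof (rule X.integrable_const_bound[where B="|B|"])
   show "AE s in ?X. norm (indicator {a..<b} s * g s) <= |B|"
    proof (rule AE_I2)
    fix s assume "s : space ?X"
    then have "|g s| <= |B|" using order_trans[OF B abs_ge_self] by simp
    then show "norm (indicator {a..<b} s * g s) <= |B|" by (simp add: indicator_def)
   qed
  qed (rule borel_measurable_times[OF indm g(1)])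
 qed
 have w3': "I t \<phi> - I r \<phi> = (\<integral>s. indicator {r..<t} s * \<Lambda> \<phi> s \<partial>?X)"
  if "0 <= r" "r <= t" "t <= T" "ctest \<phi>" for r t \<phi>
 proof -
  have "I t \<phi> - I r \<phi> = (\<integral>s. indicator {0..<t} s * \<Lambda> \<phi> s \<partial>?X) - (\<integral>s. indicator {0..<r} s * \<Lambda> \<phi> s \<partial>?X)"
   using w3[of t \<phi>] w3[of r \<phi>] that by (simp add: I_def \<Lambda>_def)
  also have "... = (\<integral>s. indicator {0..<t} s * \<Lambda> \<phi> s - indicator {0..<r} s * \<Lambda> \<phi> s \<partial>?X)"
   using bint[OF \<Lambda>m \<Lambda>b] that by (intro Bochner_Integration.integral_diff[symmetric]) auto
  also have "... = (\<integral>s. indicator {r..<t} s * \<Lambda> \<phi> s \<partial>?X)"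
   using that by (intro Bochner_Integration.integral_cong) (auto simp: indicator_def)
  finally show ?thesis .
 qed
 define kc where "kc = \<kappa> * cg"
 have kc: "0 < kc" using kap cg by (simp add: kc_def)
 have Ii: "iUI (%q. w t q * \<phi> q)" if "t : {0..T}" "ctest \<phi>" for t \<phi>
  by (rule integrable_mult_bounded[OF w1(1)[OF that(1)] wb[OF that(1)] ctest_measurable[OF that(2)] ctest_bounded[OF that(2)]])
 have sqi: "iUI (%q. (\<phi> q)^2)" if "ctest \<phi>" for \<phi>
  using integrable_mult_bounded[OF ctest_measurable[OF that] ctest_bounded[OF that] ctest_measurable[OF that] ctest_bounded[OF that]]
  by (simp add: power2_eq_square)
 \<comment> \<open>Completing the square with the coercivity of \<open>Q\<close>; this makes the
   supremum below finite.\<close>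
 have ubd: "2 * I t \<phi> - Q \<phi> \<phi> <= 1 / kc" if t: "t : {0..T}" and c: "ctest \<phi>" for t \<phi>
 proof -
  have "2 * I t \<phi> - kc * (IU q. (\<phi> q)^2) = (IU q. 2 * (w t q * \<phi> q) - kc * (\<phi> q)^2)"
   unfolding I_def using Ii[OF t c] sqi[OF c] by simp
  also have "... <= (IU q. 1 / kc)"
  proof (rule integral_mono)
   show "iUI (%q. 2 * (w t q * \<phi> q) - kc * (\<phi> q)^2)" using Ii[OF t c] sqi[OF c] by auto
   fix q assume "q : space UI"
   then have q: "0 < q" "q < 1" by auto
   have "0 <= (kc * \<phi> q - w t q)^2 / kc" using kc by simp
   also have "... = kc * (\<phi> q)^2 - 2 * (w t q * \<phi> q) + (w t q)^2 / kc"
    using kc by (simp add: power2_eq_square field_simps)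
   finally have "2 * (w t q * \<phi> q) - kc * (\<phi> q)^2 <= (w t q)^2 / kc" by simp
   also have "... <= 1 / kc"
   proof -
    have "(w t q)^2 <= 1" using w1(2)[OF t q] abs_le_square_iff[of "w t q" 1] by simp
    then show ?thesis using kc by (intro divide_right_mono) auto
   qed
   finally show "2 * (w t q * \<phi> q) - kc * (\<phi> q)^2 <= 1 / kc" .
  qed simp
  finally show ?thesis using Q_coercive[OF c] by (simp add: kc_def)
 qed
 define f where "f t = (SUP \<phi>\<in>Collect ctest. 2 * I t \<phi> - Q \<phi> \<phi>)" for t
 have f_up: "2 * I t \<phi> - Q \<phi> \<phi> <= f t" if "t : {0..T}" "ctest \<phi>" for t \<phi>
  unfolding f_def using that ubd[OF that(1)] by (intro cSUP_upper bdd_aboveI2[where M="1/kc"]) auto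
 have f_near: "\<exists>\<phi>. ctest \<phi> & f t - e < 2 * I t \<phi> - Q \<phi> \<phi>" if "t : {0..T}" "0 < e" for t e
 proof -
  have "f t - e < (SUP \<phi>\<in>Collect ctest. 2 * I t \<phi> - Q \<phi> \<phi>)" using that by (simp add: f_def)
  then show ?thesis
   by (subst (asm) less_cSUP_iff) (use ubd[OF that(1)] ctest_zero in \<open>auto intro!: bdd_aboveI2[where M="1/kc"]\<close>)
 qed
 have f_nonneg: "0 <= f t" if "t : {0..T}" for t
 proof -
  have "Q (%_. 0) (%_. 0) = 0" by (simp add: Q_def)
  then show ?thesis using f_up[OF that ctest_zero] by (simp add: I_def)
 qed
 have f0: "f 0 <= 0" unfolding f_def
 proof (rule cSUP_least)
  show "Collect ctest ~= {}" using ctest_zero by blast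
  fix \<phi> assume "\<phi> : Collect ctest"
  then have c: "ctest \<phi>" by simp
  have "I 0 \<phi> = 0" using w3[of 0 \<phi>] c T by (simp add: I_def)
  then show "2 * I 0 \<phi> - Q \<phi> \<phi> <= 0" using Q_nonneg[OF c] by simp
 qed
 define C0 where "C0 = 48 + 8 * \<kappa>"
 have C0: "0 <= C0" using kap by (simp add: C0_def)
 have I2m: "(%s. I s (w t)) : borel_measurable ?X" if "t : {0..T}" for t
  unfolding I_def using w2[OF w1(1)[OF that] w1(2)[OF that]] .
 have I2b: "\<exists>B. \<forall>s\<in>{0..T}. |I s (w t)| <= B" if t: "t : {0..T}" for t
  using Ibb[OF _ w1(1)[OF t] w1(2)[OF t]] by blast
 \<comment> \<open>Let \<phi> nearly attain \<open>f t\<close>. Then Q(\<phi>, .) is nearly <w_t,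
   .>, so <w_s, \<phi>> has derivative \<open>\<Lambda> \<phi> s\<close> close to -<w_s, w_t>, and
   the same \<phi> is a competitor for \<open>f r\<close>.\<close>
 have D: "f t - f r <= - 2 * (\<integral>s. indicator {r..<t} s * I s (w t) \<partial>?X)" if r: "0 <= r" "r <= t" "t <= T" for r t
 proof -
  have t: "t : {0..T}" "r : {0..T}" using r by auto
  let ?J = "\<integral>s. indicator {r..<t} s * I s (w t) \<partial>?X"
  let ?K = "\<integral>s. 1 + C0 * M s \<partial>?X"
  have step: "f t - f r <= - 2 * ?J + 2 * (e * ?K) + e^2" if e: "0 < e" for e
  proof -
   obtain \<phi> where \<phi>: "ctest \<phi>" "f t - e^2 < 2 * I t \<phi> - Q \<phi> \<phi>" using f_near[OF t(1), of "e^2"] e by auto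
   \<comment> \<open>Near-maximality tested in the direction \<psi> is a nonnegative quadratic
     polynomial in b; its discriminant is an approximate Euler-Lagrange equation.\<close>
   have near: "(Q \<phi> \<psi> - I t \<psi>)^2 <= e^2 * Q \<psi> \<psi>" if c: "ctest \<psi>" for \<psi>
   proof -
    define d where "d = Q \<phi> \<psi> - I t \<psi>"
    have q: "0 <= e^2 + 2 * b * d + b^2 * Q \<psi> \<psi>" for b
    proof -
     have cb: "ctest (%q. \<phi> q + b * \<psi> q)" using ctest_lincomb[OF \<phi>(1) c, of 1 b] by simp
     have Il: "I t (%q. \<phi> q + b * \<psi> q) = I t \<phi> + b * I t \<psi>"
      unfolding I_def using Ii[OF t(1) \<phi>(1)] Ii[OF t(1) c] by (simp add: distrib_left mult.left_commute)
     have "2 * (I t \<phi> + b * I t \<psi>) - (Q \<phi> \<phi> + 2 * b * Q \<phi> \<psi> + b^2 * Q \<psi> \<psi>) <= f t"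
      using f_up[OF t(1) cb] unfolding Il Q_expand[OF \<phi>(1) c] .
     then show ?thesis using \<phi>(2) by (simp add: d_def algebra_simps)
    qed
    show ?thesis
    proof (cases "Q \<psi> \<psi> = 0")
     case True
     have "d = 0"
     proof (rule ccontr)
      assume d: "d ~= 0"
      show False using q[of "- (e^2 + 1) / (2 * d)"] d True by (simp add: field_simps)
     qed
     then show ?thesis using True by (simp add: d_def)
    next
     case False
     then have p: "Q \<psi> \<psi> > 0" using Q_nonneg[OF c] by simp
     have "0 <= e^2 + 2 * (- d / Q \<psi> \<psi>) * d + (- d / Q \<psi> \<psi>)^2 * Q \<psi> \<psi>" by (rule q)
     also have "... = e^2 - d^2 / Q \<psi> \<psi>" using p by (simp add: power2_eq_square field_simps)
     finally show ?thesis using p by (simp add: d_def field_simps)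
    qed
   qed
   \<comment> \<open>\<open>w s\<close> need not be a test function; it is replaced by test
     functions of energy at most \<open>C0 * M s\<close> that converge to it in L1.\<close>
   have err: "AE s in ?X. \<Lambda> \<phi> s <= - I s (w t) + e * (1 + C0 * M s)"
    using w4(2) AE_space[of ?X]
   proof eventually_elim
    case (elim s)
    then have s: "s : {0..T}" by simp
    obtain \<psi> where \<psi>: "!!j. ctest (\<psi> j)" "(%j. (IU q. |\<psi> j q - w s q| )) ----> 0"
     "!!j. ennreal (Q (\<psi> j) (\<psi> j)) <= ennreal (48 + 8 * \<kappa>) * (reg (w s) + kil (w s))"
     using ex_test_approximation[OF w1(1)[OF s] w1(2)[OF s]] by auto
    have Qb: "Q (\<psi> j) (\<psi> j) <= C0 * M s" for j
    proof -
     have "ennreal (Q (\<psi> j) (\<psi> j)) <= ennreal C0 * (reg (w s) + kil (w s))" using \<psi>(3) by (simp add: C0_def)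
     also have "... <= ennreal C0 * ennreal (M s)" using elim by (intro mult_left_mono) auto
     also have "... = ennreal (C0 * M s)" using C0 w4(3) by (simp add: ennreal_mult)
     finally show ?thesis using C0 w4(3)[of s] by (subst (asm) ennreal_le_iff) auto
    qed
    have wsi: "iUI (w s)" by (rule integrable_bounded_UI[OF w1(1)[OF s] w1(2)[OF s]])
    have psi: "iUI (\<psi> j)" for j
    proof -
     obtain B where "!!q. 0 < q ==> q < 1 ==> |\<psi> j q| <= B" using ctest_bounded[OF \<psi>(1)[of j]] by blast
     then show ?thesis by (rule integrable_bounded_UI[OF ctest_measurable[OF \<psi>(1)]])
    qed
    have conv: "(%j. (IU q. \<psi> j q * F q)) ----> (IU q. w s q * F q)"
     if F: "F : mUI" "\<exists>B. \<forall>q. 0 < q --> q < 1 --> |F q| <= B" for F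
    proof -
     obtain B where B: "!!q. 0 < q ==> q < 1 ==> |F q| <= B" using F(2) by blast
     have i1: "iUI (%q. \<psi> j q * F q)" for j
      by (rule integrable_mult_bounded[OF ctest_measurable[OF \<psi>(1)] ctest_bounded[OF \<psi>(1)] F])
     have i2: "iUI (%q. w s q * F q)" by (rule integrable_mult_bounded[OF w1(1)[OF s] wb[OF s] F])
     have "(%j. (IU q. \<psi> j q * F q) - (IU q. w s q * F q)) ----> 0"
     proof (rule Lim_null_comparison)
      show "(%j. (IU q. |\<psi> j q - w s q| ) * B) ----> 0" using tendsto_mult_left_zero[OF \<psi>(2)] .
      show "eventually (%j. norm ((IU q. \<psi> j q * F q) - (IU q. w s q * F q)) <= (IU q. |\<psi> j q - w s q| ) * B) sequentially"
      proof (intro always_eventually allI)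
       fix j
       have "(IU q. \<psi> j q * F q) - (IU q. w s q * F q) = (IU q. \<psi> j q * F q - w s q * F q)"
        using i1 i2 by simp
       also have "norm ... <= (IU q. norm (\<psi> j q * F q - w s q * F q))" by (rule integral_norm_bound)
       also have "... <= (IU q. |\<psi> j q - w s q| * B)"
       proof (rule integral_mono)
        show "iUI (%q. norm (\<psi> j q * F q - w s q * F q))" using i1 i2 by auto
        show "iUI (%q. |\<psi> j q - w s q| * B)" using psi wsi by auto
        fix q assume "q : space UI"
        then have "|F q| <= B" using B by auto
        then show "norm (\<psi> j q * F q - w s q * F q) <= |\<psi> j q - w s q| * B"
         unfolding left_diff_distrib[symmetric] real_norm_def abs_mult by (intro mult_left_mono) auto
       qed
       finally show "norm ((IU q. \<psi> j q * F q) - (IU q. w s q * F q)) <= (IU q. |\<psi> j q - w s q| ) * B" by simp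
      qed
     qed
     then show ?thesis by (simp add: LIM_zero_iff)
    qed
    have c1: "(%j. Q \<phi> (\<psi> j)) ----> - \<Lambda> \<phi> s"
     unfolding Q_def \<Lambda>_def I_def
     using tendsto_minus[OF conv[OF ctest_L_op[OF \<phi>(1)]]] by (simp add: mult.commute)
    have c2: "(%j. I t (\<psi> j)) ----> I s (w t)"
     unfolding I_def using conv[OF w1(1)[OF t(1)] wb[OF t(1)]] by (simp add: mult.commute)
    have "(%j. (Q \<phi> (\<psi> j) - I t (\<psi> j))^2) ----> (- \<Lambda> \<phi> s - I s (w t))^2" by (intro tendsto_intros c1 c2)
    moreover have "(Q \<phi> (\<psi> j) - I t (\<psi> j))^2 <= e^2 * (C0 * M s)" for j
     using near[OF \<psi>(1)[of j]] mult_left_mono[OF Qb[of j], of "e^2"] by simp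
    ultimately have "(- \<Lambda> \<phi> s - I s (w t))^2 <= e^2 * (C0 * M s)"
     by (intro tendsto_upperbound[of _ _ sequentially]) auto
    \<comment> \<open>Bounding by a full square avoids the root of \<open>M s\<close> and keeps the
      error integrable in time.\<close>
    also have "... <= (e * (1 + C0 * M s))^2"
    proof -
     have x: "0 <= C0 * M s" using C0 w4(3) by simp
     then have "C0 * M s <= (1 + C0 * M s)^2" unfolding power2_sum using zero_le_power2[of "C0 * M s"] by simp
     then show ?thesis unfolding power_mult_distrib by (intro mult_left_mono) auto
    qed
    finally have "|- \<Lambda> \<phi> s - I s (w t)| <= |e * (1 + C0 * M s)|" by (simp add: abs_le_square_iff)
    moreover have "0 <= e * (1 + C0 * M s)" using e C0 w4(3)[of s] by simp
    ultimately show ?case by linarith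
   qed
   have Ki: "integrable ?X (%s. 1 + C0 * M s)" using w4(1) by auto
   have "I t \<phi> - I r \<phi> = (\<integral>s. indicator {r..<t} s * \<Lambda> \<phi> s \<partial>?X)" by (rule w3'[OF r \<phi>(1)])
   also have "... <= (\<integral>s. - (indicator {r..<t} s * I s (w t)) + e * (1 + C0 * M s) \<partial>?X)"
   proof (rule integral_mono_AE)
    show "integrable ?X (%s. indicator {r..<t} s * \<Lambda> \<phi> s)" by (rule bint[OF \<Lambda>m[OF \<phi>(1)] \<Lambda>b[OF \<phi>(1)]])
    show "integrable ?X (%s. - (indicator {r..<t} s * I s (w t)) + e * (1 + C0 * M s))"
     using bint[OF I2m[OF t(1)] I2b[OF t(1)]] Ki by auto
    show "AE s in ?X. indicator {r..<t} s * \<Lambda> \<phi> s <= - (indicator {r..<t} s * I s (w t)) + e * (1 + C0 * M s)"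
     using err
    proof eventually_elim
     case (elim s)
     have "0 <= e * (1 + C0 * M s)" using e C0 w4(3)[of s] by simp
     then show ?case using elim by (auto simp: indicator_def)
    qed
   qed
   also have "... = - ?J + e * ?K"
    using bint[OF I2m[OF t(1)] I2b[OF t(1)]] Ki by simp
   finally have a: "I t \<phi> - I r \<phi> <= - ?J + e * ?K" .
   have "f t - f r <= (2 * I t \<phi> - Q \<phi> \<phi> + e^2) - (2 * I r \<phi> - Q \<phi> \<phi>)"
    using \<phi>(2) f_up[OF t(2) \<phi>(1)] by linarith
   then show ?thesis using a by linarith
  qed
  have "((%e. - 2 * ?J + 2 * (e * ?K) + e^2) \<longlongrightarrow> - 2 * ?J + 2 * (0 * ?K) + 0^2) (at_right 0)"
   by (intro tendsto_intros)
  moreover have "eventually (%e. f t - f r <= - 2 * ?J + 2 * (e * ?K) + e^2) (at_right 0)"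
   by (rule eventually_mono[OF eventually_at_right_less[of 0]]) (rule step)
  ultimately show ?thesis by (intro tendsto_lowerbound[of _ _ "at_right 0"]) auto
 qed
 define g where "g n i = T * real i / real n" for n i :: nat
 \<comment> \<open>Summing the decrease over a partition of mesh T/n gives the integral of <w_s,
   w_t> with t the next partition point after s. It is nonpositive because \<open>f T\<close> is
   nonnegative and \<open>f 0\<close> is at most 0.\<close>
 define G where "G n s = (\<Sum>i<n. indicator {g n i..<g n (Suc i)} s * I s (w (g n (Suc i))))" for n s
 have gT: "g n i : {0..T}" if "i <= n" for n i
  using that T by (cases "n = 0") (auto simp: g_def divide_le_eq)
 have gm: "g n i <= g n (Suc i)" for n i using T by (simp add: g_def divide_right_mono)
 have Gi: "integrable ?X (G n)" for n
  unfolding G_def by (intro Bochner_Integration.integrable_sum bint I2m I2b gT) auto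
 have Gneg: "(\<integral>s. G n s \<partial>?X) <= 0" if "n >= 1" for n
 proof -
  have "f T - f 0 = (\<Sum>i<n. f (g n (Suc i)) - f (g n i))"
   using sum_lessThan_telescope[of "%i. f (g n i)" n] that by (simp add: g_def)
  also have "... <= (\<Sum>i<n. - 2 * (\<integral>s. indicator {g n i..<g n (Suc i)} s * I s (w (g n (Suc i))) \<partial>?X))"
  proof (rule sum_mono)
   fix i assume i: "i : {..<n}"
   have "0 <= g n i" "g n (Suc i) <= T" using gT[of i n] gT[of "Suc i" n] i by auto
   then show "f (g n (Suc i)) - f (g n i) <= - 2 * (\<integral>s. indicator {g n i..<g n (Suc i)} s * I s (w (g n (Suc i))) \<partial>?X)"
    using D gm by blast
  qed
  also have "... = - 2 * (\<integral>s. G n s \<partial>?X)"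
   unfolding G_def by (subst Bochner_Integration.integral_sum) (auto intro!: bint I2m I2b gT simp: sum_distrib_left)
  finally show ?thesis using f0 f_nonneg[of T] T by simp
 qed
 define G0 where "G0 s = indicator {..<T} s * I s (w s)" for s
 have Gval: "\<exists>t\<in>{0..T}. G n s = I s (w t) & |t - s| <= T / real n" if n: "n >= 1" and s: "0 <= s" "s < T" for n s
 proof -
  define i where "i = nat \<lfloor>s * real n / T\<rfloor>"
  have fl: "0 <= s * real n / T" using s T by simp
  have ri: "real i = of_int \<lfloor>s * real n / T\<rfloor>" using fl by (simp add: i_def)
  have b: "real i <= s * real n / T" "s * real n / T < real i + 1" using ri by linarith+
  have "s * real n / T < T * real n / T" using s T n by (intro divide_strict_right_mono mult_strict_right_mono) auto
  then have "s * real n / T < real n" using T by simp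
  then have i: "i < n" using b by linarith
  have in_iff: "s : {g n j..<g n (Suc j)} \<longleftrightarrow> real j <= s * real n / T & s * real n / T < real j + 1" for j
   using T n by (simp add: g_def divide_le_eq less_divide_eq le_divide_eq divide_less_eq mult.commute add.commute)
  have uniq: "s : {g n j..<g n (Suc j)} \<longleftrightarrow> j = i" for j
   unfolding in_iff using b by linarith
  have "G n s = (\<Sum>j<n. if j = i then I s (w (g n (Suc j))) else 0)"
   unfolding G_def using uniq by (intro sum.cong) (auto simp: indicator_def)
  also have "... = I s (w (g n (Suc i)))" using i by simp
  finally have "G n s = I s (w (g n (Suc i)))" .
  moreover have "|g n (Suc i) - s| <= T / real n"
  proof -
   have "s : {g n i..<g n (Suc i)}" using uniq by simp
   moreover have "g n (Suc i) = g n i + T / real n" by (simp add: g_def distrib_left add_divide_distrib)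
   ultimately show ?thesis by auto
  qed
  ultimately show ?thesis using gT[of "Suc i" n] i by (intro bexI[of _ "g n (Suc i)"]) auto
 qed
 \<comment> \<open>As the mesh shrinks the integrand tends to the squared norm of
   \<open>w s\<close>: pairings with a fixed test function are Lipschitz in time, and test functions
   approximate \<open>w s\<close> in L1.\<close>
 have Glim: "(%n. G (Suc n) s) ----> G0 s" if s: "s : {0..T}" for s
 proof (cases "s = T")
  case True
  have "G n s = 0" for n unfolding G_def
  proof (rule sum.neutral, rule ballI)
   fix i assume "i : {..<n}"
   then have "g n (Suc i) <= T" using gT[of "Suc i" n] by auto
   then show "indicator {g n i..<g n (Suc i)} s * I s (w (g n (Suc i))) = 0" using True by (simp add: indicator_def)
  qed
  then show ?thesis using True by (simp add: G0_def)
 next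
  case False
  then have s': "0 <= s" "s < T" using s by auto
  show ?thesis
  proof (rule LIMSEQ_I)
   fix r :: real assume r: "0 < r"
   obtain \<psi> where \<psi>: "!!j. ctest (\<psi> j)" "(%j. (IU q. |\<psi> j q - w s q| )) ----> 0"
    using ex_test_approximation[OF w1(1)[OF s] w1(2)[OF s]] by auto
   obtain j where j: "(IU q. |\<psi> j q - w s q| ) < r / 4"
    using order_tendstoD(2)[OF \<psi>(2), of "r/4"] r unfolding eventually_sequentially by auto
   obtain B where B: "!!s. s : {0..T} ==> |\<Lambda> (\<psi> j) s| <= B" using \<Lambda>b[OF \<psi>(1)] by blast
   have wsi: "iUI (w s)" by (rule integrable_bounded_UI[OF w1(1)[OF s] w1(2)[OF s]])
   have psi: "iUI (\<psi> j)"
   proof -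
    obtain B where "!!q. 0 < q ==> q < 1 ==> |\<psi> j q| <= B" using ctest_bounded[OF \<psi>(1)[of j]] by blast
    then show ?thesis by (rule integrable_bounded_UI[OF ctest_measurable[OF \<psi>(1)]])
   qed
   have Icomm: "I a (w b) = I b (w a)" for a b by (simp add: I_def mult.commute)
   have near: "|I t (w s) - I t (\<psi> j)| <= r / 4" if t: "t : {0..T}" for t
   proof -
    have i1: "iUI (%q. w t q * w s q)" by (rule integrable_mult_bounded[OF w1(1)[OF t] wb[OF t] w1(1)[OF s] wb[OF s]])
    have "I t (w s) - I t (\<psi> j) = I t (%q. w s q - \<psi> j q)"
     unfolding I_def using i1 Ii[OF t \<psi>(1)] by (simp add: right_diff_distrib)
    also have "|...| <= (IU q. |w s q - \<psi> j q| )" using wsi psi by (intro Ib t) auto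
    finally show ?thesis using j by (simp add: abs_minus_commute)
   qed
   have cont: "|I b (\<psi> j) - I a (\<psi> j)| <= B * (b - a)" if "0 <= a" "a <= b" "b <= T" for a b
   proof -
    have "|I b (\<psi> j) - I a (\<psi> j)| <= (\<integral>s. |indicator {a..<b} s * \<Lambda> (\<psi> j) s| \<partial>?X)"
     unfolding w3'[OF that \<psi>(1)] by (rule integral_abs_bound)
    also have "... <= (\<integral>s. indicator {a..<b} s * B \<partial>?X)"
    proof (rule integral_mono)
     show "integrable ?X (%s. |indicator {a..<b} s * \<Lambda> (\<psi> j) s| )" by (intro integrable_abs bint \<Lambda>m \<Lambda>b \<psi>(1))
     show "integrable ?X (%s. indicator {a..<b} s * B)" by (rule bint) auto
     fix s assume "s : space ?X"
     then show "|indicator {a..<b} s * \<Lambda> (\<psi> j) s| <= indicator {a..<b} s * B" using B[of s] by (auto simp: indicator_def)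
    qed
    also have "... = measure ?X ({a..<b} \<inter> {0..T}) * B" by simp
    also have "measure ?X ({a..<b} \<inter> {0..T}) = b - a"
    proof -
     have "{a..<b} \<inter> {0..T} = {a..<b}" using that by auto
     then show ?thesis using that by (subst measure_restrict_space) auto
    qed
    finally show ?thesis by (simp add: mult.commute)
   qed
   have "(%n. |B| * (T / real (Suc n))) ----> |B| * 0"
    by (intro tendsto_mult tendsto_const) (rule LIMSEQ_Suc[OF lim_const_over_n])
   then obtain n0 where n0: "!!n. n >= n0 ==> |B| * (T / real (Suc n)) < r / 4"
    using order_tendstoD(2)[of "%n. |B| * (T / real (Suc n))" 0 sequentially "r/4"] r unfolding eventually_sequentially by auto
   show "\<exists>no. \<forall>n\<ge>no. norm (G (Suc n) s - G0 s) < r"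
   proof (intro exI allI impI)
    fix n assume n: "n >= n0"
    obtain t where t: "t : {0..T}" "G (Suc n) s = I s (w t)" "|t - s| <= T / real (Suc n)" using Gval[of "Suc n" s] s' by auto
    have "|I t (\<psi> j) - I s (\<psi> j)| <= |B| * |t - s|"
    proof (cases "s <= t")
     case True
     then have "|I t (\<psi> j) - I s (\<psi> j)| <= B * (t - s)" using cont[of s t] s' t(1) by auto
     also have "... <= |B| * |t - s|" using True by (intro mult_mono) auto
     finally show ?thesis .
    next
     case False
     then have "|I t (\<psi> j) - I s (\<psi> j)| <= B * (s - t)" using cont[of t s] s' t(1) by (auto simp: abs_minus_commute)
     also have "... <= |B| * |t - s|" using False by (intro mult_mono) auto
     finally show ?thesis .
    qed
    also have "... <= |B| * (T / real (Suc n))" using t(3) by (intro mult_left_mono) auto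
    finally have "|I t (\<psi> j) - I s (\<psi> j)| < r / 4" using n0[OF n] by linarith
    then have "|I t (w s) - I s (w s)| < r" using near[OF t(1)] near[OF s] by linarith
    then show "norm (G (Suc n) s - G0 s) < r" using t(2) s' by (simp add: G0_def Icomm[of s t])
   qed
  qed
 qed
 have Gb: "|G (Suc n) s| <= 1" if s: "s : {0..T}" for n s
 proof (cases "s = T")
  case True
  have "indicator {g (Suc n) i..<g (Suc n) (Suc i)} s = (0::real)" if "i < Suc n" for i
   using gT[of "Suc i" "Suc n"] that True by (auto simp: indicator_def)
  then show ?thesis unfolding G_def by simp
 next
  case False
  then obtain t where "t : {0..T}" "G (Suc n) s = I s (w t)" using Gval[of "Suc n" s] s by auto
  then show ?thesis using Ibb[OF s w1(1) w1(2)] by metis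
 qed
 have G0m: "G0 : borel_measurable ?X"
  by (rule borel_measurable_LIMSEQ_real[where u="%n. G (Suc n)"]) (use Glim Gi in auto)
 have Gl: "(%n. \<integral>s. G (Suc n) s \<partial>?X) ----> (\<integral>s. G0 s \<partial>?X)"
  by (rule integral_dominated_convergence[where w="%_. 1"]) (use G0m Gi Gb Glim in "auto intro!: AE_I2")
 have G0n: "0 <= G0 s" if "s : {0..T}" for s
  unfolding G0_def I_def by (intro mult_nonneg_nonneg[of "indicator _ _"] integral_nonneg_AE AE_I2) auto
 have G0b: "|G0 s| <= 1" if "s : {0..T}" for s
  by (rule tendsto_upperbound[OF tendsto_rabs[OF Glim[OF that]]]) (use Gb[OF that] in auto)
 have G0i: "integrable ?X G0" by (rule X.integrable_const_bound[where B=1, OF _ G0m]) (use G0b in "auto intro!: AE_I2")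
 have "(\<integral>s. G0 s \<partial>?X) <= 0"
  by (rule tendsto_upperbound[OF Gl]) (auto intro!: always_eventually Gneg)
 moreover have "0 <= (\<integral>s. G0 s \<partial>?X)" using G0n by (intro integral_nonneg_AE AE_I2) auto
 ultimately have "(\<integral>s. G0 s \<partial>?X) = 0" by simp
 then have "AE s in ?X. G0 s = 0"
  using G0i G0n by (subst (asm) integral_nonneg_eq_0_iff_AE) (auto intro!: AE_I2)
 moreover have "AE s in ?X. s ~= T"
 proof -
  have "AE s in lebesgue. s ~= T"
   using negligible_sing[of T] by (intro AE_I'[of "{T}"]) (auto simp: negligible_iff_null_sets)
  then show ?thesis by (subst AE_restrict_space_iff) (auto elim: AE_mp)
 qed
 ultimately have w0: "AE s in ?X. AE q in UI. w s q = 0"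
  using AE_space[of ?X]
 proof eventually_elim
  case (elim s)
  then have s: "s : {0..T}" "s < T" by auto
  then have "(IU q. w s q * w s q) = 0" using elim by (simp add: G0_def I_def)
  moreover have "iUI (%q. w s q * w s q)"
   by (rule integrable_mult_bounded[OF w1(1)[OF s(1)] wb[OF s(1)] w1(1)[OF s(1)] wb[OF s(1)]])
  ultimately show ?case by (subst (asm) integral_nonneg_eq_0_iff_AE) auto
 qed
 \<comment> \<open>From almost every time to the given t: the integrated equation now has right side
   0.\<close>
 have It: "I t \<phi> = 0" if c: "ctest \<phi>" for \<phi>
 proof -
  have "AE s in ?X. indicator {0..<t} s * \<Lambda> \<phi> s = 0"
   using w0 AE_space[of ?X]
  proof eventually_elim
   case (elim s)
   then have s: "s : {0..T}" by simp
   have "\<Lambda> \<phi> s = (IU q. 0)" unfolding \<Lambda>_def I_def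
   proof (rule integral_cong_AE)
    show "(%q. w s q * L_op \<gamma> \<kappa> \<phi> q) : mUI" using w1(1)[OF s] ctest_L_op(1)[OF c] by simp
    show "AE q in UI. w s q * L_op \<gamma> \<kappa> \<phi> q = 0" using elim(1) by eventually_elim simp
   qed simp
   then show ?case by simp
  qed
  then have "(\<integral>s. indicator {0..<t} s * \<Lambda> \<phi> s \<partial>?X) = (\<integral>s. 0 \<partial>?X)"
   by (intro integral_cong_AE) (auto intro!: borel_measurable_times indm \<Lambda>m c)
  then show ?thesis using w3[OF t c] by (simp add: I_def \<Lambda>_def)
 qed
 obtain \<psi> where \<psi>: "!!j. ctest (\<psi> j)" "(%j. (IU q. |\<psi> j q - w t q| )) ----> 0"
  using ex_test_approximation[OF w1(1)[OF t] w1(2)[OF t]] by auto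
 have wti: "iUI (w t)" by (rule integrable_bounded_UI[OF w1(1)[OF t] w1(2)[OF t]])
 have i2: "iUI (%q. w t q * w t q)"
  by (rule integrable_mult_bounded[OF w1(1)[OF t] wb[OF t] w1(1)[OF t] wb[OF t]])
 have "I t (w t) <= (IU q. |\<psi> j q - w t q| )" for j
 proof -
  have psi: "iUI (\<psi> j)"
  proof -
   obtain B where "!!q. 0 < q ==> q < 1 ==> |\<psi> j q| <= B" using ctest_bounded[OF \<psi>(1)[of j]] by blast
   then show ?thesis by (rule integrable_bounded_UI[OF ctest_measurable[OF \<psi>(1)]])
  qed
  have "I t (w t) - I t (\<psi> j) = I t (%q. w t q - \<psi> j q)"
   unfolding I_def using i2 Ii[OF t \<psi>(1)] by (simp add: right_diff_distrib)
  also have "|...| <= (IU q. |w t q - \<psi> j q| )" using wti psi by (intro Ib t) auto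
  finally show ?thesis using It[OF \<psi>(1)] by (simp add: abs_minus_commute)
 qed
 then have "I t (w t) <= 0" by (intro tendsto_lowerbound[OF \<psi>(2)]) auto
 moreover have "0 <= I t (w t)" unfolding I_def by (intro integral_nonneg_AE AE_I2) auto
 ultimately have "(IU q. w t q * w t q) = 0" unfolding I_def by (rule antisym)
 then show ?thesis using i2 by (subst (asm) integral_nonneg_eq_0_iff_AE) auto
qed

lemma set_integral_UI: "(LINT q:{0<..<1}|lebesgue. h q) = (IU q. h q)" for h :: "real => real"
 by (subst integral_restrict_space) (simp_all add: set_lebesgue_integral_def)

text \<open>Half-open time intervals let increments over adjacent intervals add up without
  overlap.\<close>

lemma set_integral_time:
 fixes h :: "real => real"
 assumes h: "h : borel_measurable (lebesgue_on {0..T})" and t: "t : {0..T}"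
 shows "(LINT s:{0..t}|lebesgue. h s) = (\<integral>s. indicator {0..<t} s * h s \<partial>lebesgue_on {0..T})"
proof -
 have m: "(%s. indicator {0..T} s * h s) : borel_measurable lebesgue"
  using h by (subst (asm) borel_measurable_restrict_space_iff) (auto simp: mult.commute)
 have i: "(indicator A :: real => real) : borel_measurable lebesgue" if "A : sets borel" for A
  using that by (intro measurable_completion) simp
 have "(\<integral>s. indicator {0..<t} s * h s \<partial>lebesgue_on {0..T}) = (\<integral>s. indicator {0..<t} s * (indicator {0..T} s * h s) \<partial>lebesgue)"
  by (subst integral_restrict_space) (auto simp: mult.left_commute)
 also have "... = (\<integral>s. indicator {0..t} s * (indicator {0..T} s * h s) \<partial>lebesgue)"
 proof (rule integral_cong_AE)
  have "AE s in lebesgue. s ~= t"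
   using negligible_sing[of t] by (intro AE_I'[of "{t}"]) (auto simp: negligible_iff_null_sets)
  then show "AE s in lebesgue. indicator {0..<t} s * (indicator {0..T} s * h s) = indicator {0..t} s * (indicator {0..T} s * h s)"
   by eventually_elim (auto simp: indicator_def)
 qed (intro borel_measurable_times[OF i m]; simp)+
 also have "... = (LINT s:{0..t}|lebesgue. h s)"
  unfolding set_lebesgue_integral_def using t by (intro Bochner_Integration.integral_cong) (auto simp: indicator_def)
 finally show ?thesis by simp
qed

lemma nn_set_time: "(\<integral>\<^sup>+s\<in>{0..T::real}. h s \<partial>lebesgue) = (\<integral>\<^sup>+s. h s \<partial>lebesgue_on {0..T})"
 by (subst nn_integral_restrict_space) simp_all

lemma reg_diff_le:
 assumes f: "f : mUI" and h: "h : mUI"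
 shows "reg (%q. f q - h q) <= 4 * (sobolev_norm_sq \<gamma> f + sobolev_norm_sq \<gamma> h)"
proof -
 have two: "reg f <= 2 * sobolev_norm_sq \<gamma> f" if "f : mUI" for f
 proof -
  have "ennreal 2 * ennreal (1/2) = 1" by (subst ennreal_mult[symmetric]) auto
  then have "reg f = 2 * (ennreal (1/2) * reg f)" unfolding mult.assoc[symmetric] by simp
  also have "... <= 2 * sobolev_norm_sq \<gamma> f"
   unfolding sobolev_norm_reg[OF that] by (intro mult_left_mono) auto
  finally show ?thesis .
 qed
 have "reg (%q. f q - h q) <= ennreal (1 + 1) * reg f + ennreal (1 + 1 / 1) * reg (%q. f q - (f q - h q))"
  using f h by (intro reg_split) auto
 also have "... = 2 * reg f + 2 * reg h" by simp
 also have "... <= 2 * (2 * sobolev_norm_sq \<gamma> f) + 2 * (2 * sobolev_norm_sq \<gamma> h)"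
  by (intro add_mono mult_left_mono two f h) auto
 also have "... = 4 * (sobolev_norm_sq \<gamma> f + sobolev_norm_sq \<gamma> h)"
  by (simp add: distrib_left mult.assoc[symmetric])
 finally show ?thesis .
qed

lemma weak_solution_measurable:
 assumes "weak_solution \<gamma> \<kappa> \<alpha> \<beta> T g \<rho>" "s : {0..T}"
 shows "\<rho> s : mUI" "q : {0..1} ==> 0 <= \<rho> s q & \<rho> s q <= 1"
 using assms measurable_UI_closed[of "\<rho> s"] unfolding weak_solution_def by (auto simp: Pi_iff)

lemma weak_solution_test:
 assumes "weak_solution \<gamma> \<kappa> \<alpha> \<beta> T g \<rho>" "t : {0..T}" "G : test_functions T"
 shows "(LINT q:{0..1}|lebesgue. \<rho> t q * G t q) = (LINT q:{0..1}|lebesgue. g q * G 0 q)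
    + (LINT s:{0..t}|lebesgue. LINT q:{0<..<1}|lebesgue.
       \<rho> s q * (vector_derivative (%r. G r q) (at s within {0..T}) + L_op \<gamma> \<kappa> (G s) q))
    + \<kappa> * (LINT s:{0..t}|lebesgue. LINT q:{0<..<1}|lebesgue. G s q * V0 \<gamma> \<alpha> \<beta> q)"
 using assms(1)[unfolded weak_solution_def, THEN conjunct2, THEN conjunct2, THEN conjunct2, rule_format, OF assms(2,3)]
 by linarith

lemma weak_solution_functional:
 assumes ws: "weak_solution \<gamma> \<kappa> \<alpha> \<beta> T g \<rho>"
  and F: "F : mUI" "!!q. 0 < q ==> q < 1 ==> |F q| <= B"
 shows "(%s. (IU q. \<rho> s q * F q)) : borel_measurable (lebesgue_on {0..T})"
proof -
 obtain f where f: "f : L2_sobolev \<gamma> T" "AE t in lebesgue_on {0..T}. f t = \<rho> t" using ws unfolding weak_solution_def by blast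
 have "(%s. (IU q. f s q * F q)) : borel_measurable (lebesgue_on {0..T})"
  by (rule measurable_compose[OF _ integral_functional_measurable[OF F]]) (use f(1) in "auto simp: L2_sobolev_def")
 then show ?thesis
  by (rule AE_lebesgue_on_measurable) (use f(2) in "auto elim: AE_mp")
qed

text \<open>A weak solution agrees with a measurable Sobolev-valued f only for almost every time, so
  the majorant is built from f to be measurable.\<close>

lemma weak_solution_energy:
 assumes ws: "weak_solution \<gamma> \<kappa> \<alpha> \<beta> T g \<rho>"
 shows "\<exists>Z. Z : borel_measurable (lebesgue_on {0..T}) & (\<integral>\<^sup>+s. Z s \<partial>lebesgue_on {0..T}) < \<infinity> \<and>
  (AE s in lebesgue_on {0..T}. 4 * sobolev_norm_sq \<gamma> (\<rho> s) + ennreal (2 * cg) * bdry (\<rho> s) <= Z s)"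
proof -
 let ?X = "lebesgue_on {0..T}"
 obtain f where f: "f : L2_sobolev \<gamma> T" "AE t in ?X. f t = \<rho> t" using ws unfolding weak_solution_def by blast
 have fm: "f : ?X \<rightarrow>\<^sub>M sobolev_borel \<gamma>" using f(1) by (simp add: L2_sobolev_def)
 note sm = measurable_compose[OF fm sobolev_norm_measurable] and bm = measurable_compose[OF fm bdry_measurable]
 define Z where "Z s = 4 * sobolev_norm_sq \<gamma> (f s) + ennreal (2 * cg) * bdry (f s)" for s
 have "(\<integral>\<^sup>+s. bdry (\<rho> s) \<partial>?X) < \<infinity>"
  using ws unfolding weak_solution_def nn_set_time nn_set_UI bdry_def by blast
 moreover have "(\<integral>\<^sup>+s. bdry (f s) \<partial>?X) = (\<integral>\<^sup>+s. bdry (\<rho> s) \<partial>?X)"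
  by (rule nn_integral_cong_AE) (use f(2) in "auto elim: AE_mp")
 moreover have "(\<integral>\<^sup>+s. sobolev_norm_sq \<gamma> (f s) \<partial>?X) < \<infinity>"
  using f(1) unfolding L2_sobolev_def nn_set_time by blast
 ultimately have fin: "(\<integral>\<^sup>+s. Z s \<partial>?X) < \<infinity>"
  unfolding Z_def using sm bm
  by (subst nn_integral_add) (auto simp: nn_integral_cmult ennreal_mult_less_top)
 have zm: "Z : borel_measurable ?X" unfolding Z_def[abs_def] using sm bm by auto
 show ?thesis
  by (rule exI[of _ Z], intro conjI zm fin) (use f(2) in "auto simp: Z_def elim: AE_mp")
qed

text \<open>Initial value and source cancel in the difference, which is the situation of
  \<open>dual_norm_uniqueness\<close>. The energies of both solutions provide the integrable
  majorant, finite for almost every time.\<close>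

lemma weak_solution_unique:
 assumes T: "T > 0" and r: "weak_solution \<gamma> \<kappa> \<alpha> \<beta> T g \<rho>" and r': "weak_solution \<gamma> \<kappa> \<alpha> \<beta> T g \<rho>'" and t: "t : {0..T}"
 shows "AE q in lebesgue_on {0..1}. \<rho>' t q = \<rho> t q"
proof -
 let ?X = "lebesgue_on {0..T}"
 define w where "w s q = \<rho>' s q - \<rho> s q" for s q
 note m = weak_solution_measurable(1)[OF r] and m' = weak_solution_measurable(1)[OF r']
 have b: "|\<rho> s q| <= 1" "|\<rho>' s q| <= 1" "|w s q| <= 1" if "s : {0..T}" "0 < q" "q < 1" for s q
  using weak_solution_measurable(2)[OF r that(1), of q] weak_solution_measurable(2)[OF r' that(1), of q] that by (auto simp: w_def)
 have wm: "w s : mUI" if "s : {0..T}" for s unfolding w_def using m[OF that] m'[OF that] by simp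
 have ii: "iUI (%q. \<rho> s q * F q)" "iUI (%q. \<rho>' s q * F q)"
  if "s : {0..T}" "F : mUI" "\<exists>B. \<forall>q. 0 < q --> q < 1 --> |F q| <= B" for s F
  using b[OF that(1)] m[OF that(1)] m'[OF that(1)] that(2,3) by (blast intro: integrable_mult_bounded)+
 have split: "(IU q. w s q * F q) = (IU q. \<rho>' s q * F q) - (IU q. \<rho> s q * F q)"
  if "s : {0..T}" "F : mUI" "\<exists>B. \<forall>q. 0 < q --> q < 1 --> |F q| <= B" for s F
  using ii[OF that] by (simp add: w_def left_diff_distrib)
 obtain Z where Z: "Z : borel_measurable ?X" "(\<integral>\<^sup>+s. Z s \<partial>?X) < \<infinity>"
  "AE s in ?X. 4 * sobolev_norm_sq \<gamma> (\<rho> s) + ennreal (2 * cg) * bdry (\<rho> s) <= Z s" using weak_solution_energy[OF r] by auto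
 obtain Z' where Z': "Z' : borel_measurable ?X" "(\<integral>\<^sup>+s. Z' s \<partial>?X) < \<infinity>"
  "AE s in ?X. 4 * sobolev_norm_sq \<gamma> (\<rho>' s) + ennreal (2 * cg) * bdry (\<rho>' s) <= Z' s" using weak_solution_energy[OF r'] by auto
 define Y where "Y s = Z s + Z' s" for s
 have Ym: "Y : borel_measurable ?X" using Z(1) Z'(1) by (simp add: Y_def[abs_def])
 have Yi: "(\<integral>\<^sup>+s. Y s \<partial>?X) < \<infinity>" unfolding Y_def using Z(1,2) Z'(1,2) by (subst nn_integral_add) auto
 have Yf: "AE s in ?X. Y s ~= \<infinity>" using Ym Yi by (intro nn_integral_noteq_infinite) auto
 have "AE q in UI. w t q = 0"
 proof (rule dual_norm_uniqueness[OF T, where M="%s. enn2real (Y s)"])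
  show "w s : mUI" if "s : {0..T}" for s by (rule wm[OF that])
  show "|w s q| <= 1" if "s : {0..T}" "0 < q" "q < 1" for s q by (rule b(3)[OF that])
  show "t : {0..T}" by (rule t)
  show "0 <= enn2real (Y s)" for s by simp
  show wF: "(%s. (IU q. w s q * F q)) : borel_measurable ?X"
   if F: "F : mUI" "!!q. 0 < q ==> q < 1 ==> |F q| <= B" for F B
  proof -
   have "(%s. (IU q. \<rho>' s q * F q) - (IU q. \<rho> s q * F q)) : borel_measurable ?X"
    by (rule borel_measurable_diff[OF weak_solution_functional[OF r' F] weak_solution_functional[OF r F]])
   moreover have "\<exists>B. \<forall>q. 0 < q --> q < 1 --> |F q| <= B" using F(2) by blast
   ultimately show ?thesis
    by (subst measurable_cong[OF split[OF _ F(1)]]) auto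
  qed
  show "integrable ?X (%s. enn2real (Y s))"
  proof (rule integrableI_nonneg)
   have "(\<integral>\<^sup>+s. ennreal (enn2real (Y s)) \<partial>?X) = (\<integral>\<^sup>+s. Y s \<partial>?X)"
    by (rule nn_integral_cong_AE) (use Yf in "auto simp: less_top elim!: AE_mp")
   then show "(\<integral>\<^sup>+s. ennreal (enn2real (Y s)) \<partial>?X) < \<infinity>" using Yi by simp
  qed (use Ym in auto)
  show "AE s in ?X. reg (w s) + kil (w s) <= ennreal (enn2real (Y s))"
   using Yf Z(3) Z'(3) AE_space[of ?X]
  proof eventually_elim
   case (elim s)
   then have s: "s : {0..T}" by simp
   have "reg (w s) + kil (w s) <= 4 * (sobolev_norm_sq \<gamma> (\<rho>' s) + sobolev_norm_sq \<gamma> (\<rho> s)) + ennreal (2 * cg) * (bdry (\<rho>' s) + bdry (\<rho> s))"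
    unfolding w_def by (intro add_mono reg_diff_le kil_diff_le m m' s)
   also have "... = (4 * sobolev_norm_sq \<gamma> (\<rho> s) + ennreal (2 * cg) * bdry (\<rho> s)) + (4 * sobolev_norm_sq \<gamma> (\<rho>' s) + ennreal (2 * cg) * bdry (\<rho>' s))"
    by (simp add: distrib_left add_ac)
   also have "... <= Y s" unfolding Y_def by (intro add_mono elim)
   finally show ?case using elim(1) by (simp add: less_top)
  qed
  fix t \<phi> assume t: "t : {0..T}" and c: "ctest \<phi>"
  have vd: "vector_derivative (%r. \<phi> q) (at s within {0..T}) = 0" if "s : {0..T}" for s q
   using vector_derivative_const_within[OF T that] by blast
  let ?L = "L_op \<gamma> \<kappa> \<phi>"
  have L: "?L : mUI" "\<exists>B. \<forall>q. 0 < q --> q < 1 --> |?L q| <= B"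
   using ctest_L_op[OF c] by blast+
  have pb: "\<phi> : mUI" "\<exists>B. \<forall>q. 0 < q --> q < 1 --> |\<phi> q| <= B"
   using ctest_measurable[OF c] ctest_bounded[OF c] by blast+
  obtain B where B: "!!q. 0 < q ==> q < 1 ==> |?L q| <= B" using L(2) by blast
  have weak: "(IU q. \<rho> t q * \<phi> q) = (LINT q:{0..1}|lebesgue. g q * \<phi> q)
    + (LINT s:{0..t}|lebesgue. (IU q. \<rho> s q * ?L q)) + \<kappa> * (LINT s:{0..t}|lebesgue. LINT q:{0<..<1}|lebesgue. \<phi> q * V0 \<gamma> \<alpha> \<beta> q)"
   if ws: "weak_solution \<gamma> \<kappa> \<alpha> \<beta> T g \<rho>" for \<rho>
  proof -
   have "(LINT s:{0..t}|lebesgue. LINT q:{0<..<1}|lebesgue. \<rho> s q * (vector_derivative (%r. \<phi> q) (at s within {0..T}) + ?L q))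
     = (LINT s:{0..t}|lebesgue. (IU q. \<rho> s q * ?L q))"
    using t vd by (intro set_lebesgue_integral_cong) (auto simp: set_integral_UI)
   moreover have "(LINT q:{0..1}|lebesgue. \<rho> t q * \<phi> q) = (IU q. \<rho> t q * \<phi> q)"
    using weak_solution_measurable(1)[OF ws t] pb(1) by (intro LINT_closed_UI) auto
   ultimately show ?thesis using weak_solution_test[OF ws t ctest_test_function[OF c T]] by simp
  qed
  have lm: "(%s. (IU q. \<rho> s q * ?L q)) : borel_measurable ?X" "(%s. (IU q. \<rho>' s q * ?L q)) : borel_measurable ?X"
   using weak_solution_functional[OF r L(1) B] weak_solution_functional[OF r' L(1) B] by auto
  have bd: "|(IU q. \<rho> s q * ?L q)| <= |B|" if "s : {0..T}" "!!q. 0 < q ==> q < 1 ==> |\<rho> s q| <= 1" "iUI (%q. \<rho> s q * ?L q)" for s and \<rho> :: "real => real => real"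
  proof -
   have "|(IU q. \<rho> s q * ?L q)| <= (IU q. |\<rho> s q * ?L q| )" by (rule integral_abs_bound)
   also have "... <= (IU q. |B| )"
   proof (rule integral_mono)
    fix q assume "q : space UI"
    then have q: "0 < q" "q < 1" by auto
    have "|\<rho> s q| * |?L q| <= 1 * |B|" using B[OF q] that(2)[OF q] by (intro mult_mono) auto
    then show "|\<rho> s q * ?L q| <= |B|" by (simp add: abs_mult)
   qed (use that(3) in auto)
   finally show ?thesis by simp
  qed
  interpret X: finite_measure ?X by (rule finite_measure_lebesgue_on) (rule lmeasurable_cbox[of 0 T, unfolded cbox_interval])
  have tint: "integrable ?X (%s. indicator {0..<t} s * h s)" if h: "h : borel_measurable ?X" "!!s. s : {0..T} ==> |h s| <= |B|" for h :: "real => real"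
  proof (rule X.integrable_const_bound[where B="|B|"])
   show "AE s in ?X. norm (indicator {0..<t} s * h s) <= |B|" using h(2) by (intro AE_I2) (auto simp: indicator_def)
   have "(indicator {0..<t} :: real => real) : borel_measurable ?X"
    by (intro measurable_restrict_space1 measurable_completion) simp
   then show "(%s. indicator {0..<t} s * h s) : borel_measurable ?X" using h(1) by (rule borel_measurable_times)
  qed
  have "(IU q. w t q * \<phi> q) = (\<integral>s. indicator {0..<t} s * (IU q. \<rho>' s q * ?L q) \<partial>?X) - (\<integral>s. indicator {0..<t} s * (IU q. \<rho> s q * ?L q) \<partial>?X)"
   unfolding split[OF t pb] weak[OF r] weak[OF r'] set_integral_time[OF lm(1) t] set_integral_time[OF lm(2) t] by simp
  also have "... = (\<integral>s. indicator {0..<t} s * (IU q. \<rho>' s q * ?L q) - indicator {0..<t} s * (IU q. \<rho> s q * ?L q) \<partial>?X)"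
   by (rule Bochner_Integration.integral_diff[symmetric])
    (rule tint[OF lm(2)] tint[OF lm(1)], rule bd, assumption, rule b, assumption+, rule ii[OF _ L], assumption)+
  also have "... = (\<integral>s. indicator {0..<t} s * (IU q. w s q * ?L q) \<partial>?X)"
   using split[OF _ L] by (intro Bochner_Integration.integral_cong) (auto simp: right_diff_distrib)
  finally show "(IU q. w t q * \<phi> q) = (\<integral>s. indicator {0..<t} s * (IU q. w s q * ?L q) \<partial>?X)" .
 qed
 then have "AE q in UI. \<rho>' t q = \<rho> t q" by eventually_elim (simp add: w_def)
 then have "AE q in lebesgue. q : {0<..<1} --> \<rho>' t q = \<rho> t q" by (subst (asm) AE_restrict_space_iff) auto
 moreover have "AE q in lebesgue. q ~= 0" "AE q in lebesgue. q ~= 1"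
  using negligible_sing[of 0] negligible_sing[of 1] by (auto intro!: AE_I'[of "{0}"] AE_I'[of "{1}"] simp: negligible_iff_null_sets)
 ultimately have "AE q in lebesgue. q : {0..1} --> \<rho>' t q = \<rho> t q" by eventually_elim auto
 then show ?thesis by (subst AE_restrict_space_iff) auto
qed

end

section \<open>Mean profiles along a sequence of system sizes\<close>

context frac_params begin

lemma dR_le_dE: "N >= 2 ==> dR N u <= 2 * dE N u"
 using kap killing_nonneg[of N u] by (simp add: dE_eq)

lemma killing_le_dE: "N >= 2 ==> ip N (%x. Vk (real x / real N) * u x) u <= dE N u / \<kappa>"
 using kap dR_nonneg[of N u] by (simp add: dE_eq field_simps)

lemma ip_le_dE:
 assumes N: "N >= 2"
 shows "ip N u u <= dE N u / (\<kappa> * cg)"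
proof -
 have "cg * ip N u u = 1 / (real N - 1) * (\<Sum>x\<in>bulk N. cg * (u x * u x))"
  by (simp add: ip_def sum_distrib_left mult_ac)
 also have "... <= ip N (%x. Vk (real x / real N) * u x) u"
  unfolding ip_def
 proof (intro mult_left_mono sum_mono)
  fix x assume "x : bulk N"
  then have "cg <= Vk (real x / real N)" by (intro Vk_ge) (auto simp: bulk_def)
  then have "cg * (u x * u x) <= Vk (real x / real N) * (u x * u x)" by (intro mult_right_mono) auto
  then show "cg * (u x * u x) <= Vk (real x / real N) * u x * u x" by (simp add: mult.assoc)
 qed (use N in auto)
 also have "... <= dE N u / \<kappa>" by (rule killing_le_dE[OF N])
 finally show ?thesis using kap cg by (simp add: field_simps)
qed

lemma abs_ip_le:
 assumes "N >= 2" "!!x. x : bulk N ==> |u x * v x| <= B"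
 shows "|ip N u v| <= B"
proof -
 have "ip N u v <= B" using assms by (intro ip_le) (auto simp: abs_le_iff)
 moreover have "ip N (%x. - u x) v <= B" using assms by (intro ip_le) (auto simp: abs_le_iff)
 moreover have "ip N (%x. - u x) v = - ip N u v" by (simp add: ip_def sum_negf)
 ultimately show ?thesis by simp
qed

text \<open>A smooth profile joining the two boundary values; all its derivatives up to the second vanish at both
  ends, so that subtracting it from a solution homogenizes the boundary condition at the cost of a bounded
  source.\<close>

definition prof :: "real => real" where "prof q = \<alpha> + (\<beta> - \<alpha>) * (10 * q^3 - 15 * q^4 + 6 * q^5)"

lemma prof_taylor: "taylor_bound prof (%q. (\<beta> - \<alpha>) * (30 * q^2 - 60 * q^3 + 30 * q^4)) 60"
proof (rule taylor_boundI)
 show "(prof has_real_derivative (\<beta> - \<alpha>) * (30 * q^2 - 60 * q^3 + 30 * q^4)) (at q within {0..1})" for q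
  unfolding prof_def[abs_def] by (auto intro!: derivative_eq_intros simp: algebra_simps)
 show "((%q. (\<beta> - \<alpha>) * (30 * q^2 - 60 * q^3 + 30 * q^4)) has_real_derivative (\<beta> - \<alpha>) * (60 * (q * (1 - q) * (1 - 2 * q)))) (at q within {0..1})" for q
  by (auto intro!: derivative_eq_intros simp: algebra_simps power2_eq_square power3_eq_cube)
 fix q :: real assume q: "q : {0..1}"
 have "|\<beta> - \<alpha>| * (60 * ( |q| * |1 - q| * |1 - 2 * q| )) <= 1 * (60 * (1 * 1 * 1))"
  using al be q by (intro mult_mono) auto
 then show "|(\<beta> - \<alpha>) * (60 * (q * (1 - q) * (1 - 2 * q)))| <= 60" by (simp add: abs_mult)
qed auto

lemma prof_bounds:
 assumes q: "q : {0..1}"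
 shows "0 <= prof q & prof q <= 1" "|\<alpha> - prof q| <= 10 * q^3" "|\<beta> - prof q| <= 10 * (1 - q)^3"
proof -
 define S where "S q = 10 * q^3 - 15 * q^4 + 6 * q^5" for q :: real
 have S: "0 <= S q & S q <= 10 * q^3" if "q : {0..1}" for q
 proof -
  have e: "S q = q^3 * (1 + 3 * ((1 - q) * (3 - 2 * q)))" by (simp add: S_def power_numeral_reduce algebra_simps)
  have "(1 - q) * (3 - 2 * q) <= 1 * 3" using that by (intro mult_mono) auto
  then have "q^3 * (1 + 3 * ((1 - q) * (3 - 2 * q))) <= q^3 * 10" using that by (intro mult_left_mono) auto
  moreover have "0 <= q^3 * (1 + 3 * ((1 - q) * (3 - 2 * q)))" using that by (intro mult_nonneg_nonneg add_nonneg_nonneg) auto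
  ultimately show ?thesis unfolding e by simp
 qed
 \<comment> \<open>This symmetry carries the bound at 0 over to 1.\<close>
 have e: "S (1 - q) = 1 - S q" by (simp add: S_def power_numeral_reduce algebra_simps)
 have p: "prof q = (1 - S q) * \<alpha> + S q * \<beta>" by (simp add: prof_def S_def algebra_simps)
 have S1: "0 <= S q" "S q <= 1" using S[OF q] S[of "1 - q"] q e by auto
 show "0 <= prof q & prof q <= 1"
  unfolding p using S1 al be convex_bound_le[of \<alpha> 1 \<beta> "1 - S q" "S q"] by auto
 have "|\<alpha> - prof q| = S q * |\<alpha> - \<beta>|"
 proof -
  have "\<alpha> - prof q = S q * (\<alpha> - \<beta>)" by (simp add: p algebra_simps)
  then show ?thesis using S1 by (simp add: abs_mult)
 qed
 also have "... <= S q * 1" using S1 al be by (intro mult_left_mono) auto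
 finally show "|\<alpha> - prof q| <= 10 * q^3" using S[OF q] by simp
 have "|\<beta> - prof q| = S (1 - q) * |\<beta> - \<alpha>|"
 proof -
  have "\<beta> - prof q = S (1 - q) * (\<beta> - \<alpha>)" by (simp add: p e algebra_simps)
  then show ?thesis using S1 e by (simp add: abs_mult)
 qed
 also have "... <= S (1 - q) * 1" using S1 e al be by (intro mult_left_mono) auto
 finally show "|\<beta> - prof q| <= 10 * (1 - q)^3" using S[of "1 - q"] q by simp
qed

lemma prof_cont: "continuous_on {0..1} prof"
 unfolding prof_def by (intro continuous_intros)

lemma resv_prof_bound:
 assumes "q : {0..1}"
 shows "|\<kappa> * (kern q * (\<alpha> - prof q) + kern (1 - q) * (\<beta> - prof q))| <= \<kappa> * (20 * cg)"
proof -
 have "|kern q * (\<alpha> - prof q)| <= cg * 10" "|kern (1 - q) * (\<beta> - prof q)| <= cg * 10"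
  using assms prof_bounds[OF assms] kern_cubic[of q "\<alpha> - prof q" 10] kern_cubic[of "1 - q" "\<beta> - prof q" 10] by auto
 then have "|kern q * (\<alpha> - prof q) + kern (1 - q) * (\<beta> - prof q)| <= 20 * cg" by linarith
 then show ?thesis using kap by (simp add: abs_mult)
qed

end

locale hydro = frac_params +
 fixes r :: "nat => nat" and K :: "nat => real => (nat => nat) => (nat => nat) pmf" and \<xi> :: "nat => nat => nat"
 assumes r: "filterlim r at_top sequentially" and r2: "!!k. r k >= 2"
  and tf: "!!k. transition_function (configs (r k)) (gen (r k)) (K k)"
  and \<xi>: "!!k. \<xi> k : configs (r k)"
begin

sublocale X: exclusion \<gamma> \<kappa> \<alpha> \<beta> "r k" "K k" "\<xi> k" for k
 by unfold_locales (rule r2 tf \<xi>)+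

text \<open>With the boundary profile removed, an affine equation with singular source becomes a
  \<open>heat_flow\<close> with bounded source.\<close>

definition v :: "nat => real => nat => real" where "v k t x = X.m k t x - prof (real x / real (r k))"

text \<open>The drift evaluated at \<open>prof\<close>. It is bounded because \<open>prof\<close>
  meets the boundary values to third order, which outweighs the singularity of
  \<open>kern\<close>.\<close>

definition src :: "nat => nat => real" where
 "src k x = dLap (r k) (samp (r k) prof) x + resv (r k) x (prof (real x / real (r k)))"

definition Cs :: real where "Cs = near_err 60 1 + \<kappa> * (20 * cg)"

lemma Cs_nonneg: "0 <= Cs"
 using gam kap cg by (simp add: Cs_def near_err_def)

sublocale H: heat_flow \<gamma> \<kappa> \<alpha> \<beta> "r k" "v k" "src k" Cs for k
proof unfold_locales
 show "2 <= r k" by (rule r2)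
 show "0 <= Cs" by (rule Cs_nonneg)
 show "|src k x| <= Cs" if "x : bulk (r k)" for x
  using dLap_bound[OF prof_taylor that] resv_prof_bound[OF samp_in[OF that]]
  unfolding src_def Cs_def resv_def by linarith
 show "|v k t x| <= 1" if "t >= 0" "x : bulk (r k)" for t x
  using X.m_range[OF that] prof_bounds(1)[OF samp_in[OF that(2)]] unfolding v_def by linarith
 fix t :: real and x assume t: "t >= 0" and x: "x : bulk (r k)"
 have d: "dLap (r k) (v k t) x = dLap (r k) (X.m k t) x - dLap (r k) (samp (r k) prof) x"
  using dA_diff[of "r k" "X.m k t" "samp (r k) prof" x] by (simp add: v_def[abs_def] dA_def algebra_simps)
 have "src k x - dA (r k) (v k t) x = dLap (r k) (X.m k t) x + resv (r k) x (X.m k t x)"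
  unfolding dA_def d src_def by (simp add: v_def resv_def Vk_def algebra_simps)
 moreover have "((%s. v k s x) has_real_derivative dLap (r k) (X.m k t) x + resv (r k) x (X.m k t x) - 0) (at t within {0..})"
  unfolding v_def by (intro derivative_intros X.m_deriv[OF t x])
 ultimately show "((%s. v k s x) has_real_derivative src k x - dA (r k) (v k t) x) (at t within {0..})" by simp
qed

definition c1 :: "real => real" where "c1 T = 3/2 + 3 * (T^2 * Cs^2 / 2 + Cs * T)"

lemma energy_bounds:
 assumes a: "0 < a" "a <= t" "t <= T"
 shows "dE (r k) (H.w k t) <= c1 T / a^3" "dE (r k) (v k t) <= c1 T / a"
proof -
 have t: "0 <= t" using a by simp
 have c: "3/2 + 3 * (t^2 * Cs^2 / 2 + Cs * t) <= c1 T"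
  unfolding c1_def using a Cs_nonneg by (intro add_mono mult_left_mono divide_right_mono mult_right_mono power_mono) auto
 have ip: "0 <= ip (r k) u u" for u unfolding ip_def using r2[of k] by (intro mult_nonneg_nonneg[of "1 / _"] sum_nonneg) auto
 have nn: "0 <= dE (r k) (H.w k t)" "0 <= dE (r k) (v k t)" by (intro dE_nonneg r2)+
 have L: "t^3 * dE (r k) (H.w k t) + 3/2 * (t^2 * ip (r k) (H.w k t) (H.w k t) + 2 * t * dE (r k) (v k t)) <= c1 T"
  using H.lyapunov[OF t] c by (rule order_trans)
 have p: "0 <= t^2 * ip (r k) (H.w k t) (H.w k t)" "0 <= t * dE (r k) (v k t)" "0 <= t^3 * dE (r k) (H.w k t)"
  using ip nn t by auto
 have lin: "A <= c & t * D <= c" if "A + 3/2 * (B + 2 * t * D) <= c" "0 <= A" "0 <= B" "0 <= t * D" for A B D c :: real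
 proof -
  have "3/2 * (B + 2 * t * D) = 3/2 * B + 3 * (t * D)" by (simp add: algebra_simps)
  then show ?thesis using that by linarith
 qed
 note l = lin[OF L p(3,1,2)]
 have "a^3 * dE (r k) (H.w k t) <= t^3 * dE (r k) (H.w k t)" using nn a by (intro mult_right_mono power_mono) auto
 then have "a^3 * dE (r k) (H.w k t) <= c1 T" by (rule order_trans) (rule l[THEN conjunct1])
 then show "dE (r k) (H.w k t) <= c1 T / a^3" using a(1) by (simp add: field_simps)
 have "a * dE (r k) (v k t) <= t * dE (r k) (v k t)" using nn a by (intro mult_right_mono) auto
 then have "a * dE (r k) (v k t) <= c1 T" by (rule order_trans) (rule l[THEN conjunct2])
 then show "dE (r k) (v k t) <= c1 T / a" using a(1) by (simp add: field_simps)
qed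

lemma energy_lipschitz:
 assumes "0 < a" "a <= s" "s <= t" "t <= T"
 shows "dE (r k) (%x. v k t x - v k s x) <= c1 T / a^3 * (t - s)^2"
 using assms by (intro H.energy_increment[of a]) (auto intro: energy_bounds)

text \<open>Young's inequality with parameter t - s: the squared L2 norm of the increment is of
  order (t - s)^2, so both terms are of order t - s.\<close>

lemma L1_lipschitz:
 assumes a: "0 < a" "a <= s" "s < t" "t <= T"
 shows "(IU q. |v k t (idx (r k) q) - v k s (idx (r k) q)| ) <= (1 + c1 T / a^3 / (\<kappa> * cg)) / 2 * (t - s)"
proof -
 define d where "d x = v k t x - v k s x" for x
 have "ip (r k) d d <= dE (r k) d / (\<kappa> * cg)" by (rule ip_le_dE[OF r2])
 also have "... <= c1 T / a^3 * (t - s)^2 / (\<kappa> * cg)"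
  unfolding d_def using energy_lipschitz[of a s t T k] a kap cg by (intro divide_right_mono) auto
 finally have i: "ip (r k) d d <= c1 T / a^3 * (t - s)^2 / (\<kappa> * cg)" .
 have "(IU q. |d (idx (r k) q)| ) <= (IU q. (t - s) / 2 + d (idx (r k) q) * d (idx (r k) q) / (2 * (t - s)))"
 proof (rule integral_mono)
  show "iUI (%q. |d (idx (r k) q)| )" by (rule integrable_idx)
  show "iUI (%q. (t - s) / 2 + d (idx (r k) q) * d (idx (r k) q) / (2 * (t - s)))" by (rule integrable_idx)
  fix q
  let ?d = "d (idx (r k) q)"
  have "0 <= ( |?d| - (t - s))^2 / (2 * (t - s))" using a by simp
  also have "... = (t - s) / 2 + ?d * ?d / (2 * (t - s)) - |?d|"
   using a by (simp add: power2_diff field_simps power2_eq_square)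
  finally show "|?d| <= (t - s) / 2 + ?d * ?d / (2 * (t - s))" by simp
 qed
 also have "... = (t - s) / 2 + ip (r k) d d / (2 * (t - s))"
  unfolding ip_integral[OF r2] using integrable_idx[of "%x. d x * d x" "r k"] by simp
 also have "... <= (t - s) / 2 + c1 T / a^3 * (t - s)^2 / (\<kappa> * cg) / (2 * (t - s))"
  using i a by (intro add_left_mono divide_right_mono) auto
 also have "... = (1 + c1 T / a^3 / (\<kappa> * cg)) / 2 * (t - s)"
 proof -
  have "X * (t - s)^2 / Y / (2 * (t - s)) = X / Y / 2 * (t - s)" for X Y :: real
   proof -
   define z where "z = t - s"
   have "z ~= 0" using a by (simp add: z_def)
   then show ?thesis unfolding z_def[symmetric] by (simp add: power2_eq_square)
  qed
  then show ?thesis by (simp only:) (simp add: distrib_right add_divide_distrib)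
 qed
 finally show ?thesis by (simp add: d_def)
qed

lemma integrable_cell: "iUI (%p. if idx (Suc m) p = j then u (idx (r k) p) else (0::real))"
proof (rule Bochner_Integration.integrable_bound)
 show "iUI (%p. u (idx (r k) p))" by (rule integrable_idx)
 have "(%p. (if idx (Suc m) p = j then 1 else 0) * u (idx (r k) p)) : mUI"
  by (rule borel_measurable_times[OF idx_measurable_UI idx_measurable_UI])
 moreover have "(if idx (Suc m) p = j then 1 else 0) * u (idx (r k) p) = (if idx (Suc m) p = j then u (idx (r k) p) else 0)" for p by simp
 ultimately show "(%p. if idx (Suc m) p = j then u (idx (r k) p) else 0) : mUI" by simp
 show "AE p in UI. norm (if idx (Suc m) p = j then u (idx (r k) p) else 0) <= norm (u (idx (r k) p))"
  by (rule AE_I2) simp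
qed

lemma coarse_diff_le:
 fixes a b :: "nat => real"
 shows "|coarse m (%q. a (idx (r k) q)) j - coarse m (%q. b (idx (r k) q)) j| <= real m * (IU q. |a (idx (r k) q) - b (idx (r k) q)| )"
proof -
 define A B where "A p = (if idx (Suc m) p = j then a (idx (r k) p) else 0)" and "B p = (if idx (Suc m) p = j then b (idx (r k) p) else 0)" for p
 have AB: "iUI A" "iUI B" unfolding A_def B_def by (rule integrable_cell)+
 have C: "iUI (%q. |a (idx (r k) q) - b (idx (r k) q)| )" by (rule integrable_idx)
 have "|(IU p. A p - B p)| <= (IU p. |A p - B p| )" by (rule integral_abs_bound)
 also have "... <= (IU q. |a (idx (r k) q) - b (idx (r k) q)| )"
 proof (rule integral_mono[OF _ C])
  show "iUI (%p. |A p - B p| )" using AB by simp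
  show "|A p - B p| <= |a (idx (r k) p) - b (idx (r k) p)|" for p by (simp add: A_def B_def)
 qed
 finally have "|(IU p. A p) - (IU p. B p)| <= (IU q. |a (idx (r k) q) - b (idx (r k) q)| )" using AB by simp
 then have "|real m * ((IU p. A p) - (IU p. B p))| <= real m * (IU q. |a (idx (r k) q) - b (idx (r k) q)| )"
  unfolding abs_mult by (simp add: mult_left_mono)
 moreover have "coarse m (%q. a (idx (r k) q)) j = real m * (IU p. A p)" "coarse m (%q. b (idx (r k) q)) j = real m * (IU p. B p)"
  by (simp_all only: coarse_def A_def B_def)
 ultimately show ?thesis by (simp add: right_diff_distrib)
qed

lemma coarse_lipschitz:
 assumes "0 < a" "a <= s" "s < t" "t <= T"
 shows "|coarse m (%q. v k t (idx (r k) q)) j - coarse m (%q. v k s (idx (r k) q)) j| <= real m * ((1 + c1 T / a^3 / (\<kappa> * cg)) / 2) * (t - s)"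
 using order_trans[OF coarse_diff_le mult_left_mono[OF L1_lipschitz[OF assms]]] unfolding mult.assoc by simp

text \<open>Equicontinuity in k transfers convergence from a rational time slightly before t to t
  itself.\<close>

lemma convergent_if_dense:
 fixes x :: "real => nat => real"
 assumes t: "0 < t" and lip: "!!s k. t / 2 <= s ==> s < t ==> |x t k - x s k| <= L * (t - s)"
  and cv: "!!q::rat. 0 < q ==> convergent (x (of_rat q))"
 shows "convergent (x t)"
proof (rule Cauchy_convergent, rule metric_CauchyI)
 fix e :: real assume e: "0 < e"
 define b where "b = max (t / 2) (t - e / (4 * ( |L| + 1)))"
 have "b < t" using t e by (simp add: b_def)
 then obtain q where q: "b < real_of_rat q" "real_of_rat q < t" using of_rat_dense by blast
 let ?s = "real_of_rat q"
 have s: "t / 2 <= ?s" "t - ?s <= e / (4 * ( |L| + 1))" using q(1) by (auto simp: b_def)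
 have "0 < q" using s(1) t by (simp add: zero_less_of_rat_iff[symmetric, where 'a=real] del: zero_less_of_rat_iff)
 have near: "|x t k - x ?s k| <= e / 4" for k
 proof -
  have "|x t k - x ?s k| <= L * (t - ?s)" by (rule lip[OF s(1) q(2)])
  also have "... <= ( |L| + 1) * (e / (4 * ( |L| + 1)))" using q(2) s(2) by (intro mult_mono) auto
  also have "... = e / 4"
  proof -
   have "X * (e / (4 * X)) = e / 4" if "X ~= 0" for X :: real using that by simp
   moreover have "|L| + 1 ~= 0" by linarith
   ultimately show ?thesis by blast
  qed
  finally show ?thesis .
 qed
 have "Cauchy (x ?s)" using cv[OF \<open>0 < q\<close>] by (rule convergent_Cauchy)
 then obtain n where n: "!!k l. k >= n ==> l >= n ==> dist (x ?s k) (x ?s l) < e / 4"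
  using metric_CauchyD[of "x ?s" "e/4"] e by auto
 show "\<exists>M. \<forall>k\<ge>M. \<forall>l\<ge>M. dist (x t k) (x t l) < e"
 proof (intro exI allI impI)
  fix k l assume "k >= n" "l >= n"
  then show "dist (x t k) (x t l) < e" using n[of k l] near[of k] near[of l] e unfolding dist_real_def by linarith
 qed
qed

text \<open>A diagonal argument over the countable set of cell indices and rational times, extended
  to all positive times by equicontinuity.\<close>

lemma convergent_subsequence:
 "\<exists>\<sigma>. strict_mono \<sigma> & (\<forall>t>0. \<forall>m j. convergent (%k. coarse m (%q. v (\<sigma> k) t (idx (r (\<sigma> k)) q)) j))"
proof -
 \<comment> \<open>The factor m of \<open>coarse\<close> is left out so that all coordinates are
   bounded by 1.\<close>
 define F where "F k = (%(m, j, q::rat). if 0 < q then (IU p. (if idx (Suc m) p = j then v k (of_rat q) (idx (r k) p) else 0)) else 0)" for k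
 have Fb: "norm (F k x) <= 1" for k x
 proof -
  obtain m j q where x: "x = (m, j, q)" using prod_cases3 by blast
  show ?thesis
  proof (cases "0 < q")
   case True
   then have q: "0 <= real_of_rat q" by simp
   have vb0: "|v k (of_rat q) (idx (r k) p)| <= 1" if "0 < p" "p < 1" for p
    using H.vb[OF q idx_bulk[OF r2 that]] .
      
   have "|(IU p. (if idx (Suc m) p = j then v k (of_rat q) (idx (r k) p) else 0))| <= 1"
    by (rule order_trans[OF integral_abs_bound UI.integral_le_const])
     (use vb0 in "auto intro!: AE_UI_I integrable_abs integrable_cell")
   then show ?thesis using True by (simp add: F_def x)
  qed (simp add: F_def x)
 qed
 obtain \<sigma> where \<sigma>: "strict_mono (\<sigma> :: nat => nat)" "!!x. x : UNIV ==> \<exists>l. (%n. F (\<sigma> n) x) ----> l"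
  using function_convergent_subsequence[of UNIV F 1] Fb countableI_type by blast
 have "convergent (%k. coarse m (%q. v (\<sigma> k) t (idx (r (\<sigma> k)) q)) j)" if t: "0 < t" for t m j
 proof (rule convergent_if_dense[where x="%t k. coarse m (%q. v (\<sigma> k) t (idx (r (\<sigma> k)) q)) j", OF t])
  show "|coarse m (%q. v (\<sigma> k) t (idx (r (\<sigma> k)) q)) j - coarse m (%q. v (\<sigma> k) s (idx (r (\<sigma> k)) q)) j|
   <= real m * ((1 + c1 t / (t/2)^3 / (\<kappa> * cg)) / 2) * (t - s)" if "t / 2 <= s" "s < t" for s k
   using that t by (intro coarse_lipschitz) auto
  fix q :: rat assume q: "0 < q"
  obtain l where "(%n. F (\<sigma> n) (m, j, q)) ----> l" using \<sigma>(2)[of "(m, j, q)"] by auto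
  then have "(%n. real m * F (\<sigma> n) (m, j, q)) ----> real m * l" by (rule tendsto_mult_left)
  then show "convergent (%k. coarse m (%p. v (\<sigma> k) (of_rat q) (idx (r (\<sigma> k)) p)) j)"
   unfolding coarse_def F_def using q by (auto simp: convergent_def)
 qed
 then show ?thesis using \<sigma>(1) by blast
qed

end

section \<open>Limits of pairings and energies\<close>

context frac_params begin

lemma pair_limit:
 fixes a :: "nat => real => real"
 assumes a: "!!k. iUI (a k)" "(%k. (IU q. |a k q - f q| )) ----> 0"
  and f: "f : mUI" "!!q. 0 < q ==> q < 1 ==> |f q| <= 1"
  and b: "!!k. b k : mUI" "!!k q. 0 < q ==> q < 1 ==> |b k q| <= B"
  and l: "!!q. 0 < q ==> q < 1 ==> (%k. b k q) ----> h q" and h: "h : mUI"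
 shows "(%k. (IU q. a k q * b k q)) ----> (IU q. f q * h q)"
proof -
 have fi: "iUI f" by (rule integrable_bounded_UI[OF f])
 have abi: "iUI (%q. u q * b k q)" if "iUI u" for u k
 proof (rule Bochner_Integration.integrable_bound)
  show "iUI (%q. u q * B)" using that by simp
  show "(%q. u q * b k q) : mUI" using that b(1) by (intro borel_measurable_times) auto
  show "AE q in UI. norm (u q * b k q) <= norm (u q * B)"
  proof (rule AE_UI_I)
   fix q :: real assume "0 < q" "q < 1"
   then have "|b k q| <= |B|" using b(2)[of q k] by linarith
   then show "norm (u q * b k q) <= norm (u q * B)" by (simp add: abs_mult mult_left_mono)
  qed
 qed
 have "(%k. (IU q. (a k q - f q) * b k q)) ----> 0"
 proof (rule Lim_null_comparison[OF always_eventually])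
  show "(%k. (IU q. |a k q - f q| ) * B) ----> 0" using tendsto_mult_left_zero[OF a(2)] .
  show "\<forall>k. norm (IU q. (a k q - f q) * b k q) <= (IU q. |a k q - f q| ) * B"
  proof
   fix k
   have i: "iUI (%q. a k q - f q)" using a(1) fi by simp
   have "norm (IU q. (a k q - f q) * b k q) <= (IU q. norm ((a k q - f q) * b k q))" by (rule integral_norm_bound)
   also have "... <= (IU q. |a k q - f q| * B)"
   proof (rule integral_mono)
    show "iUI (%q. norm ((a k q - f q) * b k q))" by (rule integrable_norm[OF abi[OF i]])
    show "iUI (%q. |a k q - f q| * B)" using i by simp
    fix q assume "q : space UI"
    then show "norm ((a k q - f q) * b k q) <= |a k q - f q| * B"
     unfolding real_norm_def abs_mult by (intro mult_left_mono b(2)) auto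
   qed
   finally show "norm (IU q. (a k q - f q) * b k q) <= (IU q. |a k q - f q| ) * B" by simp
  qed
 qed
 moreover have "(%k. (IU q. f q * b k q)) ----> (IU q. f q * h q)"
 proof (rule integral_dominated_convergence)
  show "iUI (%q. |f q| * |B| )" using fi by simp
  show "(%q. f q * h q) : mUI" by (rule borel_measurable_times[OF f(1) h])
  show "(%q. f q * b k q) : mUI" for k by (rule borel_measurable_times[OF f(1) b(1)])
  show "AE q in UI. (%k. f q * b k q) ----> f q * h q" by (intro AE_UI_I tendsto_mult_left l)
  show "AE q in UI. norm (f q * b k q) <= |f q| * |B|" for k
  proof (rule AE_UI_I)
   fix q :: real assume "0 < q" "q < 1"
   then have "|b k q| <= |B|" using b(2)[of q k] by linarith
   then show "norm (f q * b k q) <= |f q| * |B|" by (simp add: abs_mult mult_left_mono)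
  qed
 qed
 ultimately have "(%k. (IU q. (a k q - f q) * b k q) + (IU q. f q * b k q)) ----> 0 + (IU q. f q * h q)"
  by (rule tendsto_add)
 moreover have "(IU q. (a k q - f q) * b k q) + (IU q. f q * b k q) = (IU q. a k q * b k q)" for k
  using abi[OF a(1)] abi[OF fi] by (simp add: left_diff_distrib)
 ultimately show ?thesis by simp
qed

lemma l2_le_kil: "l2 f <= ennreal (1 / cg) * kil f" if "f : mUI"
proof -
 have "l2 f <= (NU q. ennreal (1 / cg) * ennreal (Vk q * (f q)^2))" unfolding l2_def
 proof (rule nn_integral_mono)
  fix q assume "q : space UI"
  then have "cg <= Vk q" by (intro Vk_ge) auto
  then have "(f q)^2 <= 1 / cg * (Vk q * (f q)^2)" using cg by (simp add: field_simps mult_right_mono)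
  then have "ennreal ((f q)^2) <= ennreal (1 / cg * (Vk q * (f q)^2))" by (rule ennreal_leI)
  then show "ennreal ((f q)^2) <= ennreal (1 / cg) * ennreal (Vk q * (f q)^2)" using cg by (subst (asm) ennreal_mult') auto
 qed
 also have "... = ennreal (1 / cg) * kil f" unfolding kil_def
 proof (rule nn_integral_cmult)
  have "Vk : mUI" unfolding Vk_def[abs_def] by (rule borel_UI) measurable
  then have "(%q. Vk q * (f q)^2) : mUI" using that by (intro borel_measurable_times borel_measurable_power) auto
  then show "(%q. ennreal (Vk q * (f q)^2)) : mUI" by (rule measurable_compose[OF _ measurable_ennreal])
 qed
 finally show ?thesis .
qed

lemma prof_UI: "prof : mUI"
 by (rule cont_measurable_UI[OF prof_cont])

text \<open>Lower semicontinuity along discrete samples, whose energy is twice <- dLap prof, prof>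
  and thus bounded through \<open>dLap_bound\<close>.\<close>

lemma reg_prof: "reg prof < \<infinity>"
proof -
 let ?r = "%k::nat. k + 2"
 have "reg prof <= liminf (%k. ennreal (2 * dR (?r k) (samp (?r k) prof)))"
  proof (rule reg_fatou[OF filterlim_plus2])
  show "AE q in UI. (%k. samp (?r k) prof (idx (?r k) q)) ----> prof q"
   by (rule AE_UI_I, rule samp_tendsto[OF filterlim_plus2 _ prof_cont]) simp_all
 qed simp
 also have "... <= liminf (%k. ennreal (4 * near_err 60 1))"
 proof (intro Liminf_mono always_eventually allI ennreal_leI)
  fix k
  have "|ip (?r k) (dLap (?r k) (samp (?r k) prof)) (samp (?r k) prof)| <= near_err 60 1"
  proof (rule abs_ip_le)
   fix x assume x: "x : bulk (?r k)"
   have "|dLap (?r k) (samp (?r k) prof) x| * |prof (real x / real (?r k))| <= near_err 60 1 * 1"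
    using dLap_bound[OF prof_taylor x] prof_bounds(1)[OF samp_in[OF x]] by (intro mult_mono) auto
   then show "|dLap (?r k) (samp (?r k) prof) x * prof (real x / real (?r k))| <= near_err 60 1" by (simp add: abs_mult)
  qed simp
  then show "2 * dR (?r k) (samp (?r k) prof) <= 4 * near_err 60 1" unfolding ip_dLap_self by linarith
 qed
 also have "... < \<infinity>" by (simp add: Liminf_const)
 finally show ?thesis .
qed

text \<open>f is compared with \<open>prof\<close>. The profile misses the boundary values by at
  most 10 p^3, which costs 100 \<open>cg\<close> at each end; the factor 2 from the square of a sum
  and the two ends give 400.\<close>

lemma bdry_le:
 assumes f: "f : mUI"
 shows "bdry f <= ennreal 400 + ennreal (2 / cg) * kil (%q. f q - prof q)"
proof -
 have km: "(%q. ennreal (Vk q * (f q - prof q)^2)) : mUI"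
 proof -
  have "Vk : mUI" unfolding Vk_def[abs_def] by (rule borel_UI) measurable
  then have "(%q. Vk q * (f q - prof q)^2) : mUI"
   using f prof_UI by (intro borel_measurable_times borel_measurable_power borel_measurable_diff) auto
  then show ?thesis by (rule measurable_compose[OF _ measurable_ennreal])
 qed
 have "bdry f <= (NU q. ennreal 400 + ennreal (2 / cg) * ennreal (Vk q * (f q - prof q)^2))"
  unfolding bdry_def
 proof (rule nn_integral_mono)
  fix q assume "q : space UI"
  then have q: "0 < q" "q < 1" "q : {0..1}" by auto
  note pb = prof_bounds[OF q(3)]
  have one: "kern p * (a - f q)^2 <= 2 * (cg * 100) + 2 * (kern p * (f q - prof q)^2)"
   if p: "p : {0..1}" and a: "|a - prof q| <= 10 * p^3" for p a
  proof -
   have "p^3 <= 1" using p by (simp add: power_le_one)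
   then have a10: "|a - prof q| <= 10" using a by linarith
   have "|kern p * (a - prof q)| * |a - prof q| <= (cg * 10) * 10"
    using kern_cubic[of p "a - prof q" 10] p a a10 cg by (intro mult_mono) auto
   then have k: "kern p * (a - prof q)^2 <= cg * 100"
    by (simp add: abs_mult power2_eq_square mult.assoc abs_mult_self_eq)
   have "(a - f q)^2 <= 2 * (a - prof q)^2 + 2 * (f q - prof q)^2"
    using zero_le_power2[of "(a - prof q) + (f q - prof q)"] by (simp add: power2_eq_square algebra_simps)
   then have "kern p * (a - f q)^2 <= kern p * (2 * (a - prof q)^2 + 2 * (f q - prof q)^2)" by (rule mult_left_mono) simp
   then show ?thesis using k by (simp add: algebra_simps)
  qed
  have "(\<alpha> - f q)^2 / q powr (1 + \<gamma>) + (\<beta> - f q)^2 / (1 - q) powr (1 + \<gamma>) = (kern q * (\<alpha> - f q)^2 + kern (1 - q) * (\<beta> - f q)^2) / cg"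
   using q cg by (simp add: kern_inverse field_simps)
  also have "... <= (400 * cg + 2 * (Vk q * (f q - prof q)^2)) / cg"
   using one[OF q(3) pb(2)] one[of "1 - q" \<beta>] pb(3) q cg
   by (intro divide_right_mono) (auto simp: Vk_def distrib_right)
  also have "... = 400 + 2 / cg * (Vk q * (f q - prof q)^2)" using cg by (simp add: field_simps)
  finally have "ennreal ((\<alpha> - f q)^2 / q powr (1 + \<gamma>) + (\<beta> - f q)^2 / (1 - q) powr (1 + \<gamma>)) <= ennreal (400 + 2 / cg * (Vk q * (f q - prof q)^2))"
   by (rule ennreal_leI)
  also have "... = ennreal 400 + ennreal (2 / cg) * ennreal (Vk q * (f q - prof q)^2)"
  proof -
   have "0 <= Vk q" unfolding Vk_def by (intro add_nonneg_nonneg) simp_all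
   then have "ennreal (400 + 2 / cg * (Vk q * (f q - prof q)^2)) = ennreal 400 + ennreal (2 / cg * (Vk q * (f q - prof q)^2))"
    using cg by (intro ennreal_plus) auto
   also have "ennreal (2 / cg * (Vk q * (f q - prof q)^2)) = ennreal (2 / cg) * ennreal (Vk q * (f q - prof q)^2)"
    using cg by (intro ennreal_mult') auto
   finally show ?thesis .
  qed
  finally show "ennreal ((\<alpha> - f q)^2 / q powr (1 + \<gamma>) + (\<beta> - f q)^2 / (1 - q) powr (1 + \<gamma>)) <= ..." .
 qed
 also have "... = ennreal 400 + ennreal (2 / cg) * kil (%q. f q - prof q)"
  unfolding kil_def using km UI.emeasure_space_1 by (subst nn_integral_add) (auto simp: nn_integral_cmult)
 finally show ?thesis .
qed

end

context hydro begin

text \<open>The factor 4 is the 2 of \<open>reg_fatou\<close> times the 2 of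
  \<open>dR_le_dE\<close>.\<close>

lemma limit_energy:
 assumes f: "f : mUI" "!!q. 0 < q ==> q < 1 ==> |f q| <= B"
  and L1: "(%k. (IU q. |u k (idx (r k) q) - f q| )) ----> 0"
 shows "reg f <= liminf (%k. ennreal (4 * dE (r k) (u k)))" "kil f <= liminf (%k. ennreal (1 / \<kappa> * dE (r k) (u k)))"
proof -
 have fi: "iUI f" by (rule integrable_bounded_UI[OF f])
 have rs: "filterlim (%k. r (s k)) at_top sequentially" if "strict_mono s" for s :: "nat => nat"
  using filterlim_compose[OF r filterlim_subseq[OF that]] .
 show "reg f <= liminf (%k. ennreal (4 * dE (r k) (u k)))"
 proof (rule L1_liminf[OF integrable_idx fi L1])
  fix s :: "nat => nat" assume s: "strict_mono s" "AE q in UI. (%k. u (s k) (idx (r (s k)) q)) ----> f q"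
  have "reg f <= liminf (%k. ennreal (2 * dR (r (s k)) (u (s k))))" by (rule reg_fatou[OF rs[OF s(1)] r2 s(2)])
  also have "... <= liminf (%k. ennreal (4 * dE (r (s k)) (u (s k))))"
  proof (intro Liminf_mono always_eventually allI ennreal_leI)
   show "2 * dR (r (s k)) (u (s k)) <= 4 * dE (r (s k)) (u (s k))" for k using dR_le_dE[OF r2, of "s k" "u (s k)"] by simp
  qed
  finally show "reg f <= liminf (%k. ennreal (4 * dE (r (s k)) (u (s k))))" .
 qed
 show "kil f <= liminf (%k. ennreal (1 / \<kappa> * dE (r k) (u k)))"
 proof (rule L1_liminf[OF integrable_idx fi L1])
  fix s :: "nat => nat" assume s: "strict_mono s" "AE q in UI. (%k. u (s k) (idx (r (s k)) q)) ----> f q"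
  have "kil f <= liminf (%k. ennreal (ip (r (s k)) (%x. Vk (real x / real (r (s k))) * u (s k) x) (u (s k))))"
   by (rule kil_fatou[OF rs[OF s(1)] r2 s(2)])
  also have "... <= liminf (%k. ennreal (1 / \<kappa> * dE (r (s k)) (u (s k))))"
  proof (intro Liminf_mono always_eventually allI ennreal_leI)
   show "ip (r (s k)) (%x. Vk (real x / real (r (s k))) * u (s k) x) (u (s k)) <= 1 / \<kappa> * dE (r (s k)) (u (s k))" for k
    using killing_le_dE[OF r2, of "s k" "u (s k)"] by simp
  qed
  finally show "kil f <= liminf (%k. ennreal (1 / \<kappa> * dE (r (s k)) (u (s k))))" .
 qed
qed

lemma liminf_energy_measurable:
 "(%s. liminf (%k. ennreal (c * dE (r k) (v k s)))) : borel_measurable (lebesgue_on {0..T})"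
proof (intro borel_measurable_liminf)
 fix k
 have "(%s. c * dE (r k) (v k s)) : borel_measurable (lebesgue_on {0..T})"
  by (intro continuous_imp_measurable_on_sets_lebesgue continuous_intros H.continuous_Ev) simp
 then show "(%s. ennreal (c * dE (r k) (v k s))) : borel_measurable (lebesgue_on {0..T})" by (rule measurable_compose[OF _ measurable_ennreal])
qed

text \<open>Fatou's lemma in time applied to the integrated energy bound; it covers times near 0,
  where the pointwise bounds blow up.\<close>

lemma time_liminf:
 assumes c: "0 <= c" and T: "0 <= T"
 shows "(\<integral>\<^sup>+s. liminf (%k. ennreal (c * dE (r k) (v k s))) \<partial>lebesgue_on {0..T}) <= ennreal (c * (1/2 + Cs * T))"
proof -
 let ?X = "lebesgue_on {0..T}"
 have m: "(%s. c * dE (r k) (v k s)) : borel_measurable ?X" for k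
  by (intro continuous_imp_measurable_on_sets_lebesgue continuous_intros H.continuous_Ev) simp
 have "(\<integral>\<^sup>+s. liminf (%k. ennreal (c * dE (r k) (v k s))) \<partial>?X) <= liminf (%k. \<integral>\<^sup>+s. ennreal (c * dE (r k) (v k s)) \<partial>?X)"
  by (rule nn_integral_liminf) (rule measurable_compose[OF m measurable_ennreal])
 also have "... <= liminf (%k. ennreal (c * (1/2 + Cs * T)))"
 proof (intro Liminf_mono always_eventually allI)
  fix k
  have co: "continuous_on {0..T} (%s. c * dE (r k) (v k s))" by (intro continuous_intros H.continuous_Ev)
  have nn: "0 <= c * dE (r k) (v k s)" for s using c dE_nonneg[OF r2, of k "v k s"] by simp
  have ab: "(%s. c * dE (r k) (v k s)) absolutely_integrable_on {0..T}"
   using integrable_continuous_interval[OF co] nn by (intro nonnegative_absolutely_integrable_1) auto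
  have "(\<integral>\<^sup>+s. ennreal (c * dE (r k) (v k s)) \<partial>?X) = ennreal (\<integral>s. c * dE (r k) (v k s) \<partial>?X)"
  proof (rule nn_integral_eq_integral)
   show "integrable ?X (%s. c * dE (r k) (v k s))" using ab by (subst integrable_restrict_space) (auto simp: set_integrable_def)
  qed (use nn in auto)
  also have "(\<integral>s. c * dE (r k) (v k s) \<partial>?X) = integral {0..T} (%s. c * dE (r k) (v k s))"
   proof -
   have "(\<integral>s. c * dE (r k) (v k s) \<partial>?X) = (LINT s:{0..T}|lebesgue. c * dE (r k) (v k s))"
    unfolding set_lebesgue_integral_def by (rule integral_restrict_space) simp
   then show ?thesis using set_lebesgue_integral_eq_integral(2)[OF ab] by (rule trans)
  qed
  also have "... <= c * (1/2 + Cs * T)" using c H.integral_energy_le[OF T, of k] by (simp add: mult_left_mono)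
  finally show "(\<integral>\<^sup>+s. ennreal (c * dE (r k) (v k s)) \<partial>?X) <= ennreal (c * (1/2 + Cs * T))"
   by (simp add: ennreal_leI)
 qed
 also have "... = ennreal (c * (1/2 + Cs * T))" by (simp add: Liminf_const)
 finally show ?thesis .
qed

end

section \<open>Limit points are weak solutions\<close>

locale hydro_limit = hydro +
 fixes T :: real and g :: "real => real"
 assumes T: "0 < T" and g: "g : {0..1} \<rightarrow> {0..1}" "g : borel_measurable (lebesgue_on {0..1})"
  and init: "!!G. continuous_on {0..1} G ==> (%k. empirical (r k) G (\<xi> k)) ----> (LINT q:{0..1}|lebesgue. G q * g q)"
  and cc: "!!t m j. 0 < t ==> convergent (%k. coarse m (%q. v k t (idx (r k) q)) j)"
begin

definition is_limit :: "real => (real => real) => bool" where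
 "is_limit t u \<longleftrightarrow> u : mUI & (\<forall>q. |u q| <= 1) & (%k. (IU q. |v k t (idx (r k) q) - u q| )) ----> 0"

lemma is_limit_ex: "\<exists>u. is_limit t u" if t: "0 < t"
proof (rule strong_compactness[OF r r2, of "%k. v k t" "2 * (c1 t / t)"])
 show "|v k t x| <= 1" if "x : bulk (r k)" for k x using H.vb[OF _ that] t by simp
 show "dR (r k) (v k t) <= 2 * (c1 t / t)" for k
  using dR_le_dE[OF r2, of k "v k t"] energy_bounds(2)[OF t order_refl order_refl, of k] by linarith
 show "convergent (%k. coarse m (%q. v k t (idx (r k) q)) j)" for m j by (rule cc[OF t])
 fix f assume "f : mUI" "!!q. |f q| <= 1" "(%k. (IU q. |v k t (idx (r k) q) - f q| )) ----> 0"
 then show ?thesis by (auto simp: is_limit_def)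
qed

text \<open>At time 0 no energy bound is available and the value is prescribed. At later times the
  limit is clipped so that it lies in [0,1] everywhere and not just almost everywhere.\<close>

definition sol :: "real => real => real" where
 "sol t q = (if t = 0 then g q else max 0 (min 1 ((SOME u. is_limit t u) q + prof q)))"

definition y :: "real => real => real" where "y t q = sol t q - prof q"

lemma sol_measurable: "0 <= t ==> sol t : mUI"
proof (cases "t = 0")
 case True
 then show ?thesis using g(2) unfolding measurable_UI_closed by (simp add: sol_def[abs_def])
next
 case False
 assume "0 <= t"
 then have "0 < t" using False by simp
 then have "is_limit t (SOME u. is_limit t u)" by (intro someI_ex[of "is_limit t"] is_limit_ex)
 then have "(SOME u. is_limit t u) : mUI" by (simp add: is_limit_def)
 then have "(%q. max 0 (min 1 ((SOME u. is_limit t u) q + prof q))) : mUI"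
  using prof_UI by (intro borel_measurable_max borel_measurable_min borel_measurable_add) auto
 then show ?thesis using False by (simp add: sol_def[abs_def])
qed

lemma sol_range: "q : {0..1} ==> 0 <= sol t q & sol t q <= 1"
 using g(1) by (auto simp: sol_def Pi_iff)

lemma sol_bound: "0 < q ==> q < 1 ==> |sol t q| <= 1"
 using sol_range[of q t] by auto

lemma y_measurable: "0 <= t ==> y t : mUI"
 unfolding y_def[abs_def] by (intro borel_measurable_diff sol_measurable prof_UI)

lemma y_bound: "0 < q ==> q < 1 ==> |y t q| <= 1"
 using sol_range[of q t] prof_bounds(1)[of q] by (auto simp: y_def)

lemma L1_limits:
 assumes t: "0 < t"
 shows "(%k. (IU q. |v k t (idx (r k) q) - y t q| )) ----> 0" "(%k. (IU q. |X.m k t (idx (r k) q) - sol t q| )) ----> 0"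
proof -
 define u where "u = (SOME u. is_limit t u)"
 have "is_limit t u" unfolding u_def by (rule someI_ex[OF is_limit_ex[OF t]])
 then have u: "u : mUI" "!!q. |u q| <= 1" "(%k. (IU q. |v k t (idx (r k) q) - u q| )) ----> 0"
  by (auto simp: is_limit_def)
 have ui: "iUI u" by (rule integrable_bounded_UI[OF u(1)]) (rule u(2))
 have pi: "iUI prof" by (rule integrable_bounded_UI[OF prof_UI, where B=1]) (use prof_bounds(1) in auto)
 have si: "iUI (sol t)" using t by (intro integrable_bounded_UI[OF sol_measurable sol_bound]) auto
 have yi: "iUI (y t)" unfolding y_def[abs_def] using si pi by simp
 let ?p = "%k q. prof (real (idx (r k) q) / real (r k))"
 have ppi: "iUI (?p k)" for k by (rule integrable_idx)
 have pl: "(%k. (IU q. |?p k q - prof q| )) ----> (IU q. 0)"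
 proof (rule integral_dominated_convergence[where w="%_. 1"])
  show "AE q in UI. (%k. |?p k q - prof q| ) ----> 0"
   by (intro AE_UI_I tendsto_rabs_zero LIM_zero samp_tendsto[OF r r2 prof_cont])
  show "AE q in UI. norm |?p k q - prof q| <= 1" for k
  proof (rule AE_UI_I)
   fix q :: real assume q: "0 < q" "q < 1"
   show "norm |?p k q - prof q| <= 1"
    using prof_bounds(1)[of q] prof_bounds(1)[OF samp_in[OF idx_bulk[OF r2 q]], of k] q by auto
  qed
  show "(%q. |?p k q - prof q| ) : mUI" for k using ppi[of k] pi by simp
 qed auto
 have mb: "0 <= X.m k t (idx (r k) q) & X.m k t (idx (r k) q) <= 1" if "0 < q" "q < 1" for k q
  using X.m_range[OF _ idx_bulk[OF r2 that]] t by simp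
 \<comment> \<open>The means already lie in [0,1] and clipping is 1-Lipschitz, so it does not spoil
   the convergence.\<close>
 have a: "|X.m k t (idx (r k) q) - sol t q| <= |v k t (idx (r k) q) - u q| + |?p k q - prof q|" if "0 < q" "q < 1" for k q
 proof -
  have "sol t q = max 0 (min 1 (u q + prof q))" using t by (simp add: sol_def u_def)
  moreover have "X.m k t (idx (r k) q) = v k t (idx (r k) q) + ?p k q" by (simp add: v_def)
  ultimately show ?thesis using mb[OF that, of k] by linarith
 qed
 have lim: "(%k. (IU q. |v k t (idx (r k) q) - u q| ) + c * (IU q. |?p k q - prof q| )) ----> 0" for c
  using tendsto_add[OF u(3) tendsto_mult_left[OF pl, of c]] by simp
 have sumi: "iUI (%q. |v k t (idx (r k) q) - u q| + c * |?p k q - prof q| )" for k c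
  using integrable_idx[of "v k t" "r k"] ui ppi[of k] pi by (intro Bochner_Integration.integrable_add) auto
 have sume: "(IU q. |v k t (idx (r k) q) - u q| + c * |?p k q - prof q| ) = (IU q. |v k t (idx (r k) q) - u q| ) + c * (IU q. |?p k q - prof q| )" for k c
  using integrable_idx[of "v k t" "r k"] ui ppi[of k] pi by simp
 have gen: "(%k. (IU q. |w k q - f q| )) ----> 0"
  if w: "!!k. iUI (w k)" "iUI f" "!!k q. 0 < q ==> q < 1 ==> |w k q - f q| <= |v k t (idx (r k) q) - u q| + c * |?p k q - prof q|"
  for w :: "nat => real => real" and f c
 proof (rule Lim_null_comparison[OF always_eventually lim[of c]], rule allI)
  fix k
  have "(IU q. |w k q - f q| ) <= (IU q. |v k t (idx (r k) q) - u q| + c * |?p k q - prof q| )"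
   using w(1)[of k] w(2) w(3) by (intro integral_mono sumi) auto
  then show "norm (IU q. |w k q - f q| ) <= (IU q. |v k t (idx (r k) q) - u q| ) + c * (IU q. |?p k q - prof q| )"
   unfolding sume by simp
 qed
 show "(%k. (IU q. |X.m k t (idx (r k) q) - sol t q| )) ----> 0"
  by (rule gen[where w="%k q. X.m k t (idx (r k) q)" and c=1, OF integrable_idx si]) (use a in simp)
 \<comment> \<open>Relative to the means, both profiles are subtracted, one sampled and one exact;
   their difference enters a second time.\<close>
 show "(%k. (IU q. |v k t (idx (r k) q) - y t q| )) ----> 0"
 proof (rule gen[where w="%k q. v k t (idx (r k) q)" and c=2, OF integrable_idx yi])
  fix k and p :: real assume p: "0 < p" "p < 1"
  show "|v k t (idx (r k) p) - y t p| <= |v k t (idx (r k) p) - u p| + 2 * |?p k p - prof p|"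
   proof -
   have "|v k t (idx (r k) p) - y t p| <= |X.m k t (idx (r k) p) - sol t p| + |?p k p - prof p|"
    unfolding y_def v_def by linarith
   from order_trans[OF this add_right_mono[OF a[OF p]]] show ?thesis unfolding mult_2 add.assoc[symmetric] .
  qed
 qed
qed

definition R :: "real => ennreal" where "R t = liminf (%k. ennreal (4 * dE (r k) (v k t)))"

lemma reg_y: "0 < t ==> reg (y t) <= R t"
 and kil_y: "0 < t ==> kil (y t) <= liminf (%k. ennreal (1 / \<kappa> * dE (r k) (v k t)))"
 unfolding R_def by (intro limit_energy[OF y_measurable y_bound L1_limits(1)]; simp)+

lemma R_finite: "R t < \<infinity>" if t: "0 < t"
proof -
 have "R t <= liminf (%k. ennreal (4 * (c1 t / t)))"
  unfolding R_def using energy_bounds(2)[OF t order_refl order_refl]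
  by (intro Liminf_mono always_eventually allI ennreal_leI mult_left_mono) auto
 also have "... < \<infinity>" by (simp add: Liminf_const)
 finally show ?thesis .
qed

lemma reg_sol: "reg (sol t) <= 2 * reg prof + 2 * R t" if t: "0 < t"
proof -
 have "reg (sol t) <= ennreal (1 + 1) * reg prof + ennreal (1 + 1 / 1) * reg (%q. prof q - sol t q)"
  using t by (intro reg_split prof_UI sol_measurable) auto
 also have "reg (%q. prof q - sol t q) = reg (y t)"
 proof -
  have "(prof q - sol t q - (prof p - sol t p))^2 = (y t q - y t p)^2" for q p
   unfolding y_def by (simp add: power2_eq_square algebra_simps)
  then show ?thesis by (simp add: reg_def)
 qed
 also have "ennreal (1 + 1) * reg prof + ennreal (1 + 1 / 1) * reg (y t) <= 2 * reg prof + 2 * R t"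
  using reg_y[OF t] by (simp add: mult_left_mono)
 finally show ?thesis .
qed

lemma l2_sol: "l2 (sol t) <= 1"
proof -
 have "l2 (sol t) <= (NU q. 1)" unfolding l2_def
 proof (rule nn_integral_mono)
  fix q assume "q : space UI"
  then have "|sol t q| <= 1" using sol_bound by simp
  then have "(sol t q)^2 <= 1" by (simp add: abs_square_le_1)
  then show "ennreal ((sol t q)^2) <= 1" by (metis ennreal_1 ennreal_leI)
 qed
 then show ?thesis using UI.emeasure_space_1 by simp
qed

lemma sobolev_sol_le: "sobolev_norm_sq \<gamma> (sol t) <= 1 + (reg prof + R t)" if t: "0 < t"
proof -
 have "ennreal (1/2) * ennreal 2 = 1" by (subst ennreal_mult[symmetric]) auto
 then have "ennreal (1/2) * 2 = 1" unfolding ennreal_numeral .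
 then have e: "ennreal (1/2) * (2 * x + 2 * z) = x + z" for x z :: ennreal
  unfolding distrib_left mult.assoc[symmetric] by simp
 have "sobolev_norm_sq \<gamma> (sol t) <= 1 + ennreal (1/2) * (2 * reg prof + 2 * R t)"
  using t by (subst sobolev_norm_reg) (auto intro!: sol_measurable add_mono l2_sol mult_left_mono reg_sol)
 then show ?thesis unfolding e .
qed

lemma sol_sobolev: "sol t : sobolev \<gamma>" if t: "0 < t"
proof -
 have "sobolev_norm_sq \<gamma> (sol t) < \<infinity>"
  using R_finite[OF t] reg_prof by (intro le_less_trans[OF sobolev_sol_le[OF t]]) auto
 then show ?thesis using sol_measurable[of t] t by (simp add: sobolev_def)
qed

text \<open>The limiting energies of an increment: 1/(\<kappa> cg) comes from the L2 part, bounded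
  through \<open>kil\<close>, and 2 is half of the factor 4 in \<open>limit_energy\<close>.\<close>

definition Dl :: "real => real" where "Dl a = c1 T / a^3 * (1 / (\<kappa> * cg) + 2)"

lemma c1_nonneg: "0 <= t ==> 0 <= c1 t"
 using Cs_nonneg by (simp add: c1_def)

text \<open>The Lipschitz bound in discrete energy survives by lower semicontinuity. It makes the
  solution continuous in time with values in the Sobolev space, away from time 0, and hence
  measurable.\<close>

lemma sobolev_lipschitz_le:
 assumes a: "0 < a" "a <= s" "s <= t" "t <= T"
 shows "sobolev_norm_sq \<gamma> (%q. sol t q - sol s q) <= ennreal (Dl a * (t - s)^2)"
proof -
 define E where "E = c1 T / a^3 * (t - s)^2"
 have E: "0 <= E" using c1_nonneg[of T] T a by (simp add: E_def)
 have pos: "0 < s" "0 < t" "0 <= s" "0 <= t" using a by auto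
 let ?f = "%q. y t q - y s q"
 have fm: "?f : mUI" using pos by (intro borel_measurable_diff y_measurable) auto
 have fb: "|?f q| <= 2" if "0 < q" "q < 1" for q using y_bound[OF that, of t] y_bound[OF that, of s] by linarith
 have yi: "iUI (y t)" "iUI (y s)" using pos by (auto intro!: integrable_bounded_UI[OF y_measurable y_bound])
 have L1: "(%k. (IU q. |(v k t (idx (r k) q) - v k s (idx (r k) q)) - ?f q| )) ----> 0"
 proof (rule Lim_null_comparison[OF always_eventually])
  show "(%k. (IU q. |v k t (idx (r k) q) - y t q| ) + (IU q. |v k s (idx (r k) q) - y s q| )) ----> 0"
   using tendsto_add[OF L1_limits(1)[OF pos(2)] L1_limits(1)[OF pos(1)]] by simp
  show "\<forall>k. norm (IU q. |(v k t (idx (r k) q) - v k s (idx (r k) q)) - ?f q| )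
   <= (IU q. |v k t (idx (r k) q) - y t q| ) + (IU q. |v k s (idx (r k) q) - y s q| )"
  proof
   fix k
   have i: "iUI (%q. v k t (idx (r k) q))" "iUI (%q. v k s (idx (r k) q))" by (rule integrable_idx)+
   have "(IU q. |(v k t (idx (r k) q) - v k s (idx (r k) q)) - ?f q| )
    <= (IU q. |v k t (idx (r k) q) - y t q| + |v k s (idx (r k) q) - y s q| )"
    using i yi by (intro integral_mono) auto
   then show "norm (IU q. |(v k t (idx (r k) q) - v k s (idx (r k) q)) - ?f q| )
    <= (IU q. |v k t (idx (r k) q) - y t q| ) + (IU q. |v k s (idx (r k) q) - y s q| )"
    using i yi by simp
  qed
 qed
 have bd: "liminf (%k. ennreal (c * dE (r k) (%x. v k t x - v k s x))) <= ennreal (c * E)" if "0 <= c" for c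
 proof -
  have "liminf (%k. ennreal (c * dE (r k) (%x. v k t x - v k s x))) <= liminf (%k::nat. ennreal (c * E))"
   using energy_lipschitz[OF a] that unfolding E_def
   by (intro Liminf_mono always_eventually allI ennreal_leI mult_left_mono) auto
  then show ?thesis by (simp add: Liminf_const)
 qed
 have rg: "reg ?f <= ennreal (4 * E)" and kl: "kil ?f <= ennreal (1 / \<kappa> * E)"
  using limit_energy[OF fm fb L1] bd[of 4] bd[of "1 / \<kappa>"] kap by (auto intro: order_trans)
 have "sobolev_norm_sq \<gamma> ?f = l2 ?f + ennreal (1/2) * reg ?f" by (rule sobolev_norm_reg[OF fm])
 also have "... <= ennreal (1 / cg) * ennreal (1 / \<kappa> * E) + ennreal (1/2) * ennreal (4 * E)"
  by (intro add_mono mult_left_mono rg order_trans[OF l2_le_kil[OF fm]] kl) auto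
 also have "... = ennreal (Dl a * (t - s)^2)"
 proof -
  have "ennreal (1 / cg) * ennreal (1 / \<kappa> * E) = ennreal (1 / cg * (1 / \<kappa> * E))"
   using cg kap E by (intro ennreal_mult[symmetric]) auto
  moreover have "ennreal (1/2) * ennreal (4 * E) = ennreal (1/2 * (4 * E))"
   using E by (intro ennreal_mult[symmetric]) auto
  moreover have "ennreal (1 / cg * (1 / \<kappa> * E)) + ennreal (1/2 * (4 * E)) = ennreal (1 / cg * (1 / \<kappa> * E) + 1/2 * (4 * E))"
   using cg kap E by (intro ennreal_plus[symmetric]) auto
  moreover have "1 / cg * (1 / \<kappa> * E) + 1/2 * (4 * E) = Dl a * (t - s)^2"
   proof -
   have "1 / cg * (1 / \<kappa> * (X * Z)) + 1/2 * (4 * (X * Z)) = X * (1 / (\<kappa> * cg) + 2) * Z" for X Z :: real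
    by (simp add: algebra_simps)
   then show ?thesis unfolding Dl_def E_def .
  qed
  ultimately show ?thesis by simp
 qed
 finally show ?thesis by (simp add: y_def)
qed

lemma sobolev_lipschitz:
 assumes a: "0 < a" "a <= s" "a <= t" "s <= T" "t <= T"
 shows "sobolev_norm_sq \<gamma> (%q. sol t q - sol s q) <= ennreal (Dl a * (t - s)^2)"
proof (cases "s <= t")
 case True
 then show ?thesis using a by (intro sobolev_lipschitz_le) auto
next
 case False
 have "sobolev_norm_sq \<gamma> (%q. sol t q - sol s q) = sobolev_norm_sq \<gamma> (%q. sol s q - sol t q)"
 proof -
  have "(sol t q - sol s q - (sol t p - sol s p))^2 = (sol s q - sol t q - (sol s p - sol t p))^2"
   "(sol t q - sol s q)^2 = (sol s q - sol t q)^2" for q p by (simp_all add: power2_eq_square algebra_simps)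
  then show ?thesis unfolding sobolev_norm_sq_def by simp
 qed
 also have "... <= ennreal (Dl a * (s - t)^2)" using False a by (intro sobolev_lipschitz_le) auto
 finally show ?thesis by (simp add: power2_commute)
qed

text \<open>The value at time zero is replaced by \<open>0\<close>, since \<open>g\<close> need not lie in the Sobolev space.\<close>

definition solS :: "real => real => real" where "solS t = (if t = 0 then (%_. 0) else sol t)"

lemma zero_sobolev: "(%_. 0) : sobolev \<gamma>" by (simp add: sobolev_def sobolev_norm_sq_def)

text \<open>The preimage of an open set is relatively open in (0, T], up to the single time
  0.\<close>

lemma solS_measurable: "solS : lebesgue_on {0..T} \<rightarrow>\<^sub>M sobolev_borel \<gamma>"
 unfolding sobolev_borel_def
proof (rule measurable_measure_of)
 show "{U. sobolev_open \<gamma> U} \<subseteq> Pow (sobolev \<gamma>)" by (auto simp: sobolev_open_def)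
 show "solS : space (lebesgue_on {0..T}) \<rightarrow> sobolev \<gamma>" using sol_sobolev zero_sobolev by (auto simp: solS_def)
 fix U assume "U : {U. sobolev_open \<gamma> U}"
 then have U: "!!f. f : U ==> \<exists>e>0. \<forall>h\<in>sobolev \<gamma>. sobolev_norm_sq \<gamma> (%q. f q - h q) < ennreal (e^2) --> h : U"
  by (auto simp: sobolev_open_def)
 define S where "S = {t : {0<..T}. sol t : U}"
 have "openin (top_of_set {0<..T}) S"
  unfolding openin_euclidean_subtopology_iff
 proof (intro conjI ballI)
  show "S \<subseteq> {0<..T}" by (auto simp: S_def)
  fix t assume "t : S"
  then have t: "0 < t" "t <= T" "sol t : U" by (auto simp: S_def)
  obtain e where e: "e > 0" "!!h. h : sobolev \<gamma> ==> sobolev_norm_sq \<gamma> (%q. sol t q - h q) < ennreal (e^2) ==> h : U"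
   using U[OF t(3)] by blast
  define D where "D = Dl (t/2)"
  have D: "0 <= D" unfolding D_def Dl_def using c1_nonneg[of T] T t kap cg by (intro mult_nonneg_nonneg add_nonneg_nonneg divide_nonneg_nonneg) auto
  show "\<exists>e>0. \<forall>x'\<in>{0<..T}. dist x' t < e --> x' : S"
  proof (intro exI[of _ "min (t/2) (e / (D + 1))"] conjI ballI impI)
   show "0 < min (t/2) (e / (D + 1))" using t e D by simp
   fix s assume s: "s : {0<..T}" "dist s t < min (t/2) (e / (D + 1))"
   then have d: "|t - s| < t/2" "|t - s| < e / (D + 1)" by (auto simp: dist_real_def abs_minus_commute)
   then have "t/2 <= s" by linarith
   have "(D + 1) * |t - s| < e" using d(2) D by (simp add: field_simps)
   then have "((D + 1) * |t - s| )^2 < e^2" using D by (intro power_strict_mono) auto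
   moreover have "D * (t - s)^2 <= ((D + 1) * |t - s| )^2"
   proof -
    have "D <= (D + 1)^2" using D by (simp add: power2_eq_square algebra_simps)
    then show ?thesis unfolding power_mult_distrib power2_abs by (rule mult_right_mono) simp
   qed
   ultimately have "D * (t - s)^2 < e^2" by linarith
   then have "ennreal (D * (t - s)^2) < ennreal (e^2)" using e by (intro ennreal_lessI) auto
   then have "sobolev_norm_sq \<gamma> (%q. sol t q - sol s q) < ennreal (e^2)"
    using sobolev_lipschitz[of "t/2" s t] t s \<open>t/2 <= s\<close> unfolding D_def by (auto intro: le_less_trans)
   then have "sol s : U" using sol_sobolev s by (intro e(2)) auto
   then show "s : S" using s by (simp add: S_def)
  qed
 qed
 then obtain O' where O: "open O'" "S = {0<..T} \<inter> O'" by (auto simp: openin_open)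
 then have Sm: "S : sets lebesgue" by (auto intro!: sets_completionI_sets)
 have eq: "solS -` U \<inter> space (lebesgue_on {0..T}) = ({0} \<inter> {t. (%_. 0) : U}) \<union> S"
 proof (intro set_eqI)
  fix t
  show "t : solS -` U \<inter> space (lebesgue_on {0..T}) \<longleftrightarrow> t : ({0} \<inter> {t. (%_. 0) : U}) \<union> S"
   using T by (cases "t = 0") (auto simp: S_def solS_def)
 qed
 have "({0} \<inter> {t::real. (%_. 0) : U}) : sets lebesgue" by (cases "(%_. 0) : U") auto
 then have "({0} \<inter> {t. (%_. 0) : U}) \<union> S : sets lebesgue" using Sm by (rule sets.Un)
 moreover have "({0} \<inter> {t. (%_. 0) : U}) \<union> S \<subseteq> {0..T}" using T by (auto simp: S_def)
 ultimately show "solS -` U \<inter> space (lebesgue_on {0..T}) : sets (lebesgue_on {0..T})"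
  unfolding eq by (subst sets_restrict_space_iff) auto
qed

lemma AE_time: "AE t in lebesgue_on {0..T}. 0 < t & t <= T"
proof -
 have "AE t in lebesgue. t ~= (0::real)"
  using negligible_sing[of "0::real"] by (intro AE_I'[of "{0}"]) (auto simp: negligible_iff_null_sets)
 then show ?thesis by (subst AE_restrict_space_iff) (auto elim: AE_mp)
qed

lemma R_integral: "(\<integral>\<^sup>+t. R t \<partial>lebesgue_on {0..T}) < \<infinity>"
 unfolding R_def using T by (intro le_less_trans[OF time_liminf]) auto

lemma emeasure_time: "emeasure (lebesgue_on {0..T}) {0..T} = ennreal T"
 using T by (subst emeasure_restrict_space) auto

lemma solS_L2: "solS : L2_sobolev \<gamma> T"
proof -
 let ?X = "lebesgue_on {0..T}"
 have "(\<integral>\<^sup>+t. sobolev_norm_sq \<gamma> (solS t) \<partial>?X) <= (\<integral>\<^sup>+t. (1 + reg prof) + R t \<partial>?X)"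
  proof (rule nn_integral_mono_AE)
  show "AE t in ?X. sobolev_norm_sq \<gamma> (solS t) <= (1 + reg prof) + R t"
   using AE_time
  proof eventually_elim
   case (elim t)
   then show ?case using sobolev_sol_le[of t] by (simp add: solS_def add.assoc)
  qed
 qed
 also have "... = (\<integral>\<^sup>+t. 1 + reg prof \<partial>?X) + (\<integral>\<^sup>+t. R t \<partial>?X)"
  using liminf_energy_measurable[of 4 T] by (intro nn_integral_add) (auto simp: R_def)
 also have "... < \<infinity>" using R_integral reg_prof T by (simp add: emeasure_time ennreal_mult_less_top)
 finally show ?thesis using solS_measurable unfolding L2_sobolev_def nn_set_time by blast
qed

lemma bdry_integral: "(\<integral>\<^sup>+t. bdry (sol t) \<partial>lebesgue_on {0..T}) < \<infinity>"
proof -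
 let ?X = "lebesgue_on {0..T}" and ?K = "%t. liminf (%k. ennreal (1 / \<kappa> * dE (r k) (v k t)))"
 note km = liminf_energy_measurable[of "1 / \<kappa>" T]
 have "(\<integral>\<^sup>+t. bdry (sol t) \<partial>?X) <= (\<integral>\<^sup>+t. ennreal 400 + ennreal (2 / cg) * ?K t \<partial>?X)"
 proof (rule nn_integral_mono_AE)
  show "AE t in ?X. bdry (sol t) <= ennreal 400 + ennreal (2 / cg) * ?K t"
   using AE_time
  proof eventually_elim
   case (elim t)
   have "bdry (sol t) <= ennreal 400 + ennreal (2 / cg) * kil (y t)"
    using bdry_le[OF sol_measurable[of t]] elim by (simp add: y_def[abs_def])
   also have "... <= ennreal 400 + ennreal (2 / cg) * ?K t" using elim by (intro add_left_mono mult_left_mono kil_y) auto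
   finally show ?case .
  qed
 qed
 also have "... = (\<integral>\<^sup>+t. ennreal 400 \<partial>?X) + (\<integral>\<^sup>+t. ennreal (2 / cg) * ?K t \<partial>?X)"
  by (intro nn_integral_add borel_measurable_times_ennreal borel_measurable_const km)
 also have "(\<integral>\<^sup>+t. ennreal (2 / cg) * ?K t \<partial>?X) = ennreal (2 / cg) * (\<integral>\<^sup>+t. ?K t \<partial>?X)" by (rule nn_integral_cmult[OF km])
 also have "(\<integral>\<^sup>+t. ennreal 400 \<partial>?X) + ennreal (2 / cg) * (\<integral>\<^sup>+t. ?K t \<partial>?X) < \<infinity>"
 proof -
  have "(\<integral>\<^sup>+t. ?K t \<partial>?X) < \<infinity>" using kap T by (intro le_less_trans[OF time_liminf]) auto
  then show ?thesis by (simp add: emeasure_time ennreal_mult_less_top)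
 qed
 finally show ?thesis .
qed

lemma em_tendsto:
 assumes t: "t : {0..T}" and G: "continuous_on {0..1} G"
 shows "(%k. X.em k t G) ----> (LINT q:{0..1}|lebesgue. G q * sol t q)"
proof (cases "t = 0")
 case True
 then show ?thesis using init[OF G] by (simp add: X.em_def X.m_0 empirical_def sol_def)
next
 case False
 then have t: "0 < t" using t by simp
 obtain C where C: "!!q. q : {0..1} ==> |G q| <= C" using bounded_cont01[OF G] by blast
 have Gm: "G : mUI" by (rule cont_measurable_UI[OF G])
 have "(%k. (IU q. X.m k t (idx (r k) q) * samp (r k) G (idx (r k) q))) ----> (IU q. sol t q * G q)"
 proof (rule pair_limit[OF integrable_idx L1_limits(2)[OF t]])
  show "sol t : mUI" using t by (intro sol_measurable) simp
  show "(%q. samp (r k) G (idx (r k) q)) : mUI" for k by (rule idx_measurable_UI)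
  show "|samp (r k) G (idx (r k) q)| <= C" if "0 < q" "q < 1" for k q by (rule C[OF samp_in[OF idx_bulk[OF r2 that]]])
 qed (use samp_tendsto[OF r r2 G] sol_bound Gm in auto)
 moreover have "X.em k t G = (IU q. X.m k t (idx (r k) q) * samp (r k) G (idx (r k) q))" for k
  proof -
  have "X.em k t G = ip (r k) (X.m k t) (samp (r k) G)" by (simp add: X.em_def ip_def mult.commute)
  then show ?thesis unfolding ip_integral[OF r2] .
 qed
 moreover have "(LINT q:{0..1}|lebesgue. G q * sol t q) = (IU q. sol t q * G q)"
  using LINT_closed_UI[of "%q. G q * sol t q"] sol_measurable[of t] t Gm by (simp add: mult.commute)
 ultimately show ?thesis by simp
qed

definition W :: "real => real" where "W q = \<alpha> * kern q + \<beta> * kern (1 - q)"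

lemma W_V0: "0 < q ==> q < 1 ==> V0 \<gamma> \<alpha> \<beta> q = W q"
 by (simp add: V0_def W_def kern_inverse field_simps)

lemma W_flat:
 assumes "boundary_flat G B" "q : {0..1}"
 shows "|W q * G q| <= 2 * cg * B"
proof -
 have G: "0 <= B" "|G q| <= B * q^3" "|G q| <= B * (1 - q)^3" using assms by (auto simp: boundary_flat_def)
 have k: "|kern q * G q| <= cg * B" "|kern (1 - q) * G q| <= cg * B"
  using assms(2) G kern_cubic[of q "G q" B] kern_cubic[of "1 - q" "G q" B] by auto
 have "|W q * G q| <= |\<alpha>| * |kern q * G q| + |\<beta>| * |kern (1 - q) * G q|"
  unfolding W_def abs_mult[symmetric] by (rule order_trans[OF _ abs_triangle_ineq]) (simp add: algebra_simps)
 also have "... <= 1 * (cg * B) + 1 * (cg * B)" using al be k by (intro add_mono mult_mono) auto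
 also have "... = 2 * cg * B" by simp
 finally show ?thesis .
qed

lemma source_tendsto:
 assumes G: "continuous_on {0..1} G" "boundary_flat G B"
 shows "(%k. ip (r k) (samp (r k) W) (samp (r k) G)) ----> (IU q. W q * G q)"
 unfolding ip_integral[OF r2]
proof (rule integral_dominated_convergence[where w="%_. 2 * cg * B"])
 have "W : mUI" unfolding W_def[abs_def] by (rule borel_UI) measurable
 then show "(%q. W q * G q) : mUI" using cont_measurable_UI[OF G(1)] by (rule borel_measurable_times)
 show "(%q. samp (r k) W (idx (r k) q) * samp (r k) G (idx (r k) q)) : mUI" for k
  by (intro borel_measurable_times idx_measurable_UI)
 show "AE q in UI. (%k. samp (r k) W (idx (r k) q) * samp (r k) G (idx (r k) q)) ----> W q * G q"
 proof (rule AE_UI_I)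
  fix q :: real assume q: "0 < q" "q < 1"
  have "(%k. samp (r k) W (idx (r k) q)) ----> W q"
   unfolding W_def using q by (intro tendsto_intros kern_tendsto idx_tendsto[OF r]) auto
  then show "(%k. samp (r k) W (idx (r k) q) * samp (r k) G (idx (r k) q)) ----> W q * G q"
   by (rule tendsto_mult[OF _ samp_tendsto[OF r r2 G(1) q]])
 qed
 show "AE q in UI. norm (samp (r k) W (idx (r k) q) * samp (r k) G (idx (r k) q)) <= 2 * cg * B" for k
  unfolding real_norm_def by (intro AE_UI_I W_flat[OF G(2)] samp_in idx_bulk r2)
qed simp

lemma LINT_bounded:
 fixes h :: "real => real"
 assumes h: "h integrable_on {0..t}" "!!s. s : {0..t} ==> |h s| <= B"
 shows "(LINT s:{0..t}|lebesgue. h s) = integral {0..t} h"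
proof (rule set_lebesgue_integral_eq_integral(2))
 show "h absolutely_integrable_on {0..t}"
  by (rule absolutely_integrable_integrable_bound[OF _ h(1) integrable_const_ivl]) (use h(2) in auto)
qed

text \<open>The fundamental theorem in time for <m_s, G_s>, with the symmetric operator moved onto
  the test function, where it is bounded. Limits are then taken by dominated convergence in space
  and in time.\<close>

lemma weak_form:
 assumes G: "G : test_functions T" and t: "t : {0..T}"
 defines "d \<equiv> %s q. vector_derivative (%r. G r q) (at s within {0..T})"
 shows "(LINT q:{0..1}|lebesgue. G t q * sol t q) - (LINT q:{0..1}|lebesgue. G 0 q * g q)
   = (LINT s:{0..t}|lebesgue. (IU q. sol s q * (d s q + L_op \<gamma> \<kappa> (G s) q))) + \<kappa> * (LINT s:{0..t}|lebesgue. (IU q. W q * G s q))"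
proof -
 obtain B G1 where B: "B >= 0" "!!s. s : {0..T} ==> taylor_bound (G s) (G1 s) B"
  "!!s. s : {0..T} ==> boundary_flat (G s) B" "!!s q. s : {0..T} ==> q : {0..1} ==> |G s q| <= B"
  "!!s q. s : {0..T} ==> q : {0..1} ==> |d s q| <= B"
  unfolding d_def using test_function_bounds[OF T G] by blast
 have Gc: "continuous_on {0..1} (G s)" if "s : {0..T}" for s using B(2)[OF that] by (simp add: taylor_bound_def)
 have dc: "continuous_on {0..1} (d s)" if "s : {0..T}" for s
 proof -
  have "continuous_on ({0..T} \<times> {0..1}) (%(s, q). d s q)" using G by (simp add: test_functions_def d_def)
  then have "continuous_on {0..1} ((%(s, q). d s q) \<circ> (%q. (s, q)))"
   using that by (intro continuous_on_compose continuous_intros) (auto elim: continuous_on_subset)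
  then show ?thesis by (simp add: o_def)
 qed
 have Gd: "((%s. G s q) has_real_derivative d s q) (at s within {0..T})" if "s : {0..T}" "q : {0..1}" for s q
 proof -
  have "(%s. G s q) differentiable_on {0..T}" using G that by (simp add: test_functions_def)
  then have "(%s. G s q) differentiable (at s within {0..T})" using that by (simp add: differentiable_on_def)
  then show ?thesis unfolding d_def has_real_derivative_iff_has_vector_derivative vector_derivative_works .
 qed
 have sub: "s : {0..T}" if "s : {0..t}" for s using that t by auto
 define H where "H k s x = d s (real x / real (r k)) - dA (r k) (samp (r k) (G s)) x" for k s x
 define J1 where "J1 k s = ip (r k) (X.m k s) (H k s)" for k s
 define J2 where "J2 k s = ip (r k) (samp (r k) W) (samp (r k) (G s))" for k s
 define B1 where "B1 = B + (near_err B 1 + \<kappa> * (2 * cg * B))"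
 have Hb: "|H k s x| <= B1" if "s : {0..T}" "x : bulk (r k)" for k s x
  using B(5)[OF that(1) samp_in[OF that(2)]] dA_samp_bound[OF B(2)[OF that(1)] B(3)[OF that(1)] that(2)]
  unfolding H_def B1_def by linarith
 have B1: "0 <= B1" using B(1) gam kap cg by (simp add: B1_def near_err_def)
 have der: "((%s. ip (r k) (X.m k s) (samp (r k) (G s))) has_real_derivative J1 k s + \<kappa> * J2 k s) (at s within {0..T})"
  if s: "s : {0..T}" for k s
 proof -
  let ?m' = "%x. dLap (r k) (X.m k s) x + resv (r k) x (X.m k s x)"
  have D: "((%s. ip (r k) (X.m k s) (samp (r k) (G s))) has_real_derivative
    ip (r k) ?m' (samp (r k) (G s)) + ip (r k) (X.m k s) (%x. d s (real x / real (r k)))) (at s within {0..T})"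
  proof (rule deriv_ip[OF _ _ refl])
   fix x assume x: "x : bulk (r k)"
   have "((%s. X.m k s x) has_real_derivative ?m' x) (at s within {0..})" using s by (intro X.m_deriv x) simp
   then show "((%s. X.m k s x) has_real_derivative ?m' x) (at s within {0..T})" by (rule has_field_derivative_subset) auto
   show "((%s. samp (r k) (G s) x) has_real_derivative d s (real x / real (r k))) (at s within {0..T})"
    by (rule Gd[OF s samp_in[OF x]])
  qed
  have "ip (r k) ?m' (samp (r k) (G s)) = \<kappa> * J2 k s - ip (r k) (dA (r k) (X.m k s)) (samp (r k) (G s))"
  proof -
   have "?m' x = \<kappa> * W (real x / real (r k)) - dA (r k) (X.m k s) x" for x
    by (simp add: dA_def resv_def W_def Vk_def algebra_simps)
   then show ?thesis by (simp add: J2_def ip_def left_diff_distrib sum_subtractf right_diff_distrib sum_distrib_left mult_ac)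
  qed
  moreover have "J1 k s = ip (r k) (X.m k s) (%x. d s (real x / real (r k))) - ip (r k) (X.m k s) (dA (r k) (samp (r k) (G s)))"
   by (simp add: J1_def H_def ip_def right_diff_distrib sum_subtractf)
  ultimately have "ip (r k) ?m' (samp (r k) (G s)) + ip (r k) (X.m k s) (%x. d s (real x / real (r k))) = J1 k s + \<kappa> * J2 k s"
   unfolding ip_dA_sym by linarith
  then show ?thesis using D by simp
 qed
 have ftc: "((%s. J1 k s + \<kappa> * J2 k s) has_integral (X.em k t (G t) - X.em k 0 (G 0))) {0..t}" for k
 proof -
  have "((%s. J1 k s + \<kappa> * J2 k s) has_integral (ip (r k) (X.m k t) (samp (r k) (G t)) - ip (r k) (X.m k 0) (samp (r k) (G 0)))) {0..t}"
  proof (rule fundamental_theorem_of_calculus)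
   show "0 <= t" using t by simp
   fix s assume s: "s : {0..t}"
   show "((%s. ip (r k) (X.m k s) (samp (r k) (G s))) has_vector_derivative J1 k s + \<kappa> * J2 k s) (at s within {0..t})"
    using has_field_derivative_subset[OF der[OF sub[OF s]]] t
    unfolding has_real_derivative_iff_has_vector_derivative by auto
  qed
  then show ?thesis by (simp add: X.em_def ip_def mult.commute)
 qed
 have J2i: "J2 k integrable_on {0..t}" for k
 proof (rule integrable_continuous_interval)
  have "continuous_on {0..t} (%s. G s (real x / real (r k)))" if "x : bulk (r k)" for x
  proof -
   have "(%s. G s (real x / real (r k))) differentiable_on {0..T}" using G samp_in[OF that] by (simp add: test_functions_def)
   then show ?thesis using sub by (intro continuous_on_subset[OF differentiable_imp_continuous_on]) auto
  qed
  then show "continuous_on {0..t} (J2 k)" unfolding J2_def[abs_def] ip_def by (intro continuous_intros) auto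
 qed
 \<comment> \<open>The fundamental theorem already yields integrability of the sum, and
   \<open>J2\<close> is continuous; a separate study of how \<open>J1\<close> depends on time is
   thereby avoided.\<close>
 have J1i: "J1 k integrable_on {0..t}" for k
 proof -
  have "(%s. (J1 k s + \<kappa> * J2 k s) - \<kappa> * J2 k s) integrable_on {0..t}"
   using ftc[of k] J2i[of k] by (intro integrable_diff integrable_on_mult_right) (auto simp: has_integral_integrable)
  then show ?thesis by simp
 qed
 have eq: "X.em k t (G t) - X.em k 0 (G 0) = integral {0..t} (J1 k) + \<kappa> * integral {0..t} (J2 k)" for k
 proof -
  have "((%s. J1 k s + \<kappa> * J2 k s) has_integral (integral {0..t} (J1 k) + \<kappa> * integral {0..t} (J2 k))) {0..t}"
   by (intro has_integral_add has_integral_mult_right integrable_integral J1i J2i)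
  then show ?thesis using ftc[of k] by (rule has_integral_unique[rotated])
 qed
 define K1 where "K1 s = (IU q. sol s q * (d s q + L_op \<gamma> \<kappa> (G s) q))" for s
 define K2 where "K2 s = (IU q. W q * G s q)" for s
 have J2b: "|J2 k s| <= 2 * cg * B" if "s : {0..t}" for k s
  unfolding J2_def by (intro abs_ip_le r2 W_flat[OF B(3)[OF sub[OF that]]] samp_in)
 have J2l: "(%k. J2 k s) ----> K2 s" if "s : {0..t}" for s
  unfolding J2_def K2_def using source_tendsto[OF Gc B(3)] sub[OF that] by blast
 have K2: "K2 integrable_on {0..t}" "(%k. integral {0..t} (J2 k)) ----> integral {0..t} K2"
  by (rule dominated_convergence[of J2 "{0..t}" "%_. 2 * cg * B"]; use J2i J2b J2l in auto)+
 have K2b: "|K2 s| <= 2 * cg * B" if "s : {0..t}" for s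
  by (rule tendsto_upperbound[OF tendsto_rabs[OF J2l[OF that]]]) (use J2b[OF that] in auto)
 have J1b: "|J1 k s| <= B1" if s: "s : {0..t}" for k s
  unfolding J1_def
 proof (rule abs_ip_le[OF r2])
  fix x assume x: "x : bulk (r k)"
  have "|X.m k s x| * |H k s x| <= 1 * B1"
   using X.m_range[OF _ x, of s] s Hb[OF sub[OF s] x] by (intro mult_mono) auto
  then show "|X.m k s x * H k s x| <= B1" by (simp add: abs_mult)
 qed
 have bd: "|d s q + L_op \<gamma> \<kappa> (G s) q| <= B1" if "s : {0..T}" "0 < q" "q < 1" for s q
  using B(5)[OF that(1), of q] L_op_bound[OF B(2)[OF that(1)] B(3)[OF that(1)] that(2,3)] that unfolding B1_def by auto
 have dm: "(%q. d s q + L_op \<gamma> \<kappa> (G s) q) : mUI" if "s : {0..T}" for s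
  by (rule borel_measurable_add[OF cont_measurable_UI[OF dc[OF that]] L_op_measurable[OF B(2)[OF that]]])
 have J1l: "(%k. J1 k s) ----> K1 s" if s: "s : {0..t}" "s ~= 0" for s
  unfolding J1_def K1_def ip_integral[OF r2]
 proof (rule pair_limit[OF integrable_idx L1_limits(2)])
  show "0 < s" using s by simp
  show "sol s : mUI" using s by (intro sol_measurable) simp
  show "(%q. H k s (idx (r k) q)) : mUI" for k by (rule idx_measurable_UI)
  show "|H k s (idx (r k) q)| <= B1" if "0 < q" "q < 1" for k q by (rule Hb[OF sub[OF s(1)] idx_bulk[OF r2 that]])
  show "(%k. H k s (idx (r k) q)) ----> d s q + L_op \<gamma> \<kappa> (G s) q" if q: "0 < q" "q < 1" for q
   using tendsto_diff[OF samp_tendsto[OF r r2 dc[OF sub[OF s(1)]] q] dA_samp_tendsto[OF B(2)[OF sub[OF s(1)]] q r]]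
   by (simp add: H_def)
 qed (use sol_bound dm[OF sub[OF s(1)]] in auto)
 have K1b: "|K1 s| <= B1" if s: "s : {0..t}" for s
 proof -
  have s0: "0 <= s" "s : {0..T}" using s sub by auto
  have le: "|sol s q * (d s q + L_op \<gamma> \<kappa> (G s) q)| <= B1" if "0 < q" "q < 1" for q
  proof -
   have "|sol s q| * |d s q + L_op \<gamma> \<kappa> (G s) q| <= 1 * B1" using sol_bound[OF that] bd[OF s0(2) that] by (intro mult_mono) auto
   then show ?thesis by (simp add: abs_mult)
  qed
  have i: "iUI (%q. sol s q * (d s q + L_op \<gamma> \<kappa> (G s) q))"
   by (rule integrable_bounded_UI[OF borel_measurable_times[OF sol_measurable[OF s0(1)] dm[OF s0(2)]] le])
  have "|K1 s| <= (IU q. |sol s q * (d s q + L_op \<gamma> \<kappa> (G s) q)| )" unfolding K1_def by (rule integral_abs_bound)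
  also have "... <= (IU q. B1)" using i le by (intro integral_mono) auto
  finally show ?thesis by simp
 qed
 \<comment> \<open>The L1 limit is available only at positive times; changing the integrands at the
   single time 0 makes convergence hold everywhere.\<close>
 define j where "j k s = (if s = 0 then 0 else J1 k s)" for k s
 define k1 where "k1 s = (if s = 0 then 0 else K1 s)" for s
 have ji: "j k integrable_on {0..t}" and jint: "integral {0..t} (j k) = integral {0..t} (J1 k)" for k
  using integrable_spike_finite[of "{0}" "{0..t}" "j k" "J1 k"] J1i[of k]
   integral_spike[of "{0}" "{0..t}" "j k" "J1 k"] by (auto simp: j_def)
 have jb: "norm (j k s) <= B1" if "s : {0..t}" for k s using J1b[OF that, of k] B1 by (simp add: j_def)
 have jl: "(%k. j k s) ----> k1 s" if "s : {0..t}" for s using J1l[OF that] by (simp add: j_def k1_def)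
 have k1: "k1 integrable_on {0..t}" "(%k. integral {0..t} (j k)) ----> integral {0..t} k1"
  by (rule dominated_convergence[of j "{0..t}" "%_. B1"]; use ji jb jl in auto)+
 have K1: "K1 integrable_on {0..t}" and K1i: "integral {0..t} k1 = integral {0..t} K1"
  using integrable_spike_finite[of "{0}" "{0..t}" K1 k1] k1(1)
   integral_spike[of "{0}" "{0..t}" k1 K1] by (auto simp: k1_def)
 have "(%k. X.em k t (G t) - X.em k 0 (G 0)) ----> integral {0..t} K1 + \<kappa> * integral {0..t} K2"
  unfolding eq using k1(2) K2(2) unfolding jint K1i by (intro tendsto_intros)
 moreover have "(%k. X.em k t (G t) - X.em k 0 (G 0)) ----> (LINT q:{0..1}|lebesgue. G t q * sol t q) - (LINT q:{0..1}|lebesgue. G 0 q * sol 0 q)"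
  using T by (intro tendsto_diff em_tendsto t Gc) auto
 ultimately have "(LINT q:{0..1}|lebesgue. G t q * sol t q) - (LINT q:{0..1}|lebesgue. G 0 q * sol 0 q) = integral {0..t} K1 + \<kappa> * integral {0..t} K2"
  by (rule LIMSEQ_unique[rotated])
 moreover have "(LINT s:{0..t}|lebesgue. K1 s) = integral {0..t} K1" "(LINT s:{0..t}|lebesgue. K2 s) = integral {0..t} K2"
  by (rule LINT_bounded[OF K1 K1b] LINT_bounded[OF K2(1) K2b], assumption)+
 moreover have "sol 0 q = g q" for q by (simp add: sol_def)
 ultimately show ?thesis by (simp only: K1_def K2_def)
qed

lemma sol_weak: "weak_solution \<gamma> \<kappa> \<alpha> \<beta> T g sol"
 unfolding weak_solution_def
proof (intro conjI ballI)
 fix t assume t: "t : {0..T}"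
 show "sol t : {0..1} \<rightarrow> {0..1}" using sol_range by auto
 show "sol t : borel_measurable (lebesgue_on {0..1})"
  using sol_measurable[of t] t by (simp add: measurable_UI_closed)
 fix G assume G: "G : test_functions T"
 let ?d = "%s q. vector_derivative (%r. G r q) (at s within {0..T})"
 have "(LINT q:{0<..<1}|lebesgue. G s q * V0 \<gamma> \<alpha> \<beta> q) = (IU q. W q * G s q)" for s
  unfolding set_integral_UI by (intro Bochner_Integration.integral_cong) (auto simp: W_V0)
 then show "(LINT q:{0..1}|lebesgue. sol t q * G t q) - (LINT q:{0..1}|lebesgue. g q * G 0 q)
    - (LINT s:{0..t}|lebesgue. LINT q:{0<..<1}|lebesgue. sol s q * (?d s q + L_op \<gamma> \<kappa> (G s) q))
    - \<kappa> * (LINT s:{0..t}|lebesgue. LINT q:{0<..<1}|lebesgue. G s q * V0 \<gamma> \<alpha> \<beta> q) = 0"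
  using weak_form[OF G t] by (simp add: set_integral_UI mult.commute)
next
 have "AE t in lebesgue_on {0..T}. solS t = sol t"
  using AE_time by eventually_elim (simp add: solS_def)
 then show "\<exists>f\<in>L2_sobolev \<gamma> T. AE t in lebesgue_on {0..T}. f t = sol t" using solS_L2 by blast
 show "(\<integral>\<^sup>+t\<in>{0..T}. (\<integral>\<^sup>+q\<in>{0<..<1}. ennreal ((\<alpha> - sol t q)^2 / q powr (1 + \<gamma>) + (\<beta> - sol t q)^2 / (1 - q) powr (1 + \<gamma>))
    \<partial>lebesgue) \<partial>lebesgue) < \<infinity>"
  using bdry_integral unfolding nn_set_time nn_set_UI bdry_def .
qed

end

section \<open>Deterministic initial configurations and the limit theorem\<close>

lemma empirical_lincomb:
 "empirical N (%q. \<Sum>i\<le>n. a i * f i q) \<eta> = (\<Sum>i\<le>n. a i * empirical N (f i) \<eta>)"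
proof -
 have "(\<Sum>x\<in>bulk N. (\<Sum>i\<le>n. a i * f i (real x / real N)) * real (\<eta> x)) = (\<Sum>i\<le>n. a i * (\<Sum>x\<in>bulk N. f i (real x / real N) * real (\<eta> x)))"
  unfolding sum_distrib_right sum_distrib_left by (subst sum.swap) (simp add: mult.assoc)
 then show ?thesis by (simp add: empirical_def sum_distrib_left mult.left_commute)
qed

lemma empirical_diff_le:
 assumes N: "N >= 2" and \<eta>: "\<eta> : configs N" and d: "!!q. q : {0..1} ==> |F q - G q| <= d"
 shows "|empirical N F \<eta> - empirical N G \<eta>| <= d"
proof -
 have "empirical N F \<eta> - empirical N G \<eta> = 1 / (real N - 1) * (\<Sum>x\<in>bulk N. (F (real x / real N) - G (real x / real N)) * real (\<eta> x))"
  by (simp add: empirical_def left_diff_distrib sum_subtractf diff_divide_distrib)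
 also have "|...| <= 1 / (real N - 1) * (\<Sum>x\<in>bulk N. d * 1)"
 proof -
  have "|\<Sum>x\<in>bulk N. (F (real x / real N) - G (real x / real N)) * real (\<eta> x)| <= (\<Sum>x\<in>bulk N. d * 1)"
  proof (rule order_trans[OF sum_abs sum_mono])
   fix x assume x: "x : bulk N"
   have "\<eta> x : {0, 1}" using \<eta> x unfolding configs_def by (rule PiE_mem)
   then have "real (\<eta> x) <= 1" by auto
   moreover have "|F (real x / real N) - G (real x / real N)| <= d" using x by (intro d) (auto simp: bulk_def)
   ultimately have "|F (real x / real N) - G (real x / real N)| * real (\<eta> x) <= d * 1" by (intro mult_mono) auto
   then show "|(F (real x / real N) - G (real x / real N)) * real (\<eta> x)| <= d * 1" by (simp add: abs_mult)
  qed
  then show ?thesis using N by (simp add: abs_mult divide_right_mono)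
 qed
 also have "... = d" using N by (simp add: bulk_def of_nat_diff)
 finally show ?thesis .
qed

lemma LINT_g:
 fixes F g :: "real => real"
 assumes g: "g : {0..1} \<rightarrow> {0..1}" "g : borel_measurable (lebesgue_on {0..1})" and F: "continuous_on {0..1} F"
 shows "(LINT q:{0..1}|lebesgue. F q * g q) = (IU q. F q * g q)" "iUI (%q. F q * g q)"
proof -
 obtain C where C: "!!q. q : {0..1} ==> |F q| <= C" using bounded_cont01[OF F] by blast
 have m: "(%q. F q * g q) : mUI"
  using cont_measurable_UI[OF F] g(2) unfolding measurable_UI_closed by (rule borel_measurable_times)
 then show "(LINT q:{0..1}|lebesgue. F q * g q) = (IU q. F q * g q)" by (rule LINT_closed_UI)
 show "iUI (%q. F q * g q)"
 proof (rule UI.integrable_const_bound[OF _ m])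
  show "AE q in UI. norm (F q * g q) <= C"
  proof (rule AE_UI_I)
   fix q :: real assume q: "0 < q" "q < 1"
   have "|F q| * |g q| <= C * 1" using C[of q] g(1) q by (intro mult_mono) (auto simp: Pi_iff)
   then show "norm (F q * g q) <= C" by (simp add: abs_mult)
  qed
 qed
qed

text \<open>By Weierstrass approximation, association to g is decided by countably many moments,
  which permits a diagonal choice of configurations.\<close>

lemma moments_determine:
 fixes G g :: "real => real"
 assumes g: "g : {0..1} \<rightarrow> {0..1}" "g : borel_measurable (lebesgue_on {0..1})"
  and r: "!!k. r k >= 2" "!!k. \<xi> k : configs (r k)"
  and mom: "!!i. (%k. empirical (r k) (%q. q ^ i) (\<xi> k)) ----> (LINT q:{0..1}|lebesgue. q ^ i * g q)"
  and G: "continuous_on {0..1} G"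
 shows "(%k. empirical (r k) G (\<xi> k)) ----> (LINT q:{0..1}|lebesgue. G q * g q)"
proof (rule LIMSEQ_I)
 fix e :: real assume e: "0 < e"
 have c: "compact {0..1::real}" by simp
 obtain p where p: "real_polynomial_function p" "!!x. x : {0..1} ==> |G x - p x| < e/4"
  using Stone_Weierstrass_real_polynomial_function[OF c G, of "e/4"] e by auto
 obtain a n where pa: "p = (%x. \<Sum>i\<le>n. a i * x ^ i)" using p(1) unfolding real_polynomial_function_iff_sum by blast
 have pc: "continuous_on {0..1} p" unfolding pa by (intro continuous_intros)
 have ic: "continuous_on {0..1} (%q::real. q ^ i)" for i by (intro continuous_intros)
 have "(%k. \<Sum>i\<le>n. a i * empirical (r k) (%q. q ^ i) (\<xi> k)) ----> (\<Sum>i\<le>n. a i * (LINT q:{0..1}|lebesgue. q ^ i * g q))"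
  by (intro tendsto_intros mom)
 moreover have "(\<Sum>i\<le>n. a i * (LINT q:{0..1}|lebesgue. q ^ i * g q)) = (LINT q:{0..1}|lebesgue. p q * g q)"
  unfolding LINT_g(1)[OF g pc] LINT_g(1)[OF g ic] using LINT_g(2)[OF g ic]
  by (simp add: pa sum_distrib_right mult.assoc)
 ultimately have "(%k. empirical (r k) p (\<xi> k)) ----> (LINT q:{0..1}|lebesgue. p q * g q)"
  unfolding pa empirical_lincomb by simp
 then obtain n0 where n0: "!!k. k >= n0 ==> |empirical (r k) p (\<xi> k) - (LINT q:{0..1}|lebesgue. p q * g q)| < e/4"
  using LIMSEQ_D[of "%k. empirical (r k) p (\<xi> k)" _ "e/4"] e by auto
 have "|(IU q. p q * g q) - (IU q. G q * g q)| <= e/4"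
 proof -
  note i = LINT_g(2)[OF g pc] LINT_g(2)[OF g G]
  have "|(IU q. p q * g q) - (IU q. G q * g q)| = |(IU q. p q * g q - G q * g q)|" using i by simp
  also have "... <= (IU q. |p q * g q - G q * g q| )" by (rule integral_abs_bound)
  also have "... <= (IU q. e/4)"
  proof (rule integral_mono)
   fix q assume "q : space UI"
   then have "|p q - G q| * |g q| <= e/4 * 1" using p(2)[of q] g(1) by (intro mult_mono) (auto simp: Pi_iff abs_minus_commute less_imp_le[OF e])
   then show "|p q * g q - G q * g q| <= e/4" by (simp add: left_diff_distrib[symmetric] abs_mult)
  qed (use i in auto)
  finally show ?thesis by simp
 qed
 then have b: "|(LINT q:{0..1}|lebesgue. p q * g q) - (LINT q:{0..1}|lebesgue. G q * g q)| <= e/4"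
  unfolding LINT_g(1)[OF g pc] LINT_g(1)[OF g G] .
 show "\<exists>no. \<forall>k\<ge>no. norm (empirical (r k) G (\<xi> k) - (LINT q:{0..1}|lebesgue. G q * g q)) < e"
 proof (intro exI allI impI)
  fix k assume k: "k >= n0"
  have "|empirical (r k) G (\<xi> k) - empirical (r k) p (\<xi> k)| <= e/4"
   by (rule empirical_diff_le[OF r]) (use p(2) less_imp_le in blast)
  then show "norm (empirical (r k) G (\<xi> k) - (LINT q:{0..1}|lebesgue. G q * g q)) < e"
   using n0[OF k] b e unfolding real_norm_def by linarith
 qed
qed

text \<open>If events have probability bounded away from zero along infinitely many \<open>N\<close>, they contain
  deterministic initial configurations that are themselves associated to the same profile.\<close>

lemma selection:
 assumes g: "g : {0..1} \<rightarrow> {0..1}" "g : borel_measurable (lebesgue_on {0..1})"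
  and \<mu>: "!!N. N >= 1 ==> prob_space (\<mu> N)" "!!N. N >= 1 ==> sets (\<mu> N) = Pow (configs N)"
  and as: "associated \<mu> g" and A: "!!N. A N \<subseteq> configs N"
  and \<epsilon>: "0 < \<epsilon>" "frequently (%N. \<epsilon> <= measure (\<mu> N) (A N)) sequentially"
 shows "\<exists>r \<xi>. strict_mono r & (\<forall>k. r k >= 2) & (\<forall>k. \<xi> k : A (r k)) \<and>
  (\<forall>G. continuous_on {0..1} G --> (%k. empirical (r k) G (\<xi> k)) ----> (LINT q:{0..1}|lebesgue. G q * g q))"
proof -
 define L where "L i = (LINT q:{0..1}|lebesgue. q ^ i * g q)" for i
 define bad where "bad k i N = {\<eta> : configs N. |empirical N (%q. q ^ i) \<eta> - L i| > 1 / real (Suc k)}" for k i N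
 \<comment> \<open>The first k + 1 moments are matched up to 1/(k+1).\<close>
 define ok where "ok k N \<xi> \<longleftrightarrow> \<xi> : A N & (\<forall>i\<le>k. |empirical N (%q. q ^ i) \<xi> - L i| <= 1 / real (Suc k))" for k N \<xi>
 \<comment> \<open>For large N the finitely many moment failures have total probability below
   \<epsilon>, so they cannot cover \<open>A N\<close>.\<close>
 have ex: "\<exists>N>n. N >= 2 & (\<exists>\<xi>. ok k N \<xi>)" for n k
 proof -
  have "(%N. measure (\<mu> N) (bad k i N)) ----> 0" for i
   unfolding bad_def L_def
   by (rule as[unfolded associated_def, rule_format]) (auto intro!: continuous_intros)
  then have "(%N. \<Sum>i\<le>k. measure (\<mu> N) (bad k i N)) ----> (\<Sum>i\<le>k. 0)" by (rule tendsto_sum)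
  then have "eventually (%N. (\<Sum>i\<le>k. measure (\<mu> N) (bad k i N)) < \<epsilon>) sequentially"
   using \<epsilon>(1) by (intro order_tendstoD(2)[of _ "\<Sum>i\<le>k. 0"]) auto
  moreover have "eventually (%N. N > n & N >= 2) sequentially"
   by (intro eventually_conj eventually_gt_at_top eventually_ge_at_top)
  ultimately obtain N where N: "\<epsilon> <= measure (\<mu> N) (A N)" "(\<Sum>i\<le>k. measure (\<mu> N) (bad k i N)) < \<epsilon>" "N > n" "N >= 2"
   using frequently_ex[OF frequently_eventually_frequently[OF \<epsilon>(2) eventually_conj]] by blast
  interpret p: prob_space "\<mu> N" using N(4) by (intro \<mu>) simp
  have s: "S : sets (\<mu> N)" if "S \<subseteq> configs N" for S using \<mu>(2)[of N] N(4) that by simp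
  have "\<exists>\<xi>. ok k N \<xi>"
  proof (rule ccontr)
   assume "\<nexists>\<xi>. ok k N \<xi>"
   then have "A N \<subseteq> (\<Union>i\<in>{..k}. bad k i N)" using A[of N] unfolding ok_def bad_def by (auto simp: not_le)
   then have "measure (\<mu> N) (A N) <= measure (\<mu> N) (\<Union>i\<in>{..k}. bad k i N)"
    by (intro p.finite_measure_mono s) (auto simp: bad_def)
   also have "... <= (\<Sum>i\<le>k. measure (\<mu> N) (bad k i N))"
    by (intro p.finite_measure_subadditive_finite) (auto intro!: s simp: bad_def)
   finally show False using N by simp
  qed
  then show ?thesis using N by blast
 qed
 have "\<exists>r. \<forall>k. (r k >= 2 & (\<exists>\<xi>. ok k (r k) \<xi>)) & r k < r (Suc k)"
 proof (rule dependent_nat_choice)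
  show "\<exists>N. N >= 2 & (\<exists>\<xi>. ok 0 N \<xi>)" using ex by blast
  show "\<exists>M. (M >= 2 & (\<exists>\<xi>. ok (Suc k) M \<xi>)) & N < M" for N k using ex by blast
 qed
 then obtain r where r: "!!k. r k >= 2" "!!k. \<exists>\<xi>. ok k (r k) \<xi>" "!!k. r k < r (Suc k)" by blast
 obtain \<xi> where \<xi>: "!!k. ok k (r k) (\<xi> k)" using r(2) by metis
 have \<xi>A: "\<xi> k : A (r k)" for k using \<xi>[of k] by (simp add: ok_def)
 have mom: "(%k. empirical (r k) (%q. q ^ i) (\<xi> k)) ----> L i" for i
 proof (rule LIM_zero_cancel, rule Lim_null_comparison)
  show "(%k. 1 / real (Suc k)) ----> 0" by (rule LIMSEQ_Suc[OF lim_1_over_n])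
  show "eventually (%k. norm (empirical (r k) (%q. q ^ i) (\<xi> k) - L i) <= 1 / real (Suc k)) sequentially"
   using eventually_ge_at_top[of i] by eventually_elim (use \<xi> in "auto simp: ok_def")
 qed
 have "(%k. empirical (r k) G (\<xi> k)) ----> (LINT q:{0..1}|lebesgue. G q * g q)" if "continuous_on {0..1} G" for G
  proof (rule moments_determine[OF g r(1) _ _ that])
  show "\<xi> k : configs (r k)" for k using \<xi>A A by blast
  show "(%k. empirical (r k) (%q. q ^ i) (\<xi> k)) ----> (LINT q:{0..1}|lebesgue. q ^ i * g q)" for i
   using mom[of i] unfolding L_def .
 qed
 then show ?thesis using r(1,3) \<xi>A by (intro exI[of _ r] exI[of _ \<xi>]) (auto simp: strict_mono_Suc_iff)
qed

text \<open>Serves twice: for the existence of a weak solution and for identifying limits of the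
  means.\<close>

lemma (in hydro) subsequence_solution:
 assumes T: "0 < T" and g: "g : {0..1} \<rightarrow> {0..1}" "g : borel_measurable (lebesgue_on {0..1})"
  and init: "!!G. continuous_on {0..1} G ==> (%k. empirical (r k) G (\<xi> k)) ----> (LINT q:{0..1}|lebesgue. G q * g q)"
 shows "\<exists>\<sigma> \<rho>. strict_mono \<sigma> & weak_solution \<gamma> \<kappa> \<alpha> \<beta> T g \<rho> \<and>
  (\<forall>t\<in>{0..T}. \<forall>G. continuous_on {0..1} G --> (%k. X.em (\<sigma> k) t G) ----> (LINT q:{0..1}|lebesgue. G q * \<rho> t q))"
proof -
 obtain \<sigma> where \<sigma>: "strict_mono \<sigma>" "!!t m j. 0 < t ==> convergent (%k. coarse m (%q. v (\<sigma> k) t (idx (r (\<sigma> k)) q)) j)"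
  using convergent_subsequence by blast
 interpret S: hydro \<gamma> \<kappa> \<alpha> \<beta> "%k. r (\<sigma> k)" "%k. K (\<sigma> k)" "%k. \<xi> (\<sigma> k)"
  by unfold_locales (rule filterlim_compose[OF r filterlim_subseq[OF \<sigma>(1)]] r2 tf \<xi>)+
 have v: "S.v k = v (\<sigma> k)" for k unfolding S.v_def[abs_def] v_def[abs_def] ..
 interpret L: hydro_limit \<gamma> \<kappa> \<alpha> \<beta> "%k. r (\<sigma> k)" "%k. K (\<sigma> k)" "%k. \<xi> (\<sigma> k)" T g
 proof unfold_locales
  show "(%k. empirical (r (\<sigma> k)) G (\<xi> (\<sigma> k))) ----> (LINT q:{0..1}|lebesgue. G q * g q)" if "continuous_on {0..1} G" for G
   using LIMSEQ_subseq_LIMSEQ[OF init[OF that] \<sigma>(1)] by (simp add: o_def)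
  show "convergent (%k. coarse m (%q. S.v k t (idx (r (\<sigma> k)) q)) j)" if "0 < t" for t m j
   unfolding v by (rule \<sigma>(2)[OF that])
 qed (rule T g)+
 show ?thesis using \<sigma>(1) L.sol_weak L.em_tendsto by blast
qed

text \<open>A bound of Markov type: a large mean of f forces the set of starting points with large f
  to have large measure.\<close>

lemma integral_threshold:
 fixes f :: "'a => real"
 assumes "prob_space M" "sets M = Pow S" "A \<subseteq> S" and f: "!!x. x : S ==> 0 <= f x & f x <= 1"
  and s: "!!x. x : S ==> x \<notin> A ==> f x <= e" and e: "0 <= e"
 shows "(\<integral>x. f x \<partial>M) <= e + measure M A"
proof -
 interpret prob_space M by fact
 have sp: "space M = S" using assms(2) sets_eq_imp_space_eq[of M "count_space S"] by simp
 have m: "h : borel_measurable M" for h :: "'a => real"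
  proof -
  have "(borel_measurable M :: ('a => real) set) = borel_measurable (count_space S)"
   by (rule measurable_cong_sets) (simp_all add: assms(2))
  then show ?thesis by simp
 qed
 have "(\<integral>x. f x \<partial>M) <= (\<integral>x. e + indicator A x \<partial>M)"
 proof (rule integral_mono)
  show "integrable M f" by (rule integrable_const_bound[OF _ m, of _ 1]) (use f sp in "auto intro!: AE_I2")
  show "integrable M (%x. e + indicator A x)"
   by (rule integrable_const_bound[OF _ m, of _ "e + 1"]) (use e in "auto intro!: AE_I2 simp: indicator_def")
  show "f x <= e + indicator A x" if "x : space M" for x
   using f[of x] s[of x] e that sp by (auto simp: indicator_def)
 qed
 also have "... = e + measure M A"
 proof -
  have "integrable M (indicator A :: 'a => real)"
   by (rule integrable_const_bound[OF _ m, of _ 1]) (auto simp: indicator_def)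
  then have "(\<integral>x. e + indicator A x \<partial>M) = (\<integral>x. e \<partial>M) + (\<integral>x. indicator A x \<partial>M)"
   by (intro Bochner_Integration.integral_add) auto
  moreover have "A \<inter> space M = A" using assms(3) sp by auto
  moreover have "measure M S = 1" using prob_space sp by simp
  ultimately show ?thesis using sp by simp
 qed
 finally show ?thesis .
qed

text \<open>By contradiction: otherwise, for infinitely many N, initial configurations with
  deviation probability above \<epsilon>/2 have mass at least \<epsilon>/2. Configurations selected
  from them have means that converge, along a subsequence, to the unique solution, while the
  variance bound makes the deviation probability vanish.\<close>

lemma (in frac_params) hydrodynamic_limit:
 assumes T: "0 < T" and g: "g : {0..1} \<rightarrow> {0..1}" "g : borel_measurable (lebesgue_on {0..1})"
  and \<mu>: "!!N. N >= 1 ==> prob_space (\<mu> N)" "!!N. N >= 1 ==> sets (\<mu> N) = Pow (configs N)" and as: "associated \<mu> g"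
  and K: "!!N. N >= 1 ==> transition_function (configs N) (gen N) (K N)"
  and \<rho>: "weak_solution \<gamma> \<kappa> \<alpha> \<beta> T g \<rho>" and t: "t : {0..T}" and G: "continuous_on {0..1} G" and dl: "0 < dl"
 shows "(%N. \<integral>\<xi>. measure_pmf.prob (K N t \<xi>) {\<eta>. |empirical N G \<eta> - (LINT q:{0..1}|lebesgue. G q * \<rho> t q)| > dl} \<partial>\<mu> N) ----> 0"
proof -
 define I where "I = (LINT q:{0..1}|lebesgue. G q * \<rho> t q)"
 define f where "f N \<xi> = measure_pmf.prob (K N t \<xi>) {\<eta>. |empirical N G \<eta> - I| > dl}" for N \<xi>
 have nn: "0 <= (\<integral>\<xi>. f N \<xi> \<partial>\<mu> N)" for N unfolding f_def by (intro integral_nonneg_AE AE_I2) simp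
 have small: "eventually (%N. (\<integral>\<xi>. f N \<xi> \<partial>\<mu> N) < \<epsilon>) sequentially" if \<epsilon>: "0 < \<epsilon>" for \<epsilon>
 proof (rule ccontr)
  assume "\<not> eventually (%N. (\<integral>\<xi>. f N \<xi> \<partial>\<mu> N) < \<epsilon>) sequentially"
  then have fr: "frequently (%N. \<epsilon> <= (\<integral>\<xi>. f N \<xi> \<partial>\<mu> N)) sequentially" by (simp add: frequently_def not_le)
  define A where "A N = {\<xi> : configs N. \<epsilon>/2 < f N \<xi>}" for N
  have AN: "\<epsilon>/2 <= measure (\<mu> N) (A N)" if "N >= 1" "\<epsilon> <= (\<integral>\<xi>. f N \<xi> \<partial>\<mu> N)" for N
   using integral_threshold[OF \<mu>(1,2)[OF that(1)] , of "A N" "f N" "\<epsilon>/2"] that(2) \<epsilon> by (auto simp: A_def f_def not_less)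
  have "frequently (%N. \<epsilon>/2 <= measure (\<mu> N) (A N)) sequentially"
   by (rule frequently_mp[OF _ fr], rule eventually_mono[OF eventually_ge_at_top[of 1]]) (use AN in auto)
  moreover have "0 < \<epsilon>/2" using \<epsilon> by simp
  moreover have "A N \<subseteq> configs N" for N by (auto simp: A_def)
  ultimately have "\<exists>r \<xi>. strict_mono r & (\<forall>k. r k >= 2) & (\<forall>k. \<xi> k : A (r k)) \<and>
   (\<forall>G. continuous_on {0..1} G --> (%k. empirical (r k) G (\<xi> k)) ----> (LINT q:{0..1}|lebesgue. G q * g q))"
   by (intro selection[OF g \<mu> as, of A "\<epsilon>/2"]) simp_all
  then obtain r \<xi> where r: "strict_mono r" "!!k. r k >= 2" "!!k. \<xi> k : A (r k)"
   "!!G. continuous_on {0..1} G ==> (%k. empirical (r k) G (\<xi> k)) ----> (LINT q:{0..1}|lebesgue. G q * g q)"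
   by auto
  interpret H: hydro \<gamma> \<kappa> \<alpha> \<beta> r "%k. K (r k)" \<xi>
  proof unfold_locales
   show "filterlim r at_top sequentially" by (rule filterlim_subseq[OF r(1)])
   show "2 <= r k" "\<xi> k : configs (r k)" for k using r(2,3)[of k] by (auto simp: A_def)
   show "transition_function (configs (r k)) (gen (r k)) (K (r k))" for k using r(2)[of k] by (intro K) simp
  qed
  obtain \<sigma> \<rho>' where s: "strict_mono \<sigma>" "weak_solution \<gamma> \<kappa> \<alpha> \<beta> T g \<rho>'"
   "!!t G. t : {0..T} ==> continuous_on {0..1} G ==> (%k. H.X.em (\<sigma> k) t G) ----> (LINT q:{0..1}|lebesgue. G q * \<rho>' t q)"
   using H.subsequence_solution[OF T g r(4)] by blast
  have "(LINT q:{0..1}|lebesgue. G q * \<rho>' t q) = I"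
  proof -
   have Gm: "G : mUI" by (rule cont_measurable_UI[OF G])
   have "(\<integral>q. G q * \<rho>' t q \<partial>lebesgue_on {0..1}) = (\<integral>q. G q * \<rho> t q \<partial>lebesgue_on {0..1})"
   proof (rule integral_cong_AE)
    show "(%q. G q * \<rho>' t q) : borel_measurable (lebesgue_on {0..1})" "(%q. G q * \<rho> t q) : borel_measurable (lebesgue_on {0..1})"
     using Gm weak_solution_measurable(1)[OF s(2) t] weak_solution_measurable(1)[OF \<rho> t]
     unfolding measurable_UI_closed by (auto intro: borel_measurable_times)
    show "AE q in lebesgue_on {0..1}. G q * \<rho>' t q = G q * \<rho> t q"
     using weak_solution_unique[OF T \<rho> s(2) t] by eventually_elim simp
   qed
   then show ?thesis unfolding I_def by (subst (asm) (1 2) integral_restrict_space) (simp_all add: set_lebesgue_integral_def)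
  qed
  then have em: "(%k. H.X.em (\<sigma> k) t G) ----> I" using s(3)[OF t G] by simp
  obtain C where C: "C >= 0" "!!q. q : {0..1} ==> |G q| <= C" using bounded_cont01[OF G] by blast
  define b where "b k = 10 * C^2 / ((real (r (\<sigma> k)) - 1) * (dl/2)^2)" for k
  have "filterlim (%k. real (r (\<sigma> k)) - 1) at_top sequentially"
   using filterlim_compose[OF filterlim_real_sequentially filterlim_compose[OF H.r filterlim_subseq[OF s(1)]]]
   by (simp add: filterlim_tendsto_add_at_top[of "%_. -1::real" "-1", simplified])
  then have "(%k. 10 * C^2 / (dl/2)^2 / (real (r (\<sigma> k)) - 1)) ----> 0"
   by (intro tendsto_divide_0[OF tendsto_const] filterlim_at_top_imp_at_infinity)
  then have "b ----> 0" unfolding b_def[abs_def] by (simp add: mult.commute)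
  then have "eventually (%k. b k < \<epsilon>/2) sequentially" using \<epsilon> by (intro order_tendstoD(2)) auto
  moreover have "eventually (%k. |H.X.em (\<sigma> k) t G - I| < dl/2) sequentially"
   using tendstoD[OF em, of "dl/2"] dl by (simp add: dist_real_def)
  ultimately obtain k where k: "b k < \<epsilon>/2" "|H.X.em (\<sigma> k) t G - I| < dl/2"
   using eventually_happens'[OF sequentially_bot eventually_conj] by blast
  let ?N = "r (\<sigma> k)"
  have "\<epsilon>/2 < f ?N (\<xi> (\<sigma> k))" using r(3)[of "\<sigma> k"] by (simp add: A_def)
  also have "... <= measure_pmf.prob (K ?N t (\<xi> (\<sigma> k))) {\<eta>. |empirical ?N G \<eta> - H.X.em (\<sigma> k) t G| > dl/2}"
   unfolding f_def
  proof (intro measure_pmf.finite_measure_mono subsetI)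
   fix \<eta> assume "\<eta> : {\<eta>. |empirical ?N G \<eta> - I| > dl}"
   then have "|empirical ?N G \<eta> - I| > dl" by simp
   then have "|empirical ?N G \<eta> - H.X.em (\<sigma> k) t G| > dl/2" using k(2) by linarith
   then show "\<eta> : {\<eta>. |empirical ?N G \<eta> - H.X.em (\<sigma> k) t G| > dl/2}" by simp
  qed simp
  also have "... <= b k" unfolding b_def
   by (rule H.X.concentration) (use t C dl samp_in in auto)
  finally show False using k(1) by simp
 qed
 have "(%N. \<integral>\<xi>. f N \<xi> \<partial>\<mu> N) ----> 0"
  by (rule order_tendstoI) (auto intro: always_eventually less_le_trans[OF _ nn] small)
 then show ?thesis by (simp add: f_def I_def)
qed

theorem theorem4:
  fixes T \<alpha> \<beta> \<kappa> \<theta> \<gamma> :: real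
    and g :: "real \<Rightarrow> real"
    and \<mu> :: "nat \<Rightarrow> (nat \<Rightarrow> nat) measure"
    and P :: "nat \<Rightarrow> 'w measure"
    and \<eta> :: "nat \<Rightarrow> real \<Rightarrow> 'w \<Rightarrow> nat \<Rightarrow> nat"
  assumes "T > 0"
    and "\<alpha> \<in> {0..1}" and "\<beta> \<in> {0..1}"
    and "\<kappa> > 0"
    and "\<theta> = -1"
    and "\<gamma> \<in> {1<..<2}"
    and "g \<in> {0..1} \<rightarrow> {0..1}" and "g \<in> borel_measurable (lebesgue_on {0..1})"
    and "\<And>N. N \<ge> 1 \<Longrightarrow> prob_space (\<mu> N)"
    and "\<And>N. N \<ge> 1 \<Longrightarrow> sets (\<mu> N) = Pow (configs N)"
    and "associated \<mu> g"
    and "\<And>N. N \<ge> 1 \<Longrightarrow>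
      markov_process (P N) (configs N)
        (\<lambda>f \<xi>. real N powr \<gamma> * exclusion_gen \<gamma> \<kappa> \<theta> \<alpha> \<beta> N f \<xi>)
        (\<mu> N) (\<lambda>t. \<eta> N (t * real N powr \<gamma>))"
  shows "\<exists>\<rho>. weak_solution \<gamma> \<kappa> \<alpha> \<beta> T g \<rho> \<and>
    (\<forall>\<rho>'. weak_solution \<gamma> \<kappa> \<alpha> \<beta> T g \<rho>' \<longrightarrow>
      (\<forall>t\<in>{0..T}. AE q in lebesgue_on {0..1}. \<rho>' t q = \<rho> t q)) \<and>
    (\<forall>t\<in>{0..T}. \<forall>G \<delta>. continuous_on {0..1} G \<longrightarrow> \<delta> > 0 \<longrightarrow>
      (\<lambda>N. measure (P N) {\<omega> \<in> space (P N).
          \<bar>empirical N G (\<eta> N (t * real N powr \<gamma>) \<omega>)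
            - (LINT q:{0..1}|lebesgue. G q * \<rho> t q)\<bar> > \<delta>}) \<longlonglongrightarrow> 0)"
proof -
 interpret frac_params \<gamma> \<kappa> \<alpha> \<beta> by unfold_locales (use assms in auto)
 note T = assms(1) and g = assms(7,8) and \<mu> = assms(9,10) and as = assms(11)
 have "\<exists>K. N >= 1 --> transition_function (configs N) (gen N) K \<and>
  (\<forall>t\<ge>0. \<forall>B. measure (P N) {\<omega> : space (P N). \<eta> N (t * real N powr \<gamma>) \<omega> : B} = (\<integral>\<xi>. measure_pmf.prob (K t \<xi>) B \<partial>\<mu> N))" for N
 proof (cases "N >= 1")
  case N: True
  have "markov_process (P N) (configs N) (gen N) (\<mu> N) (%t. \<eta> N (t * real N powr \<gamma>))"
   using assms(12)[OF N] unfolding \<open>\<theta> = -1\<close> gen_def[abs_def] .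
  then show ?thesis
  proof (rule markov_process_law[OF _ configs_finite])
   fix K assume "transition_function (configs N) (gen N) K"
    "!!t B. 0 <= t ==> measure (P N) {\<omega> : space (P N). \<eta> N (t * real N powr \<gamma>) \<omega> : B} = (\<integral>\<xi>. measure_pmf.prob (K t \<xi>) B \<partial>\<mu> N)"
   then show ?thesis by (intro exI[of _ K]) simp
  qed
 qed simp
 then have "\<forall>N. \<exists>K. N >= 1 --> transition_function (configs N) (gen N) K \<and>
  (\<forall>t\<ge>0. \<forall>B. measure (P N) {\<omega> : space (P N). \<eta> N (t * real N powr \<gamma>) \<omega> : B} = (\<integral>\<xi>. measure_pmf.prob (K t \<xi>) B \<partial>\<mu> N))"
  by (rule allI)
 from choice[OF this]
 obtain K where K: "!!N. N >= 1 ==> transition_function (configs N) (gen N) (K N)"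
  "!!N t B. N >= 1 ==> 0 <= t ==> measure (P N) {\<omega> : space (P N). \<eta> N (t * real N powr \<gamma>) \<omega> : B} = (\<integral>\<xi>. measure_pmf.prob (K N t \<xi>) B \<partial>\<mu> N)"
  by auto
 have "measure (\<mu> N) (configs N) = 1" if "N >= 1" for N
 proof -
  interpret prob_space "\<mu> N" by (rule \<mu>(1)[OF that])
  have "space (\<mu> N) = configs N" using \<mu>(2)[OF that] sets_eq_imp_space_eq[of "\<mu> N" "count_space (configs N)"] by simp
  then show ?thesis using prob_space by simp
 qed
 then have "eventually (%N. 1 <= measure (\<mu> N) (configs N)) sequentially"
  by (intro eventually_mono[OF eventually_ge_at_top[of 1]]) simp
 then have "frequently (%N. 1 <= measure (\<mu> N) (configs N)) sequentially"
  by (rule eventually_frequently[OF sequentially_bot])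
 then have "\<exists>r \<xi>. strict_mono r & (\<forall>k. r k >= 2) & (\<forall>k. \<xi> k : configs (r k)) \<and>
   (\<forall>G. continuous_on {0..1} G --> (%k. empirical (r k) G (\<xi> k)) ----> (LINT q:{0..1}|lebesgue. G q * g q))"
  by (intro selection[OF g \<mu> as, of configs 1]) simp_all
 then obtain r \<xi> where r: "strict_mono r" "!!k. r k >= 2" "!!k. \<xi> k : configs (r k)"
   "!!G. continuous_on {0..1} G ==> (%k. empirical (r k) G (\<xi> k)) ----> (LINT q:{0..1}|lebesgue. G q * g q)"
  by auto
 interpret H: hydro \<gamma> \<kappa> \<alpha> \<beta> r "%k. K (r k)" \<xi>
 proof unfold_locales
  show "filterlim r at_top sequentially" by (rule filterlim_subseq[OF r(1)])
  show "transition_function (configs (r k)) (gen (r k)) (K (r k))" for k using r(2)[of k] by (intro K) simp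
 qed (rule r)+
 obtain \<rho> where \<rho>: "weak_solution \<gamma> \<kappa> \<alpha> \<beta> T g \<rho>" using H.subsequence_solution[OF T g r(4)] by blast
 have "(%N. measure (P N) {\<omega> : space (P N). |empirical N G (\<eta> N (t * real N powr \<gamma>) \<omega>)
      - (LINT q:{0..1}|lebesgue. G q * \<rho> t q)| > dl}) ----> 0"
  if t: "t : {0..T}" and G: "continuous_on {0..1} G" and dl: "dl > 0" for t G dl
 proof (rule Lim_transform_eventually[OF hydrodynamic_limit[OF T g \<mu> as K(1) \<rho> t G dl]])
  show "eventually (%N. (\<integral>\<xi>. measure_pmf.prob (K N t \<xi>) {\<eta>. |empirical N G \<eta> - (LINT q:{0..1}|lebesgue. G q * \<rho> t q)| > dl} \<partial>\<mu> N)
   = measure (P N) {\<omega> : space (P N). |empirical N G (\<eta> N (t * real N powr \<gamma>) \<omega>) - (LINT q:{0..1}|lebesgue. G q * \<rho> t q)| > dl}) sequentially"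
   using eventually_ge_at_top[of 1]
  proof eventually_elim
   case (elim N)
   then show ?case
    using K(2)[OF elim, of t "{\<eta>. |empirical N G \<eta> - (LINT q:{0..1}|lebesgue. G q * \<rho> t q)| > dl}"] t by simp
  qed
 qed
 then show ?thesis using \<rho> weak_solution_unique[OF T \<rho>] by blast
qed

end
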